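(* Let $N\ge5$ and let $0\le \mu\in L^1(\mathbb{R}^N)$ be the density of a probability measure $d\mu=\mu(x)\,dx$ on $\mathbb{R}^N$. Put $U:=\frac14\left|\frac{\nabla\mu}{\mu}\right|^2-\frac12\frac{\Delta\mu}{\mu}$ and assume: (H1) $\mu\in H^1_{\rm loc}(\mathbb{R}^N)$, $\frac{\nabla\mu}{\mu}\in L^r_{\rm loc}(\mathbb{R}^N,\mathbb{R}^N)$ for some $r>N$, and $\inf_{x\in K}\mu(x)>0$ for every compact $K\subset\mathbb{R}^N$; (H2) $\sqrt\mu\in H^1_{\rm loc}(\mathbb{R}^N)$ and $\Delta\mu\in L^1_{\rm loc}(\mathbb{R}^N)$; there exists $R_0>0$ such that $|x|^2U(x)\le\frac14\frac{1}{|\log|x||^2}$ for all $x\in B_{R_0}$; $U$ is bounded from above in $\mathbb{R}^N\setminus B_R$ for every $R>0$; (H3)(i) $\mu\in W^{2,1}_{\rm loc}(\mathbb{R}^N)$ and for any $\varepsilon>0$ there is $C_\varepsilon>0$ such that $\left|D_i\left(\frac{D_j\mu}{\mu}\right)\right|\le\frac{\varepsilon}{|x|^2}+C_\varepsilon\left|\frac{\nabla\mu}{\mu}\right|$ for every $i,j=1,\dots,N$. Then $D(L)=H^2_\mu(\mathbb{R}^N)$.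
   Context: $B_R$ is the ball of radius $R$ centred at $0$; $D_i$ denotes the $i$-th partial derivative. $L^2_\mu(\mathbb{R}^N)=L^2(\mathbb{R}^N,d\mu)$; $H^k_\mu(\mathbb{R}^N)$ is the weighted Sobolev space of $u\in L^2_\mu(\mathbb{R}^N)$ whose weak derivatives up to order $k$ belong to $L^2_\mu(\mathbb{R}^N)$. $(L,D(L))$ is the closure in $L^2_\mu(\mathbb{R}^N)$ of $Lf=\Delta f+\frac{\nabla\mu}{\mu}\cdot\nabla f$, $f\in C_c^\infty(\mathbb{R}^N)$; under (H1) it is known to generate an analytic contraction $C_0$-semigroup on $L^2_\mu(\mathbb{R}^N)$ and to coincide with the operator associated with the form $a(u,v)=\int\nabla u\cdot\overline{\nabla v}\,d\mu$ on $H^1_\mu(\mathbb{R}^N)$ (i.e. $Lu=f$ iff $a(u,v)=-\int f\overline v\,d\mu$ for all $v\in H^1_\mu(\mathbb{R}^N)$). *)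

theory Defs
  imports "HOL-Analysis.Analysis" "HOL-Probability.Probability"
begin

section \<open>Classical derivatives and test functions\<close>

definition partial :: "'n \<Rightarrow> (real ^ 'n \<Rightarrow> 'b) \<Rightarrow> real ^ 'n \<Rightarrow> 'b::real_normed_vector"
  where "partial i f x = frechet_derivative f (at x) (axis i 1)"

text \<open>A multi-index is given as the list of its directions; its order is the length of the list.\<close>

definition partials :: "'n list \<Rightarrow> (real ^ 'n \<Rightarrow> 'b) \<Rightarrow> real ^ 'n \<Rightarrow> 'b::real_normed_vector"
  where "partials is f = foldr partial is f"

definition laplacian :: "(real ^ 'n \<Rightarrow> 'b) \<Rightarrow> real ^ 'n \<Rightarrow> 'b::real_normed_vector"
  where "laplacian f x = (\<Sum>i\<in>UNIV. partials [i, i] f x)"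

definition test_functions :: "(real ^ 'n \<Rightarrow> 'b::real_normed_vector) set"
  where "test_functions =
    {f. (\<forall>is x. partials is f differentiable (at x)) \<and>
        (\<exists>K. compact K \<and> (\<forall>x. x \<notin> K \<longrightarrow> f x = 0))}"

section \<open>Weak derivatives and local spaces\<close>

text \<open>
  Elements of Lebesgue and Sobolev spaces are represented by Borel functions; all the sets and
  predicates below are invariant under modification on Lebesgue null sets.
\<close>

definition Lp_loc :: "real \<Rightarrow> (real ^ 'n \<Rightarrow> 'b::{banach, second_countable_topology}) set"
  where "Lp_loc p =
    {u \<in> borel_measurable borel.
       \<forall>K. compact K \<longrightarrow> set_integrable lborel K (\<lambda>x. norm (u x) powr p)}"

text \<open>Real test functions suffice, also for vector-valued (in particular complex) \<open>u\<close>.\<close>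

definition has_weak_deriv ::
    "'n list \<Rightarrow> (real ^ 'n \<Rightarrow> 'b) \<Rightarrow> (real ^ 'n \<Rightarrow> 'b::{banach, second_countable_topology}) \<Rightarrow> bool"
  where "has_weak_deriv is u v \<longleftrightarrow>
    u \<in> Lp_loc 1 \<and> v \<in> Lp_loc 1 \<and>
    (\<forall>\<phi>::real ^ 'n \<Rightarrow> real. \<phi> \<in> test_functions \<longrightarrow>
       (\<integral>x. partials is \<phi> x *\<^sub>R u x \<partial>lborel) =
       (-1) ^ length is *\<^sub>R (\<integral>x. \<phi> x *\<^sub>R v x \<partial>lborel))"

text \<open>A representative of the weak derivative, which is unique up to null sets if it exists.\<close>

definition weak_deriv ::
    "'n list \<Rightarrow> (real ^ 'n \<Rightarrow> 'b) \<Rightarrow> real ^ 'n \<Rightarrow> 'b::{banach, second_countable_topology}"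
  where "weak_deriv is u = (SOME v. has_weak_deriv is u v)"

definition weak_grad :: "(real ^ 'n \<Rightarrow> real) \<Rightarrow> real ^ 'n \<Rightarrow> real ^ 'n"
  where "weak_grad u x = (\<chi> i. weak_deriv [i] u x)"

text \<open>
  The distributional Laplacian is a locally integrable function; the individual
  second derivatives need not be.
\<close>

definition has_weak_laplacian :: "(real ^ 'n \<Rightarrow> real) \<Rightarrow> (real ^ 'n \<Rightarrow> real) \<Rightarrow> bool"
  where "has_weak_laplacian u v \<longleftrightarrow>
    u \<in> Lp_loc 1 \<and> v \<in> Lp_loc 1 \<and>
    (\<forall>\<phi>::real ^ 'n \<Rightarrow> real. \<phi> \<in> test_functions \<longrightarrow>
       (\<integral>x. laplacian \<phi> x * u x \<partial>lborel) = (\<integral>x. \<phi> x * v x \<partial>lborel))"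

definition weak_laplacian :: "(real ^ 'n \<Rightarrow> real) \<Rightarrow> real ^ 'n \<Rightarrow> real"
  where "weak_laplacian u = (SOME v. has_weak_laplacian u v)"

text \<open>\<open>W_loc k p\<close> is the local Sobolev space of order \<open>k\<close> and exponent \<open>p\<close>.\<close>

definition W_loc :: "nat \<Rightarrow> real \<Rightarrow> (real ^ 'n \<Rightarrow> 'b::{banach, second_countable_topology}) set"
  where "W_loc k p =
    {u \<in> Lp_loc p. \<forall>is. length is \<le> k \<longrightarrow> (\<exists>v \<in> Lp_loc p. has_weak_deriv is u v)}"

section \<open>Weighted spaces and the operator\<close>

definition weighted :: "(real ^ 'n \<Rightarrow> real) \<Rightarrow> (real ^ 'n) measure"
  where "weighted \<mu> = density lborel (\<lambda>x. ennreal (\<mu> x))"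

definition L2_mu :: "(real ^ 'n \<Rightarrow> real) \<Rightarrow> (real ^ 'n \<Rightarrow> complex) set"
  where "L2_mu \<mu> =
    {u \<in> borel_measurable borel. integrable (weighted \<mu>) (\<lambda>x. (norm (u x))\<^sup>2)}"

definition H_mu :: "nat \<Rightarrow> (real ^ 'n \<Rightarrow> real) \<Rightarrow> (real ^ 'n \<Rightarrow> complex) set"
  where "H_mu k \<mu> =
    {u \<in> L2_mu \<mu>. \<forall>is. length is \<le> k \<longrightarrow> (\<exists>v \<in> L2_mu \<mu>. has_weak_deriv is u v)}"

definition L2_tendsto ::
    "(real ^ 'n \<Rightarrow> real) \<Rightarrow> (nat \<Rightarrow> real ^ 'n \<Rightarrow> complex) \<Rightarrow> (real ^ 'n \<Rightarrow> complex) \<Rightarrow> bool"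
  where "L2_tendsto \<mu> f u \<longleftrightarrow>
    (\<forall>n. f n \<in> L2_mu \<mu>) \<and> u \<in> L2_mu \<mu> \<and>
    (\<lambda>n. \<integral>x. (norm (f n x - u x))\<^sup>2 \<partial>weighted \<mu>) \<longlonglongrightarrow> 0"

definition L_test :: "(real ^ 'n \<Rightarrow> real) \<Rightarrow> (real ^ 'n \<Rightarrow> complex) \<Rightarrow> real ^ 'n \<Rightarrow> complex"
  where "L_test \<mu> f x =
    laplacian f x + (\<Sum>i\<in>UNIV. (weak_grad \<mu> x /\<^sub>R \<mu> x) $ i *\<^sub>R partial i f x)"

text \<open>The graph of \<open>L\<close>: the closure in \<open>L\<^sup>2 \<times> L\<^sup>2\<close> of the graph of \<open>L\<close> on test functions.\<close>

definition L_graph ::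
    "(real ^ 'n \<Rightarrow> real) \<Rightarrow> ((real ^ 'n \<Rightarrow> complex) \<times> (real ^ 'n \<Rightarrow> complex)) set"
  where "L_graph \<mu> =
    {(u, v). \<exists>f. (\<forall>n::nat. f n \<in> test_functions) \<and>
       L2_tendsto \<mu> f u \<and> L2_tendsto \<mu> (\<lambda>n. L_test \<mu> (f n)) v}"

definition D_L :: "(real ^ 'n \<Rightarrow> real) \<Rightarrow> (real ^ 'n \<Rightarrow> complex) set"
  where "D_L \<mu> = Domain (L_graph \<mu>)"

definition U_mu :: "(real ^ 'n \<Rightarrow> real) \<Rightarrow> real ^ 'n \<Rightarrow> real"
  where "U_mu \<mu> x =
    1/4 * (norm (weak_grad \<mu> x /\<^sub>R \<mu> x))\<^sup>2 - 1/2 * (weak_laplacian \<mu> x / \<mu> x)"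

end

theory Submission
  imports Defs
begin

text \<open>
  Write \<open>b = \<nabla>\<mu> / \<mu>\<close>. Both inclusions follow from two inequalities for test functions \<open>f\<close> together
  with the density of test functions in \<open>H\<^sup>2\<^sub>\<mu>\<close>; the semigroup and the form are not needed.

  Expanding \<open>0 \<le> \<integral> |\<nabla>\<phi> + (x / |x|\<^sup>2 + b / 2) \<phi>|\<^sup>2 d\<mu>\<close> and using the bound on \<open>U\<close> gives Hardy's
  inequality \<open>\<integral> \<phi>\<^sup>2 / |x|\<^sup>2 d\<mu> \<le> C \<parallel>\<phi>\<parallel>\<^sup>2\<close> in the norm of \<open>H\<^sup>1\<^sub>\<mu>\<close>. Since
  \<open>\<integral> |b|\<^sup>2 \<phi>\<^sup>2 d\<mu> = - \<integral> (div b) \<phi>\<^sup>2 d\<mu> - 2 \<integral> \<phi> b \<cdot> \<nabla>\<phi> d\<mu>\<close> and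
  \<open>|div b| \<le> N (1 / |x|\<^sup>2 + C |b|)\<close>, also \<open>\<integral> |b|\<^sup>2 \<phi>\<^sup>2 d\<mu> \<le> C \<parallel>\<phi>\<parallel>\<^sup>2\<close>.
  With \<open>\<phi> = D\<^sub>i f\<close> this bounds \<open>L f\<close> by \<open>f\<close> in \<open>H\<^sup>2\<^sub>\<mu>\<close>. Conversely, Bochner's identity
  \<open>\<integral> |D\<^sup>2 f|\<^sup>2 d\<mu> = \<integral> (L f)\<^sup>2 d\<mu> + \<Sum> \<integral> (D\<^sub>j b\<^sub>i) (D\<^sub>i f) (D\<^sub>j f) d\<mu>\<close> and the bound
  \<open>|D\<^sub>j b\<^sub>i| \<le> \<epsilon> / |x|\<^sup>2 + C |b|\<close> bound the \<open>H\<^sup>2\<^sub>\<mu>\<close> norm by the graph norm.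

  For the density, truncated functions are mollified. This converges in the weighted norm
  because \<open>\<mu>\<close> is locally bounded: \<open>\<nabla> (ln \<mu>) = b\<close> belongs to \<open>L\<^sup>r\<close> locally with \<open>r > N\<close>,
  and Morrey's argument applies.
\<close>

section \<open>Smooth functions\<close>

text \<open>The vector \<open>b\<close> has only weak derivatives, and the weights
  \<open>1 / |x|^2\<close> and \<open>|b|^2\<close> may be unbounded. The integrals of the estimates
  are therefore expanded into Lebesgue integrals of a test function times one of
  \<open>\<mu>\<close>, \<open>G = \<nabla>\<mu>\<close>, \<open>H = D^2 \<mu>\<close>,
  \<open>G_i G_j / \<mu>\<close>, \<open>\<mu> / |x|^2\<close>, all locally integrable; each
  integration by parts is then one use of the definition of a weak derivative. The singular field
  \<open>x / |x|^2\<close> is replaced by \<open>x / (|x|^2 + \<delta>)\<close>, which gives Hardy's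
  inequality with the constant \<open>N - 3\<close>. The bound \<open>U \<le> 1 / |x|^2 + C\<close>
  costs 1, and for \<open>N \<ge> 5\<close> a positive factor \<open>N - 4\<close> remains. In
  Bochner's identity the terms with \<open>B = Db\<close> are as large as the left side. They are
  absorbed because \<open>\<epsilon>\<close> is free: \<open>\<epsilon> / |x|^2\<close> by Hardy's
  inequality, and \<open>C |b| \<le> \<kappa> |b|^2 + C^2 / \<kappa>\<close> with small
  \<open>\<kappa>\<close> by the bound on \<open>|b|^2\<close>, both applied to the first
  derivatives of \<open>f\<close>. The gradient term left over equals
  \<open>- \<integral> f L f d\<mu>\<close>.\<close>

lemma partials_Nil [simp]: "partials [] f = f"
  and partials_Cons: "partials (i # is) f = partial i (partials is f)"
  and partials_append: "partials (is @ js) f = partials is (partials js f)"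
  by (simp_all add: partials_def)

lemma partialI: "(f has_derivative D) (at x) \<Longrightarrow> partial i f x = D (axis i 1)"
  unfolding partial_def by (metis frechet_derivative_at)

lemma has_derivative_partial:
  fixes f :: "real ^ 'n \<Rightarrow> 'b::real_normed_vector"
  assumes "f differentiable (at x)"
  shows "(f has_derivative (\<lambda>h. \<Sum>i\<in>UNIV. (h $ i) *\<^sub>R partial i f x)) (at x)"
proof -
  let ?D = "frechet_derivative f (at x)"
  have D: "(f has_derivative ?D) (at x)"
    using assms frechet_derivative_works by blast
  have lin: "linear ?D"
    using D has_derivative_linear by blast
  have "?D h = (\<Sum>i\<in>UNIV. (h $ i) *\<^sub>R partial i f x)" for h
  proof -
    have "?D h = ?D (\<Sum>i\<in>UNIV. (h $ i) *\<^sub>R axis i 1)"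
      using basis_expansion[of h] by (simp add: scalar_mult_eq_scaleR)
    also have "\<dots> = (\<Sum>i\<in>UNIV. (h $ i) *\<^sub>R partial i f x)"
      using lin by (simp add: linear_sum linear_scale partial_def)
    finally show ?thesis .
  qed
  then have "?D = (\<lambda>h. \<Sum>i\<in>UNIV. (h $ i) *\<^sub>R partial i f x)" by auto
  with D show ?thesis by simp
qed

text \<open>The order is made explicit so that closure properties can be proved by induction through
  \<open>Ck_Suc\<close>, which smoothness itself does not offer. The index is shifted:
  \<open>Ck 0\<close> is differentiability, and the derivatives of order \<open>n + 1\<close> are
  not asked to be continuous.\<close>

definition Ck :: "nat \<Rightarrow> (real ^ 'n \<Rightarrow> 'b::real_normed_vector) \<Rightarrow> bool"
  where "Ck n f \<longleftrightarrow> (\<forall>is x. length is \<le> n \<longrightarrow> partials is f differentiable (at x))"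

definition smooth :: "(real ^ 'n \<Rightarrow> 'b::real_normed_vector) \<Rightarrow> bool"
  where "smooth f \<longleftrightarrow> (\<forall>is x. partials is f differentiable (at x))"

lemma Ck_0: "Ck 0 f \<longleftrightarrow> (\<forall>x. f differentiable (at x))"
  by (simp add: Ck_def)

text \<open>Entries are split off at the end of the list, because the last entry is the derivative
  taken first: \<open>partials (is @ [i]) f\<close> is \<open>partials is (partial i f)\<close>.
  Inductions over the order can thus generalise over the function.\<close>

lemma Ck_Suc: "Ck (Suc n) f \<longleftrightarrow> (\<forall>x. f differentiable (at x)) \<and> (\<forall>i. Ck n (partial i f))"
proof safe
  fix x assume "Ck (Suc n) f"
  then show "f differentiable (at x)"
    unfolding Ck_def by (metis le0 list.size(3) partials_Nil)
next
  fix i assume *: "Ck (Suc n) f"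
  show "Ck n (partial i f)"
    unfolding Ck_def
  proof safe
    fix "is" :: "'a list" and x :: "real ^ 'a" assume "length is \<le> n"
    then have "length (is @ [i]) \<le> Suc n" by simp
    with * have "partials (is @ [i]) f differentiable (at x)" unfolding Ck_def by blast
    then show "partials is (partial i f) differentiable (at x)"
      by (simp add: partials_append partials_Cons)
  qed
next
  assume d: "\<forall>x. f differentiable (at x)" and p: "\<forall>i. Ck n (partial i f)"
  show "Ck (Suc n) f"
    unfolding Ck_def
  proof safe
    fix "is" :: "'a list" and x :: "real ^ 'a" assume l: "length is \<le> Suc n"
    show "partials is f differentiable (at x)"
    proof (cases "is" rule: rev_cases)
      case Nil with d show ?thesis by simp
    next
      case (snoc js i)
      with l have "length js \<le> n" by simp
      with p have "partials js (partial i f) differentiable (at x)" unfolding Ck_def by blast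
      with snoc show ?thesis by (simp add: partials_append partials_Cons)
    qed
  qed
qed

lemma smooth_Ck: "smooth f \<longleftrightarrow> (\<forall>n. Ck n f)"
  unfolding smooth_def Ck_def by blast

lemma Ck_mono: "Ck n f \<Longrightarrow> m \<le> n \<Longrightarrow> Ck m f"
  unfolding Ck_def by (meson le_trans)

lemma Ck_differentiable: "Ck n f \<Longrightarrow> f differentiable (at x)"
  using Ck_mono[of n f 0] by (simp add: Ck_0)

lemma smooth_differentiable: "smooth f \<Longrightarrow> f differentiable (at x)"
  unfolding smooth_def by (metis partials_Nil)

lemma smooth_partials: "smooth f \<Longrightarrow> smooth (partials is f)"
  unfolding smooth_def by (metis partials_append)

lemma smooth_partial: "smooth f \<Longrightarrow> smooth (partial i f)"
  using smooth_partials[of f "[i]"] by (simp add: partials_Cons)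

lemma smooth_continuous: "smooth f \<Longrightarrow> continuous_on S f"
  by (meson continuous_at_imp_continuous_on differentiable_imp_continuous_within smooth_differentiable)

lemma smooth_measurable [measurable_dest]: "smooth f \<Longrightarrow> f \<in> borel_measurable borel"
  by (simp add: borel_measurable_continuous_onI smooth_continuous)

section \<open>Differentiation rules for \<open>partial\<close>\<close>

lemma partial_add:
  "f differentiable (at x) \<Longrightarrow> g differentiable (at x) \<Longrightarrow>
    partial i (\<lambda>x. f x + g x) x = partial i f x + partial i g x"
  by (rule partialI[where D="\<lambda>h. frechet_derivative f (at x) h + frechet_derivative g (at x) h" for f g x, folded partial_def])
    (intro has_derivative_add; simp add: frechet_derivative_works[symmetric])

lemma partial_diff:
  "f differentiable (at x) \<Longrightarrow> g differentiable (at x) \<Longrightarrow>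
    partial i (\<lambda>x. f x - g x) x = partial i f x - partial i g x"
  by (rule partialI[where D="\<lambda>h. frechet_derivative f (at x) h - frechet_derivative g (at x) h" for f g x, folded partial_def])
    (intro has_derivative_diff; simp add: frechet_derivative_works[symmetric])

lemma partial_const [simp]: "partial i (\<lambda>x. c) = (\<lambda>x. 0)"
  by (rule ext, rule partialI[where D="\<lambda>h. 0"]) (rule has_derivative_const)

lemma partial_scaleR:
  assumes "f differentiable (at x)" "g differentiable (at x)"
  shows "partial i (\<lambda>x. f x *\<^sub>R g x) x = partial i f x *\<^sub>R g x + f x *\<^sub>R partial i g x"
proof -
  have "((\<lambda>x. f x *\<^sub>R g x) has_derivative
     (\<lambda>h. f x *\<^sub>R frechet_derivative g (at x) h + frechet_derivative f (at x) h *\<^sub>R g x)) (at x)"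
    by (rule has_derivative_scaleR) (use assms frechet_derivative_works in blast)+
  from partialI[OF this, of i] show ?thesis by (simp add: partial_def)
qed

lemma partial_mult:
  fixes f g :: "real ^ 'n \<Rightarrow> real"
  assumes "f differentiable (at x)" "g differentiable (at x)"
  shows "partial i (\<lambda>x. f x * g x) x = partial i f x * g x + f x * partial i g x"
  using partial_scaleR[OF assms, of i] by simp

lemma partial_linear:
  assumes "bounded_linear T" "f differentiable (at x)"
  shows "partial i (\<lambda>x. T (f x)) x = T (partial i f x)"
proof -
  have "((\<lambda>x. T (f x)) has_derivative (\<lambda>h. T (frechet_derivative f (at x) h))) (at x)"
    using assms frechet_derivative_works bounded_linear.has_derivative by blast
  from partialI[OF this, of i] show ?thesis by (simp add: partial_def)
qed

lemma partial_real_compose: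
  fixes f :: "real ^ 'n \<Rightarrow> real"
  assumes "(g has_real_derivative d) (at (f x))" "f differentiable (at x)"
  shows "partial i (\<lambda>x. g (f x)) x = d * partial i f x"
proof -
  have "((\<lambda>x. g (f x)) has_derivative (\<lambda>h. d * frechet_derivative f (at x) h)) (at x)"
    using assms frechet_derivative_works
    by (metis has_derivative_compose has_field_derivative_def)
  from partialI[OF this, of i] show ?thesis by (simp add: partial_def)
qed

lemma differentiable_affine_compose:
  fixes f :: "real ^ 'n \<Rightarrow> 'b::real_normed_vector"
  assumes "\<And>x. f differentiable (at x)"
  shows "(\<lambda>x. f (c *\<^sub>R x + d)) differentiable (at x)"
    and "partial i (\<lambda>x. f (c *\<^sub>R x + d)) x = c *\<^sub>R partial i f (c *\<^sub>R x + d)"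
proof -
  have "(f has_derivative frechet_derivative f (at (c *\<^sub>R x + d))) (at (c *\<^sub>R x + d))"
    using assms frechet_derivative_works by blast
  moreover have "((\<lambda>x. c *\<^sub>R x + d) has_derivative (\<lambda>h. c *\<^sub>R h)) (at x)"
    by (auto intro!: derivative_eq_intros)
  ultimately have D: "((\<lambda>x. f (c *\<^sub>R x + d)) has_derivative
      (\<lambda>h. frechet_derivative f (at (c *\<^sub>R x + d)) (c *\<^sub>R h))) (at x)"
    using has_derivative_compose by blast
  then show "(\<lambda>x. f (c *\<^sub>R x + d)) differentiable (at x)"
    using differentiable_def by blast
  have "linear (frechet_derivative f (at (c *\<^sub>R x + d)))"
    using assms linear_frechet_derivative by blast
  with partialI[OF D, of i]
  show "partial i (\<lambda>x. f (c *\<^sub>R x + d)) x = c *\<^sub>R partial i f (c *\<^sub>R x + d)"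
    by (simp add: partial_def linear_scale)
qed

section \<open>Closure of \<open>Ck\<close> and \<open>smooth\<close> under algebraic operations and
  composition\<close>

lemma Ck_add: "Ck n f \<Longrightarrow> Ck n g \<Longrightarrow> Ck n (\<lambda>x. f x + g x)"
proof (induction n arbitrary: f g)
  case (Suc n)
  then have "partial i (\<lambda>x. f x + g x) = (\<lambda>x. partial i f x + partial i g x)" for i
    by (auto simp: Ck_Suc partial_add)
  with Suc show ?case by (simp add: Ck_Suc)
qed (simp add: Ck_0)

lemma Ck_const: "Ck n (\<lambda>x. c)"
  by (induction n arbitrary: c) (auto simp: Ck_0 Ck_Suc)

lemma Ck_scaleR: "Ck n f \<Longrightarrow> Ck n g \<Longrightarrow> Ck n (\<lambda>x. f x *\<^sub>R g x)"
proof (induction n arbitrary: f g)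
  case (Suc n)
  then have *: "partial i (\<lambda>x. f x *\<^sub>R g x) = (\<lambda>x. partial i f x *\<^sub>R g x + f x *\<^sub>R partial i g x)" for i
    by (auto simp: Ck_Suc partial_scaleR)
  have "Ck n f" "Ck n g" using Suc.prems Ck_mono le_Suc_eq by blast+
  with Suc show ?case
    by (auto simp: Ck_Suc * intro!: Ck_add differentiable_scaleR)
qed (simp add: Ck_0 differentiable_scaleR)

lemma Ck_linear: "bounded_linear T \<Longrightarrow> Ck n f \<Longrightarrow> Ck n (\<lambda>x. T (f x))"
proof (induction n arbitrary: f)
  case 0
  then show ?case by (simp add: Ck_0 bounded_linear_imp_differentiable differentiable_compose)
next
  case (Suc n)
  then have "partial i (\<lambda>x. T (f x)) = (\<lambda>x. T (partial i f x))" for i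
    by (auto simp: Ck_Suc partial_linear)
  with Suc show ?case
    by (simp add: Ck_Suc bounded_linear_imp_differentiable differentiable_compose)
qed

lemma Ck_affine: "Ck n f \<Longrightarrow> Ck n (\<lambda>x. f (c *\<^sub>R x + d))"
proof (induction n arbitrary: f)
  case 0
  then show ?case by (simp add: Ck_0 differentiable_affine_compose(1))
next
  case (Suc n)
  then have "partial i (\<lambda>x. f (c *\<^sub>R x + d)) = (\<lambda>x. c *\<^sub>R partial i f (c *\<^sub>R x + d))" for i
    by (intro ext differentiable_affine_compose(2)) (auto simp: Ck_Suc)
  with Suc show ?case
    by (auto simp: Ck_Suc intro!: Ck_scaleR[OF Ck_const] differentiable_affine_compose(1))
qed

lemma differentiable_real_compose:
  fixes f :: "real ^ 'n \<Rightarrow> real"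
  assumes "(g has_real_derivative d) (at (f x))" "f differentiable (at x)"
  shows "(\<lambda>x. g (f x)) differentiable (at x)"
proof -
  obtain D where D: "(f has_derivative D) (at x)" using assms(2) by (auto simp: differentiable_def)
  have "((\<lambda>x. g (f x)) has_derivative (\<lambda>h. d * D h)) (at x)"
    using has_derivative_compose[OF D, of g "(*) d"] assms(1) by (simp add: has_field_derivative_def)
  then show ?thesis by (rule differentiableI)
qed

text \<open>A family closed under differentiation, \<open>G p\<close> having the derivative
  \<open>G (d p)\<close>, lets one induction over the order treat all members at once. It is applied
  to the functions \<open>flat p\<close> indexed by polynomials.\<close>

lemma Ck_family:
  fixes f :: "real ^ 'n \<Rightarrow> real"
  assumes "\<And>p t. (G p has_real_derivative G (d p) t) (at t)"
  shows "Ck n f \<Longrightarrow> Ck n (\<lambda>x. G p (f x))"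
proof (induction n arbitrary: p)
  case 0
  then show ?case by (auto simp: Ck_0 intro: differentiable_real_compose[OF assms])
next
  case (Suc n)
  have p: "partial i (\<lambda>x. G p (f x)) = (\<lambda>x. G (d p) (f x) *\<^sub>R partial i f x)" for i
    using Suc.prems by (intro ext) (simp add: Ck_Suc partial_real_compose[OF assms])
  have d: "(\<lambda>x. G p (f x)) differentiable (at x)" for x
    by (rule differentiable_real_compose[OF assms Ck_differentiable[OF Suc.prems]])
  have "Ck n (\<lambda>x. G (d p) (f x))"
    by (rule Suc.IH, rule Ck_mono[OF Suc.prems]) simp
  then show ?case
    using Suc.prems unfolding Ck_Suc p by (intro conjI allI d Ck_scaleR) auto
qed

text \<open>The derivative of \<open>1 / f\<close> is minus the square of \<open>1 / f\<close> times
  that of \<open>f\<close>, so it is built from \<open>1 / f\<close> and \<open>partial i f\<close>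
  alone and the induction hypothesis covers it.\<close>

lemma Ck_inverse:
  fixes f :: "real ^ 'n \<Rightarrow> real"
  assumes nz: "\<And>x. f x \<noteq> 0"
  shows "Ck n f \<Longrightarrow> Ck n (\<lambda>x. inverse (f x))"
proof (induction n)
  case 0
  then show ?case by (auto simp: Ck_0 intro: differentiable_real_compose[OF DERIV_inverse[OF nz]])
next
  case (Suc n)
  have p: "partial i (\<lambda>x. inverse (f x)) =
      (\<lambda>x. (-1) *\<^sub>R ((inverse (f x) *\<^sub>R inverse (f x)) *\<^sub>R partial i f x))" for i
    using Suc.prems
    by (intro ext) (simp add: Ck_Suc partial_real_compose[OF DERIV_inverse[OF nz]] power2_eq_square)
  have d: "(\<lambda>x. inverse (f x)) differentiable (at x)" for x
    by (rule differentiable_real_compose[OF DERIV_inverse[OF nz] Ck_differentiable[OF Suc.prems]])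
  have "Ck n (\<lambda>x. inverse (f x))"
    by (rule Suc.IH, rule Ck_mono[OF Suc.prems]) simp
  then show ?case
    using Suc.prems unfolding Ck_Suc p by (intro conjI allI d Ck_scaleR Ck_const) auto
qed

lemma smooth_add: "smooth f \<Longrightarrow> smooth g \<Longrightarrow> smooth (\<lambda>x. f x + g x)"
  by (simp add: smooth_Ck Ck_add)
lemma smooth_const: "smooth (\<lambda>x. c)"
  by (simp add: smooth_Ck Ck_const)
lemma smooth_scaleR: "smooth f \<Longrightarrow> smooth g \<Longrightarrow> smooth (\<lambda>x. f x *\<^sub>R g x)"
  by (simp add: smooth_Ck Ck_scaleR)
lemma smooth_mult:
  fixes f g :: "real ^ 'n \<Rightarrow> real"
  shows "smooth f \<Longrightarrow> smooth g \<Longrightarrow> smooth (\<lambda>x. f x * g x)"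
  using smooth_scaleR[of f g] by simp
lemma smooth_linear: "bounded_linear T \<Longrightarrow> smooth f \<Longrightarrow> smooth (\<lambda>x. T (f x))"
  by (simp add: smooth_Ck Ck_linear)
lemma smooth_affine: "smooth f \<Longrightarrow> smooth (\<lambda>x. f (c *\<^sub>R x + d))"
  by (simp add: smooth_Ck Ck_affine)
lemma smooth_inverse:
  fixes f :: "real ^ 'n \<Rightarrow> real"
  shows "(\<And>x. f x \<noteq> 0) \<Longrightarrow> smooth f \<Longrightarrow> smooth (\<lambda>x. inverse (f x))"
  by (simp add: smooth_Ck Ck_inverse)
lemma smooth_diff: "smooth f \<Longrightarrow> smooth g \<Longrightarrow> smooth (\<lambda>x. f x - g x)"
  using smooth_add[OF _ smooth_scaleR[OF smooth_const[of "-1::real"]], of f g] by simp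
lemma smooth_sum: "(\<And>i. i \<in> I \<Longrightarrow> smooth (f i)) \<Longrightarrow> smooth (\<lambda>x. \<Sum>i\<in>I. f i x)"
  by (induction I rule: infinite_finite_induct) (auto intro: smooth_const smooth_add)

lemma partial_inverse:
  fixes f :: "real ^ 'n \<Rightarrow> real"
  assumes "f x \<noteq> 0" "f differentiable (at x)"
  shows "partial i (\<lambda>x. inverse (f x)) x = - (partial i f x / (f x)\<^sup>2)"
  using partial_real_compose[where g=inverse, OF DERIV_inverse[OF assms(1)] assms(2), of i]
  by (simp add: power2_eq_square divide_simps)

lemma partial_component: "partial i (\<lambda>x. x $ j) x = (if i = j then 1 else 0)"
proof -
  have "((\<lambda>x. x $ j) has_derivative (\<lambda>h. h $ j)) (at x)"
    by (intro derivative_eq_intros bounded_linear_imp_has_derivative bounded_linear_vec_nth)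
  from partialI[OF this, of i] show ?thesis by (auto simp: axis_def)
qed

lemma differentiable_component: "(\<lambda>x::real^'n. x $ j) differentiable (at x)"
  by (simp add: bounded_linear_imp_differentiable bounded_linear_vec_nth)

lemma smooth_component: "smooth (\<lambda>x. x $ j)"
proof -
  have "Ck n (\<lambda>x. x $ j)" for n
  proof (cases n)
    case (Suc m)
    have "partial i (\<lambda>x. x $ j) = (\<lambda>x. if i = j then 1 else 0)" for i
      by (rule ext) (rule partial_component)
    then show ?thesis using Suc by (simp add: Ck_Suc Ck_const differentiable_component)
  qed (simp add: Ck_0 differentiable_component)
  then show ?thesis by (simp add: smooth_Ck)
qed

lemma norm_sq_components: "(norm (x::real^'n))\<^sup>2 = (\<Sum>i\<in>UNIV. x $ i * x $ i)"
  by (simp add: norm_vec_def L2_set_def sum_nonneg power2_eq_square)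

lemma smooth_norm_sq: "smooth (\<lambda>x. (norm x)\<^sup>2)"
  unfolding norm_sq_components by (intro smooth_sum smooth_mult smooth_component)

lemma partial_norm_sq: "partial i (\<lambda>x. (norm x)\<^sup>2) x = 2 * x $ i"
proof -
  have "((\<lambda>x. (norm x)\<^sup>2) has_derivative (\<lambda>h. 2 * (x \<bullet> h))) (at x)"
    unfolding power2_norm_eq_inner by (auto intro!: derivative_eq_intros simp: inner_commute)
  from partialI[OF this, of i] show ?thesis by (simp add: inner_axis)
qed

subsection \<open>Cut-off functions\<close>

text \<open>Extension by zero of \<open>p(1/t) exp(-1/t)\<close>. The polynomial factor makes the
  family stable: in the variable \<open>s = 1/t\<close> the derivative in \<open>t\<close> is
  \<open>- s^2 d/ds\<close>, which sends \<open>p exp(-s)\<close> to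
  \<open>s^2 (p - p') exp(-s)\<close>.\<close>

definition flat :: "real poly \<Rightarrow> real \<Rightarrow> real"
  where "flat p t = (if t > 0 then poly p (1 / t) * exp (- (1 / t)) else 0)"

lemma poly_exp_tendsto: "((\<lambda>x. poly p x * exp (- x)) \<longlongrightarrow> (0::real)) at_top"
proof (induction p)
  case (pCons a p)
  have "poly p x * exp (-x) * x = (\<Sum>i\<le>degree p. coeff p i * (x ^ (Suc i) / exp x))" for x :: real
    by (simp add: poly_altdef exp_minus sum_distrib_left sum_distrib_right divide_simps mult_ac)
  moreover have "((\<lambda>x. \<Sum>i\<le>degree p. coeff p i * (x ^ (Suc i) / exp x)) \<longlongrightarrow> 0) at_top"
    by (intro tendsto_null_sum tendsto_mult_right_zero tendsto_power_div_exp_0)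
  ultimately have 1: "((\<lambda>x. poly p x * exp (-x) * x) \<longlongrightarrow> 0) at_top" by simp
  have 2: "((\<lambda>x. a * (x ^ 0 / exp x)) \<longlongrightarrow> 0) at_top"
    by (intro tendsto_mult_right_zero tendsto_power_div_exp_0)
  from tendsto_add[OF 2 1] show ?case by (simp add: algebra_simps exp_minus divide_simps)
qed simp

lemma flat_tendsto: "((\<lambda>t. poly p (1 / t) * exp (- (1 / t))) \<longlongrightarrow> (0::real)) (at_right 0)"
  using filterlim_compose[OF poly_exp_tendsto filterlim_inverse_at_top_right, of p]
  by (simp add: inverse_eq_divide)

lemma flat_deriv:
  "(flat p has_real_derivative flat ([:0, 0, 1:] * (p - pderiv p)) t) (at t)"
proof (cases t "0::real" rule: linorder_cases)
  case greater
  have "((\<lambda>t. poly p (1 / t) * exp (- (1 / t))) has_real_derivative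
      flat ([:0, 0, 1:] * (p - pderiv p)) t) (at t)"
    using greater
    by (auto intro!: derivative_eq_intros DERIV_chain2[OF poly_DERIV] simp: flat_def field_simps power2_eq_square)
  then show ?thesis
    by (rule DERIV_cong_ev[THEN iffD1, rotated 3])
      (use greater in \<open>auto simp: flat_def intro!: eventually_mono[OF order_tendstoD(1)[OF tendsto_ident_at, of 0 t UNIV]]
        eventually_nhds_in_open[THEN eventually_mono, of "{0<..}"]\<close>)
next
  case less
  have "((\<lambda>t. 0) has_real_derivative flat ([:0, 0, 1:] * (p - pderiv p)) t) (at t)"
    using less by (simp add: flat_def)
  then show ?thesis
    by (rule DERIV_cong_ev[THEN iffD1, rotated 3])
      (use less in \<open>auto simp: flat_def intro!: eventually_nhds_in_open[THEN eventually_mono, of "{..<0}"]\<close>)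
next
  case equal
  \<comment> \<open>Dividing by \<open>h\<close> multiplies the polynomial by its variable
    \<open>1/h\<close>, that is, \<open>p\<close> becomes \<open>pCons 0 p\<close>. The exponential
    decay still wins, so the difference quotient at 0 tends to 0.\<close>
  have "((\<lambda>h. flat p h / h) \<longlongrightarrow> 0) (at_right 0)"
  proof (rule Lim_transform_eventually[OF flat_tendsto[of "pCons 0 p"]])
    show "\<forall>\<^sub>F h in at_right 0. poly (pCons 0 p) (1 / h) * exp (- (1 / h)) = flat p h / h"
      by (auto simp: eventually_at_right_field flat_def intro!: exI[of _ 1])
  qed
  moreover have "((\<lambda>h. flat p h / h) \<longlongrightarrow> 0) (at_left 0)"
    by (rule tendsto_eventually) (auto simp: eventually_at_left_field flat_def intro!: exI[of _ "-1"])
  ultimately have "((\<lambda>h. flat p h / h) \<longlongrightarrow> 0) (at 0)"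
    using filterlim_split_at by blast
  then show ?thesis using equal by (simp add: DERIV_def flat_def)
qed

lemma smooth_flat:
  assumes "smooth f" shows "smooth (\<lambda>x. flat p (f x))"
  using assms Ck_family[of flat "\<lambda>p. [:0, 0, 1:] * (p - pderiv p)", OF flat_deriv]
  by (auto simp: smooth_Ck)

lemma flat_1: "flat 1 t \<ge> 0" "flat 1 t > 0 \<longleftrightarrow> t > 0"
  by (auto simp: flat_def)

definition bump :: "real ^ 'n \<Rightarrow> real"
  where "bump x = flat 1 (1 - (norm x)\<^sup>2)"

lemma bump: "smooth bump" "bump x \<ge> 0" "bump x > 0 \<longleftrightarrow> norm x < 1" "norm x \<ge> 1 \<Longrightarrow> bump x = 0"
proof -
  show "smooth (bump :: real^'n \<Rightarrow> real)"
    unfolding bump_def by (intro smooth_flat smooth_diff smooth_const smooth_norm_sq)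
  show "bump x \<ge> 0" by (simp add: bump_def flat_1)
  show "bump x > 0 \<longleftrightarrow> norm x < 1" by (simp add: bump_def flat_1 abs_square_less_1)
  show "norm x \<ge> 1 \<Longrightarrow> bump x = 0" by (simp add: bump_def flat_def not_less)
qed

text \<open>The usual quotient \<open>a / (a + b)\<close>: \<open>a\<close> is positive exactly for
  \<open>|x| < 2\<close> and \<open>b\<close> exactly for \<open>|x| > 1\<close>, so the denominator
  never vanishes. The constants 4 and 1 are squared radii, since \<open>|x|^2\<close> is smooth and
  \<open>|x|\<close> is not.\<close>

definition cutoff :: "real ^ 'n \<Rightarrow> real"
  where "cutoff x = flat 1 (4 - (norm x)\<^sup>2) *
    inverse (flat 1 (4 - (norm x)\<^sup>2) + flat 1 ((norm x)\<^sup>2 - 1))"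

lemma cutoff:
  fixes x :: "real ^ 'n"
  shows "smooth (cutoff :: real^'n \<Rightarrow> real)" "0 \<le> cutoff x" "cutoff x \<le> 1"
    "norm x \<le> 1 \<Longrightarrow> cutoff x = 1" "norm x \<ge> 2 \<Longrightarrow> cutoff x = 0"
proof -
  have pos: "flat 1 (4 - (norm x)\<^sup>2) + flat 1 ((norm x)\<^sup>2 - 1) > 0" for x :: "real^'n"
  proof (cases "(norm x)\<^sup>2 < 4")
    case True then show ?thesis using flat_1 by (simp add: add_pos_nonneg)
  next
    case False then show ?thesis using flat_1 by (simp add: add_nonneg_pos)
  qed
  show "smooth (cutoff :: real^'n \<Rightarrow> real)"
    unfolding cutoff_def
    by (intro smooth_mult smooth_inverse smooth_add smooth_flat smooth_diff smooth_const smooth_norm_sq)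
      (use pos in \<open>metis less_irrefl\<close>)
  show "0 \<le> cutoff x" using pos[of x] by (simp add: cutoff_def flat_1)
  show "cutoff x \<le> 1" using pos[of x] by (simp add: cutoff_def flat_1 divide_simps flip: divide_inverse)
  show "cutoff x = 1" if "norm x \<le> 1"
  proof -
    have "(norm x)\<^sup>2 \<le> 1" using that by (simp add: abs_square_le_1)
    then have "flat 1 ((norm x)\<^sup>2 - 1) = 0" by (simp add: flat_def)
    with pos[of x] show ?thesis by (simp add: cutoff_def)
  qed
  show "cutoff x = 0" if "norm x \<ge> 2"
  proof -
    have "(norm x)\<^sup>2 \<ge> 2\<^sup>2" using that by (intro power_mono) auto
    then show ?thesis by (simp add: cutoff_def flat_def)
  qed
qed

section \<open>Test functions and locally integrable functions\<close>

text \<open>On an open set both functions have the same derivatives as relations, so the choice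
  inside \<open>frechet_derivative\<close> returns the same map even at points where there is no
  derivative.\<close>

lemma partials_cong_open:
  fixes f g :: "real ^ 'n \<Rightarrow> 'b::real_normed_vector"
  assumes S: "open S" and eq: "\<And>x. x \<in> S \<Longrightarrow> f x = g x"
  shows "x \<in> S \<Longrightarrow> partials is f x = partials is g x"
proof (induction "is" arbitrary: x)
  case Nil
  then show ?case using eq by simp
next
  case (Cons i "is")
  have "(partials is f has_derivative D) (at x) \<longleftrightarrow> (partials is g has_derivative D) (at x)" for D
    using has_derivative_transform_within_open[OF _ S Cons.prems, of _ D UNIV] Cons.IH by metis
  then show ?case by (simp add: partials_Cons partial_def frechet_derivative_def)
qed

lemma partials_zero: "partials is (\<lambda>x. 0) = (\<lambda>x. 0)"
  by (induction "is") (simp_all add: partials_Cons)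

lemma partials_zero_outside:
  assumes "\<And>x. norm x > R \<Longrightarrow> f x = 0" "norm x > R"
  shows "partials is f x = 0"
proof -
  have "open {x::real^'n. norm x > R}" by (intro open_Collect_less continuous_intros)
  from partials_cong_open[OF this, of f "\<lambda>x. 0" x "is"] assms show ?thesis
    by (simp add: partials_zero)
qed

lemma test_functions_iff:
  "f \<in> test_functions \<longleftrightarrow> smooth f \<and> (\<exists>R. \<forall>x. norm x > R \<longrightarrow> f x = 0)"
proof
  assume f: "f \<in> test_functions"
  then obtain K where K: "compact K" "\<forall>x. x \<notin> K \<longrightarrow> f x = 0" by (auto simp: test_functions_def)
  then obtain R where "\<forall>x\<in>K. norm x \<le> R" using compact_imp_bounded bounded_iff by metis
  with K have "\<forall>x. norm x > R \<longrightarrow> f x = 0" by (metis linorder_not_less)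
  with f show "smooth f \<and> (\<exists>R. \<forall>x. norm x > R \<longrightarrow> f x = 0)"
    by (auto simp: test_functions_def smooth_def)
next
  assume "smooth f \<and> (\<exists>R. \<forall>x. norm x > R \<longrightarrow> f x = 0)"
  then obtain R where "smooth f" "\<And>x. norm x > R \<Longrightarrow> f x = 0" by blast
  then show "f \<in> test_functions"
    by (auto simp: test_functions_def smooth_def intro!: exI[of _ "cball 0 R"])
qed

lemma test_smooth: "f \<in> test_functions \<Longrightarrow> smooth f"
  by (simp add: test_functions_iff)

lemma testI: "smooth f \<Longrightarrow> (\<And>x. norm x > R \<Longrightarrow> f x = 0) \<Longrightarrow> f \<in> test_functions"
  by (auto simp: test_functions_iff)

lemma test_supp: "f \<in> test_functions \<Longrightarrow> \<exists>R. \<forall>x. norm x > R \<longrightarrow> f x = 0"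
  by (simp add: test_functions_iff)

lemma test_differentiable: "f \<in> test_functions \<Longrightarrow> f differentiable (at x)"
  by (simp add: test_functions_iff smooth_differentiable)

lemma test_partials: "f \<in> test_functions \<Longrightarrow> partials is f \<in> test_functions"
  by (auto simp: test_functions_iff smooth_partials intro: partials_zero_outside)

lemma test_partial: "f \<in> test_functions \<Longrightarrow> partial i f \<in> test_functions"
  using test_partials[of f "[i]"] by (simp add: partials_Cons)

lemma test_scaleR: "f \<in> test_functions \<Longrightarrow> smooth g \<Longrightarrow> (\<lambda>x. f x *\<^sub>R g x) \<in> test_functions"
  by (auto simp: test_functions_iff intro!: smooth_scaleR)

lemma scaleR_test: "smooth f \<Longrightarrow> g \<in> test_functions \<Longrightarrow> (\<lambda>x. f x *\<^sub>R g x) \<in> test_functions"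
  by (auto simp: test_functions_iff intro!: smooth_scaleR)

lemma test_mult:
  fixes f g :: "real ^ 'n \<Rightarrow> real"
  shows "f \<in> test_functions \<Longrightarrow> smooth g \<Longrightarrow> (\<lambda>x. f x * g x) \<in> test_functions"
  using test_scaleR[of f g] by simp

lemma mult_test:
  fixes f g :: "real ^ 'n \<Rightarrow> real"
  shows "smooth f \<Longrightarrow> g \<in> test_functions \<Longrightarrow> (\<lambda>x. f x * g x) \<in> test_functions"
  using scaleR_test[of f g] by simp

lemma test_add: "f \<in> test_functions \<Longrightarrow> g \<in> test_functions \<Longrightarrow> (\<lambda>x. f x + g x) \<in> test_functions"
proof -
  assume f: "f \<in> test_functions" and g: "g \<in> test_functions"
  obtain R S where "\<forall>x. norm x > R \<longrightarrow> f x = 0" "\<forall>x. norm x > S \<longrightarrow> g x = 0"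
    using test_supp f g by metis
  then show ?thesis using f g by (auto intro!: testI[of _ "max R S"] smooth_add intro: test_smooth)
qed

lemma test_diff: "f \<in> test_functions \<Longrightarrow> g \<in> test_functions \<Longrightarrow> (\<lambda>x. f x - g x) \<in> test_functions"
  using test_add[OF _ scaleR_test[OF smooth_const[of "-1::real"]], of f g] by simp

lemma test_linear: "bounded_linear T \<Longrightarrow> f \<in> test_functions \<Longrightarrow> (\<lambda>x. T (f x)) \<in> test_functions"
  using smooth_linear[of T f] linear_0[OF bounded_linear.linear, of T] unfolding test_functions_iff
  by metis

lemma test_affine:
  fixes f :: "real ^ 'n \<Rightarrow> 'b::real_normed_vector"
  assumes "f \<in> test_functions" "c \<noteq> 0"
  shows "(\<lambda>x. f (c *\<^sub>R x + d)) \<in> test_functions"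
proof -
  obtain R where R: "\<forall>x. norm x > R \<longrightarrow> f x = 0" using test_supp assms by metis
  show ?thesis
  proof (rule testI[of _ "(R + norm d) / \<bar>c\<bar>"])
    show "smooth (\<lambda>x. f (c *\<^sub>R x + d))" by (intro smooth_affine test_smooth assms)
    fix x :: "real^'n" assume "norm x > (R + norm d) / \<bar>c\<bar>"
    then have "R + norm d < norm (c *\<^sub>R x)" using assms(2) by (simp add: field_simps)
    then have "R < norm (c *\<^sub>R x + d)" using norm_triangle_ineq4[of "c *\<^sub>R x + d" d] by simp
    with R show "f (c *\<^sub>R x + d) = 0" by blast
  qed
qed

lemma test_continuous: "f \<in> test_functions \<Longrightarrow> continuous_on S f"
  by (simp add: test_functions_iff smooth_continuous)

lemma test_measurable [measurable_dest]: "f \<in> test_functions \<Longrightarrow> f \<in> borel_measurable borel"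
  by (simp add: smooth_measurable test_smooth)

lemma test_bounded:
  assumes "f \<in> test_functions" obtains C where "C \<ge> 0" "\<And>x. norm (f x) \<le> C"
proof -
  obtain R where R: "\<forall>x. norm x > R \<longrightarrow> f x = 0" using test_supp assms by metis
  have "bounded (f ` cball 0 R)"
    by (intro compact_imp_bounded compact_continuous_image test_continuous assms compact_cball)
  then obtain C where C: "\<forall>x\<in>cball 0 R. norm (f x) \<le> C" by (auto simp: bounded_iff)
  have "norm (f x) \<le> max C 0" for x
    using C R by (cases "norm x \<le> R") (auto simp: not_le le_max_iff_disj)
  then show ?thesis by (intro that[of "max C 0"]) auto
qed

lemma test_lipschitz:
  fixes f :: "real ^ 'n \<Rightarrow> 'b::real_normed_vector"
  assumes f: "f \<in> test_functions"
  obtains B where "B \<ge> 0" "\<And>x y. norm (f x - f y) \<le> B * norm (x - y)"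
proof -
  have "\<exists>C. C \<ge> 0 \<and> (\<forall>x. norm (partial i f x) \<le> C)" for i
    using test_bounded[OF test_partial[OF f, of i]] by metis
  then obtain C where C: "\<And>i. C i \<ge> 0" "\<And>i x. norm (partial i f x) \<le> C i" by metis
  have "norm (f x - f y) \<le> (\<Sum>i\<in>UNIV. C i) * norm (x - y)" for x y
  proof (rule differentiable_bound[OF convex_UNIV])
    fix x
    show "(f has_derivative (\<lambda>h. \<Sum>i\<in>UNIV. (h $ i) *\<^sub>R partial i f x)) (at x within UNIV)"
      using has_derivative_partial[OF test_differentiable[OF f]] by simp
    show "onorm (\<lambda>h. \<Sum>i\<in>UNIV. (h $ i) *\<^sub>R partial i f x) \<le> (\<Sum>i\<in>UNIV. C i)"
    proof (rule onorm_le)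
      fix h :: "real^'n"
      have "norm (\<Sum>i\<in>UNIV. (h $ i) *\<^sub>R partial i f x) \<le> (\<Sum>i\<in>UNIV. norm h * C i)"
        by (rule sum_norm_le) (auto intro!: mult_mono simp: component_le_norm_cart C)
      then show "norm (\<Sum>i\<in>UNIV. (h $ i) *\<^sub>R partial i f x) \<le> (\<Sum>i\<in>UNIV. C i) * norm h"
        by (simp add: sum_distrib_left mult.commute)
    qed
  qed auto
  then show ?thesis using C by (intro that[of "\<Sum>i\<in>UNIV. C i"]) (auto intro: sum_nonneg)
qed

text \<open>A second-order remainder with a fixed compact support in \<open>z\<close>: integrated
  against a locally integrable function it is \<open>O(|h|^2)\<close>, which is what differentiation
  under an integral and the limits of difference quotients below require.\<close>

lemma test_taylor:
  fixes f :: "real ^ 'n \<Rightarrow> 'b::real_normed_vector"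
  assumes f: "f \<in> test_functions"
  shows "\<exists>C R. C \<ge> 0 \<and> (\<forall>z h. norm h \<le> 1 \<longrightarrow>
    norm (f (z + h) - f z - (\<Sum>i\<in>UNIV. (h $ i) *\<^sub>R partial i f z))
      \<le> C * (norm h)\<^sup>2 * indicator (cball 0 R) z)"
proof -
  have "\<exists>B. B \<ge> 0 \<and> (\<forall>x y. norm (partial i f x - partial i f y) \<le> B * norm (x - y))" for i
    using test_lipschitz[OF test_partial[OF f, of i]] by metis
  then obtain B where B: "\<And>i. B i \<ge> 0"
    "\<And>i x y. norm (partial i f x - partial i f y) \<le> B i * norm (x - y)" by metis
  obtain R where R: "\<forall>x. norm x > R \<longrightarrow> f x = 0" using test_supp f by metis
  let ?C = "\<Sum>i\<in>UNIV. B i"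
  have C0: "?C \<ge> 0" using B by (auto intro: sum_nonneg)
  define f' where "f' = (\<lambda>x h. \<Sum>i\<in>UNIV. (h $ i) *\<^sub>R partial i f x)"
  have main: "norm (f (z + h) - f z - f' z h) \<le> ?C * (norm h)\<^sup>2" for z h
  proof -
    \<comment> \<open>The mean value inequality is applied to \<open>f\<close> minus its
      linearization at \<open>z\<close>; the Lipschitz bounds of the first partials give the extra
      factor \<open>|h|\<close>.\<close>
    have "norm (f (z + h) - f z - f' z (z + h - z)) \<le> norm (z + h - z) * (?C * norm h)"
    proof (rule differentiable_bound_linearization[where S="cball z (norm h)"])
      fix t :: real assume "t \<in> {0..1}"
      then show "z + t *\<^sub>R (z + h - z) \<in> cball z (norm h)"
        by (auto simp: dist_norm mult_left_le_one_le)
    next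
      fix x
      show "(f has_derivative f' x) (at x within cball z (norm h))"
        unfolding f'_def
        by (rule has_derivative_at_withinI[OF has_derivative_partial[OF test_differentiable[OF f]]])
    next
      fix x assume x: "x \<in> cball z (norm h)"
      show "onorm (f' x - f' z) \<le> ?C * norm h"
      proof (rule onorm_le)
        fix k :: "real^'n"
        have "norm ((f' x - f' z) k) = norm (\<Sum>i\<in>UNIV. (k $ i) *\<^sub>R (partial i f x - partial i f z))"
          by (simp add: f'_def sum_subtractf scaleR_diff_right)
        also have "\<dots> \<le> (\<Sum>i\<in>UNIV. norm k * (B i * norm h))"
        proof (rule sum_norm_le)
          fix i
          have "norm (partial i f x - partial i f z) \<le> B i * norm h"
            using B(2)[of i x z] x B(1)[of i]
            by (smt (verit) dist_norm mem_cball mult_left_mono norm_minus_commute)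
          then show "norm ((k $ i) *\<^sub>R (partial i f x - partial i f z)) \<le> norm k * (B i * norm h)"
            by (auto intro!: mult_mono simp: component_le_norm_cart B)
        qed
        also have "\<dots> = ?C * norm h * norm k"
          by (simp add: sum_distrib_left sum_distrib_right mult_ac)
        finally show "norm ((f' x - f' z) k) \<le> ?C * norm h * norm k" .
      qed
    qed auto
    then show ?thesis by (simp add: power2_eq_square mult_ac)
  qed
  \<comment> \<open>Steps of length at most 1 enlarge the support radius by at most 1.\<close>
  have out: "f (z + h) - f z - f' z h = 0" if "norm h \<le> 1" "norm z > R + 1" for z h
  proof -
    have "norm (z + h) > R" using that norm_triangle_ineq4[of "z + h" h] by simp
    moreover have "partial i f z = 0" for i
      using partials_zero_outside[of R f z "[i]"] R that by (simp add: partials_Cons)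
    ultimately show ?thesis using R that by (simp add: f'_def)
  qed
  show ?thesis
  proof (rule exI[of _ ?C], rule exI[of _ "R + 1"], intro conjI C0 allI impI)
    fix z h :: "real^'n" assume h: "norm h \<le> 1"
    show "norm (f (z + h) - f z - (\<Sum>i\<in>UNIV. (h $ i) *\<^sub>R partial i f z))
      \<le> ?C * (norm h)\<^sup>2 * indicator (cball 0 (R + 1)) z"
      using main[of z h] out[OF h, of z] unfolding f'_def
      by (auto simp: indicator_def)
  qed
qed

subsection \<open>Integration\<close>

lemma lborel_integrable_affine:
  fixes f :: "real ^ 'n \<Rightarrow> 'b::{banach, second_countable_topology}"
  assumes c: "c \<noteq> 0" and f: "integrable lborel f"
  shows "integrable lborel (\<lambda>x. f (t + c *\<^sub>R x))"
proof -
  have [measurable]: "f \<in> borel_measurable borel" using f by simp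
  have "integrable (density (distr lborel borel (\<lambda>x. t + c *\<^sub>R x)) (\<lambda>_. ennreal (\<bar>c\<bar> ^ DIM(real^'n)))) f"
    using f lborel_affine[OF c, of t] by simp
  then have "integrable lborel (\<lambda>x. (\<bar>c\<bar> ^ DIM(real^'n)) *\<^sub>R f (t + c *\<^sub>R x))"
    by (subst (asm) integrable_density) (auto simp: integrable_distr_eq)
  from integrable_scaleR_right[OF this, of "inverse (\<bar>c\<bar> ^ DIM(real^'n))"] c show ?thesis by simp
qed

lemma lborel_integral_affine:
  fixes f :: "real ^ 'n \<Rightarrow> 'b::{banach, second_countable_topology}"
  assumes c: "c \<noteq> 0" and [measurable]: "f \<in> borel_measurable borel"
  shows "(\<integral>x. f x \<partial>lborel) = (\<bar>c\<bar> ^ CARD('n)) *\<^sub>R (\<integral>x. f (t + c *\<^sub>R x) \<partial>lborel)"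
  by (subst lborel_affine[OF c, of t]) (simp add: integral_density integral_distr)

lemma lborel_integral_shift:
  fixes f :: "real ^ 'n \<Rightarrow> 'b::{banach, second_countable_topology}"
  assumes "f \<in> borel_measurable borel"
  shows "(\<integral>x. f (x + t) \<partial>lborel) = (\<integral>x. f x \<partial>lborel)"
    "(\<integral>x. f (t - x) \<partial>lborel) = (\<integral>x. f x \<partial>lborel)"
  using lborel_integral_affine[of 1 f t] lborel_integral_affine[of "-1" f t] assms
  by (simp_all add: add.commute)

lemma lborel_integrable_shift:
  fixes f :: "real ^ 'n \<Rightarrow> 'b::{banach, second_countable_topology}"
  assumes "integrable lborel f"
  shows "integrable lborel (\<lambda>x. f (x + t))" "integrable lborel (\<lambda>x. f (t - x))"
  using lborel_integrable_affine[of 1 f t] lborel_integrable_affine[of "-1" f t] assms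
  by (simp_all add: add.commute)

lemma cball_borel [measurable]: "cball (x::'a::metric_space) r \<in> sets borel"
  by (simp add: borel_closed)

section \<open>Local Lebesgue spaces and multiplication by compactly supported functions\<close>

lemma Lp_loc_iff:
  "u \<in> Lp_loc p \<longleftrightarrow> u \<in> borel_measurable borel \<and>
    (\<forall>R. integrable lborel (\<lambda>x. indicator (cball 0 R) x * norm (u x) powr p))"
proof
  assume "u \<in> Lp_loc p"
  then show "u \<in> borel_measurable borel \<and>
      (\<forall>R. integrable lborel (\<lambda>x. indicator (cball 0 R) x * norm (u x) powr p))"
    by (auto simp: Lp_loc_def set_integrable_def)
next
  assume R: "u \<in> borel_measurable borel \<and>
      (\<forall>R. integrable lborel (\<lambda>x. indicator (cball 0 R) x * norm (u x) powr p))"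
  then have [measurable]: "u \<in> borel_measurable borel" by simp
  have "set_integrable lborel K (\<lambda>x. norm (u x) powr p)" if K: "compact K" for K
  proof -
    have [measurable]: "K \<in> sets borel" using K by (simp add: borel_compact)
    obtain r where r: "\<forall>x\<in>K. norm x \<le> r" using K compact_imp_bounded bounded_iff by metis
    have "integrable lborel (\<lambda>x. indicator (cball 0 r) x * norm (u x) powr p)" using R by simp
    then show ?thesis
      unfolding set_integrable_def
      by (rule Bochner_Integration.integrable_bound) (use r in \<open>auto simp: indicator_def\<close>)
  qed
  then show "u \<in> Lp_loc p" by (simp add: Lp_loc_def)
qed

lemma Lp_loc_measurable [measurable_dest]: "u \<in> Lp_loc p \<Longrightarrow> u \<in> borel_measurable borel"
  by (simp add: Lp_loc_def)

lemma L1_loc_iff: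
  "u \<in> Lp_loc 1 \<longleftrightarrow> u \<in> borel_measurable borel \<and>
    (\<forall>R. integrable lborel (\<lambda>x. indicator (cball 0 R) x *\<^sub>R u x))"
proof -
  have "integrable lborel (\<lambda>x. indicator (cball 0 R) x * norm (u x) powr 1) \<longleftrightarrow>
      integrable lborel (\<lambda>x. indicator (cball 0 R) x *\<^sub>R u x)"
    if [measurable]: "u \<in> borel_measurable borel" for R
  proof -
    have eq: "(\<lambda>x. indicator (cball 0 R) x * norm (u x) powr 1) =
        (\<lambda>x. norm (indicator (cball 0 R) x *\<^sub>R u x))" by (auto simp: indicator_def)
    show ?thesis unfolding eq by (rule integrable_norm_iff) measurable
  qed
  then show ?thesis unfolding Lp_loc_iff by blast
qed

lemma L2_loc_iff:
  "u \<in> Lp_loc 2 \<longleftrightarrow> u \<in> borel_measurable borel \<and>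
    (\<forall>R. integrable lborel (\<lambda>x. indicator (cball 0 R) x * (norm (u x))\<^sup>2))"
  unfolding Lp_loc_iff by (simp add: powr_numeral)

text \<open>The multipliers that turn a locally integrable function into an integrable one. Unlike
  test functions they include indicators of balls, which dominate remainders.\<close>

definition bounded_supp :: "(real ^ 'n \<Rightarrow> 'b::real_normed_vector) \<Rightarrow> bool"
  where "bounded_supp f \<longleftrightarrow> f \<in> borel_measurable borel \<and>
    (\<exists>C R. \<forall>x. norm (f x) \<le> C * indicator (cball 0 R) x)"

lemma bounded_suppI:
  assumes "f \<in> borel_measurable borel" "\<And>x. norm (f x) \<le> C" "\<And>x. norm x > R \<Longrightarrow> f x = 0"
  shows "bounded_supp f"
proof -
  have "norm (f x) \<le> \<bar>C\<bar> * indicator (cball 0 R) x" for x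
    using assms(2)[of x] assms(3)[of x] by (auto simp: indicator_def not_le)
  then show ?thesis unfolding bounded_supp_def using assms(1) by blast
qed

lemma test_bounded_supp: "f \<in> test_functions \<Longrightarrow> bounded_supp f"
  by (metis bounded_suppI test_bounded test_measurable test_supp)

lemma integrable_bounded_supp:
  fixes f :: "real ^ 'n \<Rightarrow> real"
  assumes f: "bounded_supp f" and u: "u \<in> Lp_loc 1"
  shows "integrable lborel (\<lambda>x. f x *\<^sub>R u x)"
proof -
  obtain C R where C: "\<And>x. norm (f x) \<le> C * indicator (cball 0 R) x"
    using f by (auto simp: bounded_supp_def)
  have [measurable]: "f \<in> borel_measurable borel" "u \<in> borel_measurable borel"
    using f u by (auto simp: bounded_supp_def Lp_loc_def)
  have "integrable lborel (\<lambda>x. C *\<^sub>R (indicator (cball 0 R) x *\<^sub>R u x))"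
    by (intro integrable_scaleR_right) (use u in \<open>simp add: L1_loc_iff\<close>)
  then show ?thesis
  proof (rule Bochner_Integration.integrable_bound)
    show "AE x in lborel. norm (f x *\<^sub>R u x) \<le> norm (C *\<^sub>R (indicator (cball 0 R) x *\<^sub>R u x))"
    proof (rule AE_I2)
      fix x
      have "\<bar>f x\<bar> \<le> \<bar>C\<bar> * indicator (cball 0 R) x"
        using C[of x] by (auto simp: indicator_def split: if_splits)
      then show "norm (f x *\<^sub>R u x) \<le> norm (C *\<^sub>R (indicator (cball 0 R) x *\<^sub>R u x))"
        by (simp add: mult.assoc[symmetric] mult_right_mono)
    qed
  qed measurable
qed

lemma integrable_test:
  fixes f :: "real ^ 'n \<Rightarrow> real"
  shows "f \<in> test_functions \<Longrightarrow> u \<in> Lp_loc 1 \<Longrightarrow> integrable lborel (\<lambda>x. f x *\<^sub>R u x)"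
  by (simp add: integrable_bounded_supp test_bounded_supp)

lemma integrable_test_mult:
  fixes f :: "real ^ 'n \<Rightarrow> real"
  shows "f \<in> test_functions \<Longrightarrow> u \<in> Lp_loc 1 \<Longrightarrow> integrable lborel (\<lambda>x. f x * u x)"
  using integrable_test[of f u] by simp

lemma continuous_L1_loc:
  fixes f :: "real ^ 'n \<Rightarrow> 'b::{banach, second_countable_topology}"
  assumes "continuous_on UNIV f" shows "f \<in> Lp_loc 1"
  unfolding L1_loc_iff
proof (intro conjI allI)
  show "f \<in> borel_measurable borel" using assms by (rule borel_measurable_continuous_onI)
  fix R
  show "integrable lborel (\<lambda>x. indicator (cball 0 R) x *\<^sub>R f x)"
    by (intro borel_integrable_compact compact_cball continuous_on_subset[OF assms]) auto
qed

lemma smooth_L1_loc: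
  fixes f :: "real ^ 'n \<Rightarrow> 'b::{banach, second_countable_topology}"
  shows "smooth f \<Longrightarrow> f \<in> Lp_loc 1"
  by (simp add: continuous_L1_loc smooth_continuous)

lemma integrable_test_self:
  fixes f :: "real ^ 'n \<Rightarrow> 'b::{banach, second_countable_topology}"
  assumes "f \<in> test_functions" shows "integrable lborel f"
proof -
  obtain R where R: "\<forall>x. norm x > R \<longrightarrow> f x = 0" using test_supp assms by metis
  then have "f = (\<lambda>x. indicator (cball 0 R) x *\<^sub>R f x)" by (auto simp: indicator_def fun_eq_iff)
  moreover have "integrable lborel (\<lambda>x. indicator (cball 0 R) x *\<^sub>R f x)"
    using smooth_L1_loc[OF test_smooth[OF assms]] by (simp add: L1_loc_iff)
  ultimately show ?thesis by simp
qed

lemma L2_loc_imp_L1_loc: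
  fixes u :: "real ^ 'n \<Rightarrow> 'b::{banach, second_countable_topology}"
  shows "u \<in> Lp_loc 2 \<Longrightarrow> u \<in> Lp_loc 1"
  unfolding L1_loc_iff L2_loc_iff
proof safe
  fix R
  assume [measurable]: "u \<in> borel_measurable borel"
    and i: "\<forall>R. integrable lborel (\<lambda>x. indicator (cball 0 R) x * (norm (u x))\<^sup>2)"
  have "integrable lborel (\<lambda>x::real^'n. indicator (cball 0 R) x *\<^sub>R (1::real))"
    by (auto intro!: integrable_real_indicator emeasure_lborel_cball_finite)
  then have "integrable lborel (\<lambda>x. indicator (cball 0 R) x *\<^sub>R (1::real)
      + indicator (cball 0 R) x * (norm (u x))\<^sup>2)"
    using i by (intro Bochner_Integration.integrable_add) auto
  then show "integrable lborel (\<lambda>x. indicator (cball 0 R) x *\<^sub>R u x)"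
  proof (rule Bochner_Integration.integrable_bound)
    have "norm (u x) \<le> 1 + (norm (u x))\<^sup>2" for x
      using sum_squares_bound[of "norm (u x)" 1] norm_ge_zero[of "u x"]
      by (simp only: power_one mult_1_right)
    then show "AE x in lborel. norm (indicator (cball 0 R) x *\<^sub>R u x)
      \<le> norm (indicator (cball 0 R) x *\<^sub>R (1::real) + indicator (cball 0 R) x * (norm (u x))\<^sup>2)"
      by (auto simp: indicator_def)
  qed measurable
qed

lemma L2_loc_mult:
  fixes u v :: "real ^ 'n \<Rightarrow> real"
  assumes u: "u \<in> Lp_loc 2" and v: "v \<in> Lp_loc 2"
  shows "(\<lambda>x. u x * v x) \<in> Lp_loc 1"
  unfolding L1_loc_iff
proof safe
  have [measurable]: "u \<in> borel_measurable borel" "v \<in> borel_measurable borel"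
    using u v by (auto simp: Lp_loc_def)
  show "(\<lambda>x. u x * v x) \<in> borel_measurable borel" by measurable
  fix R
  have "integrable lborel (\<lambda>x. indicator (cball 0 R) x * (norm (u x))\<^sup>2 + indicator (cball 0 R) x * (norm (v x))\<^sup>2)"
    using u v by (auto simp: L2_loc_iff)
  then show "integrable lborel (\<lambda>x. indicator (cball 0 R) x *\<^sub>R (u x * v x))"
  proof (rule Bochner_Integration.integrable_bound)
    have "\<bar>u x * v x\<bar> \<le> (u x)\<^sup>2 + (v x)\<^sup>2" for x
    proof -
      have "2 * (\<bar>u x\<bar> * \<bar>v x\<bar>) \<le> (u x)\<^sup>2 + (v x)\<^sup>2"
        using sum_squares_bound[of "\<bar>u x\<bar>" "\<bar>v x\<bar>"] by (simp add: mult.assoc)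
      moreover have "0 \<le> \<bar>u x\<bar> * \<bar>v x\<bar>" by simp
      ultimately show ?thesis by (simp only: abs_mult)
    qed
    then show "AE x in lborel. norm (indicator (cball 0 R) x *\<^sub>R (u x * v x))
      \<le> norm (indicator (cball 0 R) x * (norm (u x))\<^sup>2 + indicator (cball 0 R) x * (norm (v x))\<^sup>2)"
      by (auto simp: indicator_def)
  qed measurable
qed

lemma L1_loc_bound:
  assumes u: "u \<in> Lp_loc 1" and [measurable]: "v \<in> borel_measurable borel"
    and b: "\<And>R. \<exists>C. AE x in lborel. norm x \<le> R \<longrightarrow> norm (v x) \<le> C * norm (u x)"
  shows "v \<in> Lp_loc 1"
  unfolding L1_loc_iff
proof safe
  show "v \<in> borel_measurable borel" by fact
  fix R
  obtain C where C: "AE x in lborel. norm x \<le> R \<longrightarrow> norm (v x) \<le> C * norm (u x)" using b by blast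
  have "integrable lborel (\<lambda>x. C *\<^sub>R (indicator (cball 0 R) x *\<^sub>R u x))"
    by (intro integrable_scaleR_right) (use u in \<open>simp add: L1_loc_iff\<close>)
  then show "integrable lborel (\<lambda>x. indicator (cball 0 R) x *\<^sub>R v x)"
    by (rule Bochner_Integration.integrable_bound)
      (use C in \<open>auto simp: indicator_def elim!: eventually_mono intro: order_trans[OF _ mult_right_mono[OF abs_ge_self]]\<close>)
qed

lemma L1_loc_scaleR: "u \<in> Lp_loc 1 \<Longrightarrow> (\<lambda>x. (c::real) *\<^sub>R u x) \<in> Lp_loc 1"
  by (rule L1_loc_bound[of u]) (auto intro!: exI[of _ "\<bar>c\<bar>"])

lemma L1_loc_add: "u \<in> Lp_loc 1 \<Longrightarrow> v \<in> Lp_loc 1 \<Longrightarrow> (\<lambda>x. u x + v x) \<in> Lp_loc 1"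
  by (auto simp: L1_loc_iff scaleR_add_right)

lemma L1_loc_diff: "u \<in> Lp_loc 1 \<Longrightarrow> v \<in> Lp_loc 1 \<Longrightarrow> (\<lambda>x. u x - v x) \<in> Lp_loc 1"
  by (auto simp: L1_loc_iff scaleR_diff_right)

lemma L1_loc_norm: "u \<in> Lp_loc 1 \<Longrightarrow> (\<lambda>x. norm (u x)) \<in> Lp_loc 1"
  by (rule L1_loc_bound[of u]) (auto intro!: exI[of _ 1])

lemma L1_loc_sum: "(\<And>i. i \<in> I \<Longrightarrow> u i \<in> Lp_loc 1) \<Longrightarrow> (\<lambda>x. \<Sum>i\<in>I. u i x) \<in> Lp_loc 1"
  by (induction I rule: infinite_finite_induct)
    (auto intro: L1_loc_add continuous_L1_loc continuous_on_const)

lemma smooth_mult_L1_loc: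
  assumes f: "smooth f" and u: "u \<in> Lp_loc 1"
  shows "(\<lambda>x. f x *\<^sub>R u x) \<in> Lp_loc 1"
proof (rule L1_loc_bound[OF u])
  have [measurable]: "f \<in> borel_measurable borel" "u \<in> borel_measurable borel"
    using f u by (auto simp: Lp_loc_def smooth_measurable)
  show "(\<lambda>x. f x *\<^sub>R u x) \<in> borel_measurable borel" by measurable
  fix R
  have "bounded (f ` cball 0 R)"
    by (intro compact_imp_bounded compact_continuous_image compact_cball smooth_continuous[OF f])
  then obtain D where D: "\<forall>x\<in>cball 0 R. norm (f x) \<le> D" by (auto simp: bounded_iff)
  show "\<exists>C. AE x in lborel. norm x \<le> R \<longrightarrow> norm (f x *\<^sub>R u x) \<le> C * norm (u x)"
    using D by (auto intro!: exI[of _ D] mult_right_mono)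
qed

text \<open>Translation invariance makes the integral of \<open>f (z + t e_i) - f z\<close> vanish.
  By \<open>test_taylor\<close> the integral \<open>I\<close> of the derivative then satisfies
  \<open>t |I| \<le> C V t^2\<close>, where \<open>V\<close> is the volume of a ball, and
  \<open>t\<close> tends to 0.\<close>

lemma integral_partial_test:
  fixes f :: "real ^ 'n \<Rightarrow> 'b::{banach, second_countable_topology}"
  assumes f: "f \<in> test_functions"
  shows "(\<integral>x. partial i f x \<partial>lborel) = 0"
proof -
  obtain C R where C: "C \<ge> 0"
    "\<forall>z h. norm h \<le> 1 \<longrightarrow> norm (f (z + h) - f z - (\<Sum>i\<in>UNIV. (h $ i) *\<^sub>R partial i f z))
      \<le> C * (norm h)\<^sup>2 * indicator (cball 0 R) z" using test_taylor[OF f] by blast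
  let ?I = "\<integral>x. partial i f x \<partial>lborel" and ?V = "measure lborel (cball (0::real^'n) R)"
  have fi [measurable]: "f \<in> borel_measurable borel" "integrable lborel f"
    "integrable lborel (partial i f)"
    using f by (auto intro: integrable_test_self test_partial)
  have "norm ?I \<le> t * (C * ?V)" if t: "0 < t" "t \<le> 1" for t
  proof -
    let ?h = "t *\<^sub>R axis i (1::real) :: real^'n"
    have h: "(\<Sum>j\<in>UNIV. (?h $ j) *\<^sub>R partial j f z) = t *\<^sub>R partial i f z" for z
    proof -
      have "(\<Sum>j\<in>UNIV. (?h $ j) *\<^sub>R partial j f z) = (\<Sum>j\<in>UNIV. if j = i then t *\<^sub>R partial i f z else 0)"
        by (rule sum.cong) (auto simp: axis_def)
      then show ?thesis by simp
    qed
    have b: "norm (f (z + ?h) - f z - t *\<^sub>R partial i f z) \<le> C * t\<^sup>2 * indicator (cball 0 R) z" for z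
      using C(2)[rule_format, of ?h z] t unfolding h by simp
    have "(\<integral>z. f (z + ?h) - f z - t *\<^sub>R partial i f z \<partial>lborel) = - (t *\<^sub>R ?I)"
      using fi by (simp add: lborel_integral_shift lborel_integrable_shift)
    moreover have "norm (\<integral>z. f (z + ?h) - f z - t *\<^sub>R partial i f z \<partial>lborel)
        \<le> (\<integral>z. C * t\<^sup>2 * indicator (cball (0::real^'n) R) z \<partial>lborel)"
    proof (rule Bochner_Integration.integral_norm_bound_integral)
      show "integrable lborel (\<lambda>z. f (z + ?h) - f z - t *\<^sub>R partial i f z)"
        using fi by (simp add: lborel_integrable_shift)
      show "integrable lborel (\<lambda>z::real^'n. C * t\<^sup>2 * indicator (cball 0 R) z)"
        using emeasure_lborel_cball_finite[of "0::real^'n" R]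
        by (intro integrable_mult_right integrable_real_indicator) auto
    qed (rule b)
    ultimately have "t * norm ?I \<le> t * (t * (C * ?V))"
      using t by (simp add: power2_eq_square mult_ac)
    with t show ?thesis by simp
  qed
  then have "norm ?I \<le> 0 + e" if "e > 0" for e
  proof -
    define t where "t = min 1 (e / (C * ?V + 1))"
    have CV: "C * ?V \<ge> 0" using C by simp
    then have t: "0 < t" "t \<le> 1" using that by (auto simp: t_def)
    have "t * (C * ?V) \<le> e / (C * ?V + 1) * (C * ?V)"
      using CV by (intro mult_right_mono) (auto simp: t_def)
    also have "\<dots> \<le> e" using CV that by (simp add: field_simps)
    finally show ?thesis using \<open>\<And>t. 0 < t \<Longrightarrow> t \<le> 1 \<Longrightarrow> norm ?I \<le> t * (C * ?V)\<close>[OF t] by simp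
  qed
  then have "norm ?I \<le> 0" using field_le_epsilon by blast
  then show ?thesis by simp
qed

lemma integral_by_parts_test:
  fixes f :: "real ^ 'n \<Rightarrow> real" and g :: "real ^ 'n \<Rightarrow> 'b::{banach, second_countable_topology}"
  assumes f: "f \<in> test_functions" and g: "smooth g"
  shows "(\<integral>x. partial i f x *\<^sub>R g x \<partial>lborel) = - (\<integral>x. f x *\<^sub>R partial i g x \<partial>lborel)"
proof -
  have "0 = (\<integral>x. partial i (\<lambda>x. f x *\<^sub>R g x) x \<partial>lborel)"
    using integral_partial_test[OF test_scaleR[OF f g]] by simp
  also have "\<dots> = (\<integral>x. partial i f x *\<^sub>R g x + f x *\<^sub>R partial i g x \<partial>lborel)"
    by (simp add: partial_scaleR test_differentiable[OF f] smooth_differentiable[OF g])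
  also have "\<dots> = (\<integral>x. partial i f x *\<^sub>R g x \<partial>lborel) + (\<integral>x. f x *\<^sub>R partial i g x \<partial>lborel)"
    by (intro Bochner_Integration.integral_add integrable_test smooth_L1_loc smooth_partial test_partial f g)
  finally show ?thesis by (simp add: eq_neg_iff_add_eq_0)
qed

lemma continuous_AE_zero:
  fixes f :: "real ^ 'n \<Rightarrow> 'b::real_normed_vector"
  assumes f: "continuous_on UNIV f" and ae: "AE x in lborel. f x = 0"
  shows "f x = 0"
proof -
  have o: "open {x. f x \<noteq> 0}" by (intro open_Collect_neq f continuous_on_const)
  have "AE x in lebesgue. f x = 0" using ae by (simp add: AE_completion)
  then have "{x. f x \<noteq> 0} \<in> null_sets lebesgue"
    using o by (subst (asm) AE_iff_null) (auto simp: borel_open)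
  then have "negligible {x. f x \<noteq> 0}" by (simp add: negligible_iff_null_sets)
  then have "{x. f x \<noteq> 0} = {}" using o open_not_negligible by blast
  then show ?thesis by blast
qed

text \<open>Difference quotients of \<open>f\<close> in direction \<open>i\<close> commute with \<open>partial j\<close>; they are
  moved to the other side of an integral against \<open>\<phi>\<close>.\<close>

lemma partial_commute_weak:
  fixes f \<phi> :: "real ^ 'n \<Rightarrow> real"
  assumes f: "f \<in> test_functions" and \<phi>: "\<phi> \<in> test_functions"
  shows "(\<integral>x. \<phi> x * partial i (partial j f) x \<partial>lborel) = (\<integral>x. \<phi> x * partial j (partial i f) x \<partial>lborel)"
proof -
  \<comment> \<open>Used twice below: with \<open>\<phi>\<close> and \<open>partial j f\<close>, and
    with \<open>partial j \<phi>\<close> and \<open>f\<close>. Shifted differences commute with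
    \<open>partial j\<close>, so both instances describe the same number up to sign.\<close>
  have Q: "\<exists>C. \<forall>t. 0 < t \<and> t \<le> 1 \<longrightarrow>
      \<bar>(\<integral>x. \<psi> x * (g (x + t *\<^sub>R axis i 1) - g x) \<partial>lborel) - t * (\<integral>x. \<psi> x * partial i g x \<partial>lborel)\<bar> \<le> C * t\<^sup>2"
    if \<psi>: "\<psi> \<in> test_functions" and g: "g \<in> test_functions" for \<psi> g :: "real^'n \<Rightarrow> real"
  proof -
    obtain C R where C: "C \<ge> 0"
      "\<forall>z h. norm h \<le> 1 \<longrightarrow> norm (g (z + h) - g z - (\<Sum>i\<in>UNIV. (h $ i) *\<^sub>R partial i g z))
        \<le> C * (norm h)\<^sup>2 * indicator (cball 0 R) z" using test_taylor[OF g] by blast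
    have i\<psi>: "integrable lborel \<psi>" by (rule integrable_test_self[OF \<psi>])
    have [measurable]: "\<psi> \<in> borel_measurable borel" "g \<in> borel_measurable borel"
      "partial i g \<in> borel_measurable borel"
      using \<psi> g by (auto intro: test_measurable test_partial)
    have "\<bar>(\<integral>x. \<psi> x * (g (x + t *\<^sub>R axis i 1) - g x) \<partial>lborel) - t * (\<integral>x. \<psi> x * partial i g x \<partial>lborel)\<bar>
        \<le> (C * (\<integral>x. \<bar>\<psi> x\<bar> \<partial>lborel)) * t\<^sup>2" if t: "0 < t" "t \<le> 1" for t
    proof -
      let ?h = "t *\<^sub>R axis i (1::real) :: real^'n"
      have h: "(\<Sum>j\<in>UNIV. (?h $ j) *\<^sub>R partial j g z) = t * partial i g z" for z
      proof -
        have "(\<Sum>j\<in>UNIV. (?h $ j) *\<^sub>R partial j g z) = (\<Sum>j\<in>UNIV. if j = i then t *\<^sub>R partial i g z else 0)"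
          by (rule sum.cong) (auto simp: axis_def)
        then show ?thesis by simp
      qed
      have b: "\<bar>g (z + ?h) - g z - t * partial i g z\<bar> \<le> C * t\<^sup>2" for z
      proof -
        have "\<bar>g (z + ?h) - g z - t * partial i g z\<bar> \<le> C * t\<^sup>2 * indicator (cball 0 R) z"
          using C(2)[rule_format, of ?h z] t unfolding h by simp
        also have "\<dots> \<le> C * t\<^sup>2" using C by (auto simp: indicator_def)
        finally show ?thesis .
      qed
      have sh: "smooth (\<lambda>x. g (x + ?h))" using smooth_affine[OF test_smooth[OF g], of 1 ?h] by simp
      have i1: "integrable lborel (\<lambda>x. \<psi> x * (g (x + ?h) - g x))"
        by (intro integrable_test_mult \<psi> smooth_L1_loc smooth_diff sh test_smooth g)
      have i2: "integrable lborel (\<lambda>x. \<psi> x * partial i g x)"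
        by (intro integrable_test_mult \<psi> smooth_L1_loc smooth_partial test_smooth g)
      have "(\<integral>x. \<psi> x * (g (x + ?h) - g x) \<partial>lborel) - t * (\<integral>x. \<psi> x * partial i g x \<partial>lborel)
          = (\<integral>x. \<psi> x * (g (x + ?h) - g x) - t * (\<psi> x * partial i g x) \<partial>lborel)"
        using i1 i2 by simp
      also have "\<bar>\<dots>\<bar> \<le> (\<integral>x. \<bar>\<psi> x\<bar> * (C * t\<^sup>2) \<partial>lborel)"
      proof -
        have "norm (\<integral>x. \<psi> x * (g (x + ?h) - g x) - t * (\<psi> x * partial i g x) \<partial>lborel)
            \<le> (\<integral>x. \<bar>\<psi> x\<bar> * (C * t\<^sup>2) \<partial>lborel)"
        proof (rule Bochner_Integration.integral_norm_bound_integral)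
          show "integrable lborel (\<lambda>x. \<psi> x * (g (x + ?h) - g x) - t * (\<psi> x * partial i g x))"
            using i1 i2 by simp
          show "integrable lborel (\<lambda>x. \<bar>\<psi> x\<bar> * (C * t\<^sup>2))" using i\<psi> by simp
          fix x
          have "norm (\<psi> x * (g (x + ?h) - g x) - t * (\<psi> x * partial i g x)) =
              \<bar>\<psi> x\<bar> * \<bar>g (x + ?h) - g x - t * partial i g x\<bar>"
            by (simp add: abs_mult[symmetric] algebra_simps)
          then show "norm (\<psi> x * (g (x + ?h) - g x) - t * (\<psi> x * partial i g x)) \<le> \<bar>\<psi> x\<bar> * (C * t\<^sup>2)"
            using b[of x] by (simp add: mult_left_mono)
        qed
        then show ?thesis by simp
      qed
      finally show ?thesis by (simp add: mult_ac)
    qed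
    then show ?thesis by blast
  qed
  obtain C1 where C1: "\<And>t. 0 < t \<Longrightarrow> t \<le> 1 \<Longrightarrow> \<bar>(\<integral>x. \<phi> x * (partial j f (x + t *\<^sub>R axis i 1) - partial j f x) \<partial>lborel)
      - t * (\<integral>x. \<phi> x * partial i (partial j f) x \<partial>lborel)\<bar> \<le> C1 * t\<^sup>2"
    using Q[OF \<phi> test_partial[OF f, of j]] by blast
  obtain C2 where C2: "\<And>t. 0 < t \<Longrightarrow> t \<le> 1 \<Longrightarrow> \<bar>(\<integral>x. partial j \<phi> x * (f (x + t *\<^sub>R axis i 1) - f x) \<partial>lborel)
      - t * (\<integral>x. partial j \<phi> x * partial i f x \<partial>lborel)\<bar> \<le> C2 * t\<^sup>2"
    using Q[OF test_partial[OF \<phi>, of j] f] by blast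
  let ?A = "\<integral>x. \<phi> x * partial i (partial j f) x \<partial>lborel"
  let ?B = "\<integral>x. \<phi> x * partial j (partial i f) x \<partial>lborel"
  have B: "(\<integral>x. partial j \<phi> x * partial i f x \<partial>lborel) = - ?B"
    using integral_by_parts_test[OF \<phi> smooth_partial[OF test_smooth[OF f], of i], of j] by simp
  have est: "\<bar>?A - ?B\<bar> \<le> (C1 + C2) * t" if t: "0 < t" "t \<le> 1" for t
  proof -
    have sh: "smooth (\<lambda>x. f (x + t *\<^sub>R axis i 1) - f x)"
      using smooth_affine[OF test_smooth[OF f], of 1 "t *\<^sub>R axis i 1"]
      by (auto intro!: smooth_diff test_smooth[OF f])
    have d: "(\<lambda>x. f (x + t *\<^sub>R axis i 1)) differentiable (at x)" for x
      using differentiable_affine_compose(1)[of f 1 "t *\<^sub>R axis i 1" x] test_differentiable[OF f] by simp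
    have "partial j (\<lambda>x. f (x + t *\<^sub>R axis i 1) - f x) x =
        partial j f (x + t *\<^sub>R axis i 1) - partial j f x" for x
      using differentiable_affine_compose(2)[of f j 1 "t *\<^sub>R axis i 1" x] test_differentiable[OF f]
      by (simp add: partial_diff d)
    with integral_by_parts_test[OF \<phi> sh, of j]
    have "(\<integral>x. partial j \<phi> x * (f (x + t *\<^sub>R axis i 1) - f x) \<partial>lborel) =
      - (\<integral>x. \<phi> x * (partial j f (x + t *\<^sub>R axis i 1) - partial j f x) \<partial>lborel)" by simp
    with C1[OF t] C2[OF t] B have "\<bar>t * ?A - t * ?B\<bar> \<le> C1 * t\<^sup>2 + C2 * t\<^sup>2"
      by (simp add: abs_le_iff)
    also have "\<bar>t * ?A - t * ?B\<bar> = t * \<bar>?A - ?B\<bar>"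
      using t by (simp add: abs_mult right_diff_distrib[symmetric])
    finally have "t * \<bar>?A - ?B\<bar> \<le> t * ((C1 + C2) * t)" by (simp add: power2_eq_square algebra_simps)
    then show ?thesis using t by simp
  qed
  have "\<bar>?A - ?B\<bar> \<le> 0 + e" if "e > 0" for e
  proof -
    define t where "t = min 1 (e / (\<bar>C1 + C2\<bar> + 1))"
    have t: "0 < t" "t \<le> 1" using that by (auto simp: t_def)
    have "(C1 + C2) * t \<le> \<bar>C1 + C2\<bar> * (e / (\<bar>C1 + C2\<bar> + 1))"
      using t by (intro mult_mono) (auto simp: t_def)
    also have "\<dots> \<le> e" using that by (simp add: field_simps)
    finally show ?thesis using est[OF t] by simp
  qed
  then have "\<bar>?A - ?B\<bar> \<le> 0" using field_le_epsilon by blast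
  then show ?thesis by simp
qed

text \<open>The weak identity is tested with the difference of the two sides itself, which makes the
  integral of its square zero; continuity removes the exceptional null set.\<close>

lemma partial_commute:
  fixes f :: "real ^ 'n \<Rightarrow> real"
  assumes f: "f \<in> test_functions"
  shows "partial i (partial j f) = partial j (partial i f)"
proof
  fix x
  let ?g = "\<lambda>x. partial i (partial j f) x - partial j (partial i f) x"
  have g: "?g \<in> test_functions" by (intro test_diff test_partial f)
  have "(\<integral>x. ?g x * ?g x \<partial>lborel) = (\<integral>x. ?g x * partial i (partial j f) x \<partial>lborel) - (\<integral>x. ?g x * partial j (partial i f) x \<partial>lborel)"
    by (subst Bochner_Integration.integral_diff[symmetric])
      (auto intro!: integrable_test_mult g smooth_L1_loc test_smooth test_partial f simp: algebra_simps)
  also have "\<dots> = 0" using partial_commute_weak[OF f g, of i j] by simp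
  finally have "(\<integral>x. ?g x * ?g x \<partial>lborel) = 0" .
  then have "AE x in lborel. ?g x * ?g x = 0"
    by (subst (asm) integral_nonneg_eq_0_iff_AE)
      (auto intro!: integrable_test_mult g smooth_L1_loc test_smooth)
  then have "AE x in lborel. ?g x = 0" by simp
  from continuous_AE_zero[OF test_continuous[OF g] this, of x]
  show "partial i (partial j f) x = partial j (partial i f) x" by simp
qed

section \<open>Mollification\<close>

definition conv :: "(real ^ 'n \<Rightarrow> real) \<Rightarrow> (real ^ 'n \<Rightarrow> 'b) \<Rightarrow> real ^ 'n \<Rightarrow> 'b::{banach, second_countable_topology}"
  where "conv \<rho> u x = (\<integral>y. \<rho> (x - y) *\<^sub>R u y \<partial>lborel)"

lemma test_reflect:
  fixes \<rho> :: "real ^ 'n \<Rightarrow> real"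
  assumes "\<rho> \<in> test_functions" shows "(\<lambda>y. \<rho> (x - y)) \<in> test_functions"
  using test_affine[OF assms, of "-1" x] by simp

lemma integrable_conv:
  assumes "\<rho> \<in> test_functions" "u \<in> Lp_loc 1"
  shows "integrable lborel (\<lambda>y. \<rho> (x - y) *\<^sub>R u y)"
  by (intro integrable_test test_reflect assms)

text \<open>All derivatives fall on \<open>\<rho>\<close>. The Taylor remainder of
  \<open>\<rho>\<close> at \<open>x - y\<close>, integrated against \<open>|u|\<close> over a ball
  around \<open>x\<close>, is at most \<open>C K |h|^2\<close>, so local integrability of
  \<open>u\<close> suffices.\<close>

lemma conv_has_derivative:
  fixes u :: "real ^ 'n \<Rightarrow> 'b::{banach, second_countable_topology}"
  assumes \<rho>: "\<rho> \<in> test_functions" and u: "u \<in> Lp_loc 1"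
  shows "(conv \<rho> u has_derivative (\<lambda>h. \<Sum>i\<in>UNIV. (h $ i) *\<^sub>R conv (partial i \<rho>) u x)) (at x)"
proof -
  obtain C R where C: "C \<ge> 0"
    "\<forall>z h. norm h \<le> 1 \<longrightarrow> norm (\<rho> (z + h) - \<rho> z - (\<Sum>i\<in>UNIV. (h $ i) *\<^sub>R partial i \<rho> z))
      \<le> C * (norm h)\<^sup>2 * indicator (cball 0 R) z" using test_taylor[OF \<rho>] by blast
  let ?D = "\<lambda>h. \<Sum>i\<in>UNIV. (h $ i) *\<^sub>R conv (partial i \<rho>) u x"
  define K where "K = (\<integral>y. indicator (cball 0 R) (x - y) * norm (u y) \<partial>lborel)"
  \<comment> \<open>The dominating function is the indicator of a ball centred at \<open>x\<close>;
    it is not smooth, which is why the multiplier class \<open>bounded_supp\<close> is used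
    here.\<close>
  have bs: "bounded_supp (\<lambda>y. indicator (cball 0 R) (x - y) :: real)"
  proof (rule bounded_suppI[of _ 1 "norm x + R"])
    fix y :: "real^'n" assume "norm x + R < norm y"
    then have "R < norm (x - y)" using norm_triangle_ineq2[of y x] by (simp add: norm_minus_commute)
    then show "(indicator (cball 0 R) (x - y) :: real) = 0" by simp
  qed (auto simp: indicator_def)
  have iK: "integrable lborel (\<lambda>y. indicator (cball 0 R) (x - y) * norm (u y))"
    using integrable_bounded_supp[OF bs L1_loc_norm[OF u]] by simp
  have K0: "K \<ge> 0" unfolding K_def by (rule Bochner_Integration.integral_nonneg) auto
  have est: "norm (conv \<rho> u (x + h) - conv \<rho> u x - ?D h) \<le> C * K * (norm h)\<^sup>2" if h: "norm h \<le> 1" for h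
  proof -
    have i1: "integrable lborel (\<lambda>y. \<rho> (x + h - y) *\<^sub>R u y)" "integrable lborel (\<lambda>y. \<rho> (x - y) *\<^sub>R u y)"
      by (intro integrable_conv \<rho> u)+
    have i2: "integrable lborel (\<lambda>y. (h $ i) *\<^sub>R (partial i \<rho> (x - y) *\<^sub>R u y))" for i
      by (intro integrable_scaleR_right integrable_conv \<rho> u test_partial)
    have i3: "integrable lborel (\<lambda>y. \<Sum>i\<in>UNIV. (h $ i) *\<^sub>R (partial i \<rho> (x - y) *\<^sub>R u y))"
      by (intro Bochner_Integration.integrable_sum i2)
    have "?D h = (\<Sum>i\<in>UNIV. \<integral>y. (h $ i) *\<^sub>R (partial i \<rho> (x - y) *\<^sub>R u y) \<partial>lborel)"
      unfolding conv_def by (intro sum.cong refl integral_scaleR_right[symmetric] integrable_conv \<rho> u test_partial)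
    also have "\<dots> = (\<integral>y. (\<Sum>i\<in>UNIV. (h $ i) *\<^sub>R (partial i \<rho> (x - y) *\<^sub>R u y)) \<partial>lborel)"
      by (rule Bochner_Integration.integral_sum[symmetric]) (rule i2)
    finally have "conv \<rho> u (x + h) - conv \<rho> u x - ?D h =
      (\<integral>y. \<rho> (x + h - y) *\<^sub>R u y - \<rho> (x - y) *\<^sub>R u y - (\<Sum>i\<in>UNIV. (h $ i) *\<^sub>R (partial i \<rho> (x - y) *\<^sub>R u y)) \<partial>lborel)"
      using i1 i3 by (simp add: conv_def)
    also have "norm \<dots> \<le> (\<integral>y. C * (norm h)\<^sup>2 * (indicator (cball 0 R) (x - y) * norm (u y)) \<partial>lborel)"
    proof (rule Bochner_Integration.integral_norm_bound_integral)
      fix y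
      have "norm (\<rho> (x + h - y) *\<^sub>R u y - \<rho> (x - y) *\<^sub>R u y - (\<Sum>i\<in>UNIV. (h $ i) *\<^sub>R (partial i \<rho> (x - y) *\<^sub>R u y)))
        = norm (\<rho> ((x - y) + h) - \<rho> (x - y) - (\<Sum>i\<in>UNIV. (h $ i) *\<^sub>R partial i \<rho> (x - y))) * norm (u y)"
        by (simp add: scaleR_diff_left[symmetric] scaleR_sum_left[symmetric] add_diff_eq
            flip: norm_scaleR scaleR_scaleR) (simp add: algebra_simps scaleR_sum_left)
      also have "\<dots> \<le> C * (norm h)\<^sup>2 * indicator (cball 0 R) (x - y) * norm (u y)"
        using C(2) h by (intro mult_right_mono) auto
      finally show "norm (\<rho> (x + h - y) *\<^sub>R u y - \<rho> (x - y) *\<^sub>R u y - (\<Sum>i\<in>UNIV. (h $ i) *\<^sub>R (partial i \<rho> (x - y) *\<^sub>R u y)))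
        \<le> C * (norm h)\<^sup>2 * (indicator (cball 0 R) (x - y) * norm (u y))" by (simp add: mult_ac)
    qed (use i1 i3 iK in auto)
    also have "\<dots> = C * K * (norm h)\<^sup>2" by (simp add: K_def)
    finally show ?thesis .
  qed
  show ?thesis
    unfolding has_derivative_at
  proof
    show "bounded_linear ?D"
      by (intro bounded_linear_sum bounded_linear_scaleR_const bounded_linear_vec_nth)
    show "(\<lambda>h. norm (conv \<rho> u (x + h) - conv \<rho> u x - ?D h) / norm h) \<midarrow>0\<rightarrow> 0"
    proof (rule Lim_null_comparison)
      show "((\<lambda>h. C * K * norm h) \<longlongrightarrow> 0) (at (0::real^'n))"
        by (intro tendsto_mult_right_zero tendsto_norm_zero tendsto_ident_at)
      show "\<forall>\<^sub>F h in at 0. norm (norm (conv \<rho> u (x + h) - conv \<rho> u x - ?D h) / norm h) \<le> C * K * norm h"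
        unfolding eventually_at
      proof (intro exI[of _ 1] conjI ballI impI)
        fix h :: "real^'n" assume "h \<noteq> 0 \<and> dist h 0 < 1"
        then have h: "norm h > 0" "norm h \<le> 1" by auto
        from est[OF h(2)] h(1)
        show "norm (norm (conv \<rho> u (x + h) - conv \<rho> u x - ?D h) / norm h) \<le> C * K * norm h"
          by (simp add: divide_simps power2_eq_square mult_ac)
      qed simp
    qed
  qed
qed

lemma partial_conv:
  assumes "\<rho> \<in> test_functions" "u \<in> Lp_loc 1"
  shows "partial i (conv \<rho> u) = conv (partial i \<rho>) u"
proof
  fix x
  have "partial i (conv \<rho> u) x = (\<Sum>j\<in>UNIV. (axis i 1 $ j) *\<^sub>R conv (partial j \<rho>) u x)"
    by (rule partialI[OF conv_has_derivative[OF assms]])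
  also have "\<dots> = (\<Sum>j\<in>UNIV. if j = i then conv (partial i \<rho>) u x else 0)"
    by (rule sum.cong) (auto simp: axis_def)
  finally show "partial i (conv \<rho> u) x = conv (partial i \<rho>) u x" by simp
qed

lemma partials_conv:
  assumes "\<rho> \<in> test_functions" "u \<in> Lp_loc 1"
  shows "partials is (conv \<rho> u) = conv (partials is \<rho>) u"
  by (induction "is") (simp_all add: partials_Cons partial_conv test_partials assms)

lemma smooth_conv:
  assumes "\<rho> \<in> test_functions" "u \<in> Lp_loc 1"
  shows "smooth (conv \<rho> u)"
  unfolding smooth_def partials_conv[OF assms]
  using conv_has_derivative[OF test_partials[OF assms(1)] assms(2)] differentiable_def by blast

lemma partials_affine:
  fixes f :: "real ^ 'n \<Rightarrow> real"
  assumes "smooth f"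
  shows "partials is (\<lambda>x. f (c *\<^sub>R x + d)) = (\<lambda>x. c ^ length is * partials is f (c *\<^sub>R x + d))"
proof (induction "is")
  case (Cons i "is")
  let ?f = "\<lambda>x. partials is f (c *\<^sub>R x + d)"
  have sm: "smooth (partials is f)" by (rule smooth_partials[OF assms])
  have D: "?f differentiable (at x)" "partial i ?f x = c * partial i (partials is f) (c *\<^sub>R x + d)" for x
    using differentiable_affine_compose(1)[of "partials is f" c d x, OF smooth_differentiable[OF sm]]
      differentiable_affine_compose(2)[of "partials is f" i c d x, OF smooth_differentiable[OF sm]]
    by simp_all
  have "partial i (\<lambda>x. c ^ length is * ?f x) x = c ^ length is * partial i ?f x" for x
    using partial_mult[of "\<lambda>_. c ^ length is" x ?f i] D(1) by simp
  then show ?case unfolding partials_Cons Cons.IH by (simp add: D fun_eq_iff)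
qed simp

lemma partials_reflect:
  fixes \<rho> :: "real ^ 'n \<Rightarrow> real"
  assumes "smooth \<rho>"
  shows "partials is (\<lambda>y. \<rho> (x - y)) = (\<lambda>y. (-1) ^ length is *\<^sub>R partials is \<rho> (x - y))"
  using partials_affine[OF assms, of "is" "-1" x] by simp

text \<open>The reflected kernel \<open>y \<mapsto> \<rho> (x - y)\<close> is itself a test function
  for the weak derivative. Reflection and the definition of the weak derivative each contribute the
  sign \<open>(-1)^length\<close>, and the signs cancel.\<close>

lemma partials_conv_weak:
  fixes u :: "real ^ 'n \<Rightarrow> 'b::{banach, second_countable_topology}"
  assumes \<rho>: "\<rho> \<in> test_functions" and w: "has_weak_deriv is u v"
  shows "partials is (conv \<rho> u) = conv \<rho> v"
proof
  fix x
  have u: "u \<in> Lp_loc 1" using w by (simp add: has_weak_deriv_def)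
  have "(\<integral>y. partials is (\<lambda>y. \<rho> (x - y)) y *\<^sub>R u y \<partial>lborel) =
      (-1) ^ length is *\<^sub>R (\<integral>y. \<rho> (x - y) *\<^sub>R v y \<partial>lborel)"
    using w test_reflect[OF \<rho>, of x] unfolding has_weak_deriv_def by blast
  then have "(-1) ^ length is *\<^sub>R (\<integral>y. partials is \<rho> (x - y) *\<^sub>R u y \<partial>lborel) =
      (-1) ^ length is *\<^sub>R (\<integral>y. \<rho> (x - y) *\<^sub>R v y \<partial>lborel)"
    by (simp add: partials_reflect[OF test_smooth[OF \<rho>]] flip: scaleR_scaleR)
  then show "partials is (conv \<rho> u) x = conv \<rho> v x"
    by (simp add: partials_conv[OF \<rho> u] conv_def)
qed

definition moll :: "nat \<Rightarrow> real ^ 'n \<Rightarrow> real"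
  where "moll k x = bump (real (Suc k) *\<^sub>R x) / (\<integral>y. bump (real (Suc k) *\<^sub>R (y::real^'n)) \<partial>lborel)"

lemma moll:
  fixes x :: "real ^ 'n"
  shows "(moll k :: real ^ 'n \<Rightarrow> real) \<in> test_functions" "moll k x \<ge> 0"
    "norm x \<ge> 1 / real (Suc k) \<Longrightarrow> moll k x = 0"
    "(\<integral>x. moll k (x::real^'n) \<partial>lborel) = 1"
proof -
  let ?b = "\<lambda>x::real^'n. bump (real (Suc k) *\<^sub>R x)"
  have bt: "(bump :: real^'n \<Rightarrow> real) \<in> test_functions"
    by (rule testI[of _ 1]) (auto simp: bump)
  have t: "?b \<in> test_functions" using test_affine[OF bt, of "real (Suc k)" 0] by simp
  have nn: "?b x \<ge> 0" for x by (rule bump)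
  have ib: "integrable lborel ?b" by (rule integrable_test_self[OF t])
  have "(\<integral>x. ?b x \<partial>lborel) \<noteq> 0"
  proof
    assume "(\<integral>x. ?b x \<partial>lborel) = 0"
    then have "AE x in lborel. ?b x = 0"
      using integral_nonneg_eq_0_iff_AE[OF ib] nn by simp
    from continuous_AE_zero[OF test_continuous[OF t] this, of 0] bump(3)[of "0::real^'n"] show False
      by simp
  qed
  moreover have "(\<integral>x. ?b x \<partial>lborel) \<ge> 0" by (intro Bochner_Integration.integral_nonneg nn)
  ultimately have pos: "(\<integral>x. ?b x \<partial>lborel) > 0" by simp
  have eq: "moll k = (\<lambda>x. (1 / (\<integral>x. ?b x \<partial>lborel)) * ?b x)" by (simp add: moll_def fun_eq_iff)
  show "(moll k :: real ^ 'n \<Rightarrow> real) \<in> test_functions"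
    unfolding eq by (intro mult_test smooth_const t)
  show "moll k x \<ge> 0" using nn pos by (simp add: moll_def)
  show "moll k x = 0" if "norm x \<ge> 1 / real (Suc k)"
  proof -
    have "norm (real (Suc k) *\<^sub>R x) \<ge> 1" using that by (simp add: field_simps del: of_nat_Suc)
    from bump(4)[OF this] show ?thesis by (simp add: moll_def del: of_nat_Suc)
  qed
  show "(\<integral>x. moll k (x::real^'n) \<partial>lborel) = 1" unfolding eq using pos by simp
qed

lemma moll_measurable [measurable]: "moll k \<in> borel_measurable borel"
  by (rule test_measurable[OF moll(1)])

lemma moll_reflect_integral:
  "integrable lborel (\<lambda>y::real^'n. moll k (x - y))" "(\<integral>y. moll k (x - y :: real^'n) \<partial>lborel) = 1"
  "(\<integral>\<^sup>+y. ennreal (moll k (x - y :: real^'n)) \<partial>lborel) = 1"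
  "(\<integral>\<^sup>+y. ennreal (moll k (y - x :: real^'n)) \<partial>lborel) = 1"
proof -
  have i: "integrable lborel (moll k :: real^'n \<Rightarrow> real)" by (rule integrable_test_self[OF moll(1)])
  show 1: "integrable lborel (\<lambda>y::real^'n. moll k (x - y))" "(\<integral>y. moll k (x - y :: real^'n) \<partial>lborel) = 1"
    using i by (auto simp: lborel_integrable_shift lborel_integral_shift moll)
  have 2: "integrable lborel (\<lambda>y::real^'n. moll k (y - x))" "(\<integral>y. moll k (y - x :: real^'n) \<partial>lborel) = 1"
    using i lborel_integrable_shift(1)[of "moll k" "-x"] lborel_integral_shift(1)[of "moll k" "-x"]
    by (auto simp: moll)
  show "(\<integral>\<^sup>+y. ennreal (moll k (x - y :: real^'n)) \<partial>lborel) = 1"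
    using 1 by (subst nn_integral_eq_integral) (auto simp: moll)
  show "(\<integral>\<^sup>+y. ennreal (moll k (y - x :: real^'n)) \<partial>lborel) = 1"
    using 2 by (subst nn_integral_eq_integral) (auto simp: moll)
qed

abbreviation mc :: "nat \<Rightarrow> (real ^ 'n \<Rightarrow> 'b) \<Rightarrow> real ^ 'n \<Rightarrow> 'b::{banach, second_countable_topology}"
  where "mc k \<equiv> conv (moll k)"

lemma mc_const: "mc k (\<lambda>x. c :: real) x = c"
  by (simp add: conv_def moll_reflect_integral)

lemma mc_cong:
  assumes "AE y in lborel. y \<in> ball x (1 / real (Suc k)) \<longrightarrow> u y = v y"
    and [measurable]: "u \<in> borel_measurable borel" "v \<in> borel_measurable borel"
  shows "mc k u x = mc k v x"
  unfolding conv_def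
proof (rule integral_cong_AE)
  show "AE y in lborel. moll k (x - y) *\<^sub>R u y = moll k (x - y) *\<^sub>R v y"
    using assms(1)
  proof eventually_elim
    case (elim y)
    then show ?case using moll(3)[of k "x - y"] by (cases "y \<in> ball x (1 / real (Suc k))") (auto simp: dist_norm)
  qed
qed measurable

lemma mc_diff:
  "u \<in> Lp_loc 1 \<Longrightarrow> v \<in> Lp_loc 1 \<Longrightarrow> mc k (\<lambda>x. u x - v x) x = mc k u x - mc k v x"
  unfolding conv_def by (simp add: scaleR_diff_right integrable_conv moll)

lemma mc_add:
  "u \<in> Lp_loc 1 \<Longrightarrow> v \<in> Lp_loc 1 \<Longrightarrow> mc k (\<lambda>x. u x + v x) x = mc k u x + mc k v x"
  unfolding conv_def by (simp add: scaleR_add_right integrable_conv moll)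

lemma mc_lower:
  fixes u :: "real ^ 'n \<Rightarrow> real"
  assumes u: "u \<in> Lp_loc 1" and c: "AE y in lborel. y \<in> ball x (1 / real (Suc k)) \<longrightarrow> c \<le> u y"
  shows "c \<le> mc k u x"
proof -
  have "c = (\<integral>y. moll k (x - y) * c \<partial>lborel)" by (simp add: moll_reflect_integral)
  also have "\<dots> \<le> (\<integral>y. moll k (x - y) *\<^sub>R u y \<partial>lborel)"
  proof (rule integral_mono_AE)
    show "AE y in lborel. moll k (x - y) * c \<le> moll k (x - y) *\<^sub>R u y"
      using c
    proof eventually_elim
      case (elim y)
      then show ?case using moll(3)[of k "x - y"] moll(2)[of k "x - y"]
        by (cases "y \<in> ball x (1 / real (Suc k))") (auto simp: dist_norm intro: mult_left_mono)
    qed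
  qed (use u moll_reflect_integral in \<open>auto intro: integrable_conv moll simp del: real_scaleR_def\<close>)
  finally show ?thesis by (simp add: conv_def)
qed

lemma norm_mc_le:
  assumes u: "u \<in> Lp_loc 1" and v: "v \<in> Lp_loc 1"
    and b: "AE y in lborel. y \<in> ball x (1 / real (Suc k)) \<longrightarrow> norm (u y) \<le> v y"
  shows "norm (mc k u x) \<le> mc k v x"
proof -
  have "norm (mc k u x) \<le> (\<integral>y. norm (moll k (x - y) *\<^sub>R u y) \<partial>lborel)"
    unfolding conv_def by (rule integral_norm_bound)
  also have "\<dots> \<le> (\<integral>y. moll k (x - y) *\<^sub>R v y \<partial>lborel)"
  proof (rule integral_mono_AE)
    show "AE y in lborel. norm (moll k (x - y) *\<^sub>R u y) \<le> moll k (x - y) *\<^sub>R v y"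
      using b
    proof eventually_elim
      case (elim y)
      then show ?case using moll(3)[of k "x - y"] moll(2)[of k "x - y"]
        by (cases "y \<in> ball x (1 / real (Suc k))") (auto simp: dist_norm intro: mult_left_mono)
    qed
  qed (auto intro!: integrable_conv integrable_norm u v moll simp del: real_scaleR_def norm_scaleR)
  finally show ?thesis by (simp add: conv_def)
qed

lemma integrable_L1_loc: "integrable lborel u \<Longrightarrow> u \<in> Lp_loc 1"
  unfolding L1_loc_iff by (auto intro: integrable_mult_indicator)

text \<open>Tonelli's theorem and the unit mass of the kernel. Applied to \<open>|u|\<close> and to
  \<open>|u|^2\<close> it yields the contraction properties in the two norms.\<close>

lemma mc_nonneg_integral:
  fixes w :: "real ^ 'n \<Rightarrow> real"
  assumes w: "integrable lborel w" "\<And>x. w x \<ge> 0"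
  shows "integrable lborel (mc k w)" "(\<integral>x. mc k w x \<partial>lborel) = (\<integral>x. w x \<partial>lborel)" "mc k w x \<ge> 0"
proof -
  have [measurable]: "w \<in> borel_measurable borel" using w by simp
  have wl: "w \<in> Lp_loc 1" by (rule integrable_L1_loc[OF w(1)])
  have nn: "mc k w x \<ge> 0" for x
    unfolding conv_def by (intro Bochner_Integration.integral_nonneg) (auto simp: moll w)
  show "mc k w x \<ge> 0" by (rule nn)
  have m [measurable]: "mc k w \<in> borel_measurable borel"
    by (intro smooth_measurable smooth_conv moll wl)
  have e: "ennreal (mc k w x) = (\<integral>\<^sup>+y. ennreal (moll k (x - y)) * ennreal (w y) \<partial>lborel)" for x
    unfolding conv_def using integrable_conv[OF moll(1) wl, of k x]
    by (subst nn_integral_eq_integral[symmetric]) (auto simp: moll w ennreal_mult)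
  have "(\<integral>\<^sup>+x. ennreal (mc k w x) \<partial>lborel)
      = (\<integral>\<^sup>+y. (\<integral>\<^sup>+x. ennreal (moll k (x - y)) * ennreal (w y) \<partial>lborel) \<partial>lborel)"
    unfolding e by (rule lborel_pair.Fubini') measurable
  also have "\<dots> = (\<integral>\<^sup>+y. ennreal (w y) \<partial>lborel)"
    by (simp add: nn_integral_multc moll_reflect_integral)
  finally have eq: "(\<integral>\<^sup>+x. ennreal (mc k w x) \<partial>lborel) = (\<integral>\<^sup>+y. ennreal (w y) \<partial>lborel)" .
  also have fin: "\<dots> = ennreal (\<integral>x. w x \<partial>lborel)"
    by (rule nn_integral_eq_integral) (auto simp: w)
  finally have eq2: "(\<integral>\<^sup>+x. ennreal (mc k w x) \<partial>lborel) = ennreal (\<integral>x. w x \<partial>lborel)" .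
  show i: "integrable lborel (mc k w)"
    by (rule integrableI_nonneg) (auto simp: nn eq2)
  have "ennreal (\<integral>x. mc k w x \<partial>lborel) = ennreal (\<integral>x. w x \<partial>lborel)"
    using nn_integral_eq_integral[OF i] nn eq2 by simp
  then show "(\<integral>x. mc k w x \<partial>lborel) = (\<integral>x. w x \<partial>lborel)"
    by (simp add: Bochner_Integration.integral_nonneg nn w)
qed

lemma mc_L1:
  assumes u: "integrable lborel u"
  shows "integrable lborel (mc k u)" "(\<integral>x. norm (mc k u x) \<partial>lborel) \<le> (\<integral>x. norm (u x) \<partial>lborel)"
proof -
  have ul: "u \<in> Lp_loc 1" by (rule integrable_L1_loc[OF u])
  have nl: "(\<lambda>x. norm (u x)) \<in> Lp_loc 1" by (rule L1_loc_norm[OF ul])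
  note w = mc_nonneg_integral[of "\<lambda>x. norm (u x)" k, OF integrable_norm[OF u] norm_ge_zero]
  have b: "norm (mc k u x) \<le> mc k (\<lambda>x. norm (u x)) x" for x
    by (rule norm_mc_le[OF ul nl]) simp
  have m: "mc k u \<in> borel_measurable borel" by (intro smooth_measurable smooth_conv moll ul)
  show i: "integrable lborel (mc k u)"
    by (rule Bochner_Integration.integrable_bound[OF w(1)]) (use b m w(3) in auto)
  have "(\<integral>x. norm (mc k u x) \<partial>lborel) \<le> (\<integral>x. mc k (\<lambda>x. norm (u x)) x \<partial>lborel)"
    by (intro integral_mono integrable_norm i w b)
  then show "(\<integral>x. norm (mc k u x) \<partial>lborel) \<le> (\<integral>x. norm (u x) \<partial>lborel)" using w(2) by simp
qed

lemma mc_L2: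
  assumes u: "integrable lborel u" and u2: "integrable lborel (\<lambda>x. (norm (u x))\<^sup>2)"
  shows "integrable lborel (\<lambda>x. (norm (mc k u x))\<^sup>2)"
    "(\<integral>x. (norm (mc k u x))\<^sup>2 \<partial>lborel) \<le> (\<integral>x. (norm (u x))\<^sup>2 \<partial>lborel)"
proof -
  have ul: "u \<in> Lp_loc 1" by (rule integrable_L1_loc[OF u])
  have nl: "(\<lambda>x. norm (u x)) \<in> Lp_loc 1" by (rule L1_loc_norm[OF ul])
  have ql: "(\<lambda>x. (norm (u x))\<^sup>2) \<in> Lp_loc 1" by (rule integrable_L1_loc[OF u2])
  note w = mc_nonneg_integral[of "\<lambda>x. (norm (u x))\<^sup>2" k, OF u2 zero_le_power2]
  have b: "(norm (mc k u x))\<^sup>2 \<le> mc k (\<lambda>x. (norm (u x))\<^sup>2) x" for x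
  proof -
    let ?m = "mc k (\<lambda>x. norm (u x)) x"
    have n: "norm (mc k u x) \<le> ?m" by (rule norm_mc_le[OF ul nl]) simp
    \<comment> \<open>Jensen's inequality for the probability density \<open>moll k (x - y)\<close>,
      read off from the nonnegativity of the variance of \<open>|u|\<close>.\<close>
    have "0 \<le> (\<integral>y. moll k (x - y) * (norm (u y) - ?m)\<^sup>2 \<partial>lborel)"
      by (intro Bochner_Integration.integral_nonneg) (auto simp: moll)
    also have "\<dots> = (\<integral>y. moll k (x - y) *\<^sub>R (norm (u y))\<^sup>2 - 2 * ?m * (moll k (x - y) *\<^sub>R norm (u y))
        + ?m\<^sup>2 * moll k (x - y) \<partial>lborel)"
      by (intro Bochner_Integration.integral_cong) (auto simp: power2_eq_square algebra_simps)
    also have "\<dots> = mc k (\<lambda>x. (norm (u x))\<^sup>2) x - 2 * ?m * ?m + ?m\<^sup>2"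
      using integrable_conv[OF moll(1) nl, of k x] integrable_conv[OF moll(1) ql, of k x]
        moll_reflect_integral[of k x]
      by (simp add: conv_def)
    finally have "?m\<^sup>2 \<le> mc k (\<lambda>x. (norm (u x))\<^sup>2) x" by (simp add: power2_eq_square)
    moreover have "(norm (mc k u x))\<^sup>2 \<le> ?m\<^sup>2" using n by (intro power_mono) auto
    ultimately show ?thesis by simp
  qed
  have m: "mc k u \<in> borel_measurable borel" by (intro smooth_measurable smooth_conv moll ul)
  show i: "integrable lborel (\<lambda>x. (norm (mc k u x))\<^sup>2)"
    by (rule Bochner_Integration.integrable_bound[OF w(1)]) (use b m w(3) in auto)
  have "(\<integral>x. (norm (mc k u x))\<^sup>2 \<partial>lborel) \<le> (\<integral>x. mc k (\<lambda>x. (norm (u x))\<^sup>2) x \<partial>lborel)"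
    by (intro integral_mono i w b)
  then show "(\<integral>x. (norm (mc k u x))\<^sup>2 \<partial>lborel) \<le> (\<integral>x. (norm (u x))\<^sup>2 \<partial>lborel)"
    using w(2) by simp
qed

subsection \<open>Convergence of mollifications\<close>

text \<open>Named as a predicate of \<open>u\<close> because it is proved by induction over
  integrable functions: indicators of sets, sums, limits.\<close>

definition L1c :: "(real ^ 'n \<Rightarrow> 'b::{banach, second_countable_topology}) \<Rightarrow> bool"
  where "L1c u \<longleftrightarrow> (\<lambda>k. \<integral>x. norm (mc k u x - u x) \<partial>lborel) \<longlonglongrightarrow> 0"

lemma tendsto_zero_le_eps:
  fixes f :: "nat \<Rightarrow> real"
  assumes "\<And>k. f k \<ge> 0" "\<And>e. e > 0 \<Longrightarrow> \<forall>\<^sub>F k in sequentially. f k \<le> C * e"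
  shows "f \<longlonglongrightarrow> 0"
proof (rule tendstoI)
  fix e :: real assume e: "e > 0"
  have "\<forall>\<^sub>F k in sequentially. f k \<le> C * (e / (2 * (\<bar>C\<bar> + 1)))"
    using e by (intro assms(2)) (auto intro!: divide_pos_pos)
  then show "\<forall>\<^sub>F k in sequentially. dist (f k) 0 < e"
  proof eventually_elim
    case (elim k)
    have "C * (e / (2 * (\<bar>C\<bar> + 1))) \<le> \<bar>C\<bar> * (e / (2 * (\<bar>C\<bar> + 1)))"
      using e by (intro mult_right_mono) auto
    also have "\<dots> < e" using e by (simp add: field_simps) (smt (verit) mult_nonneg_nonneg abs_ge_zero)
    finally show ?case using elim assms(1)[of k] by simp
  qed
qed

text \<open>Mollification contracts the \<open>L^1\<close> norm, so \<open>mc k u - u\<close>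
  differs from \<open>mc k v - v\<close> by at most twice the distance of \<open>u\<close> and
  \<open>v\<close>: the property is closed under \<open>L^1\<close> limits.\<close>

lemma L1c_approx:
  assumes u: "integrable lborel u"
    and ap: "\<And>e. e > 0 \<Longrightarrow> \<exists>v. integrable lborel v \<and> L1c v \<and> (\<integral>x. norm (u x - v x) \<partial>lborel) < e"
  shows "L1c u"
  unfolding L1c_def
proof (rule tendsto_zero_le_eps[where C=3])
  fix e :: real assume e: "e > 0"
  then obtain v where v: "integrable lborel v" "L1c v" "(\<integral>x. norm (u x - v x) \<partial>lborel) < e" using ap by blast
  have uv: "integrable lborel (\<lambda>x. u x - v x)" using u v by simp
  have ul: "u \<in> Lp_loc 1" "v \<in> Lp_loc 1" by (auto intro: integrable_L1_loc u v)
  have le: "(\<integral>x. norm (mc k u x - u x) \<partial>lborel) \<le> (\<integral>x. norm (mc k v x - v x) \<partial>lborel) + 2 * e" for k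
  proof -
    note i = mc_L1[OF u, of k] mc_L1[OF v(1), of k] mc_L1[OF uv, of k]
    have "(\<integral>x. norm (mc k u x - u x) \<partial>lborel) \<le>
      (\<integral>x. norm (mc k (\<lambda>x. u x - v x) x) + norm (mc k v x - v x) + norm (u x - v x) \<partial>lborel)"
    proof (rule integral_mono)
      fix x
      have "mc k u x - u x = mc k (\<lambda>x. u x - v x) x + (mc k v x - v x) - (u x - v x)"
        by (simp add: mc_diff[OF ul])
      then show "norm (mc k u x - u x) \<le> norm (mc k (\<lambda>x. u x - v x) x) + norm (mc k v x - v x) + norm (u x - v x)"
        using norm_triangle_ineq4[of "mc k (\<lambda>x. u x - v x) x + (mc k v x - v x)" "u x - v x"]
          norm_triangle_ineq[of "mc k (\<lambda>x. u x - v x) x" "mc k v x - v x"] by simp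
    qed (use i u v in auto)
    also have "\<dots> = (\<integral>x. norm (mc k (\<lambda>x. u x - v x) x) \<partial>lborel) + (\<integral>x. norm (mc k v x - v x) \<partial>lborel)
        + (\<integral>x. norm (u x - v x) \<partial>lborel)"
      using i u v by simp
    finally show ?thesis using i(6) v(3) by simp
  qed
  have "\<forall>\<^sub>F k in sequentially. (\<integral>x. norm (mc k v x - v x) \<partial>lborel) < e"
    using v(2) e unfolding L1c_def by (rule order_tendstoD(2))
  then show "\<forall>\<^sub>F k in sequentially. (\<integral>x. norm (mc k u x - u x) \<partial>lborel) \<le> 3 * e"
    by eventually_elim (use le in \<open>smt (verit)\<close>)
qed (auto intro: Bochner_Integration.integral_nonneg)

text \<open>The mollified indicator lies between 0 and 1 and has the same integral, hence its
  distance to the indicator is twice the mass missing inside the set. At a point of an open set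
  nothing is missing once \<open>1 / (k + 1)\<close> is below the distance to the
  complement.\<close>

lemma L1c_open:
  fixes U :: "(real ^ 'n) set"
  assumes U: "open U" "emeasure lborel U < \<infinity>"
  shows "L1c (indicator U :: real ^ 'n \<Rightarrow> real)"
proof -
  let ?I = "indicator U :: real ^ 'n \<Rightarrow> real"
  have [measurable]: "U \<in> sets borel" using U by simp
  have i: "integrable lborel ?I" using U by (intro integrable_real_indicator) auto
  have il: "?I \<in> Lp_loc 1" by (rule integrable_L1_loc[OF i])
  have cl: "(\<lambda>x::real^'n. 1::real) \<in> Lp_loc 1" by (intro continuous_L1_loc continuous_on_const)
  note m = mc_nonneg_integral[of ?I, OF i]
  have "norm (mc k ?I x) \<le> mc k (\<lambda>x. 1) x" for k x
    by (rule norm_mc_le[OF il cl]) (auto simp: indicator_def)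
  then have le1: "mc k ?I x \<le> 1" for k x
    by (simp add: mc_const abs_le_iff)
  have ii: "integrable lborel (\<lambda>x. ?I x * (1 - mc k ?I x))" for k
    by (rule Bochner_Integration.integrable_bound[OF i])
      (use m le1 smooth_measurable[OF smooth_conv[OF moll(1) il]] in \<open>auto simp: indicator_def\<close>)
  have "(\<integral>x. norm (mc k ?I x - ?I x) \<partial>lborel) = 2 * (\<integral>x. ?I x * (1 - mc k ?I x) \<partial>lborel)" for k
  proof -
    have "(\<integral>x. norm (mc k ?I x - ?I x) \<partial>lborel) = (\<integral>x. (mc k ?I x - ?I x) + 2 * (?I x * (1 - mc k ?I x)) \<partial>lborel)"
      using m(3) le1 by (intro Bochner_Integration.integral_cong) (auto simp: indicator_def)
    also have "\<dots> = 2 * (\<integral>x. ?I x * (1 - mc k ?I x) \<partial>lborel)"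
      using ii m(1,2)[of k] i by simp
    finally show ?thesis .
  qed
  moreover have "(\<lambda>k. \<integral>x. ?I x * (1 - mc k ?I x) \<partial>lborel) \<longlonglongrightarrow> (\<integral>x. 0 \<partial>(lborel :: (real^'n) measure))"
  proof (rule integral_dominated_convergence[where w="?I"])
    show "AE x in lborel. (\<lambda>k. ?I x * (1 - mc k ?I x)) \<longlonglongrightarrow> 0"
    proof (rule AE_I2)
      fix x
      show "(\<lambda>k. ?I x * (1 - mc k ?I x)) \<longlonglongrightarrow> 0"
      proof (cases "x \<in> U")
        case True
        then obtain e where e: "e > 0" "ball x e \<subseteq> U" using U(1) open_contains_ball by blast
        obtain n where n: "inverse (real (Suc n)) < e" using reals_Archimedean e by blast
        have "mc k ?I x = 1" if "k \<ge> n" for k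
        proof -
          have "1 / real (Suc k) \<le> inverse (real (Suc n))" using that by (simp add: field_simps)
          then have "ball x (1 / real (Suc k)) \<subseteq> U" using n e by (meson order_trans subset_ball less_imp_le)
          then have "mc k ?I x = mc k (\<lambda>x. 1) x" by (intro mc_cong) (auto simp: indicator_def intro!: AE_I2)
          then show ?thesis by (simp add: mc_const)
        qed
        then have "\<forall>\<^sub>F k in sequentially. ?I x * (1 - mc k ?I x) = 0"
          by (auto simp: eventually_sequentially)
        then show ?thesis by (rule tendsto_eventually)
      qed simp
    qed
    show "AE x in lborel. norm (?I x * (1 - mc k ?I x)) \<le> ?I x" for k
      using m(3) le1 by (auto simp: indicator_def)
  qed (use ii i in auto)
  ultimately show ?thesis unfolding L1c_def by (simp add: tendsto_mult_right_zero)
qed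

lemma mc_scaleR_const:
  fixes f :: "real ^ 'n \<Rightarrow> real"
  assumes "integrable lborel f"
  shows "mc k (\<lambda>x. f x *\<^sub>R c) x = mc k f x *\<^sub>R c"
  using integrable_conv[OF moll(1) integrable_L1_loc[OF assms], of k x]
  unfolding conv_def by simp

text \<open>Outer regularity reduces a measurable set of finite measure to an open one, where
  \<open>L1c_open\<close> applies; sums and dominated limits then reach every integrable
  function.\<close>

lemma L1c_integrable:
  fixes u :: "real ^ 'n \<Rightarrow> 'b::{banach, second_countable_topology}"
  assumes "integrable lborel u" shows "L1c u"
  using assms
proof (induction rule: integrable_induct)
  case (base A c)
  have A: "A \<in> sets borel" "emeasure lborel A < \<infinity>" using base by auto
  have iA: "integrable lborel (indicator A :: real^'n \<Rightarrow> real)"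
    using base by (intro integrable_real_indicator) auto
  have "L1c (indicator A :: real^'n \<Rightarrow> real)"
  proof (rule L1c_approx[OF iA])
    fix e :: real assume e: "e > 0"
    have "A \<in> sets lebesgue" using A(1) by simp
    then obtain T where T: "open T" "A \<subseteq> T" "T - A \<in> lmeasurable" "emeasure lebesgue (T - A) < ennreal e"
      using sets_lebesgue_outer_open e by metis
    have TA: "T - A \<in> sets borel" using T(1) A(1) by auto
    then have eTA: "emeasure lborel (T - A) < ennreal e" using T(4) by simp
    have "emeasure lborel T \<le> emeasure lborel A + emeasure lborel (T - A)"
      using emeasure_subadditive[of A lborel "T - A"] A TA T(2) by (simp add: Un_absorb1)
    also have "\<dots> < \<infinity>"
      using A(2) order_less_trans[OF eTA ennreal_less_top] unfolding infinity_ennreal_def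
      by (intro ennreal_add_less_top[THEN iffD2] conjI)
    finally have fT: "emeasure lborel T < \<infinity>" .
    have iT: "integrable lborel (indicator T :: real^'n \<Rightarrow> real)"
      using T fT by (intro integrable_real_indicator) auto
    have "(\<integral>x. norm (indicator A x - indicator T x :: real) \<partial>lborel) = (\<integral>x. indicator (T - A) x \<partial>lborel)"
      using T(2) by (intro Bochner_Integration.integral_cong) (auto simp: indicator_def)
    also have "\<dots> = measure lborel (T - A)" by simp
    also have "\<dots> < e" using eTA e by (simp add: measure_def enn2real_less_iff less_top order_less_trans[OF eTA])
    finally show "\<exists>v. integrable lborel v \<and> L1c v \<and> (\<integral>x. norm (indicator A x - v x :: real) \<partial>lborel) < e"
      using iT L1c_open[OF T(1) fT] by blast
  qed
  then have "(\<lambda>k. (\<integral>x. norm (mc k (indicator A :: real^'n \<Rightarrow> real) x - indicator A x) \<partial>lborel) * norm c) \<longlonglongrightarrow> 0"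
    unfolding L1c_def by (rule tendsto_mult_left_zero)
  then show ?case
    unfolding L1c_def mc_scaleR_const[OF iA] scaleR_diff_left[symmetric] norm_scaleR
    by (simp add: integral_mult_left_zero)
next
  case (add f g)
  have l: "f \<in> Lp_loc 1" "g \<in> Lp_loc 1" using add.hyps by (auto intro: integrable_L1_loc)
  have "(\<integral>x. norm (mc k (\<lambda>x. f x + g x) x - (f x + g x)) \<partial>lborel) \<le>
     (\<integral>x. norm (mc k f x - f x) \<partial>lborel) + (\<integral>x. norm (mc k g x - g x) \<partial>lborel)" for k
  proof -
    have "(\<integral>x. norm (mc k (\<lambda>x. f x + g x) x - (f x + g x)) \<partial>lborel) \<le>
     (\<integral>x. norm (mc k f x - f x) + norm (mc k g x - g x) \<partial>lborel)"
      using mc_L1(1)[of f k] mc_L1(1)[of g k] add.hyps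
      by (intro integral_mono)
        (auto simp: mc_add[OF l] intro!: order_trans[OF eq_refl norm_triangle_ineq] arg_cong[where f=norm])
    then show ?thesis using mc_L1(1)[of f k] mc_L1(1)[of g k] add.hyps by simp
  qed
  then show ?case
    unfolding L1c_def
    by (intro tendsto_sandwich[OF _ _ tendsto_const tendsto_add_zero[OF add.IH(1)[unfolded L1c_def] add.IH(2)[unfolded L1c_def]]]
        always_eventually allI Bochner_Integration.integral_nonneg) auto
next
  case (lim f s)
  show ?case
  proof (rule L1c_approx[OF lim.hyps(4)])
    fix e :: real assume e: "e > 0"
    have "(\<lambda>i. \<integral>x. norm (f x - s i x) \<partial>lborel) \<longlonglongrightarrow> (\<integral>x. 0 \<partial>(lborel :: (real^'n) measure))"
    proof (rule integral_dominated_convergence[where w="\<lambda>x. 3 * norm (f x)"])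
      show "AE x in lborel. (\<lambda>i. norm (f x - s i x)) \<longlonglongrightarrow> 0"
      proof (rule AE_I2)
        fix x
        have "(\<lambda>i. f x - s i x) \<longlonglongrightarrow> f x - f x" by (intro tendsto_intros lim.hyps(2)) simp
        then show "(\<lambda>i. norm (f x - s i x)) \<longlonglongrightarrow> 0" by (simp add: tendsto_norm_zero)
      qed
      show "AE x in lborel. norm (norm (f x - s i x)) \<le> 3 * norm (f x)" for i
      proof (rule AE_I2)
        fix x
        show "norm (norm (f x - s i x)) \<le> 3 * norm (f x)"
          using norm_triangle_ineq4[of "f x" "s i x"] lim.hyps(3)[of x i] by simp
      qed
    qed (use lim.hyps in auto)
    then have "\<forall>\<^sub>F i in sequentially. (\<integral>x. norm (f x - s i x) \<partial>lborel) < e"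
      using e order_tendstoD(2)[of _ 0] by simp
    then obtain i where "(\<integral>x. norm (f x - s i x) \<partial>lborel) < e"
      by (auto simp: eventually_sequentially)
    then show "\<exists>v. integrable lborel v \<and> L1c v \<and> (\<integral>x. norm (f x - v x) \<partial>lborel) < e"
      using lim.hyps(1) lim.IH by blast
  qed
qed

lemma norm_sq_sum3:
  fixes a b c :: "'b::real_normed_vector"
  shows "(norm (a + b + c))\<^sup>2 \<le> 3 * ((norm a)\<^sup>2 + (norm b)\<^sup>2 + (norm c)\<^sup>2)"
proof -
  have "norm (a + b + c) \<le> norm a + norm b + norm c"
    using norm_triangle_ineq[of "a + b" c] norm_triangle_ineq[of a b] by simp
  then have "(norm (a + b + c))\<^sup>2 \<le> (norm a + norm b + norm c)\<^sup>2" by (intro power_mono) auto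
  also have "\<dots> \<le> 3 * ((norm a)\<^sup>2 + (norm b)\<^sup>2 + (norm c)\<^sup>2)"
    using sum_squares_bound[of "norm a" "norm b"] sum_squares_bound[of "norm b" "norm c"]
      sum_squares_bound[of "norm a" "norm c"]
    by (simp add: power2_eq_square algebra_simps)
  finally show ?thesis .
qed

text \<open>Convergence in \<open>L^2\<close> is reduced to \<open>L^1\<close> by cutting
  \<open>u\<close> at height \<open>M\<close>. The bounded part differs from its mollification by at
  most \<open>2 M\<close>, which bounds the square by \<open>2 M\<close> times the absolute value;
  the remainder is small in \<open>L^2\<close> and stays so under mollification.\<close>

lemma mc_L2_tendsto:
  fixes u :: "real ^ 'n \<Rightarrow> 'b::{banach, second_countable_topology}"
  assumes u: "integrable lborel u" and u2: "integrable lborel (\<lambda>x. (norm (u x))\<^sup>2)"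
  shows "(\<lambda>k. \<integral>x. (norm (mc k u x - u x))\<^sup>2 \<partial>lborel) \<longlonglongrightarrow> 0"
proof (rule tendsto_zero_le_eps[where C=9])
  fix e :: real assume e: "e > 0"
  have [measurable]: "u \<in> borel_measurable borel" using u by simp
  define v where "v M x = (if norm (u x) \<le> real M then u x else 0)" for M x
  have vm [measurable]: "v M \<in> borel_measurable borel" for M unfolding v_def by measurable
  have vb: "norm (v M x) \<le> norm (u x)" "norm (v M x) \<le> real M" "norm (u x - v M x) \<le> norm (u x)" for M x
    by (auto simp: v_def)
  have iv: "integrable lborel (v M)" for M
    by (rule Bochner_Integration.integrable_bound[OF u]) (use vb in auto)
  have id: "integrable lborel (\<lambda>x. u x - v M x)" for M using u iv by simp
  have id2: "integrable lborel (\<lambda>x. (norm (u x - v M x))\<^sup>2)" for M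
    by (rule Bochner_Integration.integrable_bound[OF u2]) (use vb in \<open>auto intro!: power_mono\<close>)
  have "(\<lambda>M. \<integral>x. (norm (u x - v M x))\<^sup>2 \<partial>lborel) \<longlonglongrightarrow> (\<integral>x. 0 \<partial>(lborel :: (real^'n) measure))"
  proof (rule integral_dominated_convergence[where w="\<lambda>x. (norm (u x))\<^sup>2"])
    show "AE x in lborel. (\<lambda>M. (norm (u x - v M x))\<^sup>2) \<longlonglongrightarrow> 0"
    proof (rule AE_I2, rule tendsto_eventually)
      fix x
      obtain n where "norm (u x) \<le> real n" using real_arch_simple by blast
      then show "\<forall>\<^sub>F M in sequentially. (norm (u x - v M x))\<^sup>2 = 0"
        by (auto simp: v_def eventually_sequentially intro!: exI[of _ n])
    qed
    show "AE x in lborel. norm ((norm (u x - v M x))\<^sup>2) \<le> (norm (u x))\<^sup>2" for M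
      using vb by (auto intro!: power_mono)
  qed (use u2 in auto)
  then have "\<forall>\<^sub>F M in sequentially. (\<integral>x. (norm (u x - v M x))\<^sup>2 \<partial>lborel) < e"
    using e order_tendstoD(2)[of _ 0] by simp
  then obtain M where M: "(\<integral>x. (norm (u x - v M x))\<^sup>2 \<partial>lborel) < e"
    by (auto simp: eventually_sequentially)
  have ul: "u \<in> Lp_loc 1" "v M \<in> Lp_loc 1" using u iv by (auto intro: integrable_L1_loc)
  have cl: "(\<lambda>x::real^'n. real M) \<in> Lp_loc 1" by (intro continuous_L1_loc continuous_on_const)
  have mv: "norm (mc k (v M) x) \<le> real M" for k x
  proof -
    have "norm (mc k (v M) x) \<le> mc k (\<lambda>x. real M) x" by (rule norm_mc_le[OF ul(2) cl]) (use vb in auto)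
    then show ?thesis by (simp add: mc_const)
  qed
  have le: "(\<integral>x. (norm (mc k u x - u x))\<^sup>2 \<partial>lborel) \<le>
     6 * e + 3 * (2 * real M * (\<integral>x. norm (mc k (v M) x - v M x) \<partial>lborel))" for k
  proof -
    note i = mc_L2[OF id id2, of k M] and j = mc_L1(1)[OF iv, of k M]
    have [measurable]: "mc k u \<in> borel_measurable borel"
      by (intro smooth_measurable smooth_conv moll ul)
    have s1: "integrable lborel (\<lambda>x. 2 * real M * norm (mc k (v M) x - v M x))" using j iv by simp
    have rhs: "integrable lborel (\<lambda>x. 3 * ((norm (mc k (\<lambda>x. u x - v M x) x))\<^sup>2
        + 2 * real M * norm (mc k (v M) x - v M x) + (norm (u x - v M x))\<^sup>2))"
      using i(1) id2[of M] s1 by (intro integrable_mult_right Bochner_Integration.integrable_add) auto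
    have pw: "(norm (mc k u x - u x))\<^sup>2 \<le> 3 * ((norm (mc k (\<lambda>x. u x - v M x) x))\<^sup>2
        + 2 * real M * norm (mc k (v M) x - v M x) + (norm (u x - v M x))\<^sup>2)" for x
    proof -
      have "mc k u x - u x = mc k (\<lambda>x. u x - v M x) x + (mc k (v M) x - v M x) + - (u x - v M x)"
        by (simp add: mc_diff[OF ul])
      then have "(norm (mc k u x - u x))\<^sup>2 \<le> 3 * ((norm (mc k (\<lambda>x. u x - v M x) x))\<^sup>2
        + (norm (mc k (v M) x - v M x))\<^sup>2 + (norm (u x - v M x))\<^sup>2)"
        using norm_sq_sum3[of "mc k (\<lambda>x. u x - v M x) x" "mc k (v M) x - v M x" "- (u x - v M x)"]
        by (simp only: norm_minus_cancel)
      moreover have "(norm (mc k (v M) x - v M x))\<^sup>2 \<le> 2 * real M * norm (mc k (v M) x - v M x)"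
      proof -
        have "norm (mc k (v M) x - v M x) \<le> 2 * real M"
          using norm_triangle_ineq4[of "mc k (v M) x" "v M x"] mv[of k x] vb(2)[of M x] by simp
        then show ?thesis unfolding power2_eq_square by (intro mult_right_mono) auto
      qed
      ultimately show ?thesis by simp
    qed
    have "(\<integral>x. (norm (mc k u x - u x))\<^sup>2 \<partial>lborel) \<le> (\<integral>x. 3 * ((norm (mc k (\<lambda>x. u x - v M x) x))\<^sup>2
        + 2 * real M * norm (mc k (v M) x - v M x) + (norm (u x - v M x))\<^sup>2) \<partial>lborel)"
    proof (rule integral_mono[OF _ rhs pw])
      show "integrable lborel (\<lambda>x. (norm (mc k u x - u x))\<^sup>2)"
        by (rule Bochner_Integration.integrable_bound[OF rhs])
          (use pw in \<open>auto intro!: order_trans[OF pw abs_ge_self]\<close>)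
    qed
    also have "\<dots> = 3 * ((\<integral>x. (norm (mc k (\<lambda>x. u x - v M x) x))\<^sup>2 \<partial>lborel)
        + 2 * real M * (\<integral>x. norm (mc k (v M) x - v M x) \<partial>lborel) + (\<integral>x. (norm (u x - v M x))\<^sup>2 \<partial>lborel))"
      using i(1) id2[of M] s1 j iv[of M] by simp
    finally show ?thesis using i(2) M by simp
  qed
  have "(\<lambda>k. 3 * (2 * real M * (\<integral>x. norm (mc k (v M) x - v M x) \<partial>lborel))) \<longlonglongrightarrow> 0"
    by (intro tendsto_mult_right_zero L1c_integrable[OF iv, unfolded L1c_def])
  then have "\<forall>\<^sub>F k in sequentially. 3 * (2 * real M * (\<integral>x. norm (mc k (v M) x - v M x) \<partial>lborel)) < e"
    using e by (rule order_tendstoD(2))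
  then show "\<forall>\<^sub>F k in sequentially. (\<integral>x. (norm (mc k u x - u x))\<^sup>2 \<partial>lborel) \<le> 9 * e"
    by eventually_elim (use le e in \<open>smt (verit)\<close>)
qed (auto intro: Bochner_Integration.integral_nonneg)

lemma mc_restrict:
  fixes u :: "real ^ 'n \<Rightarrow> 'b::{banach, second_countable_topology}"
  assumes [measurable]: "u \<in> borel_measurable borel" and x: "x \<in> cball 0 R"
  shows "mc k (\<lambda>y. indicator (cball 0 (R + 1)) y *\<^sub>R u y) x = mc k u x"
proof (rule mc_cong)
  have "y \<in> cball 0 (R + 1)" if "y \<in> ball x (1 / real (Suc k))" for y
  proof -
    have "norm (x - y) \<le> 1" using that order_less_le_trans[of "norm (x - y)" "1 / real (Suc k)" 1]
      by (simp add: dist_norm)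
    then show ?thesis using x norm_triangle_ineq2[of y x] by (simp add: norm_minus_commute)
  qed
  then show "AE y in lborel. y \<in> ball x (1 / real (Suc k)) \<longrightarrow> indicator (cball 0 (R + 1)) y *\<^sub>R u y = u y"
    by (intro AE_I2) (auto simp: indicator_def)
qed measurable

lemma mc_L1_loc:
  fixes u :: "real ^ 'n \<Rightarrow> 'b::{banach, second_countable_topology}"
  assumes u: "u \<in> Lp_loc 1"
  shows "(\<lambda>k. \<integral>x. indicator (cball 0 R) x * norm (mc k u x - u x) \<partial>lborel) \<longlonglongrightarrow> 0"
proof -
  have [measurable]: "u \<in> borel_measurable borel" using u by (simp add: Lp_loc_def)
  let ?v = "\<lambda>y. indicator (cball 0 (R + 1)) y *\<^sub>R u y"
  have iv: "integrable lborel ?v" using u by (simp add: L1_loc_iff)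
  have i: "integrable lborel (\<lambda>x. norm (mc k ?v x - ?v x))" for k
    using mc_L1(1)[OF iv] iv by simp
  have "indicator (cball 0 R) x * norm (mc k u x - u x) \<le> norm (mc k ?v x - ?v x)" for k x
    using mc_restrict[of u x R k] by (auto simp: indicator_def)
  then have le: "(\<integral>x. indicator (cball 0 R) x * norm (mc k u x - u x) \<partial>lborel) \<le> (\<integral>x. norm (mc k ?v x - ?v x) \<partial>lborel)" for k
    by (intro integral_mono' i) auto
  show ?thesis
    by (rule tendsto_sandwich[OF _ _ tendsto_const L1c_integrable[OF iv, unfolded L1c_def]])
      (auto intro!: always_eventually Bochner_Integration.integral_nonneg le)
qed

lemma mc_L2_loc:
  fixes u :: "real ^ 'n \<Rightarrow> 'b::{banach, second_countable_topology}"
  assumes u: "u \<in> Lp_loc 2"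
  shows "(\<lambda>k. \<integral>x. indicator (cball 0 R) x * (norm (mc k u x - u x))\<^sup>2 \<partial>lborel) \<longlonglongrightarrow> 0"
proof -
  have [measurable]: "u \<in> borel_measurable borel" using u by (simp add: Lp_loc_def)
  let ?v = "\<lambda>y. indicator (cball 0 (R + 1)) y *\<^sub>R u y"
  have iv: "integrable lborel ?v" using L2_loc_imp_L1_loc[OF u] by (simp add: L1_loc_iff)
  have "(\<lambda>x. (norm (?v x))\<^sup>2) = (\<lambda>x. indicator (cball 0 (R + 1)) x * (norm (u x))\<^sup>2)"
    by (auto simp: indicator_def fun_eq_iff)
  then have iv2: "integrable lborel (\<lambda>x. (norm (?v x))\<^sup>2)" using u by (simp only: L2_loc_iff)
  have [measurable]: "mc k ?v \<in> borel_measurable borel" for k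
    by (intro smooth_measurable smooth_conv moll integrable_L1_loc iv)
  have i: "integrable lborel (\<lambda>x. (norm (mc k ?v x - ?v x))\<^sup>2)" for k
  proof (rule Bochner_Integration.integrable_bound)
    show "integrable lborel (\<lambda>x. 2 * (norm (mc k ?v x))\<^sup>2 + 2 * (norm (?v x))\<^sup>2)"
      using mc_L2(1)[OF iv iv2, of k] iv2 by (intro Bochner_Integration.integrable_add integrable_mult_right)
    have "(norm (a - b))\<^sup>2 \<le> 2 * (norm a)\<^sup>2 + 2 * (norm b)\<^sup>2" for a b :: 'b
    proof -
      have "(norm (a - b))\<^sup>2 \<le> (norm a + norm b)\<^sup>2" by (intro power_mono norm_triangle_ineq4) auto
      then show ?thesis using sum_squares_bound[of "norm a" "norm b"] by (simp add: power2_sum)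
    qed
    then show "AE x in lborel. norm ((norm (mc k ?v x - ?v x))\<^sup>2) \<le> norm (2 * (norm (mc k ?v x))\<^sup>2 + 2 * (norm (?v x))\<^sup>2)"
      by (intro AE_I2) (simp del: norm_scaleR)
  qed measurable
  have "indicator (cball 0 R) x * (norm (mc k u x - u x))\<^sup>2 \<le> (norm (mc k ?v x - ?v x))\<^sup>2" for k x
    using mc_restrict[of u x R k] by (auto simp: indicator_def)
  then have le: "(\<integral>x. indicator (cball 0 R) x * (norm (mc k u x - u x))\<^sup>2 \<partial>lborel) \<le> (\<integral>x. (norm (mc k ?v x - ?v x))\<^sup>2 \<partial>lborel)" for k
    by (intro integral_mono' i) auto
  show ?thesis
    by (rule tendsto_sandwich[OF _ _ tendsto_const mc_L2_tendsto[OF iv iv2]])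
      (auto intro!: always_eventually Bochner_Integration.integral_nonneg le)
qed

lemma AE_norm_le_imp_AE:
  assumes "\<And>n::nat. AE x::real^'n in lborel. norm x \<le> real n \<longrightarrow> P x"
  shows "AE x in lborel. P x"
proof -
  have "AE x in lborel. \<forall>n::nat. norm x \<le> real n \<longrightarrow> P x" unfolding AE_all_countable using assms by blast
  then show ?thesis
  proof eventually_elim
    case (elim x)
    obtain n where "norm x \<le> real n" using real_arch_simple by blast
    with elim show ?case by blast
  qed
qed

text \<open>Testing with reflected mollifiers shows that every \<open>mc k v\<close> is zero; since
  \<open>mc k v\<close> tends to \<open>v\<close> in \<open>L^1\<close> on balls, \<open>v\<close>
  is zero almost everywhere.\<close>

lemma fundamental_lemma:
  fixes v :: "real ^ 'n \<Rightarrow> 'b::{banach, second_countable_topology}"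
  assumes v: "v \<in> Lp_loc 1" and z: "\<And>\<phi>::real^'n \<Rightarrow> real. \<phi> \<in> test_functions \<Longrightarrow> (\<integral>x. \<phi> x *\<^sub>R v x \<partial>lborel) = 0"
  shows "AE x in lborel. v x = 0"
proof (rule AE_norm_le_imp_AE)
  fix n :: nat
  have "mc k v x = 0" for k x unfolding conv_def by (intro z test_reflect moll)
  with mc_L1_loc[OF v, of "real n"]
  have 0: "(\<integral>x. indicator (cball 0 (real n)) x * norm (v x) \<partial>lborel) = 0"
    by (simp add: LIMSEQ_const_iff)
  have "integrable lborel (\<lambda>x. indicator (cball 0 (real n)) x * norm (v x))"
    using L1_loc_norm[OF v] by (simp add: L1_loc_iff)
  from integral_nonneg_eq_0_iff_AE[OF this] 0
  have "AE x in lborel. indicator (cball 0 (real n)) x * norm (v x) = 0" by simp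
  then show "AE x in lborel. norm x \<le> real n \<longrightarrow> v x = 0"
    by eventually_elim (auto simp: indicator_def)
qed

section \<open>Uniqueness of weak derivatives and splitting of second derivatives\<close>

lemma has_weak_derivD:
  fixes \<phi> :: "real ^ 'n \<Rightarrow> real"
  assumes "has_weak_deriv is u v" "\<phi> \<in> test_functions"
  shows "(\<integral>x. partials is \<phi> x *\<^sub>R u x \<partial>lborel) = (-1) ^ length is *\<^sub>R (\<integral>x. \<phi> x *\<^sub>R v x \<partial>lborel)"
  using assms by (simp add: has_weak_deriv_def)

lemma has_weak_deriv_unique:
  assumes "has_weak_deriv is u v" "has_weak_deriv is u w"
  shows "AE x in lborel. v x = w x"
proof -
  have l: "v \<in> Lp_loc 1" "w \<in> Lp_loc 1" using assms by (auto simp: has_weak_deriv_def)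
  have "AE x in lborel. v x - w x = 0"
  proof (rule fundamental_lemma[OF L1_loc_diff[OF l]])
    fix \<phi> :: "real^'a \<Rightarrow> real" assume \<phi>: "\<phi> \<in> test_functions"
    have "(-1) ^ length is *\<^sub>R (\<integral>x. \<phi> x *\<^sub>R v x \<partial>lborel) = (-1) ^ length is *\<^sub>R (\<integral>x. \<phi> x *\<^sub>R w x \<partial>lborel)"
      by (rule trans[OF has_weak_derivD[OF assms(1) \<phi>, symmetric] has_weak_derivD[OF assms(2) \<phi>]])
    then have "(\<integral>x. \<phi> x *\<^sub>R v x \<partial>lborel) = (\<integral>x. \<phi> x *\<^sub>R w x \<partial>lborel)" by simp
    then show "(\<integral>x. \<phi> x *\<^sub>R (v x - w x) \<partial>lborel) = 0"
      using l \<phi> by (simp add: scaleR_diff_right integrable_test)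
  qed
  then show ?thesis by simp
qed

lemma has_weak_deriv_weak_deriv: "has_weak_deriv is u v \<Longrightarrow> has_weak_deriv is u (weak_deriv is u)"
  unfolding weak_deriv_def by (rule someI[where P="has_weak_deriv is u"])

lemma has_weak_deriv_1:
  "has_weak_deriv [i] u v \<longleftrightarrow> u \<in> Lp_loc 1 \<and> v \<in> Lp_loc 1 \<and>
    (\<forall>\<phi>::real ^ 'n \<Rightarrow> real. \<phi> \<in> test_functions \<longrightarrow>
       (\<integral>x. partial i \<phi> x *\<^sub>R u x \<partial>lborel) = - (\<integral>x. \<phi> x *\<^sub>R v x \<partial>lborel))"
  by (simp add: has_weak_deriv_def partials_Cons)

text \<open>The test function for the first derivative is \<open>partial j \<phi>\<close>: the list
  \<open>[i, j]\<close> acts on \<open>\<phi>\<close> as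
  \<open>partial i (partial j \<phi>)\<close>, so the head of the list is the derivative that
  reaches \<open>u\<close> first.\<close>

lemma has_weak_deriv_step:
  assumes "has_weak_deriv [i, j] u v" "has_weak_deriv [i] u w"
  shows "has_weak_deriv [j] w v"
  unfolding has_weak_deriv_1
proof safe
  fix \<phi> :: "real^'a \<Rightarrow> real" assume \<phi>: "\<phi> \<in> test_functions"
  have "(\<integral>x. partial i (partial j \<phi>) x *\<^sub>R u x \<partial>lborel) = (\<integral>x. \<phi> x *\<^sub>R v x \<partial>lborel)"
    using assms(1) \<phi> by (simp add: has_weak_deriv_def partials_Cons)
  moreover have "(\<integral>x. partial i (partial j \<phi>) x *\<^sub>R u x \<partial>lborel) = - (\<integral>x. partial j \<phi> x *\<^sub>R w x \<partial>lborel)"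
    using assms(2) test_partial[OF \<phi>] unfolding has_weak_deriv_1 by blast
  ultimately have "- (\<integral>x. partial j \<phi> x *\<^sub>R w x \<partial>lborel) = (\<integral>x. \<phi> x *\<^sub>R v x \<partial>lborel)" by simp
  then show "(\<integral>x. partial j \<phi> x *\<^sub>R w x \<partial>lborel) = - (\<integral>x. \<phi> x *\<^sub>R v x \<partial>lborel)"
    by (metis minus_minus)
qed (use assms in \<open>auto simp: has_weak_deriv_def\<close>)

section \<open>Local regularity of the density\<close>

lemma bounded_supp_ball:
  fixes \<phi> :: "real ^ 'n \<Rightarrow> real"
  assumes "bounded_supp \<phi>"
  obtains C R where "C \<ge> 0" "R \<ge> 0" "\<And>x. \<bar>\<phi> x\<bar> \<le> C * indicator (cball 0 R) x"
proof -
  obtain C R where C: "\<And>x. norm (\<phi> x) \<le> C * indicator (cball 0 R) x"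
    using assms by (auto simp: bounded_supp_def)
  have "\<bar>\<phi> x\<bar> \<le> \<bar>C\<bar> * indicator (cball 0 (max R 0)) x" for x
    using C[of x] by (cases "norm x \<le> R") auto
  then show ?thesis by (intro that[of "\<bar>C\<bar>" "max R 0"]) auto
qed

lemma L1_loc_ball: "u \<in> Lp_loc 1 \<Longrightarrow> integrable lborel (\<lambda>x. indicator (cball 0 R) x *\<^sub>R u x)"
  by (simp add: L1_loc_iff)

lemma L2_loc_ball: "u \<in> Lp_loc 2 \<Longrightarrow> integrable lborel (\<lambda>x. indicator (cball 0 R) x * (norm (u x))\<^sup>2)"
  by (simp add: L2_loc_iff)

text \<open>Used with \<open>F k\<close> equal to \<open>1 / mc (s k) \<mu>\<close> or its square
  and a fixed locally integrable \<open>W\<close>. Pointwise convergence is asked in the ball of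
  radius \<open>R0\<close> outside which \<open>\<phi>\<close> vanishes, because the subsequence
  \<open>s\<close> is extracted for one ball.\<close>

lemma bounded_supp_dct:
  fixes \<phi> W :: "real ^ 'n \<Rightarrow> real" and F :: "nat \<Rightarrow> real ^ 'n \<Rightarrow> real"
  assumes \<phi>: "bounded_supp \<phi>" and W: "W \<in> Lp_loc 1"
    and [measurable]: "\<And>k. F k \<in> borel_measurable borel" "f \<in> borel_measurable borel"
    and b: "\<And>R. \<exists>M. \<forall>k. AE x in lborel. norm x \<le> R \<longrightarrow> \<bar>F k x\<bar> \<le> M"
    and R0: "\<And>x. norm x > R0 \<Longrightarrow> \<phi> x = 0"
    and l: "AE x in lborel. norm x \<le> R0 \<longrightarrow> (\<lambda>k. F k x) \<longlonglongrightarrow> f x"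
  shows "(\<lambda>k. \<integral>x. \<phi> x * (W x * F k x) \<partial>lborel) \<longlonglongrightarrow> (\<integral>x. \<phi> x * (W x * f x) \<partial>lborel)"
proof -
  obtain C R where C: "C \<ge> 0" "\<And>x. \<bar>\<phi> x\<bar> \<le> C * indicator (cball 0 R) x"
    using bounded_supp_ball[OF \<phi>] by metis
  obtain M where M: "\<And>k. AE x in lborel. norm x \<le> R \<longrightarrow> \<bar>F k x\<bar> \<le> M" using b by metis
  have [measurable]: "\<phi> \<in> borel_measurable borel" "W \<in> borel_measurable borel"
    using \<phi> W by (auto simp: bounded_supp_def Lp_loc_def)
  show ?thesis
  proof (rule integral_dominated_convergence[where w="\<lambda>x. (C * \<bar>M\<bar>) * (indicator (cball 0 R) x *\<^sub>R \<bar>W x\<bar>)"])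
    show "integrable lborel (\<lambda>x. (C * \<bar>M\<bar>) * (indicator (cball 0 R) x *\<^sub>R \<bar>W x\<bar>))"
      using L1_loc_ball[OF L1_loc_norm[OF W]] by (intro integrable_mult_right) simp
    show "AE x in lborel. (\<lambda>k. \<phi> x * (W x * F k x)) \<longlonglongrightarrow> \<phi> x * (W x * f x)"
      using l
    proof eventually_elim
      case (elim x)
      then show ?case
        by (cases "norm x \<le> R0") (auto simp: R0 intro!: tendsto_mult tendsto_const)
    qed
    show "AE x in lborel. norm (\<phi> x * (W x * F k x)) \<le> (C * \<bar>M\<bar>) * (indicator (cball 0 R) x *\<^sub>R \<bar>W x\<bar>)" for k
      using M[of k]
    proof eventually_elim
      case (elim x)
      show ?case
      proof (cases "norm x \<le> R")
        case True
        then have "\<bar>\<phi> x\<bar> * (\<bar>W x\<bar> * \<bar>F k x\<bar>) \<le> C * (\<bar>W x\<bar> * \<bar>M\<bar>)"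
          using elim C(2)[of x] C(1) by (intro mult_mono) auto
        with True show ?thesis by (simp add: abs_mult mult_ac)
      next
        case False
        then have "\<phi> x = 0" using C(2)[of x] by simp
        then show ?thesis using C by simp
      qed
    qed
  qed measurable
qed

text \<open>Both \<open>V\<close> and \<open>mc k w - w\<close> are merely square integrable, so
  their product is split by Young's inequality with weights \<open>e\<close> and
  \<open>1 / e\<close>. The bounded factor \<open>F k\<close> may vary with \<open>k\<close>; the
  smallness comes from the \<open>L^2\<close> convergence of \<open>mc k w\<close>, whose squared
  error is eventually below \<open>e^2\<close>.\<close>

lemma bounded_supp_L2_error:
  fixes \<phi> V w :: "real ^ 'n \<Rightarrow> real" and F :: "nat \<Rightarrow> real ^ 'n \<Rightarrow> real"
  assumes \<phi>: "bounded_supp \<phi>" and V: "V \<in> Lp_loc 2" and w: "w \<in> Lp_loc 2"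
    and [measurable]: "\<And>k. F k \<in> borel_measurable borel"
    and b: "\<And>R. \<exists>M. \<forall>k. AE x in lborel. norm x \<le> R \<longrightarrow> \<bar>F k x\<bar> \<le> M"
  shows "(\<lambda>k. \<integral>x. \<phi> x * (V x * F k x * (mc k w x - w x)) \<partial>lborel) \<longlonglongrightarrow> 0"
proof -
  obtain C R where C: "C \<ge> 0" "\<And>x. \<bar>\<phi> x\<bar> \<le> C * indicator (cball 0 R) x"
    using bounded_supp_ball[OF \<phi>] by metis
  obtain M where M: "\<And>k. AE x in lborel. norm x \<le> R \<longrightarrow> \<bar>F k x\<bar> \<le> M" using b by metis
  have wl: "w \<in> Lp_loc 1" by (rule L2_loc_imp_L1_loc[OF w])
  have [measurable]: "\<phi> \<in> borel_measurable borel" "V \<in> borel_measurable borel" "w \<in> borel_measurable borel"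
    using \<phi> V w by (auto simp: bounded_supp_def Lp_loc_def)
  have [measurable]: "mc k w \<in> borel_measurable borel" for k
    by (intro smooth_measurable smooth_conv moll wl)
  let ?S = "\<lambda>k. \<integral>x. indicator (cball 0 R) x * (norm (mc k w x - w x))\<^sup>2 \<partial>lborel"
  let ?A = "\<integral>x. indicator (cball 0 R) x * (norm (V x))\<^sup>2 \<partial>lborel"
  have iV: "integrable lborel (\<lambda>x. indicator (cball 0 R) x * (norm (V x))\<^sup>2)" by (rule L2_loc_ball[OF V])
  have A0: "?A \<ge> 0" by (intro Bochner_Integration.integral_nonneg) auto
  have iS: "integrable lborel (\<lambda>x. indicator (cball 0 R) x * (norm (mc k w x - w x))\<^sup>2)" for k
  proof -
    have "continuous_on UNIV (\<lambda>x. norm (mc k w x))"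
      by (intro continuous_intros smooth_continuous smooth_conv moll wl)
    then have "continuous_on UNIV (\<lambda>x. (norm (mc k w x))\<^sup>2)" by (rule continuous_on_power)
    from L1_loc_ball[OF continuous_L1_loc[OF this], of R]
    have "integrable lborel (\<lambda>x. 2 * (indicator (cball 0 R) x * (norm (mc k w x))\<^sup>2) + 2 * (indicator (cball 0 R) x * (norm (w x))\<^sup>2))"
      using L2_loc_ball[OF w] by (intro Bochner_Integration.integrable_add integrable_mult_right) auto
    then show ?thesis
    proof (rule Bochner_Integration.integrable_bound)
      have "(a - b)\<^sup>2 \<le> 2 * a\<^sup>2 + 2 * b\<^sup>2" for a b :: real
        using zero_le_power2[of "a + b"] by (simp add: power2_eq_square algebra_simps)
      then show "AE x in lborel. norm (indicator (cball 0 R) x * (norm (mc k w x - w x))\<^sup>2) \<le>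
        norm (2 * (indicator (cball 0 R) x * (norm (mc k w x))\<^sup>2) + 2 * (indicator (cball 0 R) x * (norm (w x))\<^sup>2))"
        by (intro AE_I2) (auto simp: indicator_def)
    qed measurable
  qed
  have "(\<lambda>k. \<bar>\<integral>x. \<phi> x * (V x * F k x * (mc k w x - w x)) \<partial>lborel\<bar>) \<longlonglongrightarrow> 0"
  proof (rule tendsto_zero_le_eps[where C="C * \<bar>M\<bar> * (?A + 1)"])
    fix e :: real assume e: "e > 0"
    have le: "\<bar>\<integral>x. \<phi> x * (V x * F k x * (mc k w x - w x)) \<partial>lborel\<bar> \<le> C * \<bar>M\<bar> * (e * ?A + (1 / e) * ?S k)" for k
    proof -
      have rhs: "integrable lborel (\<lambda>x. C * \<bar>M\<bar> * (e * (indicator (cball 0 R) x * (norm (V x))\<^sup>2)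
          + (1 / e) * (indicator (cball 0 R) x * (norm (mc k w x - w x))\<^sup>2)))"
        using iV iS[of k] by (intro integrable_mult_right Bochner_Integration.integrable_add)
      have pw: "AE x in lborel. norm (\<phi> x * (V x * F k x * (mc k w x - w x))) \<le>
         C * \<bar>M\<bar> * (e * (indicator (cball 0 R) x * (norm (V x))\<^sup>2) + (1 / e) * (indicator (cball 0 R) x * (norm (mc k w x - w x))\<^sup>2))"
        using M[of k]
      proof eventually_elim
        case (elim x)
        show ?case
        proof (cases "norm x \<le> R")
          case True
          let ?d = "mc k w x - w x"
          have "\<bar>V x\<bar> * \<bar>?d\<bar> \<le> e * (V x)\<^sup>2 + (1 / e) * ?d\<^sup>2"
          proof -
            have "2 * (\<bar>V x\<bar> * \<bar>?d\<bar>) \<le> e * (V x)\<^sup>2 + (1 / e) * ?d\<^sup>2"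
              using sum_squares_bound[of "sqrt e * \<bar>V x\<bar>" "\<bar>?d\<bar> / sqrt e"] e
              by (simp add: power_mult_distrib power_divide)
            moreover have "0 \<le> \<bar>V x\<bar> * \<bar>?d\<bar>" by simp
            ultimately show ?thesis by linarith
          qed
          then have "\<bar>\<phi> x\<bar> * \<bar>F k x\<bar> * (\<bar>V x\<bar> * \<bar>?d\<bar>) \<le> C * \<bar>M\<bar> * (e * (V x)\<^sup>2 + (1 / e) * ?d\<^sup>2)"
            using elim True C(2)[of x] C(1) by (intro mult_mono) auto
          with True show ?thesis by (simp add: abs_mult mult_ac)
        next
          case False
          then have "\<phi> x = 0" using C(2)[of x] by simp
          then show ?thesis using C e by simp
        qed
      qed
      have i: "integrable lborel (\<lambda>x. \<phi> x * (V x * F k x * (mc k w x - w x)))"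
        by (rule Bochner_Integration.integrable_bound[OF rhs])
          (use pw in \<open>auto elim!: eventually_mono intro: order_trans[OF _ abs_ge_self]\<close>)
      have "norm (\<integral>x. \<phi> x * (V x * F k x * (mc k w x - w x)) \<partial>lborel) \<le>
          (\<integral>x. norm (\<phi> x * (V x * F k x * (mc k w x - w x))) \<partial>lborel)" by (rule integral_norm_bound)
      also have "\<dots> \<le> (\<integral>x. C * \<bar>M\<bar> * (e * (indicator (cball 0 R) x * (norm (V x))\<^sup>2)
          + (1 / e) * (indicator (cball 0 R) x * (norm (mc k w x - w x))\<^sup>2)) \<partial>lborel)"
        by (rule integral_mono_AE[OF integrable_norm[OF i] rhs pw])
      also have "\<dots> = C * \<bar>M\<bar> * (e * ?A + (1 / e) * ?S k)"
        using iV iS[of k] by simp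
      finally show ?thesis by simp
    qed
    have "\<forall>\<^sub>F k in sequentially. ?S k < e\<^sup>2"
      using mc_L2_loc[OF w, of R] e by (intro order_tendstoD(2)) auto
    then show "\<forall>\<^sub>F k in sequentially. \<bar>\<integral>x. \<phi> x * (V x * F k x * (mc k w x - w x)) \<partial>lborel\<bar> \<le> C * \<bar>M\<bar> * (?A + 1) * e"
    proof eventually_elim
      case (elim k)
      have "(1 / e) * ?S k \<le> (1 / e) * e\<^sup>2" using e elim by (intro mult_left_mono) auto
      then have "e * ?A + (1 / e) * ?S k \<le> (?A + 1) * e" using e by (simp add: power2_eq_square algebra_simps)
      then have "C * \<bar>M\<bar> * (e * ?A + (1 / e) * ?S k) \<le> C * \<bar>M\<bar> * ((?A + 1) * e)"
        using C by (intro mult_left_mono) auto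
      with le[of k] show ?case by (simp add: mult.assoc)
    qed
  qed simp
  then show ?thesis by (simp add: tendsto_rabs_zero_iff)
qed

text \<open>Convergence in \<open>L^1\<close> on one ball gives almost everywhere convergence along
  a subsequence; the subsequence may depend on the radius, and one radius is enough whenever a test
  function is present.\<close>

lemma mc_AE_subseq:
  fixes u :: "real ^ 'n \<Rightarrow> 'b::{banach, second_countable_topology}"
  assumes u: "u \<in> Lp_loc 1"
  obtains s :: "nat \<Rightarrow> nat" where "strict_mono s"
    "AE x in lborel. norm x \<le> R \<longrightarrow> (\<lambda>k. mc (s k) u x) \<longlonglongrightarrow> u x"
proof -
  let ?d = "\<lambda>k x. indicator (cball 0 R) x *\<^sub>R (mc k u x - u x)"
  have i: "integrable lborel (?d k)" for k
    by (intro L1_loc_ball L1_loc_diff u smooth_L1_loc smooth_conv moll)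
  have "(\<lambda>k. \<integral>x. norm (?d k x) \<partial>lborel) \<longlonglongrightarrow> 0"
    using mc_L1_loc[OF u, of R] by simp
  from tendsto_L1_AE_subseq[OF i this] obtain s :: "nat \<Rightarrow> nat" where
    s: "strict_mono s" "AE x in lborel. (\<lambda>k. ?d (s k) x) \<longlonglongrightarrow> 0" by blast
  have "AE x in lborel. norm x \<le> R \<longrightarrow> (\<lambda>k. mc (s k) u x) \<longlonglongrightarrow> u x"
    using s(2) by eventually_elim (auto simp: LIM_zero_iff)
  with s(1) that show ?thesis by blast
qed

lemma mc_L1_ball:
  fixes u :: "real ^ 'n \<Rightarrow> 'b::{banach, second_countable_topology}"
  assumes u: "u \<in> Lp_loc 1"
  shows "(\<integral>x. indicator (cball 0 R) x * norm (mc k u x) \<partial>lborel)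
    \<le> (\<integral>x. indicator (cball 0 (R + 1)) x * norm (u x) \<partial>lborel)"
proof -
  let ?v = "\<lambda>y. indicator (cball 0 (R + 1)) y *\<^sub>R u y"
  have [measurable]: "u \<in> borel_measurable borel" using u by (simp add: Lp_loc_def)
  have iv: "integrable lborel ?v" by (rule L1_loc_ball[OF u])
  have "(\<integral>x. indicator (cball 0 R) x * norm (mc k u x) \<partial>lborel) \<le> (\<integral>x. norm (mc k ?v x) \<partial>lborel)"
    using mc_L1(1)[OF iv, of k] mc_restrict[of u _ R k] by (intro integral_mono') (auto simp: indicator_def)
  also have "\<dots> \<le> (\<integral>x. norm (?v x) \<partial>lborel)" by (rule mc_L1(2)[OF iv])
  finally show ?thesis by simp
qed

subsection \<open>A pointwise bound of Morrey type\<close>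


lemma cbox_1_mem: "(y::real^'n) \<in> cbox (-1) 1 \<longleftrightarrow> (\<forall>i. \<bar>y $ i\<bar> \<le> 1)"
  by (auto simp: mem_box_cart abs_le_iff minus_le_iff)

text \<open>Either \<open>s\<close> lies below the threshold \<open>t^(-\<theta>/(r-1))\<close>, or
  \<open>t^\<theta> s^(r-1) \<ge> 1\<close> and the first term dominates. It trades the gradient for
  its \<open>r\<close>-th power, which is locally integrable, plus a power of \<open>t\<close> that
  is integrable at 0.\<close>

lemma Young_powr:
  fixes s t \<theta> r :: real
  assumes "s \<ge> 0" "t > 0" "r > 1"
  shows "s \<le> t powr \<theta> * s powr r + t powr (- (\<theta> / (r - 1)))"
proof (cases "s \<le> t powr (- (\<theta> / (r - 1)))")
  case True then show ?thesis by (smt (verit) mult_nonneg_nonneg powr_ge_zero)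
next
  case False
  define a where "a = t powr (- (\<theta> / (r - 1)))"
  have a: "a > 0" "a < s" using False assms by (auto simp: a_def)
  have "a powr (r - 1) \<le> s powr (r - 1)" using a assms by (intro powr_mono2) auto
  moreover have "a powr (r - 1) = t powr (- \<theta>)" using assms by (simp add: a_def powr_powr)
  ultimately have "t powr \<theta> * t powr (- \<theta>) \<le> t powr \<theta> * s powr (r - 1)"
    by (intro mult_left_mono) auto
  then have "1 \<le> t powr \<theta> * s powr (r - 1)" using assms by (simp add: powr_add[symmetric])
  then have "s \<le> s * (t powr \<theta> * s powr (r - 1))" using assms by (simp add: mult_le_cancel_left1)
  also have "\<dots> = t powr \<theta> * s powr r"
    using a powr_add[of s 1 "r - 1"] by (simp add: mult_ac)
  finally show ?thesis by (smt (verit) powr_ge_zero)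
qed

text \<open>The mean of \<open>w\<close> over a cube of size \<open>t\<close> around \<open>x\<close> is differentiated with
  respect to \<open>t\<close>; the hypothesis on the gradient makes the derivative integrable at \<open>0\<close>.\<close>

lemma Morrey_bound:
  fixes w h :: "real ^ 'n \<Rightarrow> real" and \<theta> q H x
  assumes w: "smooth w" and h: "continuous_on UNIV h" "\<And>z. h z \<ge> 0"
    and \<theta>: "\<theta> - real CARD('n) > -1" and q: "q < 1"
    and g: "\<And>t z i. 0 < t \<Longrightarrow> t \<le> 1 \<Longrightarrow> \<bar>partial i w z\<bar> \<le> t powr \<theta> * h z + t powr (- q)"
  defines "K \<equiv> cbox (-1) (1 :: real^'n)" and "N \<equiv> real CARD('n)"
  shows "2 powr N * \<bar>w x\<bar> \<le> integral (cbox (x - 1) (x + 1)) (\<lambda>z. \<bar>w z\<bar>)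
    + N * integral (cbox (x - 1) (x + 1)) h / (\<theta> - N + 1) + N * 2 powr N / (1 - q)"
proof -
  let ?B = "cbox (x - 1) (x + 1)"
  define F where "F t = integral K (\<lambda>y. w (x + t *\<^sub>R y))" for t :: real
  define F' where "F' t = integral K (\<lambda>y. \<Sum>i\<in>UNIV. y $ i * partial i w (x + t *\<^sub>R y))" for t :: real
  have cw: "continuous_on UNIV w" "continuous_on UNIV (partial i w)" for i
    by (intro smooth_continuous smooth_partial w)+
  have cwt: "continuous_on S (\<lambda>y. w (x + t *\<^sub>R y))" "continuous_on S (\<lambda>y. partial i w (x + t *\<^sub>R y))"
    "continuous_on S (\<lambda>y. h (x + t *\<^sub>R y))" for S t i
    by (auto intro!: continuous_on_compose2[OF cw(1)] continuous_on_compose2[OF cw(2)]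
        continuous_on_compose2[OF h(1)] continuous_intros)
  have Fd: "(F has_real_derivative F' t) (at t)" for t
  proof -
    have "(F has_vector_derivative F' t) (at t within UNIV)"
      unfolding F_def F'_def K_def
    proof (rule leibniz_rule_vector_derivative)
      fix t y
      have "((\<lambda>t. x + t *\<^sub>R y) has_derivative (\<lambda>s. s *\<^sub>R y)) (at t)"
        by (auto intro!: derivative_eq_intros)
      from has_derivative_compose[OF this has_derivative_partial[OF smooth_differentiable[OF w]]]
      have "((\<lambda>t. w (x + t *\<^sub>R y)) has_derivative
          (\<lambda>s. \<Sum>i\<in>UNIV. (s *\<^sub>R y) $ i *\<^sub>R partial i w (x + t *\<^sub>R y))) (at t)" .
      then show "((\<lambda>t. w (x + t *\<^sub>R y)) has_vector_derivative
          (\<Sum>i\<in>UNIV. y $ i * partial i w (x + t *\<^sub>R y))) (at t within UNIV)"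
        unfolding has_vector_derivative_def by (simp add: sum_distrib_left mult.assoc)
    next
      show "(\<lambda>y. w (x + t *\<^sub>R y)) integrable_on cbox (-1) 1" for t
        by (intro integrable_continuous cwt)
      show "continuous_on (UNIV \<times> cbox (-1) 1) (\<lambda>(t, y). \<Sum>i\<in>UNIV. y $ i * partial i w (x + t *\<^sub>R y))"
        unfolding split_beta
        by (intro continuous_on_sum continuous_on_mult continuous_on_compose2[OF cw(2)] continuous_intros) auto
    qed auto
    then show ?thesis by (simp add: has_real_derivative_iff_has_vector_derivative)
  qed
  have contK: "measure lborel K = 2 powr N"
  proof -
    have "measure lborel K = 2 ^ CARD('n)"
      unfolding K_def by (subst content_cbox_cart) (auto simp: interval_eq_empty_cart)
    then show ?thesis by (simp add: N_def powr_realpow)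
  qed
  define I where "I = integral ?B h"
  have I0: "I \<ge> 0" unfolding I_def by (intro Henstock_Kurzweil_Integration.integral_nonneg integrable_continuous continuous_on_subset[OF h(1)] h(2)) auto
  \<comment> \<open>Rescaling the cube of side \<open>2 t\<close> to \<open>K\<close> costs
    \<open>t^(-N)\<close>; the exponent \<open>\<theta>\<close> therefore appears below as
    \<open>\<theta> - N\<close>, whence the assumption that this exceeds \<open>-1\<close>.\<close>
  have hK: "integral K (\<lambda>y. h (x + t *\<^sub>R y)) \<le> t powr (- N) * I" if t: "0 < t" "t \<le> 1" for t
  proof -
    let ?a = "x - t *\<^sub>R 1" and ?b = "x + t *\<^sub>R (1::real^'n)"
    have "h integrable_on cbox ?a ?b" by (intro integrable_continuous continuous_on_subset[OF h(1)]) auto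
    then have "(h has_integral integral (cbox ?a ?b) h) (cbox ?a ?b)" by (rule integrable_integral)
    from has_integral_affinity'[OF this t(1), of x]
    have "((\<lambda>y. h (t *\<^sub>R y + x)) has_integral integral (cbox ?a ?b) h /\<^sub>R t ^ CARD('n)) (cbox (-1) 1)"
      using t by simp
    then have "integral K (\<lambda>y. h (x + t *\<^sub>R y)) = integral (cbox ?a ?b) h /\<^sub>R t ^ CARD('n)"
      unfolding K_def by (simp add: integral_unique add.commute)
    also have "\<dots> = t powr (- N) * integral (cbox ?a ?b) h"
      using t by (simp add: N_def powr_minus powr_realpow)
    also have "\<dots> \<le> t powr (- N) * I"
    proof -
      have "cbox ?a ?b \<subseteq> ?B"
      proof
        fix y assume "y \<in> cbox ?a ?b"
        then have "x $ i - t \<le> y $ i \<and> y $ i \<le> x $ i + t" for i by (auto simp: mem_box_cart)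
        then have "x $ i - 1 \<le> y $ i \<and> y $ i \<le> x $ i + 1" for i using t by (smt (verit))
        then show "y \<in> ?B" by (simp add: mem_box_cart)
      qed
      then show ?thesis
        unfolding I_def using t
        by (intro mult_left_mono integral_subset_le integrable_continuous continuous_on_subset[OF h(1)])
          (auto simp: h(2))
    qed
    finally show ?thesis .
  qed
  have F'b: "\<bar>F' t\<bar> \<le> N * I * t powr (\<theta> - N) + N * 2 powr N * t powr (- q)" if t: "0 < t" "t \<le> 1" for t
  proof -
    have "norm (F' t) \<le> integral K (\<lambda>y. N * (t powr \<theta> * h (x + t *\<^sub>R y) + t powr (- q)))"
      unfolding F'_def
    proof (rule Henstock_Kurzweil_Integration.integral_norm_bound_integral)
      show "(\<lambda>y. \<Sum>i\<in>UNIV. y $ i * partial i w (x + t *\<^sub>R y)) integrable_on K"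
        unfolding K_def by (intro integrable_continuous continuous_on_sum continuous_on_mult cwt continuous_intros)
      show "(\<lambda>y. N * (t powr \<theta> * h (x + t *\<^sub>R y) + t powr (- q))) integrable_on K"
        unfolding K_def by (intro integrable_continuous continuous_on_mult continuous_on_add cwt continuous_on_const)
      fix y assume "y \<in> K"
      then have y: "\<bar>y $ i\<bar> \<le> 1" for i by (simp add: K_def cbox_1_mem)
      have "norm (\<Sum>i\<in>UNIV. y $ i * partial i w (x + t *\<^sub>R y)) \<le>
          (\<Sum>i\<in>(UNIV::'n set). 1 * (t powr \<theta> * h (x + t *\<^sub>R y) + t powr (- q)))"
      proof (rule sum_norm_le)
        fix i
        show "norm (y $ i * partial i w (x + t *\<^sub>R y)) \<le> 1 * (t powr \<theta> * h (x + t *\<^sub>R y) + t powr (- q))"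
          unfolding real_norm_def abs_mult using y g[OF t] by (intro mult_mono) auto
      qed
      then show "norm (\<Sum>i\<in>UNIV. y $ i * partial i w (x + t *\<^sub>R y)) \<le> N * (t powr \<theta> * h (x + t *\<^sub>R y) + t powr (- q))"
        by (simp add: N_def)
    qed
    also have "\<dots> = N * (t powr \<theta> * integral K (\<lambda>y. h (x + t *\<^sub>R y)) + 2 powr N * t powr (- q))"
    proof -
      have "(\<lambda>y. t powr \<theta> * h (x + t *\<^sub>R y)) integrable_on K" "(\<lambda>y. t powr (- q)) integrable_on K"
        unfolding K_def by (intro integrable_continuous continuous_on_mult cwt continuous_on_const)+
      then show ?thesis
        using contK by (simp add: Henstock_Kurzweil_Integration.integral_add K_def)
    qed
    also have "\<dots> \<le> N * (t powr \<theta> * (t powr (- N) * I) + 2 powr N * t powr (- q))"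
      using hK[OF t] by (intro mult_left_mono add_right_mono) (auto simp: N_def)
    also have "\<dots> = N * I * t powr (\<theta> - N) + N * 2 powr N * t powr (- q)"
      by (simp add: powr_diff powr_minus field_simps)
    finally show ?thesis by simp
  qed
  \<comment> \<open>An antiderivative of the bound on \<open>F'\<close>, finite at 0 since both
    exponents exceed \<open>-1\<close>. The mean value theorem for \<open>\<Phi> - s F\<close> with
    \<open>s = 1\<close> and \<open>s = -1\<close> then takes the place of integrating the bound
    from 0 to 1.\<close>
  define \<Phi> where "\<Phi> t = N * I * (t powr (\<theta> - N + 1) / (\<theta> - N + 1)) + N * 2 powr N * (t powr (1 - q) / (1 - q))" for t
  have e: "\<theta> - N + 1 > 0" "1 - q > 0" using \<theta> q by (auto simp: N_def)
  have \<Phi>d: "(\<Phi> has_real_derivative N * I * t powr (\<theta> - N) + N * 2 powr N * t powr (- q)) (at t)" if "t > 0" for t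
    unfolding \<Phi>_def using e that by (auto intro!: derivative_eq_intros)
  have \<Phi>c: "continuous_on {0..1} \<Phi>"
    unfolding \<Phi>_def using e by (auto intro!: continuous_intros continuous_on_powr')
  have \<Phi>0: "\<Phi> 0 = 0" and \<Phi>1: "\<Phi> 1 = N * I / (\<theta> - N + 1) + N * 2 powr N / (1 - q)"
    by (simp_all add: \<Phi>_def)
  have Fc: "continuous_on {0..1} F"
    using Fd by (meson DERIV_continuous continuous_at_imp_continuous_on)
  have key: "s * F 1 - s * F 0 \<le> \<Phi> 1" if s: "\<bar>s\<bar> = 1" for s :: real
  proof -
    have "\<exists>l z. 0 < z \<and> z < 1 \<and> ((\<lambda>t. \<Phi> t - s * F t) has_real_derivative l) (at z) \<and>
       (\<Phi> 1 - s * F 1) - (\<Phi> 0 - s * F 0) = (1 - 0) * l"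
    proof (rule MVT)
      show "continuous_on {0..1} (\<lambda>t. \<Phi> t - s * F t)"
        by (intro continuous_intros \<Phi>c Fc)
      fix z :: real assume "0 < z" "z < 1"
      then show "(\<lambda>t. \<Phi> t - s * F t) differentiable (at z)"
        using DERIV_diff[OF \<Phi>d DERIV_cmult[OF Fd]] real_differentiable_def by blast
    qed simp
    then obtain l z where lz: "0 < z" "z < 1" "((\<lambda>t. \<Phi> t - s * F t) has_real_derivative l) (at z)"
       "(\<Phi> 1 - s * F 1) - (\<Phi> 0 - s * F 0) = l" by auto
    have "l = N * I * z powr (\<theta> - N) + N * 2 powr N * z powr (- q) - s * F' z"
      using DERIV_unique[OF lz(3) DERIV_diff[OF \<Phi>d[OF lz(1)] DERIV_cmult[OF Fd]]] .
    moreover have "s * F' z \<le> \<bar>F' z\<bar>" using s by (metis abs_ge_self abs_mult mult_1)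
    ultimately have "l \<ge> 0" using F'b[of z] lz by simp
    with lz(4) \<Phi>0 show ?thesis by simp
  qed
  have "\<bar>F 0\<bar> \<le> \<bar>F 1\<bar> + \<Phi> 1" using key[of 1] key[of "-1"] by (simp add: abs_if)
  moreover have "F 0 = 2 powr N * w x"
    using contK by (simp add: F_def K_def)
  moreover have "\<bar>F 1\<bar> \<le> integral ?B (\<lambda>z. \<bar>w z\<bar>)"
  proof -
    have "(\<lambda>z. \<bar>w z\<bar>) integrable_on ?B" by (intro integrable_continuous continuous_intros continuous_on_subset[OF cw(1)]) auto
    then have "((\<lambda>z. \<bar>w z\<bar>) has_integral integral ?B (\<lambda>z. \<bar>w z\<bar>)) ?B" by (rule integrable_integral)
    from has_integral_affinity'[OF this, of 1 x]
    have "((\<lambda>y. \<bar>w (y + x)\<bar>) has_integral integral ?B (\<lambda>z. \<bar>w z\<bar>)) (cbox (-1) 1)" by simp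
    then have "integral K (\<lambda>y. \<bar>w (x + y)\<bar>) = integral ?B (\<lambda>z. \<bar>w z\<bar>)"
      unfolding K_def by (simp add: integral_unique add.commute)
    moreover have "norm (F 1) \<le> integral K (\<lambda>y. \<bar>w (x + y)\<bar>)"
      unfolding F_def K_def using cwt(1)[where t=1]
      by (intro Henstock_Kurzweil_Integration.integral_norm_bound_integral integrable_continuous continuous_intros) auto
    ultimately show ?thesis by simp
  qed
  ultimately show ?thesis using \<Phi>1 by (simp add: I_def abs_mult)
qed

lemma smooth_ln:
  fixes f :: "real ^ 'n \<Rightarrow> real"
  assumes f: "smooth f" and pos: "\<And>x. f x > 0"
  shows "smooth (\<lambda>x. ln (f x))" "partial i (\<lambda>x. ln (f x)) x = partial i f x / f x"
proof -
  have d: "(ln has_real_derivative inverse (f x)) (at (f x))" for x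
    by (rule DERIV_ln[OF pos])
  have p: "partial i (\<lambda>x. ln (f x)) = (\<lambda>x. inverse (f x) *\<^sub>R partial i f x)" for i
    by (rule ext) (simp add: partial_real_compose[OF d smooth_differentiable[OF f]])
  then show "partial i (\<lambda>x. ln (f x)) x = partial i f x / f x" by (simp add: divide_inverse mult.commute)
  have df: "(\<lambda>x. ln (f x)) differentiable (at x)" for x
    by (rule differentiable_real_compose[OF d smooth_differentiable[OF f]])
  have "Ck n (\<lambda>x. ln (f x))" for n
  proof (cases n)
    case 0 then show ?thesis by (simp add: Ck_0 df)
  next
    case (Suc m)
    have "smooth (\<lambda>x. inverse (f x))" by (intro smooth_inverse f) (use pos in \<open>metis less_irrefl\<close>)
    then show ?thesis unfolding Suc Ck_Suc p using smooth_partial[OF f]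
      by (intro conjI allI df Ck_scaleR) (auto simp: smooth_Ck)
  qed
  then show "smooth (\<lambda>x. ln (f x))" by (simp add: smooth_Ck)
qed

lemma ln_diff_bound:
  fixes a b c :: real
  assumes "c > 0" "c \<le> a" "c \<le> b"
  shows "\<bar>ln a - ln b\<bar> \<le> (1 / c) * \<bar>a - b\<bar>"
proof -
  have *: "ln a - ln b \<le> (1 / c) * \<bar>a - b\<bar>" if "c \<le> a" "c \<le> b" for a b
  proof -
    have "ln a - ln b \<le> (a - b) / b" using that assms(1) by (intro ln_diff_le) auto
    also have "\<dots> \<le> \<bar>a - b\<bar> / b" using that assms(1) by (intro divide_right_mono) auto
    also have "\<dots> \<le> \<bar>a - b\<bar> / c" using that assms(1) by (intro divide_left_mono) auto
    finally show ?thesis by simp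
  qed
  from *[OF assms(2,3)] *[OF assms(3,2)] show ?thesis by (simp add: abs_le_iff abs_minus_commute)
qed

text \<open>Representatives \<open>G\<close> of the weak gradient are parameters, not choices by
  \<open>weak_deriv\<close>; the locale thus also covers the weight 1 with \<open>G = 0\<close>,
  from which the classical Hardy inequality is obtained. The exponent 2 makes the products of two
  components of \<open>G\<close> locally integrable.\<close>

locale sobolev_weight =
  fixes \<mu> :: "real ^ 'n \<Rightarrow> real" and G :: "'n \<Rightarrow> real ^ 'n \<Rightarrow> real"
  assumes mu_L2: "\<mu> \<in> Lp_loc 2"
    and weak_G: "\<And>i. has_weak_deriv [i] \<mu> (G i)"
    and G_L2: "\<And>i. G i \<in> Lp_loc 2"
    and low: "\<And>R. \<exists>c>0. AE x in lborel. norm x \<le> R \<longrightarrow> c \<le> \<mu> x"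
begin

lemma mu_measurable [measurable]: "\<mu> \<in> borel_measurable borel"
  using mu_L2 by (rule Lp_loc_measurable)

lemma G_measurable [measurable]: "G i \<in> borel_measurable borel"
  using G_L2 by (rule Lp_loc_measurable)

lemma mu_L1: "\<mu> \<in> Lp_loc 1"
  by (rule L2_loc_imp_L1_loc[OF mu_L2])

lemma G_L1: "G i \<in> Lp_loc 1"
  by (rule L2_loc_imp_L1_loc[OF G_L2])

lemma GG_L1: "(\<lambda>x. G i x * G j x) \<in> Lp_loc 1"
  by (rule L2_loc_mult[OF G_L2 G_L2])

lemma mu_pos: "AE x in lborel. 0 < \<mu> x"
proof (rule AE_norm_le_imp_AE)
  fix n :: nat
  obtain c where "c > 0" "AE x in lborel. norm x \<le> real n \<longrightarrow> c \<le> \<mu> x" using low by blast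
  then show "AE x in lborel. norm x \<le> real n \<longrightarrow> 0 < \<mu> x" by (auto elim!: eventually_mono)
qed

text \<open>A mollification averages over a ball of radius at most 1, so a lower bound on the ball
  of radius \<open>R + 1\<close> passes to all \<open>mc k \<mu>\<close> with one constant.
  Quotients by \<open>mc k \<mu>\<close> are then bounded uniformly in \<open>k\<close>.\<close>

lemma low_mc:
  obtains c where "c > 0" "AE x in lborel. norm x \<le> R \<longrightarrow> c \<le> \<mu> x"
    "\<And>k x. norm x \<le> R \<Longrightarrow> c \<le> mc k \<mu> x"
proof -
  obtain c where c: "c > 0" "AE x in lborel. norm x \<le> R + 1 \<longrightarrow> c \<le> \<mu> x" using low by blast
  show ?thesis
  proof (rule that[OF c(1)])
    show "AE x in lborel. norm x \<le> R \<longrightarrow> c \<le> \<mu> x" using c(2) by eventually_elim auto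
    fix k and x :: "real^'n" assume x: "norm x \<le> R"
    show "c \<le> mc k \<mu> x"
    proof (rule mc_lower[OF mu_L1])
      have "norm y \<le> R + 1" if "y \<in> ball x (1 / real (Suc k))" for y
      proof -
        have "norm (x - y) \<le> 1" using that order_less_le_trans[of "norm (x - y)" "1 / real (Suc k)" 1]
          by (simp add: dist_norm)
        then show ?thesis using x norm_triangle_ineq2[of y x] by (simp add: norm_minus_commute)
      qed
      then show "AE y in lborel. y \<in> ball x (1 / real (Suc k)) \<longrightarrow> c \<le> \<mu> y"
        using c(2) by (auto elim!: eventually_mono)
    qed
  qed
qed

lemma mc_mu_pos: "mc k \<mu> x > 0"
  by (rule low_mc[of "norm x"]) (meson order_less_le_trans order_refl)

lemma smooth_mc_mu: "smooth (mc k \<mu>)"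
  by (intro smooth_conv moll mu_L1)

lemma partial_mc_mu: "partial i (mc k \<mu>) = mc k (G i)"
  using partials_conv_weak[OF moll(1)[of k] weak_G[of i]] by (simp add: partials_Cons)

lemma inv_bound: "\<exists>M. \<forall>k. AE x in lborel. norm x \<le> R \<longrightarrow> \<bar>1 / mc (s k) \<mu> x\<bar> \<le> M"
proof -
  obtain c where c: "c > 0" "\<And>k x. norm x \<le> R \<Longrightarrow> c \<le> mc k \<mu> x" using low_mc by metis
  have "\<bar>1 / mc (s k) \<mu> x\<bar> \<le> 1 / c" if "norm x \<le> R" for k x
    using c(1) c(2)[OF that, of "s k"] by (simp add: divide_simps)
  then show ?thesis by (intro exI[of _ "1 / c"]) auto
qed

lemma inv2_bound: "\<exists>M. \<forall>k. AE x in lborel. norm x \<le> R \<longrightarrow> \<bar>1 / (mc (s k) \<mu> x)\<^sup>2\<bar> \<le> M"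
proof -
  obtain c where c: "c > 0" "\<And>k x. norm x \<le> R \<Longrightarrow> c \<le> mc k \<mu> x" using low_mc by metis
  have "\<bar>1 / (mc (s k) \<mu> x)\<^sup>2\<bar> \<le> 1 / c\<^sup>2" if "norm x \<le> R" for k x
    using c(1) c(2)[OF that, of "s k"] by (simp add: frac_le power_mono)
  then show ?thesis by (intro exI[of _ "1 / c\<^sup>2"]) auto
qed

lemma L1_loc_div:
  assumes u: "u \<in> Lp_loc 1" shows "(\<lambda>x. u x / \<mu> x) \<in> Lp_loc 1"
proof (rule L1_loc_bound[OF u])
  have [measurable]: "u \<in> borel_measurable borel" by (rule Lp_loc_measurable[OF u])
  show "(\<lambda>x. u x / \<mu> x) \<in> borel_measurable borel" by measurable
  fix R
  obtain c where c: "c > 0" "AE x in lborel. norm x \<le> R \<longrightarrow> c \<le> \<mu> x" using low by blast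
  have "AE x in lborel. norm x \<le> R \<longrightarrow> norm (u x / \<mu> x) \<le> (1 / c) * norm (u x)"
    using c(2)
  proof eventually_elim
    case (elim x)
    then show ?case using c(1) by (auto simp: abs_divide intro!: divide_left_mono)
  qed
  then show "\<exists>C. AE x in lborel. norm x \<le> R \<longrightarrow> norm (u x / \<mu> x) \<le> C * norm (u x)" by blast
qed

lemma L1_loc_div2:
  assumes u: "u \<in> Lp_loc 1" shows "(\<lambda>x. u x / (\<mu> x)\<^sup>2) \<in> Lp_loc 1"
  using L1_loc_div[OF L1_loc_div[OF u]] by (simp add: power2_eq_square)

lemma one_L2: "(\<lambda>x::real^'n. 1::real) \<in> Lp_loc 2"
  unfolding L2_loc_iff by (auto intro!: integrable_real_indicator emeasure_lborel_cball_finite)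

text \<open>The chain rule holds classically for the smooth positive \<open>mc k \<mu>\<close>. Both
  sides then converge: the left one by the Lipschitz bound of \<open>ln\<close> above a positive
  constant, the right one after \<open>mc k (G i)\<close> is replaced by \<open>G i\<close>.\<close>

lemma weak_ln: "has_weak_deriv [i] (\<lambda>x. ln (\<mu> x)) (\<lambda>x. G i x / \<mu> x)"
  unfolding has_weak_deriv_1
proof (intro conjI allI impI)
  show "(\<lambda>x. G i x / \<mu> x) \<in> Lp_loc 1" by (rule L1_loc_div[OF G_L1])
  have "(\<lambda>x. 1 + norm (\<mu> x)) \<in> Lp_loc 1"
    by (intro L1_loc_add L1_loc_norm mu_L1 continuous_L1_loc continuous_on_const)
  then show ln1: "(\<lambda>x. ln (\<mu> x)) \<in> Lp_loc 1"
  proof (rule L1_loc_bound)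
    fix R
    obtain c where c: "c > 0" "AE x in lborel. norm x \<le> R \<longrightarrow> c \<le> \<mu> x" using low by blast
    have "AE x in lborel. norm x \<le> R \<longrightarrow> norm (ln (\<mu> x)) \<le> (\<bar>ln c\<bar> + 1) * norm (1 + norm (\<mu> x))"
      using c(2)
    proof eventually_elim
      case (elim x)
      show ?case
      proof
        assume "norm x \<le> R"
        with elim have m: "c \<le> \<mu> x" by simp
        then have "ln c \<le> ln (\<mu> x)" "ln (\<mu> x) \<le> \<mu> x" using c(1) by (auto intro: ln_bound)
        then have "\<bar>ln (\<mu> x)\<bar> \<le> \<bar>ln c\<bar> + \<bar>\<mu> x\<bar>" by simp
        also have "\<dots> \<le> (\<bar>ln c\<bar> + 1) * (1 + \<bar>\<mu> x\<bar>)" by (simp add: algebra_simps)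
        finally show "norm (ln (\<mu> x)) \<le> (\<bar>ln c\<bar> + 1) * norm (1 + norm (\<mu> x))" by simp
      qed
    qed
    then show "\<exists>C. AE x in lborel. norm x \<le> R \<longrightarrow> norm (ln (\<mu> x)) \<le> C * norm (1 + norm (\<mu> x))" by blast
  qed measurable
  fix \<phi> :: "real^'n \<Rightarrow> real" assume \<phi>: "\<phi> \<in> test_functions"
  obtain R where R: "\<And>x. norm x > R \<Longrightarrow> \<phi> x = 0" using test_supp[OF \<phi>] by blast
  obtain s where s: "strict_mono s" "AE x in lborel. norm x \<le> R \<longrightarrow> (\<lambda>k. mc (s k) \<mu> x) \<longlonglongrightarrow> \<mu> x"
    using mc_AE_subseq[OF mu_L1, of R] by blast
  have pos: "AE x in lborel. 0 < \<mu> x" by (rule mu_pos)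
  have [measurable]: "mc k \<mu> \<in> borel_measurable borel" for k by (intro smooth_measurable smooth_mc_mu)
  have [measurable]: "mc k (G i) \<in> borel_measurable borel" for k
    by (intro smooth_measurable smooth_conv moll G_L1)
  have t': "partial i \<phi> \<in> test_functions" by (rule test_partial[OF \<phi>])
  have ln_k: "(\<lambda>x. ln (mc k \<mu> x)) \<in> Lp_loc 1" for k
    by (intro smooth_L1_loc smooth_ln smooth_mc_mu mc_mu_pos)
  \<comment> \<open>The difference of logarithms is written as a difference quotient times
    \<open>mc k \<mu> - \<mu>\<close>, the form of \<open>bounded_supp_L2_error\<close>. Where the
    two functions agree the quotient is 0 by division by zero, and the product is still
    right.\<close>
  have lhs: "(\<lambda>k. \<integral>x. partial i \<phi> x * (1 * ((ln (mc k \<mu> x) - ln (\<mu> x)) / (mc k \<mu> x - \<mu> x)) * (mc k \<mu> x - \<mu> x)) \<partial>lborel) \<longlonglongrightarrow> 0"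
  proof (rule bounded_supp_L2_error[OF test_bounded_supp[OF t'] one_L2 mu_L2])
    fix R
    obtain c where c: "c > 0" "AE x in lborel. norm x \<le> R \<longrightarrow> c \<le> \<mu> x"
      "\<And>k x. norm x \<le> R \<Longrightarrow> c \<le> mc k \<mu> x" using low_mc by metis
    have "AE x in lborel. norm x \<le> R \<longrightarrow> \<bar>(ln (mc k \<mu> x) - ln (\<mu> x)) / (mc k \<mu> x - \<mu> x)\<bar> \<le> 1 / c" for k
      using c(2)
    proof eventually_elim
      case (elim x)
      show ?case
      proof
        assume x: "norm x \<le> R"
        show "\<bar>(ln (mc k \<mu> x) - ln (\<mu> x)) / (mc k \<mu> x - \<mu> x)\<bar> \<le> 1 / c"
        proof (cases "mc k \<mu> x = \<mu> x")
          case False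
          then show ?thesis using ln_diff_bound[OF c(1) c(3)[OF x, of k], of "\<mu> x"] elim x
            by (simp add: abs_divide pos_divide_le_eq)
        qed (use c(1) in simp)
      qed
    qed
    then show "\<exists>M. \<forall>k. AE x in lborel. norm x \<le> R \<longrightarrow>
       \<bar>(ln (mc k \<mu> x) - ln (\<mu> x)) / (mc k \<mu> x - \<mu> x)\<bar> \<le> M" by blast
  qed measurable
  have "(\<integral>x. partial i \<phi> x * (1 * ((ln (mc k \<mu> x) - ln (\<mu> x)) / (mc k \<mu> x - \<mu> x)) * (mc k \<mu> x - \<mu> x)) \<partial>lborel)
     = - (\<integral>x. \<phi> x * (mc k (G i) x / mc k \<mu> x) \<partial>lborel) - (\<integral>x. partial i \<phi> x * ln (\<mu> x) \<partial>lborel)" for k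
  proof -
    have "(\<integral>x. partial i \<phi> x * (1 * ((ln (mc k \<mu> x) - ln (\<mu> x)) / (mc k \<mu> x - \<mu> x)) * (mc k \<mu> x - \<mu> x)) \<partial>lborel)
      = (\<integral>x. partial i \<phi> x * ln (mc k \<mu> x) - partial i \<phi> x * ln (\<mu> x) \<partial>lborel)"
    proof (rule Bochner_Integration.integral_cong)
      fix x
      show "partial i \<phi> x * (1 * ((ln (mc k \<mu> x) - ln (\<mu> x)) / (mc k \<mu> x - \<mu> x)) * (mc k \<mu> x - \<mu> x))
        = partial i \<phi> x * ln (mc k \<mu> x) - partial i \<phi> x * ln (\<mu> x)"
      proof (cases "mc k \<mu> x = \<mu> x")
        case False
        then have "(ln (mc k \<mu> x) - ln (\<mu> x)) / (mc k \<mu> x - \<mu> x) * (mc k \<mu> x - \<mu> x) = ln (mc k \<mu> x) - ln (\<mu> x)"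
          by simp
        then show ?thesis by (simp only: mult_1 right_diff_distrib[symmetric])
      qed simp
    qed simp
    also have "\<dots> = (\<integral>x. partial i \<phi> x * ln (mc k \<mu> x) \<partial>lborel) - (\<integral>x. partial i \<phi> x * ln (\<mu> x) \<partial>lborel)"
      by (intro Bochner_Integration.integral_diff integrable_test_mult t' ln1 ln_k)
    also have "(\<integral>x. partial i \<phi> x * ln (mc k \<mu> x) \<partial>lborel) = - (\<integral>x. \<phi> x * (mc k (G i) x / mc k \<mu> x) \<partial>lborel)"
      using integral_by_parts_test[OF \<phi> smooth_ln(1)[OF smooth_mc_mu mc_mu_pos], of i k]
      by (simp add: smooth_ln(2)[OF smooth_mc_mu mc_mu_pos] partial_mc_mu)
    finally show ?thesis .
  qed
  with lhs have L: "(\<lambda>k. - (\<integral>x. \<phi> x * (mc k (G i) x / mc k \<mu> x) \<partial>lborel) - (\<integral>x. partial i \<phi> x * ln (\<mu> x) \<partial>lborel)) \<longlonglongrightarrow> 0"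
    by simp
  have e1: "(\<lambda>k. \<integral>x. \<phi> x * (1 * (1 / mc k \<mu> x) * (mc k (G i) x - G i x)) \<partial>lborel) \<longlonglongrightarrow> 0"
    using inv_bound[where s="\<lambda>k. k"]
    by (intro bounded_supp_L2_error[OF test_bounded_supp[OF \<phi>] one_L2 G_L2]) auto
  have e2: "(\<lambda>k. \<integral>x. \<phi> x * (G i x * (1 / mc (s k) \<mu> x)) \<partial>lborel) \<longlonglongrightarrow> (\<integral>x. \<phi> x * (G i x * (1 / \<mu> x)) \<partial>lborel)"
  proof (rule bounded_supp_dct[OF test_bounded_supp[OF \<phi>] G_L1 _ _ inv_bound R])
    show "AE x in lborel. norm x \<le> R \<longrightarrow> (\<lambda>k. 1 / mc (s k) \<mu> x) \<longlonglongrightarrow> 1 / \<mu> x"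
      using s(2) pos by eventually_elim (auto intro!: tendsto_divide)
  qed auto
  \<comment> \<open>Replacing \<open>mc k (G i)\<close> by \<open>G i\<close> leaves an
    \<open>L^2\<close> error that tends to 0 along the full sequence; the remaining quotient
    \<open>G i / mc k \<mu>\<close> converges along the subsequence \<open>s\<close>.\<close>
  have sp: "(\<integral>x. \<phi> x * (mc k (G i) x / mc k \<mu> x) \<partial>lborel) =
     (\<integral>x. \<phi> x * (1 * (1 / mc k \<mu> x) * (mc k (G i) x - G i x)) \<partial>lborel) + (\<integral>x. \<phi> x * (G i x * (1 / mc k \<mu> x)) \<partial>lborel)" for k
  proof -
    have sm: "smooth (\<lambda>x. inverse (mc k \<mu> x))"
      by (intro smooth_inverse smooth_mc_mu) (use mc_mu_pos[of k] in \<open>metis less_irrefl\<close>)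
    have tk: "(\<lambda>x. \<phi> x * inverse (mc k \<mu> x)) \<in> test_functions" by (rule test_mult[OF \<phi> sm])
    have i: "integrable lborel (\<lambda>x. (\<phi> x * inverse (mc k \<mu> x)) * G i x)"
      "integrable lborel (\<lambda>x. (\<phi> x * inverse (mc k \<mu> x)) * mc k (G i) x)"
      by (intro integrable_test_mult tk G_L1 smooth_L1_loc smooth_conv moll)+
    have "(\<integral>x. \<phi> x * (1 * (1 / mc k \<mu> x) * (mc k (G i) x - G i x)) \<partial>lborel) =
      (\<integral>x. (\<phi> x * inverse (mc k \<mu> x)) * mc k (G i) x - (\<phi> x * inverse (mc k \<mu> x)) * G i x \<partial>lborel)"
      by (rule Bochner_Integration.integral_cong) (auto simp: divide_inverse algebra_simps)
    also have "\<dots> = (\<integral>x. (\<phi> x * inverse (mc k \<mu> x)) * mc k (G i) x \<partial>lborel) - (\<integral>x. (\<phi> x * inverse (mc k \<mu> x)) * G i x \<partial>lborel)"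
      using i by simp
    finally show ?thesis by (simp add: divide_inverse mult_ac)
  qed
  have "(\<lambda>k. \<integral>x. \<phi> x * (mc (s k) (G i) x / mc (s k) \<mu> x) \<partial>lborel) \<longlonglongrightarrow> 0 + (\<integral>x. \<phi> x * (G i x * (1 / \<mu> x)) \<partial>lborel)"
    unfolding sp by (intro tendsto_add e2 LIMSEQ_subseq_LIMSEQ[OF e1 s(1), unfolded o_def])
  then have "(\<lambda>k. - (\<integral>x. \<phi> x * (mc (s k) (G i) x / mc (s k) \<mu> x) \<partial>lborel) - (\<integral>x. partial i \<phi> x * ln (\<mu> x) \<partial>lborel)) \<longlonglongrightarrow>
     - (0 + (\<integral>x. \<phi> x * (G i x * (1 / \<mu> x)) \<partial>lborel)) - (\<integral>x. partial i \<phi> x * ln (\<mu> x) \<partial>lborel)"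
    by (intro tendsto_intros)
  from LIMSEQ_unique[OF this LIMSEQ_subseq_LIMSEQ[OF L s(1), unfolded o_def]]
  show "(\<integral>x. partial i \<phi> x *\<^sub>R ln (\<mu> x) \<partial>lborel) = - (\<integral>x. \<phi> x *\<^sub>R (G i x / \<mu> x) \<partial>lborel)" by simp
qed

text \<open>The weak derivative of \<open>G i\<close> is tested with
  \<open>\<phi> / mc k \<mu>\<close>. Mollifying the denominator alone keeps \<open>H\<close>, which
  is merely \<open>L^1\<close>, next to bounded factors; the function \<open>mc k (G j)\<close> that
  appears meets \<open>G i\<close> and is handled in \<open>L^2\<close>.\<close>

lemma weak_quotient:
  assumes H: "has_weak_deriv [j] (G i) H"
  shows "has_weak_deriv [j] (\<lambda>x. G i x / \<mu> x) (\<lambda>x. H x / \<mu> x - G i x * G j x / (\<mu> x)\<^sup>2)"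
  unfolding has_weak_deriv_1
proof (intro conjI allI impI)
  have H1: "H \<in> Lp_loc 1" using H by (simp add: has_weak_deriv_def)
  have [measurable]: "H \<in> borel_measurable borel" by (rule Lp_loc_measurable[OF H1])
  show "(\<lambda>x. G i x / \<mu> x) \<in> Lp_loc 1" by (rule L1_loc_div[OF G_L1])
  have i3: "(\<lambda>x. H x / \<mu> x) \<in> Lp_loc 1" "(\<lambda>x. G i x * G j x / (\<mu> x)\<^sup>2) \<in> Lp_loc 1"
    by (rule L1_loc_div[OF H1], rule L1_loc_div2[OF GG_L1])
  then show "(\<lambda>x. H x / \<mu> x - G i x * G j x / (\<mu> x)\<^sup>2) \<in> Lp_loc 1" by (rule L1_loc_diff)
  fix \<phi> :: "real^'n \<Rightarrow> real" assume \<phi>: "\<phi> \<in> test_functions"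
  obtain R where R: "\<And>x. norm x > R \<Longrightarrow> \<phi> x = 0" using test_supp[OF \<phi>] by blast
  have R': "norm x > R \<Longrightarrow> partial j \<phi> x = 0" for x
    using partials_zero_outside[of R \<phi> x "[j]"] R by (simp add: partials_Cons)
  obtain s where s: "strict_mono s" "AE x in lborel. norm x \<le> R \<longrightarrow> (\<lambda>k. mc (s k) \<mu> x) \<longlonglongrightarrow> \<mu> x"
    using mc_AE_subseq[OF mu_L1, of R] by blast
  have pos: "AE x in lborel. 0 < \<mu> x" by (rule mu_pos)
  have [measurable]: "mc k \<mu> \<in> borel_measurable borel" for k by (intro smooth_measurable smooth_mc_mu)
  have [measurable]: "mc k (G j) \<in> borel_measurable borel" for k
    by (intro smooth_measurable smooth_conv moll G_L1)
  have t': "partial j \<phi> \<in> test_functions" by (rule test_partial[OF \<phi>])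
  have l1: "AE x in lborel. norm x \<le> R \<longrightarrow> (\<lambda>k. 1 / mc (s k) \<mu> x) \<longlonglongrightarrow> 1 / \<mu> x"
    using s(2) pos by eventually_elim (auto intro!: tendsto_divide)
  have l2: "AE x in lborel. norm x \<le> R \<longrightarrow> (\<lambda>k. 1 / (mc (s k) \<mu> x)\<^sup>2) \<longlonglongrightarrow> 1 / (\<mu> x)\<^sup>2"
    using s(2) pos by eventually_elim (auto intro!: tendsto_divide tendsto_power)
  have a: "(\<lambda>k. \<integral>x. partial j \<phi> x * (G i x * (1 / mc (s k) \<mu> x)) \<partial>lborel) \<longlonglongrightarrow> (\<integral>x. partial j \<phi> x * (G i x * (1 / \<mu> x)) \<partial>lborel)"
    by (rule bounded_supp_dct[OF test_bounded_supp[OF t'] G_L1 _ _ inv_bound R' l1]) auto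
  have b: "(\<lambda>k. \<integral>x. \<phi> x * (H x * (1 / mc (s k) \<mu> x)) \<partial>lborel) \<longlonglongrightarrow> (\<integral>x. \<phi> x * (H x * (1 / \<mu> x)) \<partial>lborel)"
    by (rule bounded_supp_dct[OF test_bounded_supp[OF \<phi>] H1 _ _ inv_bound R l1]) auto
  have c: "(\<lambda>k. \<integral>x. \<phi> x * (G i x * G j x * (1 / (mc (s k) \<mu> x)\<^sup>2)) \<partial>lborel) \<longlonglongrightarrow> (\<integral>x. \<phi> x * (G i x * G j x * (1 / (\<mu> x)\<^sup>2)) \<partial>lborel)"
    by (rule bounded_supp_dct[OF test_bounded_supp[OF \<phi>] GG_L1 _ _ inv2_bound R l2]) auto
  have d: "(\<lambda>k. \<integral>x. \<phi> x * (G i x * (1 / (mc k \<mu> x)\<^sup>2) * (mc k (G j) x - G j x)) \<partial>lborel) \<longlonglongrightarrow> 0"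
    using inv2_bound[where s="\<lambda>k. k"]
    by (intro bounded_supp_L2_error[OF test_bounded_supp[OF \<phi>] G_L2 G_L2]) auto
  have eq: "(\<integral>x. partial j \<phi> x * (G i x * (1 / mc k \<mu> x)) \<partial>lborel)
     - (\<integral>x. \<phi> x * (G i x * (1 / (mc k \<mu> x)\<^sup>2) * (mc k (G j) x - G j x)) \<partial>lborel)
     - (\<integral>x. \<phi> x * (G i x * G j x * (1 / (mc k \<mu> x)\<^sup>2)) \<partial>lborel)
     = - (\<integral>x. \<phi> x * (H x * (1 / mc k \<mu> x)) \<partial>lborel)" for k
  proof -
    have sm: "smooth (\<lambda>x. inverse (mc k \<mu> x))"
      by (intro smooth_inverse smooth_mc_mu) (use mc_mu_pos[of k] in \<open>metis less_irrefl\<close>)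
    let ?\<psi> = "\<lambda>x. \<phi> x * inverse (mc k \<mu> x)"
    have tk: "?\<psi> \<in> test_functions" by (rule test_mult[OF \<phi> sm])
    have tk': "(\<lambda>x. partial j \<phi> x * inverse (mc k \<mu> x)) \<in> test_functions" by (rule test_mult[OF t' sm])
    have tk2: "(\<lambda>x. ?\<psi> x * inverse (mc k \<mu> x)) \<in> test_functions" by (rule test_mult[OF tk sm])
    have tk3: "(\<lambda>x. (?\<psi> x * inverse (mc k \<mu> x)) * mc k (G j) x) \<in> test_functions"
      by (intro test_mult tk2 smooth_conv moll G_L1)
    have p: "partial j ?\<psi> x = partial j \<phi> x * inverse (mc k \<mu> x) - (?\<psi> x * inverse (mc k \<mu> x)) * mc k (G j) x" for x
    proof -
      have nz: "mc k \<mu> x \<noteq> 0" using mc_mu_pos[of k x] by simp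
      show ?thesis
        using nz by (simp add: partial_mult[OF test_differentiable[OF \<phi>] smooth_differentiable[OF sm]]
          partial_inverse[OF nz smooth_differentiable[OF smooth_mc_mu]] partial_mc_mu power2_eq_square divide_inverse)
    qed
    have i: "integrable lborel (\<lambda>x. (partial j \<phi> x * inverse (mc k \<mu> x)) * G i x)"
      "integrable lborel (\<lambda>x. ((?\<psi> x * inverse (mc k \<mu> x)) * mc k (G j) x) * G i x)"
      "integrable lborel (\<lambda>x. (?\<psi> x * inverse (mc k \<mu> x)) * (G i x * G j x))"
      by (intro integrable_test_mult tk' tk3 tk2 G_L1 GG_L1)+
    have "(\<integral>x. partial j ?\<psi> x * G i x \<partial>lborel) = - (\<integral>x. ?\<psi> x * H x \<partial>lborel)"
      using H tk unfolding has_weak_deriv_1 real_scaleR_def by blast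
    moreover have "(\<integral>x. partial j ?\<psi> x * G i x \<partial>lborel) =
      (\<integral>x. (partial j \<phi> x * inverse (mc k \<mu> x)) * G i x \<partial>lborel) - (\<integral>x. ((?\<psi> x * inverse (mc k \<mu> x)) * mc k (G j) x) * G i x \<partial>lborel)"
      unfolding p left_diff_distrib using i by simp
    moreover have "(\<integral>x. \<phi> x * (G i x * (1 / (mc k \<mu> x)\<^sup>2) * (mc k (G j) x - G j x)) \<partial>lborel) =
      (\<integral>x. ((?\<psi> x * inverse (mc k \<mu> x)) * mc k (G j) x) * G i x \<partial>lborel) - (\<integral>x. (?\<psi> x * inverse (mc k \<mu> x)) * (G i x * G j x) \<partial>lborel)"
      using i by (subst Bochner_Integration.integral_diff[symmetric])
        (auto intro!: Bochner_Integration.integral_cong simp: power2_eq_square divide_inverse algebra_simps)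
    ultimately show ?thesis
      by (simp add: power2_eq_square divide_inverse mult_ac)
  qed
  have "(\<lambda>k. (\<integral>x. partial j \<phi> x * (G i x * (1 / mc (s k) \<mu> x)) \<partial>lborel)
     - (\<integral>x. \<phi> x * (G i x * (1 / (mc (s k) \<mu> x)\<^sup>2) * (mc (s k) (G j) x - G j x)) \<partial>lborel)
     - (\<integral>x. \<phi> x * (G i x * G j x * (1 / (mc (s k) \<mu> x)\<^sup>2)) \<partial>lborel)) \<longlonglongrightarrow>
     (\<integral>x. partial j \<phi> x * (G i x * (1 / \<mu> x)) \<partial>lborel) - 0 - (\<integral>x. \<phi> x * (G i x * G j x * (1 / (\<mu> x)\<^sup>2)) \<partial>lborel)"
    by (intro tendsto_diff a c LIMSEQ_subseq_LIMSEQ[OF d s(1), unfolded o_def])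
  from LIMSEQ_unique[OF this[unfolded eq] tendsto_minus[OF b]]
  have "(\<integral>x. partial j \<phi> x * (G i x / \<mu> x) \<partial>lborel) =
     (\<integral>x. \<phi> x * (G i x * G j x / (\<mu> x)\<^sup>2) \<partial>lborel) - (\<integral>x. \<phi> x * (H x / \<mu> x) \<partial>lborel)" by simp
  also have "\<dots> = - (\<integral>x. \<phi> x * (H x / \<mu> x - G i x * G j x / (\<mu> x)\<^sup>2) \<partial>lborel)"
    using integrable_test_mult[OF \<phi> i3(1)] integrable_test_mult[OF \<phi> i3(2)] by (simp add: right_diff_distrib)
  finally show "(\<integral>x. partial j \<phi> x *\<^sub>R (G i x / \<mu> x) \<partial>lborel) = - (\<integral>x. \<phi> x *\<^sub>R (H x / \<mu> x - G i x * G j x / (\<mu> x)\<^sup>2) \<partial>lborel)"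
    by simp
qed

lemma mu_locally_bounded:
  assumes r: "r > real CARD('n)" and b: "(\<lambda>x. \<chi> i. G i x / \<mu> x) \<in> Lp_loc r"
  shows "\<exists>C. AE x in lborel. norm x \<le> R \<longrightarrow> \<mu> x \<le> C"
proof -
  let ?N = "real CARD('n)" and ?\<beta> = "\<lambda>x. norm (\<chi> i. G i x / \<mu> x)"
  let ?l = "\<lambda>x. ln (\<mu> x)" and ?h = "\<lambda>x. ?\<beta> x powr r"
  have N1: "?N \<ge> 1" by (simp add: Suc_leI)
  have h1: "?h \<in> Lp_loc 1"
  proof -
    have [measurable]: "(\<lambda>x. \<chi> i. G i x / \<mu> x) \<in> borel_measurable borel" by (rule Lp_loc_measurable[OF b])
    have "?h \<in> borel_measurable borel" by measurable
    then show ?thesis using b unfolding Lp_loc_iff by simp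
  qed
  have l1: "?l \<in> Lp_loc 1" using weak_ln by (simp add: has_weak_deriv_def)
  have bi1: "(\<lambda>x. G i x / \<mu> x) \<in> Lp_loc 1" for i by (rule L1_loc_div[OF G_L1])
  \<comment> \<open>The midpoint of \<open>N - 1\<close> and \<open>r - 1\<close>: both
    \<open>\<theta> - N > -1\<close> and \<open>q = \<theta> / (r - 1) < 1\<close> hold, and this is
    where \<open>r > N\<close> enters.\<close>
  define \<theta> where "\<theta> = (?N + r - 2) / 2"
  define q where "q = \<theta> / (r - 1)"
  have \<theta>: "\<theta> - ?N > -1" "\<theta> < r - 1" using r by (auto simp: \<theta>_def field_simps)
  have r1: "r > 1" using r N1 by linarith
  have q: "q < 1" using \<theta> r1 by (simp add: q_def divide_simps)
  \<comment> \<open>Bounds that depend neither on \<open>k\<close> nor on the point: the cube of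
    half side 1 around \<open>x\<close> stays within distance \<open>N\<close> of \<open>x\<close>,
    and mollification adds 1 to the radius.\<close>
  define A where "A = (\<integral>x. indicator (cball 0 (R + ?N + 1)) x * norm (?l x) \<partial>lborel)"
  define B where "B = (\<integral>x. indicator (cball 0 (R + ?N + 1)) x * norm (?h x) \<partial>lborel)"
  define M where "M = A + ?N * B / (\<theta> - ?N + 1) + ?N * 2 powr ?N / (1 - q)"
  have cb: "integral (cbox (x - 1) (x + 1)) f \<le> (\<integral>y. indicator (cball 0 (R + ?N)) y * f y \<partial>lborel)"
    if x: "norm x \<le> R" and f: "continuous_on UNIV f" "\<And>y. f y \<ge> 0" for x :: "real^'n" and f :: "real^'n \<Rightarrow> real"
  proof -
    have sub: "cbox (x - 1) (x + 1) \<subseteq> cball 0 (R + ?N)"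
    proof
      fix y assume "y \<in> cbox (x - 1) (x + 1)"
      then have "x $ i - 1 \<le> y $ i \<and> y $ i \<le> x $ i + 1" for i by (auto simp: mem_box_cart)
      then have "\<bar>(y - x) $ i\<bar> \<le> 1" for i by (simp add: abs_le_iff) (smt (verit))
      then have "norm (y - x) \<le> (\<Sum>i\<in>(UNIV::'n set). 1)"
        by (intro order_trans[OF norm_le_l1_cart] sum_mono)
      then have "norm (y - x) \<le> ?N" by simp
      with x norm_triangle_ineq2[of y x] show "y \<in> cball 0 (R + ?N)" by simp
    qed
    have si: "set_integrable lborel (cbox (x - 1) (x + 1)) f"
      unfolding set_integrable_def
      using borel_integrable_compact[OF compact_cbox[of "x - 1" "x + 1"] continuous_on_subset[OF f(1) subset_UNIV]]
      by simp
    have "integral (cbox (x - 1) (x + 1)) f = (\<integral>y. indicator (cbox (x - 1) (x + 1)) y *\<^sub>R f y \<partial>lborel)"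
      using set_borel_integral_eq_integral(2)[OF si] by (simp add: set_lebesgue_integral_def)
    also have "\<dots> \<le> (\<integral>y. indicator (cball 0 (R + ?N)) y *\<^sub>R f y \<partial>lborel)"
      using si sub by (intro integral_mono L1_loc_ball continuous_L1_loc f)
        (auto simp: set_integrable_def indicator_def f)
    finally show ?thesis by simp
  qed
  have bound: "2 powr ?N * \<bar>mc k ?l x\<bar> \<le> M" if x: "norm x \<le> R" for k x
  proof -
    have sl: "smooth (mc k ?l)" by (intro smooth_conv moll l1)
    have ch: "continuous_on UNIV (mc k ?h)" by (intro smooth_continuous smooth_conv moll h1)
    have h0: "mc k ?h z \<ge> 0" for z
      by (rule mc_lower[OF h1]) auto
    \<comment> \<open>Young's inequality is applied to \<open>|b|\<close> before mollification, with
      \<open>t\<close> fixed. Averaging is linear and keeps the bound, and the mollified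
      \<open>|b|^r\<close> stays bounded in \<open>L^1\<close> on balls.\<close>
    have g: "\<bar>partial i (mc k ?l) z\<bar> \<le> t powr \<theta> * mc k ?h z + t powr (- q)" if t: "0 < t" "t \<le> 1" for t z i
    proof -
      have p: "partial i (mc k ?l) = mc k (\<lambda>x. G i x / \<mu> x)"
        using partials_conv_weak[OF moll(1)[of k] weak_ln[of i]] by (simp add: partials_Cons)
      have c1: "(\<lambda>x. t powr \<theta> *\<^sub>R ?h x) \<in> Lp_loc 1" "(\<lambda>x::real^'n. t powr (- q)) \<in> Lp_loc 1"
        by (intro L1_loc_scaleR h1, intro continuous_L1_loc continuous_on_const)
      have "norm (mc k (\<lambda>x. G i x / \<mu> x) z) \<le> mc k (\<lambda>x. t powr \<theta> *\<^sub>R ?h x + t powr (- q)) z"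
      proof (rule norm_mc_le[OF bi1 L1_loc_add[OF c1]], intro AE_I2 impI)
        fix y
        have "norm (G i y / \<mu> y) \<le> ?\<beta> y"
          using component_le_norm_cart[of "\<chi> i. G i y / \<mu> y" i] by simp
        also have "\<dots> \<le> t powr \<theta> * ?\<beta> y powr r + t powr (- q)"
          using Young_powr[of "?\<beta> y" t r \<theta>] t r1 by (simp add: q_def)
        finally show "norm (G i y / \<mu> y) \<le> t powr \<theta> *\<^sub>R ?h y + t powr (- q)" by simp
      qed
      also have "\<dots> = t powr \<theta> * mc k ?h z + t powr (- q)"
      proof -
        have "mc k (\<lambda>x. t powr \<theta> *\<^sub>R ?h x + t powr (- q)) z = mc k (\<lambda>x. t powr \<theta> *\<^sub>R ?h x) z + t powr (- q)"
          unfolding mc_add[OF c1] mc_const ..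
        also have "mc k (\<lambda>x. t powr \<theta> *\<^sub>R ?h x) z = t powr \<theta> * mc k ?h z"
          unfolding conv_def real_scaleR_def
          by (subst integral_mult_right_zero[symmetric]) (simp add: mult_ac)
        finally show ?thesis .
      qed
      finally show ?thesis by (simp add: p)
    qed
    have "2 powr ?N * \<bar>mc k ?l x\<bar> \<le> integral (cbox (x - 1) (x + 1)) (\<lambda>z. \<bar>mc k ?l z\<bar>)
      + ?N * integral (cbox (x - 1) (x + 1)) (mc k ?h) / (\<theta> - ?N + 1) + ?N * 2 powr ?N / (1 - q)"
      by (rule Morrey_bound[OF sl ch h0 \<theta>(1) q g])
    also have "\<dots> \<le> M"
    proof -
      have "integral (cbox (x - 1) (x + 1)) (\<lambda>z. \<bar>mc k ?l z\<bar>) \<le> A"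
        using cb[OF x, of "\<lambda>z. \<bar>mc k ?l z\<bar>"] mc_L1_ball[OF l1, of "R + ?N" k]
          continuous_on_rabs[OF smooth_continuous[OF sl]] by (simp add: A_def)
      moreover have "integral (cbox (x - 1) (x + 1)) (mc k ?h) \<le> B"
        using cb[OF x ch h0] mc_L1_ball[OF h1, of "R + ?N" k] h0 by (simp add: B_def)
      then have "?N * integral (cbox (x - 1) (x + 1)) (mc k ?h) / (\<theta> - ?N + 1) \<le> ?N * B / (\<theta> - ?N + 1)"
        using \<theta> by (intro divide_right_mono mult_left_mono) auto
      ultimately show ?thesis unfolding M_def by simp
    qed
    finally show ?thesis .
  qed
  obtain s where s: "strict_mono s" "AE x in lborel. norm x \<le> R \<longrightarrow> (\<lambda>k. mc (s k) ?l x) \<longlonglongrightarrow> ?l x"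
    using mc_AE_subseq[OF l1, of R] by blast
  have "AE x in lborel. norm x \<le> R \<longrightarrow> \<mu> x \<le> exp (M / 2 powr ?N)"
    using s(2) mu_pos
  proof eventually_elim
    case (elim x)
    show ?case
    proof
      assume x: "norm x \<le> R"
      have "mc (s k) ?l x \<le> M / 2 powr ?N" for k
      proof -
        have "2 powr ?N * mc (s k) ?l x \<le> 2 powr ?N * \<bar>mc (s k) ?l x\<bar>" by (intro mult_left_mono) auto
        also have "\<dots> \<le> M" by (rule bound[OF x])
        finally show ?thesis by (subst pos_le_divide_eq) (simp_all add: mult.commute)
      qed
      then have "?l x \<le> M / 2 powr ?N" using elim(1) x by (intro LIMSEQ_le_const2) auto
      with elim(2) show "\<mu> x \<le> exp (M / 2 powr ?N)"
        using exp_le_cancel_iff[of "?l x" "M / 2 powr ?N"] by simp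
    qed
  qed
  then show ?thesis by blast
qed

end

section \<open>Hardy's inequality\<close>

lemma integral_by_parts_weak:
  fixes p q w g :: "real ^ 'n \<Rightarrow> real"
  assumes w: "has_weak_deriv [i] w g" and p: "p \<in> test_functions" and q: "smooth q"
  shows "(\<integral>x. (partial i p x * q x) * w x \<partial>lborel) + (\<integral>x. (p x * partial i q x) * w x \<partial>lborel)
    + (\<integral>x. (p x * q x) * g x \<partial>lborel) = 0"
proof -
  have wl: "w \<in> Lp_loc 1" using w by (simp add: has_weak_deriv_def)
  have "(\<integral>x. partial i (\<lambda>x. p x * q x) x * w x \<partial>lborel) = - (\<integral>x. (p x * q x) * g x \<partial>lborel)"
    using w test_mult[OF p q] unfolding has_weak_deriv_1 real_scaleR_def by blast
  moreover have "(\<integral>x. partial i (\<lambda>x. p x * q x) x * w x \<partial>lborel) =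
    (\<integral>x. (partial i p x * q x) * w x + (p x * partial i q x) * w x \<partial>lborel)"
    by (simp add: partial_mult[OF test_differentiable[OF p] smooth_differentiable[OF q]] distrib_right)
  moreover have "\<dots> = (\<integral>x. (partial i p x * q x) * w x \<partial>lborel) + (\<integral>x. (p x * partial i q x) * w x \<partial>lborel)"
    by (intro Bochner_Integration.integral_add integrable_test_mult test_mult test_partial p q smooth_partial wl)
  ultimately show ?thesis by simp
qed

lemma partial_square:
  fixes f :: "real ^ 'n \<Rightarrow> real"
  assumes "f \<in> test_functions"
  shows "partial i (\<lambda>x. f x * f x) = (\<lambda>x. 2 * (f x * partial i f x))"
  using partial_mult[OF test_differentiable[OF assms] test_differentiable[OF assms]] by (simp add: fun_eq_iff)

text \<open>A smooth substitute for the singular field \<open>x / |x|^2\<close>. The parameter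
  \<open>\<delta>\<close> is sent to 0 only after all integrations by parts.\<close>

definition Xf :: "real \<Rightarrow> 'n \<Rightarrow> real ^ 'n \<Rightarrow> real"
  where "Xf \<delta> i x = x $ i * inverse ((norm x)\<^sup>2 + \<delta>)"

text \<open>With \<open>s = 1 / (|x|^2 + \<delta>)\<close> the divergence is
  \<open>N s - 2 |x|^2 s^2\<close>, and \<open>|X|^2 = |x|^2 s^2\<close>. Since
  \<open>|x|^2 s \<le> 1\<close>, their difference is at least \<open>(N - 3) s\<close>; this is the
  origin of the constant \<open>N - 3\<close>.\<close>

lemma Xf:
  fixes x :: "real ^ 'n"
  assumes \<delta>: "\<delta> > 0"
  shows "smooth (Xf \<delta> i :: real ^ 'n \<Rightarrow> real)" "smooth (\<lambda>x::real^'n. inverse ((norm x)\<^sup>2 + \<delta>))"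
    "(\<Sum>i\<in>UNIV. partial i (Xf \<delta> i) x - Xf \<delta> i x * Xf \<delta> i x) \<ge> (real CARD('n) - 3) * inverse ((norm x)\<^sup>2 + \<delta>)"
proof -
  have nz: "(norm x)\<^sup>2 + \<delta> > 0" for x :: "real^'n" using \<delta> by (simp add: add_nonneg_pos)
  have nz': "(norm x)\<^sup>2 + \<delta> \<noteq> 0" for x :: "real^'n" using nz[of x] by simp
  have ss: "smooth (\<lambda>x::real^'n. (norm x)\<^sup>2 + \<delta>)" by (intro smooth_add smooth_norm_sq smooth_const)
  show si: "smooth (\<lambda>x::real^'n. inverse ((norm x)\<^sup>2 + \<delta>))" by (rule smooth_inverse[OF nz' ss])
  show "smooth (Xf \<delta> i :: real ^ 'n \<Rightarrow> real)"
    unfolding Xf_def by (intro smooth_mult smooth_component si)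
  let ?s = "inverse ((norm x)\<^sup>2 + \<delta>)"
  have p: "partial i (Xf \<delta> i) x = ?s - 2 * (x $ i * x $ i) * (?s * ?s)" for i
  proof -
    have ps: "partial i (\<lambda>x. inverse ((norm x)\<^sup>2 + \<delta>)) x = - (2 * x $ i / ((norm x)\<^sup>2 + \<delta>)\<^sup>2)"
      using partial_inverse[OF nz'[of x] smooth_differentiable[OF ss], of i]
      by (simp add: partial_add[OF smooth_differentiable[OF smooth_norm_sq] smooth_differentiable[OF smooth_const]] partial_norm_sq)
    have "partial i (Xf \<delta> i) x = 1 * ?s + x $ i * partial i (\<lambda>x. inverse ((norm x)\<^sup>2 + \<delta>)) x"
      unfolding Xf_def
      by (simp add: partial_mult[OF differentiable_component smooth_differentiable[OF si]] partial_component)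
    then show ?thesis unfolding ps by (simp add: divide_inverse power2_eq_square mult_ac)
  qed
  have "(\<Sum>i\<in>UNIV. partial i (Xf \<delta> i) x - Xf \<delta> i x * Xf \<delta> i x) =
      (\<Sum>i\<in>UNIV. ?s - 3 * (x $ i * x $ i) * (?s * ?s))"
    by (rule sum.cong) (auto simp: p Xf_def algebra_simps)
  also have "\<dots> = real CARD('n) * ?s - 3 * (norm x)\<^sup>2 * (?s * ?s)"
    by (simp add: sum_subtractf norm_sq_components flip: sum_distrib_left sum_distrib_right)
  finally have eq: "(\<Sum>i\<in>UNIV. partial i (Xf \<delta> i) x - Xf \<delta> i x * Xf \<delta> i x) =
      real CARD('n) * ?s - 3 * (norm x)\<^sup>2 * (?s * ?s)" .
  have "(norm x)\<^sup>2 * ?s \<le> 1" using nz[of x] \<delta> by (simp add: field_simps)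
  then have "(norm x)\<^sup>2 * ?s * ?s \<le> 1 * ?s" using nz[of x] by (intro mult_right_mono) auto
  then show "(\<Sum>i\<in>UNIV. partial i (Xf \<delta> i) x - Xf \<delta> i x * Xf \<delta> i x) \<ge> (real CARD('n) - 3) * ?s"
    unfolding eq by (simp add: algebra_simps)
qed

lemma has_weak_laplacian_grad:
  fixes u v :: "real ^ 'n \<Rightarrow> real"
  assumes v: "has_weak_laplacian u v" and g: "\<And>i. has_weak_deriv [i] u (g i)" and \<psi>: "\<psi> \<in> test_functions"
  shows "(\<Sum>i\<in>UNIV. \<integral>x. partial i \<psi> x * g i x \<partial>lborel) = - (\<integral>x. \<psi> x * v x \<partial>lborel)"
proof -
  have u: "u \<in> Lp_loc 1" using v by (simp add: has_weak_laplacian_def)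
  have "(\<integral>x. \<psi> x * v x \<partial>lborel) = (\<integral>x. laplacian \<psi> x * u x \<partial>lborel)"
    using v \<psi> by (simp add: has_weak_laplacian_def)
  also have "\<dots> = (\<integral>x. (\<Sum>i\<in>UNIV. partial i (partial i \<psi>) x * u x) \<partial>lborel)"
    by (simp add: laplacian_def partials_Cons sum_distrib_right)
  also have "\<dots> = (\<Sum>i\<in>UNIV. \<integral>x. partial i (partial i \<psi>) x * u x \<partial>lborel)"
    by (intro Bochner_Integration.integral_sum integrable_test_mult test_partial \<psi> u)
  also have "\<dots> = (\<Sum>i\<in>UNIV. - (\<integral>x. partial i \<psi> x * g i x \<partial>lborel))"
    using g test_partial[OF \<psi>] unfolding has_weak_deriv_1 real_scaleR_def by (intro sum.cong) blast+
  finally show ?thesis by (simp add: sum_negf)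
qed

context sobolev_weight
begin

lemma GG_div_L1: "(\<lambda>x. G i x * G j x / \<mu> x) \<in> Lp_loc 1"
  by (rule L1_loc_div[OF GG_L1])

text \<open>The inequality is the nonnegativity of the integral of
  \<open>|\<nabla>\<phi> + (X + \<nabla>\<mu> / (2 \<mu>)) \<phi>|\<^sup>2 \<mu>\<close> with \<open>X = Xf \<delta>\<close>.\<close>

lemma hardy_delta:
  assumes Lap: "has_weak_laplacian \<mu> v" and \<phi>: "\<phi> \<in> test_functions" and \<delta>: "\<delta> > 0"
  shows "(real CARD('n) - 3) * (\<integral>x. (\<phi> x * \<phi> x * inverse ((norm x)\<^sup>2 + \<delta>)) * \<mu> x \<partial>lborel)
    \<le> (\<Sum>i\<in>UNIV. \<integral>x. (partial i \<phi> x * partial i \<phi> x) * \<mu> x \<partial>lborel)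
      + (\<integral>x. (\<phi> x * \<phi> x) * (1/4 * (\<Sum>i\<in>UNIV. G i x * G i x / \<mu> x) - 1/2 * v x) \<partial>lborel)"
proof -
  let ?p = "\<lambda>i. partial i \<phi>" and ?X = "Xf \<delta>"
  have v1: "v \<in> Lp_loc 1" using Lap by (simp add: has_weak_laplacian_def)
  have sX: "smooth (?X i)" for i by (rule Xf(1)[OF \<delta>])
  have tp: "?p i \<in> test_functions" for i by (rule test_partial[OF \<phi>])
  have sq: "(\<lambda>x. \<phi> x * \<phi> x) \<in> test_functions" by (intro test_mult \<phi> test_smooth)
  have t2: "(\<lambda>x. ?p i x * ?p i x) \<in> test_functions" "(\<lambda>x. (\<phi> x * ?p i x) * ?X i x) \<in> test_functions"
    "(\<lambda>x. \<phi> x * ?p i x) \<in> test_functions" "(\<lambda>x. (\<phi> x * \<phi> x) * (?X i x * ?X i x)) \<in> test_functions"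
    "(\<lambda>x. (\<phi> x * \<phi> x) * ?X i x) \<in> test_functions" "(\<lambda>x. (\<phi> x * \<phi> x) * partial i (?X i) x) \<in> test_functions" for i
    by (intro test_mult sq \<phi> test_smooth tp smooth_mult sX smooth_partial)+
  let ?A = "\<lambda>i. \<integral>x. (?p i x * ?p i x) * \<mu> x \<partial>lborel"
  let ?B = "\<lambda>i. \<integral>x. ((\<phi> x * ?p i x) * ?X i x) * \<mu> x \<partial>lborel"
  let ?C = "\<lambda>i. \<integral>x. (\<phi> x * ?p i x) * G i x \<partial>lborel"
  let ?E = "\<lambda>i. \<integral>x. ((\<phi> x * \<phi> x) * (?X i x * ?X i x)) * \<mu> x \<partial>lborel"
  let ?F = "\<lambda>i. \<integral>x. ((\<phi> x * \<phi> x) * ?X i x) * G i x \<partial>lborel"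
  let ?K = "\<lambda>i. \<integral>x. (\<phi> x * \<phi> x) * (G i x * G i x / \<mu> x) \<partial>lborel"
  let ?Y = "\<lambda>i. \<integral>x. ((\<phi> x * \<phi> x) * partial i (?X i) x) * \<mu> x \<partial>lborel"
  have int: "integrable lborel (\<lambda>x. (?p i x * ?p i x) * \<mu> x)"
    "integrable lborel (\<lambda>x. ((\<phi> x * ?p i x) * ?X i x) * \<mu> x)"
    "integrable lborel (\<lambda>x. (\<phi> x * ?p i x) * G i x)"
    "integrable lborel (\<lambda>x. ((\<phi> x * \<phi> x) * (?X i x * ?X i x)) * \<mu> x)"
    "integrable lborel (\<lambda>x. ((\<phi> x * \<phi> x) * ?X i x) * G i x)"
    "integrable lborel (\<lambda>x. (\<phi> x * \<phi> x) * (G i x * G i x / \<mu> x))"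
    "integrable lborel (\<lambda>x. ((\<phi> x * \<phi> x) * partial i (?X i) x) * \<mu> x)" for i
    by (intro integrable_test_mult t2 sq mu_L1 G_L1 GG_div_L1)+
  define c :: real where "c = 1 / 4"
  \<comment> \<open>The \<open>i\<close>-th component of the square, times \<open>\<mu>\<close>,
    expanded with \<open>G i\<close> in place of \<open>b_i \<mu>\<close> so that every term is a
    test function times a locally integrable function.\<close>
  define q where "q i x = (?p i x * ?p i x) * \<mu> x + 2 * (((\<phi> x * ?p i x) * ?X i x) * \<mu> x) + (\<phi> x * ?p i x) * G i x
     + ((\<phi> x * \<phi> x) * (?X i x * ?X i x)) * \<mu> x + ((\<phi> x * \<phi> x) * ?X i x) * G i x
     + c * ((\<phi> x * \<phi> x) * (G i x * G i x / \<mu> x))" for i x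
  have qi: "(\<integral>x. q i x \<partial>lborel) = ?A i + 2 * ?B i + ?C i + ?E i + ?F i + c * ?K i" for i
    unfolding q_def using int[of i] by (simp del: times_divide_eq_right)
  have q0: "(\<integral>x. q i x \<partial>lborel) \<ge> 0" for i
  proof (rule integral_nonneg_AE)
    show "AE x in lborel. 0 \<le> q i x"
      using mu_pos
    proof eventually_elim
      case (elim x)
      have "q i x = (?p i x + ?X i x * \<phi> x + G i x / (2 * \<mu> x) * \<phi> x)\<^sup>2 * \<mu> x"
        using elim by (simp add: q_def c_def power2_eq_square field_simps)
      then show ?case using elim by simp
    qed
  qed
  \<comment> \<open>The cross terms containing \<open>X\<close> combine:
    \<open>2 \<phi> D_i \<phi> X_i \<mu> + \<phi>^2 X_i G_i\<close> is
    \<open>X_i D_i (\<phi>^2 \<mu>)\<close>, whose integral is minus that of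
    \<open>\<phi>^2 D_i X_i \<mu>\<close>.\<close>
  have BF: "2 * ?B i + ?F i = - ?Y i" for i
    using integral_by_parts_weak[OF weak_G sq sX[of i], of i]
    by (simp add: partial_square[OF \<phi>] mult.assoc)
  \<comment> \<open>The mixed term without \<open>X\<close> is half of the gradient of
    \<open>\<phi>^2\<close> paired with the gradient of \<open>\<mu>\<close>. Only its sum over
    \<open>i\<close> is evaluated, through the distributional Laplacian.\<close>
  have "2 * (\<Sum>i\<in>UNIV. ?C i) = - (\<integral>x. (\<phi> x * \<phi> x) * v x \<partial>lborel)"
    using has_weak_laplacian_grad[OF Lap weak_G sq] by (simp add: partial_square[OF \<phi>] sum_distrib_left mult.assoc)
  moreover have "0 \<le> (\<Sum>i\<in>UNIV. ?A i + 2 * ?B i + ?C i + ?E i + ?F i + 1/4 * ?K i)"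
    using q0 qi by (intro sum_nonneg) (auto simp: c_def)
  moreover have "(\<Sum>i\<in>UNIV. ?A i + 2 * ?B i + ?C i + ?E i + ?F i + 1/4 * ?K i) =
     (\<Sum>i\<in>UNIV. ?A i) + (\<Sum>i\<in>UNIV. ?C i) - (\<Sum>i\<in>UNIV. ?Y i - ?E i) + 1/4 * (\<Sum>i\<in>UNIV. ?K i)"
  proof -
    have eq: "?A i + 2 * ?B i + ?C i + ?E i + ?F i + 1/4 * ?K i = ?A i + ?C i - (?Y i - ?E i) + 1/4 * ?K i" for i
      using BF[of i] by linarith
    show ?thesis unfolding eq by (simp add: sum.distrib sum_subtractf sum_distrib_left)
  qed
  ultimately have main: "(\<Sum>i\<in>UNIV. ?Y i - ?E i) \<le> (\<Sum>i\<in>UNIV. ?A i) + (1/4 * (\<Sum>i\<in>UNIV. ?K i)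
      - 1/2 * (\<integral>x. (\<phi> x * \<phi> x) * v x \<partial>lborel))" by linarith
  have "(\<Sum>i\<in>UNIV. ?Y i - ?E i) = (\<integral>x. (\<Sum>i\<in>UNIV. ((\<phi> x * \<phi> x) * partial i (?X i) x) * \<mu> x
      - ((\<phi> x * \<phi> x) * (?X i x * ?X i x)) * \<mu> x) \<partial>lborel)"
    using int by simp
  also have "\<dots> \<ge> (\<integral>x. (real CARD('n) - 3) * ((\<phi> x * \<phi> x * inverse ((norm x)\<^sup>2 + \<delta>)) * \<mu> x) \<partial>lborel)"
  proof (rule integral_mono_AE)
    show "integrable lborel (\<lambda>x. (real CARD('n) - 3) * ((\<phi> x * \<phi> x * inverse ((norm x)\<^sup>2 + \<delta>)) * \<mu> x))"
      by (intro integrable_mult_right integrable_test_mult mu_L1 test_mult sq Xf(2)[OF \<delta>])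
    show "integrable lborel (\<lambda>x. \<Sum>i\<in>UNIV. ((\<phi> x * \<phi> x) * partial i (?X i) x) * \<mu> x
      - ((\<phi> x * \<phi> x) * (?X i x * ?X i x)) * \<mu> x)" using int by simp
    show "AE x in lborel. (real CARD('n) - 3) * ((\<phi> x * \<phi> x * inverse ((norm x)\<^sup>2 + \<delta>)) * \<mu> x) \<le>
      (\<Sum>i\<in>UNIV. ((\<phi> x * \<phi> x) * partial i (?X i) x) * \<mu> x - ((\<phi> x * \<phi> x) * (?X i x * ?X i x)) * \<mu> x)"
      using mu_pos
    proof eventually_elim
      case (elim x)
      have "(\<phi> x * \<phi> x * \<mu> x) * ((real CARD('n) - 3) * inverse ((norm x)\<^sup>2 + \<delta>)) \<le>
        (\<phi> x * \<phi> x * \<mu> x) * (\<Sum>i\<in>UNIV. partial i (?X i) x - ?X i x * ?X i x)"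
        using elim by (intro mult_left_mono Xf(3)[OF \<delta>]) auto
      then show ?case by (simp add: sum_distrib_left right_diff_distrib mult_ac)
    qed
  qed
  finally have lower: "(real CARD('n) - 3) * (\<integral>x. (\<phi> x * \<phi> x * inverse ((norm x)\<^sup>2 + \<delta>)) * \<mu> x \<partial>lborel) \<le> (\<Sum>i\<in>UNIV. ?Y i - ?E i)"
    by simp
  have "(\<integral>x. (\<phi> x * \<phi> x) * (1/4 * (\<Sum>i\<in>UNIV. G i x * G i x / \<mu> x) - 1/2 * v x) \<partial>lborel) =
    (\<integral>x. 1/4 * (\<Sum>i\<in>UNIV. (\<phi> x * \<phi> x) * (G i x * G i x / \<mu> x)) - 1/2 * ((\<phi> x * \<phi> x) * v x) \<partial>lborel)"
    by (intro Bochner_Integration.integral_cong) (auto simp: right_diff_distrib sum_distrib_left mult_ac)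
  also have "\<dots> = 1/4 * (\<Sum>i\<in>UNIV. ?K i) - 1/2 * (\<integral>x. (\<phi> x * \<phi> x) * v x \<partial>lborel)"
    using int(6) integrable_test_mult[OF sq v1] by simp
  finally show ?thesis using main lower by linarith
qed

end

text \<open>The weight 1 turns the weighted inequality into one for Lebesgue measure, from which the
  local integrability of \<open>1 / |x|^2\<close> is drawn.\<close>

lemma sobolev_weight_const: "sobolev_weight (\<lambda>x::real^'n. 1) (\<lambda>i x. 0)"
proof
  show one: "(\<lambda>x::real^'n. 1::real) \<in> Lp_loc 2"
    unfolding L2_loc_iff by (auto intro!: integrable_real_indicator emeasure_lborel_cball_finite)
  show "(\<lambda>x::real^'n. 0::real) \<in> Lp_loc 2" by (simp add: L2_loc_iff)
  show "has_weak_deriv [i] (\<lambda>x::real^'n. 1) (\<lambda>x. 0::real)" for i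
    unfolding has_weak_deriv_1
    by (auto simp: integral_partial_test intro: L2_loc_imp_L1_loc[OF one] continuous_L1_loc continuous_on_const)
  show "\<exists>c>0. AE x::real^'n in lborel. norm x \<le> R \<longrightarrow> c \<le> (1::real)" for R
    by (intro exI[of _ 1]) auto
qed

lemma hardy_lebesgue:
  fixes \<phi> :: "real ^ 'n \<Rightarrow> real"
  assumes \<phi>: "\<phi> \<in> test_functions" and \<delta>: "\<delta> > 0"
  shows "(real CARD('n) - 3) * (\<integral>x. \<phi> x * \<phi> x * inverse ((norm x)\<^sup>2 + \<delta>) \<partial>lborel)
    \<le> (\<Sum>i\<in>UNIV. \<integral>x. partial i \<phi> x * partial i \<phi> x \<partial>lborel)"
proof -
  have "has_weak_laplacian (\<lambda>x::real^'n. 1) (\<lambda>x. 0)"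
    unfolding has_weak_laplacian_def
  proof (intro conjI allI impI)
    fix \<psi> :: "real^'n \<Rightarrow> real" assume \<psi>: "\<psi> \<in> test_functions"
    have "(\<integral>x. laplacian \<psi> x \<partial>lborel) = (\<Sum>i\<in>UNIV. \<integral>x. partial i (partial i \<psi>) x \<partial>lborel)"
      unfolding laplacian_def partials_Cons partials_Nil
      by (intro Bochner_Integration.integral_sum integrable_test_self test_partial \<psi>)
    then show "(\<integral>x. laplacian \<psi> x * 1 \<partial>lborel) = (\<integral>x. \<psi> x * 0 \<partial>lborel)"
      by (simp add: integral_partial_test test_partial[OF \<psi>])
  qed (auto intro: continuous_L1_loc continuous_on_const)
  from sobolev_weight.hardy_delta[OF sobolev_weight_const this \<phi> \<delta>] show ?thesis by simp
qed

text \<open>Monotone convergence along \<open>\<delta> = 1 / (n + 1)\<close>: Hardy's inequality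
  bounds the regularised integrals by the Dirichlet integral of \<open>\<phi>\<close>, uniformly in
  \<open>n\<close>.\<close>

lemma inverse_norm_sq_integrable:
  fixes \<phi> :: "real ^ 'n \<Rightarrow> real"
  assumes N: "CARD('n) \<ge> 5" and \<phi>: "\<phi> \<in> test_functions"
  shows "integrable lborel (\<lambda>x. \<phi> x * \<phi> x * inverse ((norm x)\<^sup>2))"
proof -
  let ?d = "\<lambda>n::nat. inverse (real (Suc n))"
  let ?f = "\<lambda>n x. \<phi> x * \<phi> x * inverse ((norm x)\<^sup>2 + ?d n)"
  let ?D = "\<Sum>i\<in>UNIV. \<integral>x. partial i \<phi> x * partial i \<phi> x \<partial>lborel"
  have [measurable]: "\<phi> \<in> borel_measurable borel" using \<phi> by (rule test_measurable)
  have d: "?d n > 0" for n by simp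
  have sq: "(\<lambda>x. \<phi> x * \<phi> x) \<in> test_functions" by (intro test_mult \<phi> test_smooth)
  have i: "integrable lborel (?f n)" for n
    by (intro integrable_test_self test_mult sq Xf(2) d)
  have N2: "real CARD('n) - 3 \<ge> 1" using N by simp
  have pos: "(norm x)\<^sup>2 + ?d n > 0" for x :: "real^'n" and n using d[of n] by (simp add: add_nonneg_pos)
  have b: "(\<integral>x. ?f n x \<partial>lborel) \<le> ?D" for n
  proof -
    have "0 \<le> (\<integral>x. ?f n x \<partial>lborel)" using pos by (intro Bochner_Integration.integral_nonneg) (simp add: less_imp_le)
    then have "1 * (\<integral>x. ?f n x \<partial>lborel) \<le> (real CARD('n) - 3) * (\<integral>x. ?f n x \<partial>lborel)"
      using N2 by (intro mult_right_mono)
    then show ?thesis using hardy_lebesgue[OF \<phi> d[of n]] by simp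
  qed
  have mono: "?f n x \<le> ?f m x" if "n \<le> m" for n m x
    using pos[of x m] that by (intro mult_left_mono le_imp_inverse_le) (auto simp: field_simps)
  have inc: "incseq (\<lambda>n. \<integral>x. ?f n x \<partial>lborel)"
    unfolding incseq_def by (intro allI impI integral_mono i mono)
  obtain l where l: "(\<lambda>n. \<integral>x. ?f n x \<partial>lborel) \<longlonglongrightarrow> l"
    using incseq_convergent[OF inc, of ?D] b by blast
  show ?thesis
  proof (rule integrable_monotone_convergence[OF i _ _ l])
    show "AE x in lborel. mono (\<lambda>n. ?f n x)" using mono by (auto intro!: AE_I2 monoI)
    have "AE x in lborel. x \<noteq> (0::real^'n)" by (rule AE_lborel_singleton)
    then show "AE x in lborel. (\<lambda>n. ?f n x) \<longlonglongrightarrow> \<phi> x * \<phi> x * inverse ((norm x)\<^sup>2)"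
    proof eventually_elim
      case (elim x)
      have "(\<lambda>n. (norm x)\<^sup>2 + ?d n) \<longlonglongrightarrow> (norm x)\<^sup>2 + 0"
        by (intro tendsto_intros LIMSEQ_inverse_real_of_nat)
      then show ?case using elim by (intro tendsto_mult tendsto_const tendsto_inverse) auto
    qed
  qed measurable
qed

lemma inverse_norm_sq_L1_loc:
  assumes N: "CARD('n) \<ge> 5"
  shows "(\<lambda>x::real^'n. inverse ((norm x)\<^sup>2)) \<in> Lp_loc 1"
  unfolding L1_loc_iff
proof (intro conjI allI)
  show "(\<lambda>x::real^'n. inverse ((norm x)\<^sup>2)) \<in> borel_measurable borel" by measurable
  fix R :: real
  let ?R = "max R 1"
  let ?\<phi> = "\<lambda>x::real^'n. cutoff (inverse ?R *\<^sub>R x)"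
  have ct: "(cutoff :: real^'n \<Rightarrow> real) \<in> test_functions"
    by (rule testI[of _ 2]) (auto simp: cutoff)
  have t: "?\<phi> \<in> test_functions" using test_affine[OF ct, of "inverse ?R" 0] by simp
  show "integrable lborel (\<lambda>x::real^'n. indicator (cball 0 R) x *\<^sub>R inverse ((norm x)\<^sup>2))"
  proof (rule Bochner_Integration.integrable_bound[OF inverse_norm_sq_integrable[OF N t]])
    have "?\<phi> x = 1" if "norm x \<le> R" for x
      using that by (intro cutoff(4)) (simp add: field_simps)
    then show "AE x in lborel. norm (indicator (cball 0 R) x *\<^sub>R inverse ((norm x)\<^sup>2))
        \<le> norm (?\<phi> x * ?\<phi> x * inverse ((norm x)\<^sup>2))"
      by (auto simp: indicator_def)
  qed measurable
qed

section \<open>A priori estimates\<close>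

text \<open>The hypotheses in the form in which they are used. \<open>B i j\<close> stands for
  \<open>D_j b_i\<close>, and \<open>HB\<close> is the quotient rule for
  \<open>b_i = G i / \<mu>\<close> solved for the Hessian \<open>H\<close> of \<open>\<mu>\<close>;
  through it integrals containing \<open>B i j \<mu>\<close> are reduced to locally integrable
  functions. \<open>U_le\<close> merges the bounds on \<open>U\<close> near 0 and away from
  0.\<close>

locale kolmogorov_weight = sobolev_weight \<mu> G
  for \<mu> :: "real ^ 'n \<Rightarrow> real" and G :: "'n \<Rightarrow> real ^ 'n \<Rightarrow> real" +
  fixes H B :: "'n \<Rightarrow> 'n \<Rightarrow> real ^ 'n \<Rightarrow> real" and Lap :: "real ^ 'n \<Rightarrow> real"
  assumes N: "CARD('n) \<ge> 5"
    and weak_H: "\<And>i j. has_weak_deriv [j] (G i) (H i j)"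
    and B_measurable [measurable]: "\<And>i j. B i j \<in> borel_measurable borel"
    and HB: "\<And>i j. AE x in lborel. H i j x = B i j x * \<mu> x + G i x * G j x / \<mu> x"
    and bdd: "\<And>R. \<exists>C. AE x in lborel. norm x \<le> R \<longrightarrow> \<mu> x \<le> C"
    and weak_Lap: "has_weak_laplacian \<mu> Lap"
    and U_le: "\<exists>C\<ge>0. AE x in lborel. 1/4 * (\<Sum>i\<in>UNIV. (G i x / \<mu> x)\<^sup>2) - 1/2 * (Lap x / \<mu> x)
        \<le> inverse ((norm x)\<^sup>2) + C"
    and B_le: "\<And>\<epsilon>. \<epsilon> > 0 \<Longrightarrow> \<exists>C>0. \<forall>i j. AE x in lborel. \<bar>B i j x\<bar>
        \<le> \<epsilon> * inverse ((norm x)\<^sup>2) + C * norm (\<chi> i. G i x / \<mu> x)"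
begin

abbreviation \<beta> :: "real ^ 'n \<Rightarrow> real" where "\<beta> x \<equiv> norm (\<chi> i. G i x / \<mu> x)"

abbreviation w0 :: "real ^ 'n \<Rightarrow> real" where "w0 x \<equiv> inverse ((norm x)\<^sup>2) * \<mu> x"

abbreviation w1 :: "real ^ 'n \<Rightarrow> real" where "w1 x \<equiv> (\<beta> x)\<^sup>2 * \<mu> x"

definition S :: "(real ^ 'n \<Rightarrow> real) \<Rightarrow> real"
  where "S \<phi> = (\<integral>x. (\<phi> x * \<phi> x) * \<mu> x \<partial>lborel)"

lemma beta_sq: "(\<beta> x)\<^sup>2 = (\<Sum>i\<in>UNIV. (G i x / \<mu> x)\<^sup>2)"
  unfolding norm_sq_components by (simp add: power2_eq_square)

lemma w1_eq: "w1 x = (\<Sum>i\<in>UNIV. G i x * G i x / \<mu> x)"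
  unfolding beta_sq by (cases "\<mu> x = 0") (simp_all add: sum_distrib_right power2_eq_square)

lemma w1_L1: "w1 \<in> Lp_loc 1"
  unfolding w1_eq by (intro L1_loc_sum GG_div_L1)

text \<open>The local boundedness of \<open>\<mu>\<close> is used here: the singularity
  \<open>1 / |x|^2\<close> alone is integrable near 0, and \<open>\<mu>\<close> only adds a bounded
  factor.\<close>

lemma w0_L1: "w0 \<in> Lp_loc 1"
proof (rule L1_loc_bound[OF inverse_norm_sq_L1_loc[OF N]])
  fix R
  obtain C where C: "AE x in lborel. norm x \<le> R \<longrightarrow> \<mu> x \<le> C" using bdd by blast
  have "AE x in lborel. norm x \<le> R \<longrightarrow> norm (w0 x) \<le> C * norm (inverse ((norm x)\<^sup>2))"
    using C mu_pos
  proof eventually_elim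
    case (elim x)
    then show ?case by (auto simp: abs_mult mult.commute intro!: mult_right_mono)
  qed
  then show "\<exists>C. AE x in lborel. norm x \<le> R \<longrightarrow> norm (w0 x) \<le> C * norm (inverse ((norm x)\<^sup>2))" by blast
qed measurable

lemma S_nonneg: "S \<phi> \<ge> 0"
  unfolding S_def by (rule integral_nonneg_AE) (use mu_pos in \<open>auto elim!: eventually_mono\<close>)

lemma test_sq: "\<phi> \<in> test_functions \<Longrightarrow> (\<lambda>x. \<phi> x * \<phi> x :: real) \<in> test_functions"
  by (intro test_mult test_smooth)

text \<open>With \<open>I\<close> the integral on the left and \<open>D\<close> the gradient term,
  letting \<open>\<delta> = 1 / (n + 1)\<close> tend to 0 in \<open>hardy_delta\<close> gives
  \<open>(N - 3) I \<le> D + (I + C S \<phi>)\<close>; the \<open>I\<close> on the right is the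
  price of \<open>U \<le> 1 / |x|^2 + C\<close>. As \<open>I\<close> is finite and
  \<open>N - 3 \<ge> 2\<close>, it is absorbed.\<close>

lemma hardy: "\<exists>C\<ge>0. \<forall>\<phi>\<in>test_functions.
    (\<integral>x. (\<phi> x * \<phi> x) * w0 x \<partial>lborel) \<le> (\<Sum>i\<in>UNIV. S (partial i \<phi>)) + C * S \<phi>"
proof -
  obtain C where C: "C \<ge> 0" "AE x in lborel. 1/4 * (\<Sum>i\<in>UNIV. (G i x / \<mu> x)\<^sup>2) - 1/2 * (Lap x / \<mu> x)
        \<le> inverse ((norm x)\<^sup>2) + C" using U_le by blast
  have "(\<integral>x. (\<phi> x * \<phi> x) * w0 x \<partial>lborel) \<le> (\<Sum>i\<in>UNIV. S (partial i \<phi>)) + C * S \<phi>"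
    if \<phi>: "\<phi> \<in> test_functions" for \<phi>
  proof -
    let ?I = "\<integral>x. (\<phi> x * \<phi> x) * w0 x \<partial>lborel" and ?D = "\<Sum>i\<in>UNIV. S (partial i \<phi>)"
    let ?d = "\<lambda>n::nat. inverse (real (Suc n))"
    note sq = test_sq[OF \<phi>]
    have [measurable]: "\<phi> \<in> borel_measurable borel" using \<phi> by (rule test_measurable)
    have i0: "integrable lborel (\<lambda>x. (\<phi> x * \<phi> x) * w0 x)" by (intro integrable_test_mult sq w0_L1)
    have iS: "integrable lborel (\<lambda>x. (\<phi> x * \<phi> x) * \<mu> x)" by (intro integrable_test_mult sq mu_L1)
    have L1: "Lap \<in> Lp_loc 1" using weak_Lap by (simp add: has_weak_laplacian_def)
    have U1: "(\<lambda>x. 1/4 * (\<Sum>i\<in>UNIV. G i x * G i x / \<mu> x) - 1/2 * Lap x) \<in> Lp_loc 1"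
      using L1_loc_diff[OF L1_loc_scaleR[OF w1_L1, of "1/4"] L1_loc_scaleR[OF L1, of "1/2"]]
      unfolding w1_eq by simp
    have "(\<integral>x. (\<phi> x * \<phi> x) * (1/4 * (\<Sum>i\<in>UNIV. G i x * G i x / \<mu> x) - 1/2 * Lap x) \<partial>lborel)
      \<le> (\<integral>x. (\<phi> x * \<phi> x) * w0 x + C * ((\<phi> x * \<phi> x) * \<mu> x) \<partial>lborel)"
    proof (rule integral_mono_AE)
      show "AE x in lborel. (\<phi> x * \<phi> x) * (1/4 * (\<Sum>i\<in>UNIV. G i x * G i x / \<mu> x) - 1/2 * Lap x)
        \<le> (\<phi> x * \<phi> x) * w0 x + C * ((\<phi> x * \<phi> x) * \<mu> x)"
        using C(2) mu_pos
      proof eventually_elim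
        case (elim x)
        have "1/4 * (\<Sum>i\<in>UNIV. G i x * G i x / \<mu> x) - 1/2 * Lap x =
          (1/4 * (\<Sum>i\<in>UNIV. (G i x / \<mu> x)\<^sup>2) - 1/2 * (Lap x / \<mu> x)) * \<mu> x"
          using elim(2) unfolding w1_eq[symmetric] beta_sq by (simp add: left_diff_distrib)
        also have "\<dots> \<le> (inverse ((norm x)\<^sup>2) + C) * \<mu> x"
          using elim by (intro mult_right_mono) auto
        finally have "(\<phi> x * \<phi> x) * (1/4 * (\<Sum>i\<in>UNIV. G i x * G i x / \<mu> x) - 1/2 * Lap x)
          \<le> (\<phi> x * \<phi> x) * ((inverse ((norm x)\<^sup>2) + C) * \<mu> x)" by (intro mult_left_mono) auto
        then show ?case by (simp add: algebra_simps)
      qed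
      show "integrable lborel (\<lambda>x. (\<phi> x * \<phi> x) * (1/4 * (\<Sum>i\<in>UNIV. G i x * G i x / \<mu> x) - 1/2 * Lap x))"
        by (rule integrable_test_mult[OF sq U1])
    qed (use i0 iS in auto)
    also have "\<dots> = ?I + C * S \<phi>" using i0 iS by (simp add: S_def)
    finally have U: "(\<integral>x. (\<phi> x * \<phi> x) * (1/4 * (\<Sum>i\<in>UNIV. G i x * G i x / \<mu> x) - 1/2 * Lap x) \<partial>lborel) \<le> ?I + C * S \<phi>" .
    have n: "(real CARD('n) - 3) * (\<integral>x. (\<phi> x * \<phi> x * inverse ((norm x)\<^sup>2 + ?d n)) * \<mu> x \<partial>lborel) \<le> ?D + (?I + C * S \<phi>)" for n
      using hardy_delta[OF weak_Lap \<phi>, of "?d n"] U by (simp add: S_def)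
    have "(\<lambda>n. \<integral>x. (\<phi> x * \<phi> x * inverse ((norm x)\<^sup>2 + ?d n)) * \<mu> x \<partial>lborel) \<longlonglongrightarrow> ?I"
    \<comment> \<open>The limit function itself dominates; it is integrable beforehand by
      \<open>w0_L1\<close>.\<close>
    proof (rule integral_dominated_convergence[where w="\<lambda>x. (\<phi> x * \<phi> x) * w0 x"])
      have "AE x in lborel. x \<noteq> (0::real^'n)" by (rule AE_lborel_singleton)
      then show "AE x in lborel. (\<lambda>n. (\<phi> x * \<phi> x * inverse ((norm x)\<^sup>2 + ?d n)) * \<mu> x) \<longlonglongrightarrow> (\<phi> x * \<phi> x) * w0 x"
      proof eventually_elim
        case (elim x)
        have "(\<lambda>n. (norm x)\<^sup>2 + ?d n) \<longlonglongrightarrow> (norm x)\<^sup>2 + 0"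
          by (intro tendsto_intros LIMSEQ_inverse_real_of_nat)
        then have "(\<lambda>n. inverse ((norm x)\<^sup>2 + ?d n)) \<longlonglongrightarrow> inverse ((norm x)\<^sup>2)"
          using elim by (intro tendsto_inverse) auto
        then show ?case unfolding mult.assoc by (intro tendsto_mult tendsto_const)
      qed
      show "AE x in lborel. norm ((\<phi> x * \<phi> x * inverse ((norm x)\<^sup>2 + ?d n)) * \<mu> x) \<le> (\<phi> x * \<phi> x) * w0 x" for n
        using \<open>AE x in lborel. x \<noteq> (0::real^'n)\<close> mu_pos
      proof eventually_elim
        case (elim x)
        have "inverse ((norm x)\<^sup>2 + ?d n) \<le> inverse ((norm x)\<^sup>2)"
          using elim by (intro le_imp_inverse_le) auto
        moreover have "inverse ((norm x)\<^sup>2 + ?d n) \<ge> 0" by simp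
        ultimately have le: "(\<phi> x * \<phi> x) * (inverse ((norm x)\<^sup>2 + ?d n) * \<mu> x) \<le> (\<phi> x * \<phi> x) * w0 x"
          using elim by (intro mult_left_mono mult_right_mono) auto
        have nn: "0 \<le> (\<phi> x * \<phi> x * inverse ((norm x)\<^sup>2 + ?d n)) * \<mu> x"
          using elim by (intro mult_nonneg_nonneg[OF mult_nonneg_nonneg]) auto
        show ?case unfolding real_norm_def abs_of_nonneg[OF nn] using le by (simp only: mult.assoc)
      qed
    qed (use i0 in auto)
    then have "(\<lambda>n. (real CARD('n) - 3) * (\<integral>x. (\<phi> x * \<phi> x * inverse ((norm x)\<^sup>2 + ?d n)) * \<mu> x \<partial>lborel)) \<longlonglongrightarrow> (real CARD('n) - 3) * ?I"
      by (intro tendsto_mult tendsto_const)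
    then have "(real CARD('n) - 3) * ?I \<le> ?D + (?I + C * S \<phi>)" by (rule LIMSEQ_le_const2) (use n in auto)
    moreover have "?I \<ge> 0"
      by (rule integral_nonneg_AE) (use mu_pos in \<open>auto elim!: eventually_mono\<close>)
    then have "2 * ?I \<le> (real CARD('n) - 3) * ?I" using N by (intro mult_right_mono) auto
    ultimately show ?thesis by simp
  qed
  with C(1) show ?thesis by blast
qed

lemma drift_estimate: "\<exists>C\<ge>0. \<forall>\<phi>\<in>test_functions.
    (\<integral>x. (\<phi> x * \<phi> x) * w1 x \<partial>lborel) \<le> C * ((\<Sum>i\<in>UNIV. S (partial i \<phi>)) + S \<phi>)"
proof -
  obtain C1 where C1: "C1 > 0" "\<And>i j. AE x in lborel. \<bar>B i j x\<bar> \<le> 1 * inverse ((norm x)\<^sup>2) + C1 * \<beta> x"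
    using B_le[of 1] by auto
  obtain C2 where C2: "C2 \<ge> 0" "\<And>\<phi>. \<phi> \<in> test_functions \<Longrightarrow>
    (\<integral>x. (\<phi> x * \<phi> x) * w0 x \<partial>lborel) \<le> (\<Sum>i\<in>UNIV. S (partial i \<phi>)) + C2 * S \<phi>" using hardy by blast
  let ?N = "real CARD('n)"
  \<comment> \<open>Twice the constants left after half of the integral has been absorbed: 8 and
    \<open>2 N^2 C1^2\<close> come from the two uses of Young's inequality,
    \<open>2 N (1 + C2)\<close> from Hardy's inequality.\<close>
  define K where "K = 8 + 2 * ?N * (1 + C2) + 2 * ?N\<^sup>2 * C1\<^sup>2"
  have K0: "K \<ge> 0" using C1 C2 by (simp add: K_def)
  have "(\<integral>x. (\<phi> x * \<phi> x) * w1 x \<partial>lborel) \<le> K * ((\<Sum>i\<in>UNIV. S (partial i \<phi>)) + S \<phi>)"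
    if \<phi>: "\<phi> \<in> test_functions" for \<phi>
  proof -
    let ?D = "\<Sum>i\<in>UNIV. S (partial i \<phi>)" and ?W = "\<integral>x. (\<phi> x * \<phi> x) * w1 x \<partial>lborel"
      and ?I = "\<integral>x. (\<phi> x * \<phi> x) * w0 x \<partial>lborel"
    note sq = test_sq[OF \<phi>]
    have D0: "?D \<ge> 0" by (intro sum_nonneg S_nonneg)
    have H1: "H i j \<in> Lp_loc 1" for i j using weak_H[where i=i and j=j] by (simp add: has_weak_deriv_def)
    have tp: "(\<lambda>x. partial i \<phi> x * \<phi> x) \<in> test_functions" "(\<lambda>x. partial i \<phi> x * partial i \<phi> x) \<in> test_functions" for i
      by (intro test_mult test_partial \<phi> test_smooth)+
    have int: "integrable lborel (\<lambda>x. (\<phi> x * \<phi> x) * H i i x)" "integrable lborel (\<lambda>x. (partial i \<phi> x * \<phi> x) * G i x)"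
      "integrable lborel (\<lambda>x. (\<phi> x * \<phi> x) * w1 x)" "integrable lborel (\<lambda>x. (\<phi> x * \<phi> x) * w0 x)"
      "integrable lborel (\<lambda>x. (\<phi> x * \<phi> x) * \<mu> x)" "integrable lborel (\<lambda>x. (partial i \<phi> x * partial i \<phi> x) * \<mu> x)" for i
      by (intro integrable_test_mult sq tp H1 G_L1 w0_L1 w1_L1 mu_L1)+
    have zero: "(\<integral>x. (\<phi> x * \<phi> x) * H i i x \<partial>lborel) + 2 * (\<integral>x. (partial i \<phi> x * \<phi> x) * G i x \<partial>lborel) = 0" for i
      using integral_by_parts_weak[OF weak_H \<phi> test_smooth[OF \<phi>], of i i] by (simp add: mult.commute)
    \<comment> \<open>Subtracting the vanishing sum \<open>zero\<close> replaces
      \<open>|b|^2 \<mu>\<close> by \<open>- (div b) \<mu>\<close> and the mixed term, since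
      \<open>H i i = B i i \<mu> + b_i^2 \<mu>\<close>.\<close>
    have "?W + 0 = (\<integral>x. (\<phi> x * \<phi> x) * w1 x \<partial>lborel) - (\<Sum>i\<in>UNIV. (\<integral>x. (\<phi> x * \<phi> x) * H i i x \<partial>lborel) + 2 * (\<integral>x. (partial i \<phi> x * \<phi> x) * G i x \<partial>lborel))"
      unfolding zero by simp
    also have "\<dots> = (\<integral>x. (\<phi> x * \<phi> x) * w1 x - (\<Sum>i\<in>UNIV. (\<phi> x * \<phi> x) * H i i x + 2 * ((partial i \<phi> x * \<phi> x) * G i x)) \<partial>lborel)"
      using int by simp
    also have "\<dots> \<le> (\<integral>x. 1/2 * ((\<phi> x * \<phi> x) * w1 x) + 4 * (\<Sum>i\<in>UNIV. (partial i \<phi> x * partial i \<phi> x) * \<mu> x)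
        + ?N * ((\<phi> x * \<phi> x) * w0 x) + ?N\<^sup>2 * C1\<^sup>2 * ((\<phi> x * \<phi> x) * \<mu> x) \<partial>lborel)"
    proof (rule integral_mono_AE)
      have "AE x in lborel. \<forall>i. H i i x = B i i x * \<mu> x + G i x * G i x / \<mu> x"
        using HB by (simp add: AE_all_countable)
      moreover have "AE x in lborel. \<forall>i. \<bar>B i i x\<bar> \<le> 1 * inverse ((norm x)\<^sup>2) + C1 * \<beta> x"
        using C1(2) by (simp add: AE_all_countable)
      ultimately show "AE x in lborel. (\<phi> x * \<phi> x) * w1 x - (\<Sum>i\<in>UNIV. (\<phi> x * \<phi> x) * H i i x + 2 * ((partial i \<phi> x * \<phi> x) * G i x))
         \<le> 1/2 * ((\<phi> x * \<phi> x) * w1 x) + 4 * (\<Sum>i\<in>UNIV. (partial i \<phi> x * partial i \<phi> x) * \<mu> x)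
        + ?N * ((\<phi> x * \<phi> x) * w0 x) + ?N\<^sup>2 * C1\<^sup>2 * ((\<phi> x * \<phi> x) * \<mu> x)"
        using mu_pos
      proof eventually_elim
        case (elim x)
        let ?m = "\<mu> x" and ?f = "\<phi> x" and ?b = "\<lambda>i. G i x / \<mu> x" and ?v = "inverse ((norm x)\<^sup>2)"
        have G: "G i x = ?b i * ?m" for i using elim(3) by simp
        have Hx: "H i i x = B i i x * ?m + ?b i * ?b i * ?m" for i using elim by simp
        have w1x: "w1 x = (\<Sum>i\<in>UNIV. ?b i * ?b i * ?m)" using elim(3) unfolding w1_eq by simp
        have "(?f * ?f) * w1 x - (\<Sum>i\<in>UNIV. (?f * ?f) * H i i x + 2 * ((partial i \<phi> x * ?f) * G i x)) =
          (\<Sum>i\<in>UNIV. - ((?f * ?f) * (B i i x * ?m)) - 2 * ((partial i \<phi> x * ?f) * (?b i * ?m)))"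
          unfolding w1x Hx sum_distrib_left sum_subtractf[symmetric]
          by (rule sum.cong) (use G in \<open>auto simp: algebra_simps\<close>)
        also have "\<dots> \<le> (\<Sum>i\<in>UNIV. (?f * ?f) * ((?v + C1 * \<beta> x) * ?m)
             + (1/4 * ((?f * ?f) * (?b i * ?b i * ?m)) + 4 * ((partial i \<phi> x * partial i \<phi> x) * ?m)))"
        proof (rule sum_mono)
          fix i
          have "- B i i x \<le> ?v + C1 * \<beta> x" using elim(2) by (smt (verit) mult_1)
          then have "(?f * ?f) * (- B i i x * ?m) \<le> (?f * ?f) * ((?v + C1 * \<beta> x) * ?m)"
            using elim(3) by (intro mult_left_mono mult_right_mono) auto
          \<comment> \<open>Both Young inequalities carry the weight \<open>1/4\<close>, here for
            the mixed term and below for \<open>N C1 \<beta>\<close>, so that together they cost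
            half of the finite integral of \<open>\<phi>^2 w1\<close>.\<close>
          moreover have "- 2 * ((partial i \<phi> x * ?f) * (?b i * ?m)) \<le>
             1/4 * ((?f * ?f) * (?b i * ?b i * ?m)) + 4 * ((partial i \<phi> x * partial i \<phi> x) * ?m)"
          proof -
            have "0 \<le> (1/2 * (?f * ?b i) + 2 * partial i \<phi> x)\<^sup>2 * ?m" using elim(3) by simp
            also have "\<dots> = 1/4 * ((?f * ?f) * (?b i * ?b i * ?m)) + 4 * ((partial i \<phi> x * partial i \<phi> x) * ?m)
                + 2 * ((partial i \<phi> x * ?f) * (?b i * ?m))"
              by (simp only: power2_eq_square) (simp add: algebra_simps)
            finally show ?thesis by simp
          qed
          ultimately show "- ((?f * ?f) * (B i i x * ?m)) - 2 * ((partial i \<phi> x * ?f) * (?b i * ?m)) \<le>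
            (?f * ?f) * ((?v + C1 * \<beta> x) * ?m)
             + (1/4 * ((?f * ?f) * (?b i * ?b i * ?m)) + 4 * ((partial i \<phi> x * partial i \<phi> x) * ?m))"
            by simp
        qed
        also have "\<dots> = ?N * ((?f * ?f) * w0 x) + (?f * ?f) * ((?N * C1 * \<beta> x) * ?m) + 1/4 * ((?f * ?f) * w1 x)
            + 4 * (\<Sum>i\<in>UNIV. (partial i \<phi> x * partial i \<phi> x) * ?m)"
          unfolding w1x sum.distrib sum_distrib_left by (simp add: algebra_simps)
        also have "(?f * ?f) * ((?N * C1 * \<beta> x) * ?m) \<le> 1/4 * ((?f * ?f) * w1 x) + ?N\<^sup>2 * C1\<^sup>2 * ((?f * ?f) * ?m)"
        proof -
          have "?N * C1 * \<beta> x \<le> 1/4 * (\<beta> x)\<^sup>2 + (?N * C1)\<^sup>2"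
            using zero_le_power2[of "1/2 * \<beta> x - ?N * C1"] by (simp add: power2_eq_square algebra_simps)
          then have "(?f * ?f) * ((?N * C1 * \<beta> x) * ?m) \<le> (?f * ?f) * ((1/4 * (\<beta> x)\<^sup>2 + (?N * C1)\<^sup>2) * ?m)"
            using elim(3) by (intro mult_left_mono mult_right_mono) auto
          then show ?thesis by (simp add: power_mult_distrib algebra_simps)
        qed
        finally show ?case by linarith
      qed
    qed (use int in \<open>auto intro!: Bochner_Integration.integrable_add Bochner_Integration.integrable_diff integrable_mult_right Bochner_Integration.integrable_sum\<close>)
    also have "\<dots> = 1/2 * ?W + 4 * ?D + ?N * ?I + ?N\<^sup>2 * C1\<^sup>2 * S \<phi>"
      using int by (simp add: S_def)
    finally have "?W \<le> 8 * ?D + 2 * ?N * ?I + 2 * ?N\<^sup>2 * C1\<^sup>2 * S \<phi>" by simp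
    also have "\<dots> \<le> 8 * ?D + 2 * ?N * (?D + C2 * S \<phi>) + 2 * ?N\<^sup>2 * C1\<^sup>2 * S \<phi>"
      using C2(2)[OF \<phi>] by (intro add_mono mult_left_mono) auto
    also have "\<dots> \<le> K * (?D + S \<phi>)"
    proof -
      have "0 \<le> 8 * S \<phi> + 2 * ?N * S \<phi> + 2 * ?N * C2 * ?D + 2 * ?N\<^sup>2 * C1\<^sup>2 * ?D"
        using S_nonneg[of \<phi>] D0 C2(1) by (intro add_nonneg_nonneg mult_nonneg_nonneg) auto
      then show ?thesis by (simp add: K_def algebra_simps)
    qed
    finally show ?thesis .
  qed
  with K0 show ?thesis by blast
qed

section \<open>The operator and the second-order estimates for real test functions\<close>

definition Lr :: "(real ^ 'n \<Rightarrow> real) \<Rightarrow> real ^ 'n \<Rightarrow> real"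
  where "Lr f x = (\<Sum>i\<in>UNIV. partial i (partial i f) x + G i x / \<mu> x * partial i f x)"

definition D1 :: "(real ^ 'n \<Rightarrow> real) \<Rightarrow> real"
  where "D1 f = (\<Sum>i\<in>UNIV. S (partial i f))"

definition D2 :: "(real ^ 'n \<Rightarrow> real) \<Rightarrow> real"
  where "D2 f = (\<Sum>j\<in>UNIV. D1 (partial j f))"

definition EL :: "(real ^ 'n \<Rightarrow> real) \<Rightarrow> real"
  where "EL f = (\<integral>x. (Lr f x)\<^sup>2 * \<mu> x \<partial>lborel)"

lemma D1_nonneg: "D1 f \<ge> 0" and D2_nonneg: "D2 f \<ge> 0"
  by (auto simp: D1_def D2_def intro!: sum_nonneg S_nonneg)

lemma H_L1: "H i j \<in> Lp_loc 1"
  using weak_H[of j i] by (simp add: has_weak_deriv_def)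

text \<open>Replacing \<open>b_i \<mu>\<close> by \<open>G i\<close> and
  \<open>b_i b_j \<mu>\<close> by \<open>G i G j / \<mu>\<close> splits the square into products of
  a test function and a locally integrable function. This gives integrability, and the four kinds of
  integrals are those met again in \<open>bochner\<close>.\<close>

lemma Lr_square:
  assumes f: "f \<in> test_functions"
  shows "integrable lborel (\<lambda>x. (Lr f x)\<^sup>2 * \<mu> x)"
    "EL f = (\<Sum>i\<in>UNIV. \<Sum>j\<in>UNIV.
        (\<integral>x. (partial i (partial i f) x * partial j (partial j f) x) * \<mu> x \<partial>lborel)
      + (\<integral>x. (partial j f x * partial i (partial i f) x) * G j x \<partial>lborel)
      + (\<integral>x. (partial i f x * partial j (partial j f) x) * G i x \<partial>lborel)
      + (\<integral>x. (partial i f x * partial j f x) * (G i x * G j x / \<mu> x) \<partial>lborel))"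
proof -
  let ?p = "\<lambda>i. partial i f" and ?q = "\<lambda>i. partial i (partial i f)"
  have t: "?p i \<in> test_functions" "?q i \<in> test_functions" for i by (intro test_partial f)+
  have int: "integrable lborel (\<lambda>x. (?q i x * ?q j x) * \<mu> x)" "integrable lborel (\<lambda>x. (?p j x * ?q i x) * G j x)"
    "integrable lborel (\<lambda>x. (?p i x * ?q j x) * G i x)"
    "integrable lborel (\<lambda>x. (?p i x * ?p j x) * (G i x * G j x / \<mu> x))" for i j
    by (intro integrable_test_mult test_mult t test_smooth mu_L1 G_L1 GG_div_L1)+
  define s where "s x = (\<Sum>i\<in>UNIV. \<Sum>j\<in>UNIV. (?q i x * ?q j x) * \<mu> x + (?p j x * ?q i x) * G j x
     + (?p i x * ?q j x) * G i x + (?p i x * ?p j x) * (G i x * G j x / \<mu> x))" for x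
  have si: "integrable lborel s"
    unfolding s_def by (intro Bochner_Integration.integrable_sum Bochner_Integration.integrable_add int)
  have [measurable]: "?p i \<in> borel_measurable borel" "?q i \<in> borel_measurable borel" for i
    using t by (auto intro: test_measurable)
  have m [measurable]: "Lr f \<in> borel_measurable borel" unfolding Lr_def by measurable
  have ae: "AE x in lborel. s x = (Lr f x)\<^sup>2 * \<mu> x"
    using mu_pos
  proof eventually_elim
    case (elim x)
    have "(Lr f x)\<^sup>2 * \<mu> x = (\<Sum>i\<in>UNIV. \<Sum>j\<in>UNIV. (?q i x + G i x / \<mu> x * ?p i x) * (?q j x + G j x / \<mu> x * ?p j x) * \<mu> x)"
      unfolding Lr_def power2_eq_square unfolding sum_product unfolding sum_distrib_right by (rule refl)
    also have "\<dots> = s x"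
      unfolding s_def
    proof (intro sum.cong refl)
      fix i j
      have id: "(q + b * p) * (q' + b' * p') * m = (q * q') * m + (p' * q) * (b' * m) + (p * q') * (b * m) + (p * p') * (b * b' * m)"
        for q b p q' b' p' m :: real by (simp add: algebra_simps)
      have b: "G k x / \<mu> x * \<mu> x = G k x" "G i x / \<mu> x * (G j x / \<mu> x) * \<mu> x = G i x * G j x / \<mu> x" for k
        using elim by simp_all
      show "(?q i x + G i x / \<mu> x * ?p i x) * (?q j x + G j x / \<mu> x * ?p j x) * \<mu> x =
        (?q i x * ?q j x) * \<mu> x + (?p j x * ?q i x) * G j x + (?p i x * ?q j x) * G i x + (?p i x * ?p j x) * (G i x * G j x / \<mu> x)"
        unfolding id b by (rule refl)
    qed
    finally show ?case by simp
  qed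
  show "integrable lborel (\<lambda>x. (Lr f x)\<^sup>2 * \<mu> x)"
    by (rule integrable_cong_AE[THEN iffD1, OF borel_measurable_integrable[OF si] _ ae si]) measurable
  have "EL f = (\<integral>x. s x \<partial>lborel)"
    unfolding EL_def using si by (intro integral_cong_AE) (use ae in \<open>auto elim!: eventually_mono\<close>)
  also have "\<dots> = (\<Sum>i\<in>UNIV. \<Sum>j\<in>UNIV. (\<integral>x. (?q i x * ?q j x) * \<mu> x \<partial>lborel) + (\<integral>x. (?p j x * ?q i x) * G j x \<partial>lborel)
     + (\<integral>x. (?p i x * ?q j x) * G i x \<partial>lborel) + (\<integral>x. (?p i x * ?p j x) * (G i x * G j x / \<mu> x) \<partial>lborel))"
    unfolding s_def
    by (simp add: Bochner_Integration.integral_sum Bochner_Integration.integrable_sum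
      Bochner_Integration.integrable_add Bochner_Integration.integral_add int del: times_divide_eq_right)
  finally show "EL f = (\<Sum>i\<in>UNIV. \<Sum>j\<in>UNIV.
        (\<integral>x. (partial i (partial i f) x * partial j (partial j f) x) * \<mu> x \<partial>lborel)
      + (\<integral>x. (partial j f x * partial i (partial i f) x) * G j x \<partial>lborel)
      + (\<integral>x. (partial i f x * partial j (partial j f) x) * G i x \<partial>lborel)
      + (\<integral>x. (partial i f x * partial j f x) * (G i x * G j x / \<mu> x) \<partial>lborel))" .
qed

lemma EL_nonneg: "EL f \<ge> 0"
  unfolding EL_def by (rule integral_nonneg_AE) (use mu_pos in \<open>auto elim!: eventually_mono\<close>)

text \<open>Integration by parts gives \<open>D1 f = - \<integral> f L f d\<mu>\<close>, to which
  Young's inequality is applied.\<close>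

lemma D1_le:
  assumes f: "f \<in> test_functions"
  shows "D1 f \<le> 1/2 * S f + 1/2 * EL f"
proof -
  let ?p = "\<lambda>i. partial i f" and ?q = "\<lambda>i. partial i (partial i f)"
  have t: "?p i \<in> test_functions" "?q i \<in> test_functions" for i by (intro test_partial f)+
  have int: "integrable lborel (\<lambda>x. (f x * ?q i x) * \<mu> x)" "integrable lborel (\<lambda>x. (f x * ?p i x) * G i x)"
    "integrable lborel (\<lambda>x. (f x * f x) * \<mu> x)" for i
    by (intro integrable_test_mult test_mult f t test_smooth mu_L1 G_L1)+
  have "S (?p i) = - ((\<integral>x. (f x * ?q i x) * \<mu> x \<partial>lborel) + (\<integral>x. (f x * ?p i x) * G i x \<partial>lborel))" for i
    using integral_by_parts_weak[OF weak_G f test_smooth[OF t(1)], of i i] by (simp add: S_def)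
  then have "D1 f = (\<Sum>i\<in>UNIV. - ((\<integral>x. (f x * ?q i x) * \<mu> x \<partial>lborel) + (\<integral>x. (f x * ?p i x) * G i x \<partial>lborel)))"
    by (simp add: D1_def)
  also have "\<dots> = (\<integral>x. (\<Sum>i\<in>UNIV. - ((f x * ?q i x) * \<mu> x + (f x * ?p i x) * G i x)) \<partial>lborel)"
    using int by simp
  also have "\<dots> \<le> (\<integral>x. 1/2 * ((f x * f x) * \<mu> x) + 1/2 * ((Lr f x)\<^sup>2 * \<mu> x) \<partial>lborel)"
  proof (rule integral_mono_AE)
    show "AE x in lborel. (\<Sum>i\<in>UNIV. - ((f x * ?q i x) * \<mu> x + (f x * ?p i x) * G i x))
        \<le> 1/2 * ((f x * f x) * \<mu> x) + 1/2 * ((Lr f x)\<^sup>2 * \<mu> x)"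
      using mu_pos
    proof eventually_elim
      case (elim x)
      have "(\<Sum>i\<in>UNIV. - ((f x * ?q i x) * \<mu> x + (f x * ?p i x) * G i x)) = (\<Sum>i\<in>UNIV. - (f x * \<mu> x) * (?q i x + G i x / \<mu> x * ?p i x))"
        by (intro sum.cong refl) (use elim in \<open>simp add: field_simps\<close>)
      also have "\<dots> = - (f x * \<mu> x) * Lr f x" unfolding Lr_def by (rule sum_distrib_left[symmetric])
      also have "\<dots> = - (f x * Lr f x) * \<mu> x" by simp
      also have "\<dots> \<le> (1/2 * (f x * f x) + 1/2 * (Lr f x)\<^sup>2) * \<mu> x"
      proof (rule mult_right_mono)
        show "- (f x * Lr f x) \<le> 1/2 * (f x * f x) + 1/2 * (Lr f x)\<^sup>2"
          using zero_le_power2[of "f x + Lr f x"] by (simp add: power2_eq_square algebra_simps)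
      qed (use elim in simp)
      finally show ?case by (simp add: algebra_simps)
    qed
  qed (use int Lr_square(1)[OF f] in auto)
  also have "\<dots> = 1/2 * S f + 1/2 * EL f"
    using int(3) Lr_square(1)[OF f] by (simp add: S_def EL_def)
  finally show ?thesis .
qed

text \<open>Each squared second derivative is integrated by parts until only pure second derivatives
  and \<open>H\<close> remain. These are the terms of \<open>Lr_square\<close>, except that
  \<open>H i j\<close> stands where \<open>G i G j / \<mu>\<close> did; the difference of the two is
  \<open>B i j \<mu>\<close>.\<close>

lemma bochner:
  assumes f: "f \<in> test_functions"
  shows "D2 f = EL f + (\<Sum>i\<in>UNIV. \<Sum>j\<in>UNIV. \<integral>x. (partial i f x * partial j f x) * (B i j x * \<mu> x) \<partial>lborel)"
proof -
  let ?p = "\<lambda>i. partial i f" and ?q = "\<lambda>i j. partial i (partial j f)"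
  have t: "?p i \<in> test_functions" "?q i j \<in> test_functions" for i j by (intro test_partial f)+
  have BH: "(\<integral>x. (?p i x * ?p j x) * (B i j x * \<mu> x) \<partial>lborel) =
      (\<integral>x. (?p i x * ?p j x) * H i j x \<partial>lborel) - (\<integral>x. (?p i x * ?p j x) * (G i x * G j x / \<mu> x) \<partial>lborel)" for i j
  proof -
    have "(\<integral>x. (?p i x * ?p j x) * H i j x \<partial>lborel) - (\<integral>x. (?p i x * ?p j x) * (G i x * G j x / \<mu> x) \<partial>lborel)
      = (\<integral>x. (?p i x * ?p j x) * H i j x - (?p i x * ?p j x) * (G i x * G j x / \<mu> x) \<partial>lborel)"
      by (intro Bochner_Integration.integral_diff[symmetric] integrable_test_mult test_mult t test_smooth H_L1 GG_div_L1)
    also have "\<dots> = (\<integral>x. (?p i x * ?p j x) * (B i j x * \<mu> x) \<partial>lborel)"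
    proof (rule integral_cong_AE)
      have [measurable]: "?p i \<in> borel_measurable borel" "?p j \<in> borel_measurable borel" "H i j \<in> borel_measurable borel"
        using t H_L1 by (auto intro: test_measurable Lp_loc_measurable)
      show "(\<lambda>x. (?p i x * ?p j x) * H i j x - (?p i x * ?p j x) * (G i x * G j x / \<mu> x)) \<in> borel_measurable lborel"
        "(\<lambda>x. (?p i x * ?p j x) * (B i j x * \<mu> x)) \<in> borel_measurable lborel" by measurable
      show "AE x in lborel. (?p i x * ?p j x) * H i j x - (?p i x * ?p j x) * (G i x * G j x / \<mu> x) = (?p i x * ?p j x) * (B i j x * \<mu> x)"
        using HB[of i j]
      proof eventually_elim
        case (elim x)
        show ?case unfolding elim by (simp only: right_diff_distrib[symmetric]) simp
      qed
    qed
    finally show ?thesis by simp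
  qed
  have S_ij: "S (?q i j) = (\<integral>x. (?q i i x * ?q j j x) * \<mu> x \<partial>lborel) + (\<integral>x. (?p j x * ?q i i x) * G j x \<partial>lborel)
      + (\<integral>x. (?p i x * ?q j j x) * G i x \<partial>lborel) + (\<integral>x. (?p i x * ?p j x) * H i j x \<partial>lborel)" for i j
  proof -
    \<comment> \<open>The third derivatives produced in \<open>a\<close> and \<open>b\<close>
      coincide and cancel; \<open>d\<close> then moves one derivative from the remaining mixed term
      to \<open>G i\<close> and \<open>partial j f\<close>.\<close>
    have c: "partial i (?q i j) = partial j (?q i i)"
      by (metis partial_commute f t(1))
    have a: "(\<integral>x. (?q j j x * ?q i i x) * \<mu> x \<partial>lborel) + (\<integral>x. (?p j x * partial j (?q i i) x) * \<mu> x \<partial>lborel)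
        + (\<integral>x. (?p j x * ?q i i x) * G j x \<partial>lborel) = 0"
      by (rule integral_by_parts_weak[OF weak_G t(1) test_smooth[OF t(2)]])
    have b: "(\<integral>x. (?q i j x * ?q i j x) * \<mu> x \<partial>lborel) + (\<integral>x. (?p j x * partial i (?q i j) x) * \<mu> x \<partial>lborel)
        + (\<integral>x. (?p j x * ?q i j x) * G i x \<partial>lborel) = 0"
      by (rule integral_by_parts_weak[OF weak_G t(1) test_smooth[OF t(2)]])
    have d: "(\<integral>x. (?q j i x * ?p j x) * G i x \<partial>lborel) + (\<integral>x. (?p i x * ?q j j x) * G i x \<partial>lborel)
        + (\<integral>x. (?p i x * ?p j x) * H i j x \<partial>lborel) = 0"
      by (rule integral_by_parts_weak[OF weak_H t(1) test_smooth[OF t(1)]])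
    have e: "(\<integral>x. (?q j i x * ?p j x) * G i x \<partial>lborel) = (\<integral>x. (?p j x * ?q i j x) * G i x \<partial>lborel)"
      by (simp add: partial_commute[OF f, of j i] mult.commute)
    have g: "(\<integral>x. (?q j j x * ?q i i x) * \<mu> x \<partial>lborel) = (\<integral>x. (?q i i x * ?q j j x) * \<mu> x \<partial>lborel)"
      by (simp add: mult.commute)
    show ?thesis using a b d unfolding c e g S_def by linarith
  qed
  have "D2 f = (\<Sum>i\<in>UNIV. \<Sum>j\<in>UNIV. S (?q i j))"
    unfolding D2_def D1_def by (rule sum.swap)
  also have "\<dots> = EL f + (\<Sum>i\<in>UNIV. \<Sum>j\<in>UNIV. \<integral>x. (?p i x * ?p j x) * (B i j x * \<mu> x) \<partial>lborel)"
    unfolding Lr_square(2)[OF f] BH S_ij by (simp add: sum.distrib sum_subtractf del: times_divide_eq_right)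
  finally show ?thesis .
qed

text \<open>The order of choices matters: \<open>\<epsilon>\<close> depends on \<open>N\<close>,
  \<open>\<kappa>\<close> on \<open>N\<close> and the constant of the drift estimate, and
  \<open>C1\<close> is taken from \<open>B_le\<close> for this \<open>\<epsilon>\<close>. It may be
  large, since it enters only the coefficient of \<open>D1 f\<close>.\<close>

lemma second_order_estimate:
  "\<exists>C\<ge>0. \<forall>f\<in>test_functions. D1 f + D2 f \<le> C * (S f + EL f)"
proof -
  let ?N = "real CARD('n)"
  have N0: "?N > 0" by simp
  obtain C2 where C2: "C2 \<ge> 0" "\<And>\<phi>. \<phi> \<in> test_functions \<Longrightarrow>
    (\<integral>x. (\<phi> x * \<phi> x) * w0 x \<partial>lborel) \<le> D1 \<phi> + C2 * S \<phi>" using hardy unfolding D1_def by blast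
  obtain C3 where C3: "C3 \<ge> 0" "\<And>\<phi>. \<phi> \<in> test_functions \<Longrightarrow>
    (\<integral>x. (\<phi> x * \<phi> x) * w1 x \<partial>lborel) \<le> C3 * (D1 \<phi> + S \<phi>)" using drift_estimate unfolding D1_def by blast
  \<comment> \<open>\<open>N \<epsilon> = 1/4\<close> and \<open>N \<kappa> C3 \<le> 1/4\<close>, so
    the two singular terms together take half of \<open>D2 f\<close>; the \<open>+ 1\<close> in
    \<open>\<kappa>\<close> guards against \<open>C3 = 0\<close>.\<close>
  define \<epsilon> where "\<epsilon> = 1 / (4 * ?N)"
  define \<kappa> where "\<kappa> = 1 / (4 * ?N * (C3 + 1))"
  have \<epsilon>0: "\<epsilon> > 0" and \<kappa>0: "\<kappa> > 0" using N0 C3(1) by (simp_all add: \<epsilon>_def \<kappa>_def)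
  obtain C1 where C1: "C1 > 0" "\<And>i j. AE x in lborel. \<bar>B i j x\<bar> \<le> \<epsilon> * inverse ((norm x)\<^sup>2) + C1 * \<beta> x"
    using B_le[OF \<epsilon>0] by auto
  define A where "A = C1\<^sup>2 / \<kappa>"
  define K where "K = 1/4 * C2 + 1/4 + ?N * A"
  have A0: "A \<ge> 0" and K0: "K \<ge> 0" using \<kappa>0 C2 by (simp_all add: A_def K_def)
  have "D1 f + D2 f \<le> (3 + 2 * K) * (S f + EL f)" if f: "f \<in> test_functions" for f
  proof -
    let ?p = "\<lambda>i. partial i f"
    have t: "?p i \<in> test_functions" for i by (intro test_partial f)
    have int: "integrable lborel (\<lambda>x. (?p i x * ?p i x) * w0 x)" "integrable lborel (\<lambda>x. (?p i x * ?p i x) * w1 x)"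
      "integrable lborel (\<lambda>x. (?p i x * ?p i x) * \<mu> x)" "integrable lborel (\<lambda>x. (?p i x * ?p j x) * H i j x)"
      "integrable lborel (\<lambda>x. (?p i x * ?p j x) * (G i x * G j x / \<mu> x))" for i j
      by (intro integrable_test_mult test_mult t test_smooth w0_L1 w1_L1 mu_L1 H_L1 GG_div_L1)+
    have [measurable]: "?p i \<in> borel_measurable borel" for i
      using t by (auto intro: test_measurable)
    have intB: "integrable lborel (\<lambda>x. (?p i x * ?p j x) * (B i j x * \<mu> x))" for i j
    proof -
      have ae: "AE x in lborel. (?p i x * ?p j x) * H i j x - (?p i x * ?p j x) * (G i x * G j x / \<mu> x) = (?p i x * ?p j x) * (B i j x * \<mu> x)"
        using HB[of i j]
      proof eventually_elim
        case (elim x)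
        show ?case unfolding elim by (simp only: right_diff_distrib[symmetric]) simp
      qed
      have d: "integrable lborel (\<lambda>x. (?p i x * ?p j x) * H i j x - (?p i x * ?p j x) * (G i x * G j x / \<mu> x))"
        using int by (intro Bochner_Integration.integrable_diff) auto
      show ?thesis
        by (rule integrable_cong_AE[THEN iffD1, OF _ _ ae d]) (use d in measurable)
    qed
    have "(\<Sum>i\<in>UNIV. \<Sum>j\<in>UNIV. \<integral>x. (?p i x * ?p j x) * (B i j x * \<mu> x) \<partial>lborel)
       = (\<integral>x. (\<Sum>i\<in>UNIV. \<Sum>j\<in>UNIV. (?p i x * ?p j x) * (B i j x * \<mu> x)) \<partial>lborel)"
      using intB by (simp add: Bochner_Integration.integral_sum Bochner_Integration.integrable_sum)
    also have "\<dots> \<le> (\<integral>x. (\<Sum>i\<in>UNIV. ?N * \<epsilon> * ((?p i x * ?p i x) * w0 x) + ?N * \<kappa> * ((?p i x * ?p i x) * w1 x)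
        + ?N * A * ((?p i x * ?p i x) * \<mu> x)) \<partial>lborel)"
    proof (rule integral_mono_AE)
      show "integrable lborel (\<lambda>x. \<Sum>i\<in>UNIV. \<Sum>j\<in>UNIV. (?p i x * ?p j x) * (B i j x * \<mu> x))"
        by (intro Bochner_Integration.integrable_sum intB)
      show "integrable lborel (\<lambda>x. \<Sum>i\<in>UNIV. ?N * \<epsilon> * ((?p i x * ?p i x) * w0 x) + ?N * \<kappa> * ((?p i x * ?p i x) * w1 x)
        + ?N * A * ((?p i x * ?p i x) * \<mu> x))"
        by (intro Bochner_Integration.integrable_sum Bochner_Integration.integrable_add integrable_mult_right int)
      have "AE x in lborel. \<forall>i j. \<bar>B i j x\<bar> \<le> \<epsilon> * inverse ((norm x)\<^sup>2) + C1 * \<beta> x"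
        using C1(2) by (simp add: AE_all_countable)
      then show "AE x in lborel. (\<Sum>i\<in>UNIV. \<Sum>j\<in>UNIV. (?p i x * ?p j x) * (B i j x * \<mu> x)) \<le>
         (\<Sum>i\<in>UNIV. ?N * \<epsilon> * ((?p i x * ?p i x) * w0 x) + ?N * \<kappa> * ((?p i x * ?p i x) * w1 x)
        + ?N * A * ((?p i x * ?p i x) * \<mu> x))"
        using mu_pos
      proof eventually_elim
        case (elim x)
        let ?v = "\<epsilon> * inverse ((norm x)\<^sup>2) + \<kappa> * (\<beta> x)\<^sup>2 + A"
        have C1b: "C1 * \<beta> x \<le> \<kappa> * (\<beta> x)\<^sup>2 + A"
        proof -
          have "0 \<le> (\<kappa> * \<beta> x - C1)\<^sup>2 / \<kappa> + C1 * \<beta> x" using \<kappa>0 C1(1) by simp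
          then show ?thesis using \<kappa>0 by (simp add: A_def power2_eq_square field_simps)
        qed
        then have Bv: "\<bar>B i j x\<bar> \<le> ?v" for i j
          using elim(1)[rule_format, of i j] by linarith
        have v0: "?v \<ge> 0" using Bv[of undefined undefined] by linarith
        have ij: "(?p i x * ?p j x) * (B i j x * \<mu> x) \<le> 1/2 * ((?p i x * ?p i x) * (?v * \<mu> x)) + 1/2 * ((?p j x * ?p j x) * (?v * \<mu> x))" for i j
        proof -
          have "(?p i x * ?p j x) * B i j x \<le> (\<bar>?p i x\<bar> * \<bar>?p j x\<bar>) * \<bar>B i j x\<bar>"
            by (metis abs_ge_self abs_mult)
          also have "\<dots> \<le> (\<bar>?p i x\<bar> * \<bar>?p j x\<bar>) * ?v" using Bv by (intro mult_left_mono) auto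
          also have "\<dots> \<le> (1/2 * (?p i x * ?p i x) + 1/2 * (?p j x * ?p j x)) * ?v"
            using sum_squares_bound[of "\<bar>?p i x\<bar>" "\<bar>?p j x\<bar>"] v0
            by (intro mult_right_mono) (auto simp: power2_eq_square)
          finally have "(?p i x * ?p j x) * B i j x * \<mu> x \<le> (1/2 * (?p i x * ?p i x) + 1/2 * (?p j x * ?p j x)) * ?v * \<mu> x"
            using elim(2) by (intro mult_right_mono) auto
          then show ?thesis by (simp add: algebra_simps)
        qed
        have "(\<Sum>i\<in>UNIV. \<Sum>j\<in>UNIV. (?p i x * ?p j x) * (B i j x * \<mu> x)) \<le>
          (\<Sum>i\<in>UNIV. \<Sum>j\<in>UNIV. 1/2 * ((?p i x * ?p i x) * (?v * \<mu> x)) + 1/2 * ((?p j x * ?p j x) * (?v * \<mu> x)))"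
          by (intro sum_mono ij)
        \<comment> \<open>The double sum is symmetric, so each square is counted \<open>N\<close>
          times; this is the factor \<open>N\<close> in the choices of \<open>\<epsilon>\<close> and
          \<open>\<kappa>\<close>.\<close>
        also have "\<dots> = (\<Sum>i\<in>UNIV. ?N * ((?p i x * ?p i x) * (?v * \<mu> x)))"
          by (simp add: sum.distrib sum_distrib_left)
        also have "\<dots> = (\<Sum>i\<in>UNIV. ?N * \<epsilon> * ((?p i x * ?p i x) * w0 x) + ?N * \<kappa> * ((?p i x * ?p i x) * w1 x)
          + ?N * A * ((?p i x * ?p i x) * \<mu> x))"
          by (intro sum.cong refl) (simp add: algebra_simps)
        finally show ?case .
      qed
    qed
    also have "\<dots> = (\<Sum>i\<in>UNIV. ?N * \<epsilon> * (\<integral>x. (?p i x * ?p i x) * w0 x \<partial>lborel) + ?N * \<kappa> * (\<integral>x. (?p i x * ?p i x) * w1 x \<partial>lborel)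
        + ?N * A * S (?p i))"
      using int by (simp add: S_def Bochner_Integration.integral_sum)
    also have "\<dots> \<le> (\<Sum>i\<in>UNIV. 1/4 * (D1 (?p i) + C2 * S (?p i)) + 1/4 * (D1 (?p i) + S (?p i)) + ?N * A * S (?p i))"
    proof (rule sum_mono)
      fix i
      have e: "?N * \<epsilon> = 1/4" using N0 by (simp add: \<epsilon>_def)
      have "?N * \<kappa> * (\<integral>x. (?p i x * ?p i x) * w1 x \<partial>lborel) \<le> ?N * \<kappa> * (C3 * (D1 (?p i) + S (?p i)))"
        using C3(2)[OF t] \<kappa>0 by (intro mult_left_mono) auto
      also have "\<dots> \<le> 1/4 * (D1 (?p i) + S (?p i))"
      proof -
        have "?N * \<kappa> * C3 = 1/4 * (C3 / (C3 + 1))" using N0 by (simp add: \<kappa>_def)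
        also have "\<dots> \<le> 1/4" using C3(1) by simp
        finally have "?N * \<kappa> * C3 \<le> 1/4" .
        then have "(?N * \<kappa> * C3) * (D1 (?p i) + S (?p i)) \<le> 1/4 * (D1 (?p i) + S (?p i))"
          using D1_nonneg S_nonneg by (intro mult_right_mono) auto
        then show ?thesis by (simp add: mult.assoc)
      qed
      finally have k: "?N * \<kappa> * (\<integral>x. (?p i x * ?p i x) * w1 x \<partial>lborel) \<le> 1/4 * (D1 (?p i) + S (?p i))" .
      show "?N * \<epsilon> * (\<integral>x. (?p i x * ?p i x) * w0 x \<partial>lborel) + ?N * \<kappa> * (\<integral>x. (?p i x * ?p i x) * w1 x \<partial>lborel)
        + ?N * A * S (?p i) \<le> 1/4 * (D1 (?p i) + C2 * S (?p i)) + 1/4 * (D1 (?p i) + S (?p i)) + ?N * A * S (?p i)"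
        unfolding e by (intro add_mono order_refl k mult_left_mono C2(2)[OF t]) simp_all
    qed
    also have "\<dots> = 1/2 * D2 f + K * D1 f"
      unfolding D2_def D1_def[of f] K_def by (simp add: sum.distrib sum_distrib_left algebra_simps)
    \<comment> \<open>\<open>D2 f\<close> is a finite number for a test function, so half of it can
      be moved to the left; the \<open>D1 f\<close> left over is covered by
      \<open>D1_le\<close>.\<close>
    finally have "D2 f \<le> EL f + (1/2 * D2 f + K * D1 f)" unfolding bochner[OF f] by simp
    then have "D2 f \<le> 2 * EL f + 2 * K * D1 f" by simp
    moreover have "D1 f \<le> S f + EL f" using D1_le[OF f] S_nonneg[of f] EL_nonneg[of f] by simp
    moreover have "2 * K * D1 f \<le> 2 * K * (S f + EL f)" using calculation(2) K0 by (intro mult_left_mono) auto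
    ultimately have "D1 f + D2 f \<le> (S f + EL f) + 2 * EL f + 2 * K * (S f + EL f)" by simp
    also have "\<dots> \<le> (3 + 2 * K) * (S f + EL f)" using S_nonneg[of f] by (simp add: algebra_simps)
    finally show ?thesis .
  qed
  with K0 show ?thesis by (intro exI[of _ "3 + 2 * K"]) auto
qed

text \<open>By the Cauchy-Schwarz inequality the square of \<open>b \<bullet> \<nabla>f\<close> is
  at most \<open>|b|^2 |\<nabla>f|^2\<close>; the drift estimate for each \<open>partial i f\<close>
  controls the integral of the latter.\<close>

lemma operator_bound: "\<exists>C\<ge>0. \<forall>f\<in>test_functions. EL f \<le> C * (D1 f + D2 f)"
proof -
  let ?N = "real CARD('n)"
  obtain C3 where C3: "C3 \<ge> 0" "\<And>\<phi>. \<phi> \<in> test_functions \<Longrightarrow>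
    (\<integral>x. (\<phi> x * \<phi> x) * w1 x \<partial>lborel) \<le> C3 * (D1 \<phi> + S \<phi>)" using drift_estimate unfolding D1_def by blast
  have "EL f \<le> (2 * ?N + 2 * C3) * (D1 f + D2 f)" if f: "f \<in> test_functions" for f
  proof -
    let ?p = "\<lambda>i. partial i f" and ?q = "\<lambda>i. partial i (partial i f)"
    have t: "?p i \<in> test_functions" "?q i \<in> test_functions" for i by (intro test_partial f)+
    have int: "integrable lborel (\<lambda>x. (?q i x * ?q i x) * \<mu> x)" "integrable lborel (\<lambda>x. (?p i x * ?p i x) * w1 x)" for i
      by (intro integrable_test_mult test_mult t test_smooth w1_L1 mu_L1)+
    have "EL f \<le> (\<integral>x. (\<Sum>i\<in>UNIV. 2 * ?N * ((?q i x * ?q i x) * \<mu> x) + 2 * ((?p i x * ?p i x) * w1 x)) \<partial>lborel)"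
      unfolding EL_def
    proof (rule integral_mono_AE[OF Lr_square(1)[OF f]])
      show "integrable lborel (\<lambda>x. \<Sum>i\<in>UNIV. 2 * ?N * ((?q i x * ?q i x) * \<mu> x) + 2 * ((?p i x * ?p i x) * w1 x))"
        by (intro Bochner_Integration.integrable_sum Bochner_Integration.integrable_add integrable_mult_right int)
      show "AE x in lborel. (Lr f x)\<^sup>2 * \<mu> x \<le> (\<Sum>i\<in>UNIV. 2 * ?N * ((?q i x * ?q i x) * \<mu> x) + 2 * ((?p i x * ?p i x) * w1 x))"
        using mu_pos
      proof eventually_elim
        case (elim x)
        let ?a = "\<Sum>i\<in>UNIV. ?q i x" and ?b = "\<Sum>i\<in>UNIV. G i x / \<mu> x * ?p i x"
        have "(Lr f x)\<^sup>2 = (?a + ?b)\<^sup>2" by (simp add: Lr_def sum.distrib)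
        also have "\<dots> \<le> 2 * ?a\<^sup>2 + 2 * ?b\<^sup>2"
          using zero_le_power2[of "?a - ?b"] by (simp only: power2_eq_square) (simp add: algebra_simps)
        also have "?b\<^sup>2 \<le> (\<beta> x)\<^sup>2 * (\<Sum>i\<in>UNIV. (?p i x)\<^sup>2)"
          unfolding beta_sq by (rule Cauchy_Schwarz_ineq_sum)
        also have "?a\<^sup>2 \<le> ?N * (\<Sum>i\<in>UNIV. (?q i x)\<^sup>2)"
          using Cauchy_Schwarz_ineq_sum[of "\<lambda>_. 1" "\<lambda>i. ?q i x" "UNIV :: 'n set"] by simp
        finally have "(Lr f x)\<^sup>2 * \<mu> x \<le> (2 * (?N * (\<Sum>i\<in>UNIV. (?q i x)\<^sup>2)) + 2 * ((\<beta> x)\<^sup>2 * (\<Sum>i\<in>UNIV. (?p i x)\<^sup>2))) * \<mu> x"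
          using elim by (intro mult_right_mono) auto
        also have "\<dots> = (\<Sum>i\<in>UNIV. 2 * ?N * ((?q i x * ?q i x) * \<mu> x) + 2 * ((?p i x * ?p i x) * w1 x))"
          by (simp add: sum.distrib sum_distrib_left sum_distrib_right power2_eq_square algebra_simps)
        finally show ?case .
      qed
    qed
    also have "\<dots> = (\<Sum>i\<in>UNIV. 2 * ?N * S (?q i) + 2 * (\<integral>x. (?p i x * ?p i x) * w1 x \<partial>lborel))"
      using int by (simp add: S_def Bochner_Integration.integral_sum)
    also have "\<dots> \<le> (\<Sum>i\<in>UNIV. 2 * ?N * D1 (?p i) + 2 * (C3 * (D1 (?p i) + S (?p i))))"
    proof (rule sum_mono)
      fix i
      have "S (?q i) \<le> D1 (?p i)" unfolding D1_def by (rule member_le_sum) (auto intro: S_nonneg)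
      then have "2 * ?N * S (?q i) \<le> 2 * ?N * D1 (?p i)" by (intro mult_left_mono) auto
      then show "2 * ?N * S (?q i) + 2 * (\<integral>x. (?p i x * ?p i x) * w1 x \<partial>lborel) \<le> 2 * ?N * D1 (?p i) + 2 * (C3 * (D1 (?p i) + S (?p i)))"
        by (intro add_mono mult_left_mono C3(2)[OF t(1)]) auto
    qed
    also have "\<dots> = 2 * ?N * D2 f + 2 * C3 * (D2 f + D1 f)"
      unfolding D2_def D1_def[of f] by (simp add: sum.distrib sum_distrib_left algebra_simps)
    also have "\<dots> \<le> (2 * ?N + 2 * C3) * (D1 f + D2 f)"
      using D1_nonneg[of f] by (simp add: algebra_simps)
    finally show ?thesis .
  qed
  with C3(1) show ?thesis by (intro exI[of _ "2 * ?N + 2 * C3"]) auto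
qed

end

section \<open>The domain of the operator\<close>

lemma norm_sq_add_le:
  fixes a b :: "'b::real_normed_vector"
  shows "(norm (a + b))\<^sup>2 \<le> 2 * (norm a)\<^sup>2 + 2 * (norm b)\<^sup>2"
proof -
  have "(norm (a + b))\<^sup>2 \<le> (norm a + norm b)\<^sup>2" by (intro power_mono norm_triangle_ineq) auto
  then show ?thesis using sum_squares_bound[of "norm a" "norm b"] by (simp add: power2_sum)
qed

lemma norm_sq_diff_le:
  fixes a b :: "'b::real_normed_vector"
  shows "(norm (a - b))\<^sup>2 \<le> 2 * (norm a)\<^sup>2 + 2 * (norm b)\<^sup>2"
  using norm_sq_add_le[of a "-b"] by simp

text \<open>Serves in place of the Cauchy-Schwarz inequality: with \<open>d\<close> free it bounds
  an \<open>L^1\<close> quantity by a small constant plus a multiple of the squared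
  \<open>L^2\<close> norm.\<close>

lemma le_eps_square:
  fixes s d :: real
  assumes "s \<ge> 0" "d > 0"
  shows "s \<le> d + (1 / d) * s\<^sup>2"
proof (cases "s \<le> d")
  case True
  then show ?thesis using assms by (simp add: add_increasing2)
next
  case False
  then have "s * d \<le> s * s" using assms by (intro mult_left_mono) auto
  then have "s \<le> (1 / d) * s\<^sup>2" using assms by (simp add: power2_eq_square pos_le_divide_eq)
  then show ?thesis using assms by simp
qed

text \<open>On a finite measure a Cauchy sequence in \<open>L^2\<close> is Cauchy in
  \<open>L^1\<close>, hence has a subsequence converging almost everywhere; Fatou's lemma then
  carries the \<open>L^2\<close> bounds to the limit.\<close>

lemma L2_complete:
  fixes f :: "nat \<Rightarrow> 'a \<Rightarrow> 'b::{banach, second_countable_topology}"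
  assumes M: "finite_measure M"
    and f [measurable]: "\<And>n. f n \<in> borel_measurable M"
    and f2: "\<And>n. integrable M (\<lambda>x. (norm (f n x))\<^sup>2)"
    and cau: "\<And>e. e > 0 \<Longrightarrow> \<exists>N. \<forall>m\<ge>N. \<forall>n\<ge>N. (\<integral>x. (norm (f m x - f n x))\<^sup>2 \<partial>M) < e"
  shows "\<exists>g \<in> borel_measurable M. integrable M (\<lambda>x. (norm (g x))\<^sup>2) \<and>
    (\<lambda>n. \<integral>x. (norm (f n x - g x))\<^sup>2 \<partial>M) \<longlonglongrightarrow> 0"
proof -
  interpret finite_measure M by fact
  have ic: "integrable M (\<lambda>x. c)" for c :: real by simp
  have i1: "integrable M (f n)" for n
  proof (rule Bochner_Integration.integrable_bound)
    show "integrable M (\<lambda>x. 1 + 1 / 1 * (norm (f n x))\<^sup>2)"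
      using f2 by (intro Bochner_Integration.integrable_add ic) auto
    show "AE x in M. norm (f n x) \<le> norm (1 + 1 / 1 * (norm (f n x))\<^sup>2)"
    proof (rule AE_I2)
      fix x
      show "norm (f n x) \<le> norm (1 + 1 / 1 * (norm (f n x))\<^sup>2)"
        using le_eps_square[of "norm (f n x)" 1] by simp
    qed
  qed simp
  have id2: "integrable M (\<lambda>x. (norm (f m x - f n x))\<^sup>2)" for m n
  proof (rule Bochner_Integration.integrable_bound)
    show "integrable M (\<lambda>x. 2 * (norm (f m x))\<^sup>2 + 2 * (norm (f n x))\<^sup>2)"
      using f2 by (intro Bochner_Integration.integrable_add integrable_mult_right)
    show "AE x in M. norm ((norm (f m x - f n x))\<^sup>2) \<le> norm (2 * (norm (f m x))\<^sup>2 + 2 * (norm (f n x))\<^sup>2)"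
      using norm_sq_diff_le by (intro AE_I2) simp
  qed measurable
  have "\<exists>N. \<forall>i\<ge>N. \<forall>j\<ge>N. (\<integral>x. norm (f i x - f j x) \<partial>M) < e" if e: "e > 0" for e
  proof -
    let ?m = "measure M (space M)"
    \<comment> \<open>Then \<open>d\<close> times the total mass is at most \<open>e / 2\<close>,
      and the tolerance \<open>d e / 2\<close> for the squares makes the other part less than
      \<open>e / 2\<close> after division by \<open>d\<close>.\<close>
    define d where "d = e / (2 * (?m + 1))"
    have m0: "?m \<ge> 0" by simp
    have d: "d > 0" using e m0 by (simp add: d_def add_nonneg_pos)
    have dm: "d * ?m \<le> e / 2"
    proof -
      have "d * ?m = e / 2 * (?m / (?m + 1))" by (simp add: d_def)
      also have "\<dots> \<le> e / 2 * 1"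
      proof (rule mult_left_mono)
        have "a / (a + 1) \<le> 1" if "a \<ge> 0" for a :: real using that by simp
        from this[OF m0] show "?m / (?m + 1) \<le> 1" .
      qed (use e in simp)
      finally show ?thesis by simp
    qed
    obtain N where N: "\<forall>m\<ge>N. \<forall>n\<ge>N. (\<integral>x. (norm (f m x - f n x))\<^sup>2 \<partial>M) < d * (e / 2)"
      using cau[of "d * (e / 2)"] d e by auto
    have "(\<integral>x. norm (f i x - f j x) \<partial>M) < e" if "i \<ge> N" "j \<ge> N" for i j
    proof -
      have "(\<integral>x. norm (f i x - f j x) \<partial>M) \<le> (\<integral>x. d + (1 / d) * (norm (f i x - f j x))\<^sup>2 \<partial>M)"
        using i1 id2 d by (intro integral_mono le_eps_square Bochner_Integration.integrable_add ic) auto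
      also have "\<dots> = d * ?m + (1 / d) * (\<integral>x. (norm (f i x - f j x))\<^sup>2 \<partial>M)"
        using id2[of i j] by (simp add: mult.commute)
      also have "(1 / d) * (\<integral>x. (norm (f i x - f j x))\<^sup>2 \<partial>M) < (1 / d) * (d * (e / 2))"
        using N that d by (intro mult_strict_left_mono) auto
      also have "\<dots> = e / 2" using d by simp
      finally show ?thesis using dm by simp
    qed
    then show ?thesis by blast
  qed
  from cauchy_L1_AE_cauchy_subseq[OF i1 this] obtain r where
    r: "strict_mono r" "AE x in M. Cauchy (\<lambda>i. f (r i) x)" by blast
  define g where "g x = lim (\<lambda>i. f (r i) x)" for x
  have g [measurable]: "g \<in> borel_measurable M" unfolding g_def by measurable
  have gl: "AE x in M. (\<lambda>i. f (r i) x) \<longlonglongrightarrow> g x"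
    using r(2) by eventually_elim (simp add: g_def Cauchy_convergent_iff convergent_LIMSEQ_iff)
  have key: "\<exists>N. \<forall>n\<ge>N. (\<integral>\<^sup>+x. ennreal ((norm (f n x - g x))\<^sup>2) \<partial>M) \<le> ennreal e" if e: "e > 0" for e
  proof -
    obtain N where N: "\<forall>m\<ge>N. \<forall>n\<ge>N. (\<integral>x. (norm (f m x - f n x))\<^sup>2 \<partial>M) < e" using cau e by blast
    have "(\<integral>\<^sup>+x. ennreal ((norm (f n x - g x))\<^sup>2) \<partial>M) \<le> ennreal e" if n: "n \<ge> N" for n
    proof -
      have "(\<integral>\<^sup>+x. ennreal ((norm (f n x - g x))\<^sup>2) \<partial>M) =
        (\<integral>\<^sup>+x. liminf (\<lambda>k. ennreal ((norm (f n x - f (r k) x))\<^sup>2)) \<partial>M)"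
      proof (rule nn_integral_cong_AE)
        show "AE x in M. ennreal ((norm (f n x - g x))\<^sup>2) = liminf (\<lambda>k. ennreal ((norm (f n x - f (r k) x))\<^sup>2))"
          using gl
        proof eventually_elim
          case (elim x)
          have "(\<lambda>k. ennreal ((norm (f n x - f (r k) x))\<^sup>2)) \<longlonglongrightarrow> ennreal ((norm (f n x - g x))\<^sup>2)"
            by (intro tendsto_ennrealI tendsto_power tendsto_norm tendsto_diff tendsto_const elim)
          from lim_imp_Liminf[OF trivial_limit_sequentially this] show ?case by simp
        qed
      qed
      also have "\<dots> \<le> liminf (\<lambda>k. \<integral>\<^sup>+x. ennreal ((norm (f n x - f (r k) x))\<^sup>2) \<partial>M)"
        by (rule nn_integral_liminf) measurable
      also have "\<dots> \<le> liminf (\<lambda>k::nat. ennreal e)"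
      proof (rule Liminf_mono)
        show "\<forall>\<^sub>F k in sequentially. (\<integral>\<^sup>+x. ennreal ((norm (f n x - f (r k) x))\<^sup>2) \<partial>M) \<le> ennreal e"
          unfolding eventually_sequentially
        proof (intro exI[of _ N] allI impI)
          fix k assume "k \<ge> N"
          then have "r k \<ge> N" using seq_suble[OF r(1), of k] by simp
          then have "(\<integral>x. (norm (f n x - f (r k) x))\<^sup>2 \<partial>M) < e" using N n by blast
          then show "(\<integral>\<^sup>+x. ennreal ((norm (f n x - f (r k) x))\<^sup>2) \<partial>M) \<le> ennreal e"
            using nn_integral_eq_integral[OF id2[of n "r k"]] by (simp add: ennreal_leI)
        qed
      qed
      also have "\<dots> = ennreal e" by (simp add: Liminf_const)
      finally show ?thesis .
    qed
    then show ?thesis by blast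
  qed
  have key2: "\<exists>N. \<forall>n\<ge>N. integrable M (\<lambda>x. (norm (f n x - g x))\<^sup>2) \<and> (\<integral>x. (norm (f n x - g x))\<^sup>2 \<partial>M) \<le> e" if e: "e > 0" for e
  proof -
    obtain N where N: "\<forall>n\<ge>N. (\<integral>\<^sup>+x. ennreal ((norm (f n x - g x))\<^sup>2) \<partial>M) \<le> ennreal e" using key[OF e] by blast
    have "integrable M (\<lambda>x. (norm (f n x - g x))\<^sup>2) \<and> (\<integral>x. (norm (f n x - g x))\<^sup>2 \<partial>M) \<le> e" if "n \<ge> N" for n
    proof
      have le: "(\<integral>\<^sup>+x. ennreal ((norm (f n x - g x))\<^sup>2) \<partial>M) \<le> ennreal e" using N that by blast
      show i: "integrable M (\<lambda>x. (norm (f n x - g x))\<^sup>2)"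
        by (rule integrableI_nonneg) (auto intro: le_less_trans[OF le])
      have "ennreal (\<integral>x. (norm (f n x - g x))\<^sup>2 \<partial>M) \<le> ennreal e"
        using le nn_integral_eq_integral[OF i] by simp
      then show "(\<integral>x. (norm (f n x - g x))\<^sup>2 \<partial>M) \<le> e" using e by (simp add: ennreal_le_iff)
    qed
    then show ?thesis by blast
  qed
  have ig: "integrable M (\<lambda>x. (norm (g x))\<^sup>2)"
  proof -
    obtain n where n: "integrable M (\<lambda>x. (norm (f n x - g x))\<^sup>2)" using key2[of 1] by auto
    show ?thesis
    proof (rule Bochner_Integration.integrable_bound)
      show "integrable M (\<lambda>x. 2 * (norm (f n x))\<^sup>2 + 2 * (norm (f n x - g x))\<^sup>2)"
        using f2 n by (intro Bochner_Integration.integrable_add integrable_mult_right)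
      show "AE x in M. norm ((norm (g x))\<^sup>2) \<le> norm (2 * (norm (f n x))\<^sup>2 + 2 * (norm (f n x - g x))\<^sup>2)"
      proof (rule AE_I2)
        fix x
        show "norm ((norm (g x))\<^sup>2) \<le> norm (2 * (norm (f n x))\<^sup>2 + 2 * (norm (f n x - g x))\<^sup>2)"
          using norm_sq_diff_le[of "f n x" "f n x - g x"] by simp
      qed
    qed measurable
  qed
  have "(\<lambda>n. \<integral>x. (norm (f n x - g x))\<^sup>2 \<partial>M) \<longlonglongrightarrow> 0"
  proof (rule tendsto_zero_le_eps[where C=1])
    fix e :: real assume "e > 0"
    then show "\<forall>\<^sub>F n in sequentially. (\<integral>x. (norm (f n x - g x))\<^sup>2 \<partial>M) \<le> 1 * e"
      using key2[of e] by (auto simp: eventually_sequentially)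
  qed (auto intro: Bochner_Integration.integral_nonneg)
  with ig g show ?thesis by blast
qed

subsection \<open>Calculus of weak derivatives\<close>

lemma partials_diff:
  assumes "smooth f" "smooth g"
  shows "partials is (\<lambda>x. f x - g x) = (\<lambda>x. partials is f x - partials is g x)"
proof (induction "is")
  case (Cons i "is")
  show ?case unfolding partials_Cons Cons.IH
    by (simp add: fun_eq_iff partial_diff smooth_differentiable smooth_partials assms)
qed simp

lemma partials_linear:
  assumes "bounded_linear T" "smooth f"
  shows "partials is (\<lambda>x. T (f x)) = (\<lambda>x. T (partials is f x))"
proof (induction "is")
  case (Cons i "is")
  show ?case unfolding partials_Cons Cons.IH
    by (simp add: fun_eq_iff partial_linear[OF assms(1)] smooth_differentiable smooth_partials assms)
qed simp

lemma partials_scale: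
  fixes f :: "real ^ 'n \<Rightarrow> real"
  assumes "smooth f"
  shows "partials is (\<lambda>x. f (c *\<^sub>R x)) = (\<lambda>x. c ^ length is * partials is f (c *\<^sub>R x))"
  using partials_affine[OF assms, of "is" c 0] by simp

text \<open>Integration by parts removes the head of the list from \<open>\<phi>\<close> first, so
  on \<open>w\<close> the head becomes the innermost derivative; hence the reversal.\<close>

lemma smooth_has_weak_deriv:
  fixes w :: "real ^ 'n \<Rightarrow> 'b::{banach, second_countable_topology}"
  assumes "smooth w"
  shows "has_weak_deriv is w (partials (rev is) w)"
proof -
  have "(\<integral>x. partials is \<phi> x *\<^sub>R w x \<partial>lborel) = (-1) ^ length is *\<^sub>R (\<integral>x. \<phi> x *\<^sub>R partials (rev is) w x \<partial>lborel)"
    if \<phi>: "\<phi> \<in> test_functions" and w: "smooth w" for \<phi> :: "real^'n \<Rightarrow> real" and w :: "real ^ 'n \<Rightarrow> 'b"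
    using w
  proof (induction "is" arbitrary: w)
    case (Cons i js)
    have "(\<integral>x. partials (i # js) \<phi> x *\<^sub>R w x \<partial>lborel) = - (\<integral>x. partials js \<phi> x *\<^sub>R partial i w x \<partial>lborel)"
      unfolding partials_Cons by (rule integral_by_parts_test[OF test_partials[OF \<phi>] Cons.prems])
    also have "\<dots> = - ((-1) ^ length js *\<^sub>R (\<integral>x. \<phi> x *\<^sub>R partials (rev js) (partial i w) x \<partial>lborel))"
      using Cons.IH[OF smooth_partial[OF Cons.prems]] by simp
    finally show ?case by (simp add: partials_append partials_Cons)
  qed simp
  with assms show ?thesis
    by (auto simp: has_weak_deriv_def intro: smooth_L1_loc smooth_partials)
qed

lemma has_weak_deriv_compose:
  assumes "has_weak_deriv [i] u w" "has_weak_deriv [j] w v"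
  shows "has_weak_deriv [i, j] u v"
  unfolding has_weak_deriv_def
proof (intro conjI allI impI)
  fix \<phi> :: "real^'a \<Rightarrow> real" assume \<phi>: "\<phi> \<in> test_functions"
  have "(\<integral>x. partial i (partial j \<phi>) x *\<^sub>R u x \<partial>lborel) = - (\<integral>x. partial j \<phi> x *\<^sub>R w x \<partial>lborel)"
    using assms(1) test_partial[OF \<phi>] unfolding has_weak_deriv_1 by blast
  also have "(\<integral>x. partial j \<phi> x *\<^sub>R w x \<partial>lborel) = - (\<integral>x. \<phi> x *\<^sub>R v x \<partial>lborel)"
    using assms(2) \<phi> unfolding has_weak_deriv_1 by blast
  finally show "(\<integral>x. partials [i, j] \<phi> x *\<^sub>R u x \<partial>lborel) = (- 1) ^ length [i, j] *\<^sub>R (\<integral>x. \<phi> x *\<^sub>R v x \<partial>lborel)"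
    by (simp add: partials_Cons)
qed (use assms in \<open>auto simp: has_weak_deriv_def\<close>)

lemma has_weak_deriv_add:
  assumes "has_weak_deriv is u v" "has_weak_deriv is u' v'"
  shows "has_weak_deriv is (\<lambda>x. u x + u' x) (\<lambda>x. v x + v' x)"
  unfolding has_weak_deriv_def
proof (intro conjI allI impI)
  have l: "u \<in> Lp_loc 1" "v \<in> Lp_loc 1" "u' \<in> Lp_loc 1" "v' \<in> Lp_loc 1"
    using assms by (auto simp: has_weak_deriv_def)
  then show "(\<lambda>x. u x + u' x) \<in> Lp_loc 1" "(\<lambda>x. v x + v' x) \<in> Lp_loc 1" by (intro L1_loc_add; simp)+
  fix \<phi> :: "real^'a \<Rightarrow> real" assume \<phi>: "\<phi> \<in> test_functions"
  show "(\<integral>x. partials is \<phi> x *\<^sub>R (u x + u' x) \<partial>lborel) = (- 1) ^ length is *\<^sub>R (\<integral>x. \<phi> x *\<^sub>R (v x + v' x) \<partial>lborel)"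
    using l has_weak_derivD[OF assms(1) \<phi>] has_weak_derivD[OF assms(2) \<phi>]
    by (simp add: scaleR_add_right integrable_test \<phi> test_partials[OF \<phi>])
qed

lemma has_weak_deriv_mult:
  fixes \<eta> :: "real ^ 'n \<Rightarrow> real"
  assumes u: "has_weak_deriv [i] u w" and \<eta>: "smooth \<eta>"
  shows "has_weak_deriv [i] (\<lambda>x. \<eta> x *\<^sub>R u x) (\<lambda>x. partial i \<eta> x *\<^sub>R u x + \<eta> x *\<^sub>R w x)"
  unfolding has_weak_deriv_1
proof (intro conjI allI impI)
  have l: "u \<in> Lp_loc 1" "w \<in> Lp_loc 1" using u by (auto simp: has_weak_deriv_def)
  have s: "(\<lambda>x. partial i \<eta> x *\<^sub>R u x) \<in> Lp_loc 1" "(\<lambda>x. \<eta> x *\<^sub>R w x) \<in> Lp_loc 1"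
    by (intro smooth_mult_L1_loc smooth_partial \<eta> l)+
  show "(\<lambda>x. \<eta> x *\<^sub>R u x) \<in> Lp_loc 1" by (intro smooth_mult_L1_loc \<eta> l)
  show "(\<lambda>x. partial i \<eta> x *\<^sub>R u x + \<eta> x *\<^sub>R w x) \<in> Lp_loc 1" by (intro L1_loc_add s)
  fix \<phi> :: "real^'n \<Rightarrow> real" assume \<phi>: "\<phi> \<in> test_functions"
  have t: "(\<lambda>x. partial i \<phi> x * \<eta> x) \<in> test_functions" "(\<lambda>x. \<phi> x * partial i \<eta> x) \<in> test_functions"
    by (intro test_mult test_partial \<phi> \<eta> smooth_partial)+
  have "(\<integral>x. partial i (\<lambda>x. \<phi> x * \<eta> x) x *\<^sub>R u x \<partial>lborel) = - (\<integral>x. (\<phi> x * \<eta> x) *\<^sub>R w x \<partial>lborel)"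
    using u test_mult[OF \<phi> \<eta>] unfolding has_weak_deriv_1 by blast
  moreover have "(\<integral>x. partial i (\<lambda>x. \<phi> x * \<eta> x) x *\<^sub>R u x \<partial>lborel) =
     (\<integral>x. (partial i \<phi> x * \<eta> x) *\<^sub>R u x \<partial>lborel) + (\<integral>x. (\<phi> x * partial i \<eta> x) *\<^sub>R u x \<partial>lborel)"
    using integrable_test[OF t(1) l(1)] integrable_test[OF t(2) l(1)]
    by (simp add: partial_mult[OF test_differentiable[OF \<phi>] smooth_differentiable[OF \<eta>]] scaleR_add_left)
  moreover have "(\<integral>x. \<phi> x *\<^sub>R (partial i \<eta> x *\<^sub>R u x + \<eta> x *\<^sub>R w x) \<partial>lborel) =
     (\<integral>x. (\<phi> x * partial i \<eta> x) *\<^sub>R u x \<partial>lborel) + (\<integral>x. (\<phi> x * \<eta> x) *\<^sub>R w x \<partial>lborel)"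
    using integrable_test[OF \<phi> s(1)] integrable_test[OF \<phi> s(2)] by (simp add: scaleR_add_right)
  ultimately show "(\<integral>x. partial i \<phi> x *\<^sub>R (\<eta> x *\<^sub>R u x) \<partial>lborel) = - (\<integral>x. \<phi> x *\<^sub>R (partial i \<eta> x *\<^sub>R u x + \<eta> x *\<^sub>R w x) \<partial>lborel)"
    by (simp add: algebra_simps)
qed

definition cutoffs :: "nat \<Rightarrow> real ^ 'n \<Rightarrow> real"
  where "cutoffs m x = cutoff (inverse (real (Suc m)) *\<^sub>R x)"

text \<open>Scaling by \<open>1 / (m + 1)\<close> multiplies a derivative of order \<open>l\<close>
  by \<open>(m + 1)^(-l) \<le> 1\<close>, whence bounds uniform in \<open>m\<close>. Near a fixed
  point the function is eventually the constant 1, so its derivatives there are eventually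
  0.\<close>

lemma cutoffs:
  fixes x :: "real ^ 'n"
  shows "smooth (cutoffs m :: real ^ 'n \<Rightarrow> real)"
    "norm x > 2 * real (Suc m) \<Longrightarrow> partials is (cutoffs m) x = 0"
    "\<exists>C. \<forall>m x. \<bar>partials is (cutoffs m) (x :: real ^ 'n)\<bar> \<le> C"
    "(\<lambda>m. partials is (cutoffs m) x) \<longlonglongrightarrow> (if is = [] then 1 else 0)"
proof -
  have e: "cutoffs m = (\<lambda>x::real^'n. cutoff (inverse (real (Suc m)) *\<^sub>R x))" for m by (simp add: cutoffs_def fun_eq_iff)
  show "smooth (cutoffs m :: real ^ 'n \<Rightarrow> real)" for m
    using smooth_affine[OF cutoff(1), of "inverse (real (Suc m))" 0] by (simp add: e)
  show "partials is (cutoffs m) x = 0" if "norm x > 2 * real (Suc m)"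
  proof (rule partials_zero_outside[OF _ that])
    fix y :: "real^'n" assume "norm y > 2 * real (Suc m)"
    then show "cutoffs m y = 0" unfolding cutoffs_def by (intro cutoff(5)) (simp add: field_simps)
  qed
  have ct: "(cutoff :: real^'n \<Rightarrow> real) \<in> test_functions"
    by (rule testI[of _ 2]) (auto simp: cutoff)
  obtain C where C: "C \<ge> 0" "\<And>x::real^'n. norm (partials is cutoff x) \<le> C"
    using test_bounded[OF test_partials[OF ct]] by metis
  have "\<bar>partials is (cutoffs m) x\<bar> \<le> C" for m and x :: "real^'n"
  proof -
    have "\<bar>inverse (real (Suc m)) ^ length is\<bar> \<le> 1" by (simp add: power_le_one field_simps)
    then have "\<bar>inverse (real (Suc m)) ^ length is\<bar> * \<bar>partials is cutoff (inverse (real (Suc m)) *\<^sub>R x)\<bar> \<le> 1 * C"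
      using C by (intro mult_mono) auto
    then show ?thesis by (simp only: e partials_scale[OF cutoff(1)] abs_mult)
  qed
  then show "\<exists>C. \<forall>m x. \<bar>partials is (cutoffs m) (x :: real ^ 'n)\<bar> \<le> C" by blast
  obtain n where n: "norm x < real n" using reals_Archimedean2 by blast
  have "partials is (cutoffs m) x = (if is = [] then 1 else 0)" if "m \<ge> n" for m
  proof -
    have "partials is (cutoffs m) x = partials is (\<lambda>x. 1) x"
    proof (rule partials_cong_open[of "ball 0 (real (Suc m))"])
      show "x \<in> ball 0 (real (Suc m))" using n that by simp
      fix y :: "real^'n" assume "y \<in> ball 0 (real (Suc m))"
      then show "cutoffs m y = 1" unfolding cutoffs_def by (intro cutoff(4)) (simp add: field_simps)
    qed simp
    also have "\<dots> = (if is = [] then 1 else 0)"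
      by (cases "is" rule: rev_cases) (simp_all add: partials_append partials_Cons partials_zero)
    finally show ?thesis .
  qed
  then show "(\<lambda>m. partials is (cutoffs m) x) \<longlonglongrightarrow> (if is = [] then 1 else 0)"
    by (intro tendsto_eventually eventually_sequentiallyI)
qed

locale kolmogorov_operator = kolmogorov_weight \<mu> G H B Lap
  for \<mu> :: "real ^ 'n \<Rightarrow> real" and G :: "'n \<Rightarrow> real ^ 'n \<Rightarrow> real" and H B Lap +
  assumes prob: "prob_space (weighted \<mu>)"
begin

section \<open>The weighted space \<open>L2_mu\<close> and its squared norm\<close>

abbreviation M :: "(real ^ 'n) measure" where "M \<equiv> weighted \<mu>"

lemma measurable_M: "borel_measurable M = borel_measurable borel"
  by (rule measurable_cong_sets) (simp_all add: weighted_def)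

lemma mu_nonneg: "AE x in lborel. 0 \<le> \<mu> x"
  using mu_pos by eventually_elim simp

lemma M_integral:
  fixes g :: "real ^ 'n \<Rightarrow> real"
  assumes [measurable]: "g \<in> borel_measurable borel"
  shows "integrable M g \<longleftrightarrow> integrable lborel (\<lambda>x. g x * \<mu> x)"
    "(\<integral>x. g x \<partial>M) = (\<integral>x. g x * \<mu> x \<partial>lborel)"
proof -
  show "integrable M g \<longleftrightarrow> integrable lborel (\<lambda>x. g x * \<mu> x)"
    unfolding weighted_def by (subst integrable_density) (use mu_nonneg in \<open>simp_all add: mult.commute\<close>)
  show "(\<integral>x. g x \<partial>M) = (\<integral>x. g x * \<mu> x \<partial>lborel)"
    unfolding weighted_def by (subst integral_density) (use mu_nonneg in \<open>simp_all add: mult.commute\<close>)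
qed

text \<open>The norm is kept squared. The triangle inequality then holds with a factor 2, which is
  harmless for convergence to 0 and for Cauchy sequences.\<close>

definition N2 :: "(real ^ 'n \<Rightarrow> complex) \<Rightarrow> real"
  where "N2 u = (\<integral>x. (norm (u x))\<^sup>2 \<partial>M)"

lemma N2_nonneg: "N2 u \<ge> 0"
  unfolding N2_def by (rule Bochner_Integration.integral_nonneg) simp

lemma L2_mu_iff: "u \<in> L2_mu \<mu> \<longleftrightarrow> u \<in> borel_measurable borel \<and> integrable M (\<lambda>x. (norm (u x))\<^sup>2)"
  by (simp add: L2_mu_def)

lemma L2_mu_measurable [measurable_dest]: "u \<in> L2_mu \<mu> \<Longrightarrow> u \<in> borel_measurable borel"
  by (simp add: L2_mu_def)

lemma L2_mu_bound:
  assumes u: "u \<in> L2_mu \<mu>" and [measurable]: "v \<in> borel_measurable borel"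
    and b: "\<And>x. norm (v x) \<le> C * norm (u x)"
  shows "v \<in> L2_mu \<mu>"
  unfolding L2_mu_iff
proof
  have m: "(\<lambda>x. (norm (v x))\<^sup>2) \<in> borel_measurable M" unfolding measurable_M by measurable
  have "integrable M (\<lambda>x. C\<^sup>2 * (norm (u x))\<^sup>2)" using u by (simp add: L2_mu_iff)
  then show "integrable M (\<lambda>x. (norm (v x))\<^sup>2)"
  proof (rule Bochner_Integration.integrable_bound[OF _ m])
    have "(norm (v x))\<^sup>2 \<le> C\<^sup>2 * (norm (u x))\<^sup>2" for x
      using power_mono[OF b[of x] norm_ge_zero, of 2] by (simp add: power_mult_distrib)
    then show "AE x in M. norm ((norm (v x))\<^sup>2) \<le> norm (C\<^sup>2 * (norm (u x))\<^sup>2)" by simp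
  qed
qed fact

lemma L2_mu_add:
  assumes u: "u \<in> L2_mu \<mu>" and v: "v \<in> L2_mu \<mu>"
  shows "(\<lambda>x. u x + v x) \<in> L2_mu \<mu>" "N2 (\<lambda>x. u x + v x) \<le> 2 * N2 u + 2 * N2 v"
proof -
  have [measurable]: "u \<in> borel_measurable borel" "v \<in> borel_measurable borel"
    using u v by (auto simp: L2_mu_iff)
  have i: "integrable M (\<lambda>x. (norm (u x))\<^sup>2)" "integrable M (\<lambda>x. (norm (v x))\<^sup>2)"
    using u v by (auto simp: L2_mu_iff)
  have rhs: "integrable M (\<lambda>x. 2 * (norm (u x))\<^sup>2 + 2 * (norm (v x))\<^sup>2)"
    using i by (intro Bochner_Integration.integrable_add integrable_mult_right)
  have m: "(\<lambda>x. (norm (u x + v x))\<^sup>2) \<in> borel_measurable M" unfolding measurable_M by measurable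
  have ii: "integrable M (\<lambda>x. (norm (u x + v x))\<^sup>2)"
    by (rule Bochner_Integration.integrable_bound[OF rhs m]) (use norm_sq_add_le in \<open>auto intro!: AE_I2\<close>)
  then show "(\<lambda>x. u x + v x) \<in> L2_mu \<mu>" unfolding L2_mu_iff by (intro conjI) measurable
  have "N2 (\<lambda>x. u x + v x) \<le> (\<integral>x. 2 * (norm (u x))\<^sup>2 + 2 * (norm (v x))\<^sup>2 \<partial>M)"
    unfolding N2_def by (rule integral_mono[OF ii rhs norm_sq_add_le])
  then show "N2 (\<lambda>x. u x + v x) \<le> 2 * N2 u + 2 * N2 v" using i by (simp add: N2_def)
qed

lemma L2_mu_scaleR: "u \<in> L2_mu \<mu> \<Longrightarrow> (\<lambda>x. (c::real) *\<^sub>R u x) \<in> L2_mu \<mu>"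
  by (rule L2_mu_bound[where u=u and C="\<bar>c\<bar>"]) auto

lemma L2_mu_diff:
  assumes u: "u \<in> L2_mu \<mu>" and v: "v \<in> L2_mu \<mu>"
  shows "(\<lambda>x. u x - v x) \<in> L2_mu \<mu>" "N2 (\<lambda>x. u x - v x) \<le> 2 * N2 u + 2 * N2 v"
  using L2_mu_add[OF u L2_mu_scaleR[OF v, of "-1"]] by (simp_all add: N2_def)

lemma N2_triangle:
  assumes "u \<in> L2_mu \<mu>" "v \<in> L2_mu \<mu>" "w \<in> L2_mu \<mu>"
  shows "N2 (\<lambda>x. u x - w x) \<le> 2 * N2 (\<lambda>x. u x - v x) + 2 * N2 (\<lambda>x. v x - w x)"
  using L2_mu_add(2)[OF L2_mu_diff(1)[OF assms(1,2)] L2_mu_diff(1)[OF assms(2,3)]] by simp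

lemma N2_commute: "N2 (\<lambda>x. u x - v x) = N2 (\<lambda>x. v x - u x)"
  by (simp add: N2_def norm_minus_commute)

lemma L2_tendsto_iff:
  "L2_tendsto \<mu> f u \<longleftrightarrow> (\<forall>n. f n \<in> L2_mu \<mu>) \<and> u \<in> L2_mu \<mu> \<and> (\<lambda>n. N2 (\<lambda>x. f n x - u x)) \<longlonglongrightarrow> 0"
  by (simp add: L2_tendsto_def N2_def)

lemma L2_tendsto_add:
  assumes "L2_tendsto \<mu> f u" "L2_tendsto \<mu> g v"
  shows "L2_tendsto \<mu> (\<lambda>n x. f n x + g n x) (\<lambda>x. u x + v x)"
  unfolding L2_tendsto_iff
proof (intro conjI allI)
  have l: "f n \<in> L2_mu \<mu>" "u \<in> L2_mu \<mu>" "g n \<in> L2_mu \<mu>" "v \<in> L2_mu \<mu>" for n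
    using assms by (auto simp: L2_tendsto_iff)
  have t: "(\<lambda>n. N2 (\<lambda>x. f n x - u x)) \<longlonglongrightarrow> 0" "(\<lambda>n. N2 (\<lambda>x. g n x - v x)) \<longlonglongrightarrow> 0"
    using assms by (auto simp: L2_tendsto_iff)
  show "(\<lambda>x. f n x + g n x) \<in> L2_mu \<mu>" "(\<lambda>x. u x + v x) \<in> L2_mu \<mu>" for n by (intro L2_mu_add l)+
  have le: "N2 (\<lambda>x. f n x + g n x - (u x + v x)) \<le> 2 * N2 (\<lambda>x. f n x - u x) + 2 * N2 (\<lambda>x. g n x - v x)" for n
    using L2_mu_add(2)[OF L2_mu_diff(1)[OF l(1,2)] L2_mu_diff(1)[OF l(3,4)], of n n] by (simp add: algebra_simps)
  have "(\<lambda>n. 2 * N2 (\<lambda>x. f n x - u x) + 2 * N2 (\<lambda>x. g n x - v x)) \<longlonglongrightarrow> 2 * 0 + 2 * 0"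
    by (intro tendsto_intros t)
  then have z: "(\<lambda>n. 2 * N2 (\<lambda>x. f n x - u x) + 2 * N2 (\<lambda>x. g n x - v x)) \<longlonglongrightarrow> 0" by simp
  show "(\<lambda>n. N2 (\<lambda>x. f n x + g n x - (u x + v x))) \<longlonglongrightarrow> 0"
    by (rule tendsto_sandwich[OF _ _ tendsto_const z]) (auto intro!: always_eventually N2_nonneg le)
qed

lemma L2_mu_complete:
  assumes f: "\<And>n. f n \<in> L2_mu \<mu>"
    and cau: "\<And>e. e > 0 \<Longrightarrow> \<exists>N. \<forall>m\<ge>N. \<forall>n\<ge>N. N2 (\<lambda>x. f m x - f n x) < e"
  obtains g where "L2_tendsto \<mu> f g"
proof -
  have "\<exists>g \<in> borel_measurable M. integrable M (\<lambda>x. (norm (g x))\<^sup>2) \<and>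
    (\<lambda>n. \<integral>x. (norm (f n x - g x))\<^sup>2 \<partial>M) \<longlonglongrightarrow> 0"
    using f cau prob_space.finite_measure[OF prob]
    by (intro L2_complete) (auto simp: L2_mu_iff measurable_M N2_def)
  then obtain g where "g \<in> borel_measurable borel" "integrable M (\<lambda>x. (norm (g x))\<^sup>2)"
    "(\<lambda>n. \<integral>x. (norm (f n x - g x))\<^sup>2 \<partial>M) \<longlonglongrightarrow> 0" unfolding measurable_M by blast
  then have "L2_tendsto \<mu> f g" using f by (auto simp: L2_tendsto_iff L2_mu_iff N2_def)
  with that show ?thesis by blast
qed

text \<open>The form in which a linear a priori estimate, applied to differences of an approximating
  sequence, yields a Cauchy sequence.\<close>

lemma tendsto_zero_Cauchy:
  fixes a :: "nat \<Rightarrow> real" and d :: "nat \<Rightarrow> nat \<Rightarrow> real"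
  assumes a: "a \<longlonglongrightarrow> 0" and d: "\<And>m n. d m n \<le> C * (a m + a n)" and e: "e > 0" and C: "C \<ge> 0"
  shows "\<exists>N. \<forall>m\<ge>N. \<forall>n\<ge>N. d m n < e"
proof -
  have "\<forall>\<^sub>F n in sequentially. a n < e / (2 * (C + 1))"
    using a e C by (intro order_tendstoD(2)) auto
  then obtain N where N: "\<And>n. n \<ge> N \<Longrightarrow> a n < e / (2 * (C + 1))" by (auto simp: eventually_sequentially)
  have "d m n < e" if "m \<ge> N" "n \<ge> N" for m n
  proof -
    have "a m + a n \<le> e / (C + 1)" using N[OF that(1)] N[OF that(2)] C by (simp add: field_simps)
    then have "C * (a m + a n) \<le> C * (e / (C + 1))" using C by (intro mult_left_mono)
    also have "\<dots> < e" using C e by (simp add: field_simps)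
    finally show ?thesis using d[of m n] by simp
  qed
  then show ?thesis by blast
qed

subsection \<open>Test functions and the operator\<close>

text \<open>The operator \<open>L_test\<close> written with the representatives \<open>G\<close> of
  the locale; the two agree once \<open>G i\<close> is \<open>weak_deriv [i] \<mu>\<close>.\<close>

definition Lc :: "(real ^ 'n \<Rightarrow> complex) \<Rightarrow> real ^ 'n \<Rightarrow> complex"
  where "Lc f x = laplacian f x + (\<Sum>i\<in>UNIV. (G i x / \<mu> x) *\<^sub>R partial i f x)"

lemma norm_sq_complex: "(norm z)\<^sup>2 = Re z * Re z + Im z * Im z"
  unfolding cmod_power2 by (simp add: power2_eq_square)

text \<open>The coefficients of the operator are real, so it acts separately on real and imaginary
  parts; the squared norms add, and the real estimates carry over.\<close>

lemma test_Re_Im: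
  fixes f :: "real ^ 'n \<Rightarrow> complex"
  assumes f: "f \<in> test_functions"
  shows "(\<lambda>x. Re (f x)) \<in> test_functions" "(\<lambda>x. Im (f x)) \<in> test_functions"
    "partials is (\<lambda>x. Re (f x)) = (\<lambda>x. Re (partials is f x))"
    "partials is (\<lambda>x. Im (f x)) = (\<lambda>x. Im (partials is f x))"
    "Re (Lc f x) = Lr (\<lambda>x. Re (f x)) x" "Im (Lc f x) = Lr (\<lambda>x. Im (f x)) x"
proof -
  show "(\<lambda>x. Re (f x)) \<in> test_functions" "(\<lambda>x. Im (f x)) \<in> test_functions"
    by (rule test_linear[OF bounded_linear_Re f], rule test_linear[OF bounded_linear_Im f])
  show r: "partials is (\<lambda>x. Re (f x)) = (\<lambda>x. Re (partials is f x))" for "is"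
    by (rule partials_linear[OF bounded_linear_Re test_smooth[OF f]])
  show i: "partials is (\<lambda>x. Im (f x)) = (\<lambda>x. Im (partials is f x))" for "is"
    by (rule partials_linear[OF bounded_linear_Im test_smooth[OF f]])
  show "Re (Lc f x) = Lr (\<lambda>x. Re (f x)) x"
    using r[of "[i, i]" for i] r[of "[i]" for i]
    by (simp add: Lc_def Lr_def laplacian_def partials_Cons sum.distrib)
  show "Im (Lc f x) = Lr (\<lambda>x. Im (f x)) x"
    using i[of "[i, i]" for i] i[of "[i]" for i]
    by (simp add: Lc_def Lr_def laplacian_def partials_Cons sum.distrib)
qed

lemma test_N2:
  assumes f: "f \<in> test_functions"
  shows "f \<in> L2_mu \<mu>" "N2 f = S (\<lambda>x. Re (f x)) + S (\<lambda>x. Im (f x))"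
proof -
  have [measurable]: "f \<in> borel_measurable borel" using f by (rule test_measurable)
  note t = test_Re_Im(1,2)[OF f]
  have i: "integrable lborel (\<lambda>x. (Re (f x) * Re (f x)) * \<mu> x)" "integrable lborel (\<lambda>x. (Im (f x) * Im (f x)) * \<mu> x)"
    by (intro integrable_test_mult test_mult t test_smooth mu_L1)+
  have m: "(\<lambda>x. (norm (f x))\<^sup>2) \<in> borel_measurable borel" by measurable
  have e: "(norm (f x))\<^sup>2 * \<mu> x = (Re (f x) * Re (f x)) * \<mu> x + (Im (f x) * Im (f x)) * \<mu> x" for x
    by (simp add: norm_sq_complex distrib_right)
  show "f \<in> L2_mu \<mu>" using i unfolding L2_mu_iff M_integral(1)[OF m] e by simp
  show "N2 f = S (\<lambda>x. Re (f x)) + S (\<lambda>x. Im (f x))"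
    unfolding N2_def M_integral(2)[OF m] e S_def using i by simp
qed

lemma Lc_N2:
  assumes f: "f \<in> test_functions"
  shows "Lc f \<in> L2_mu \<mu>" "N2 (Lc f) = EL (\<lambda>x. Re (f x)) + EL (\<lambda>x. Im (f x))"
proof -
  have "partial i f \<in> borel_measurable borel" "partial i (partial i f) \<in> borel_measurable borel" for i
    by (intro test_measurable test_partial f)+
  then have [measurable]: "Lc f \<in> borel_measurable borel"
    unfolding Lc_def laplacian_def partials_Cons partials_Nil by measurable
  note i = Lr_square(1)[OF test_Re_Im(1)[OF f]] Lr_square(1)[OF test_Re_Im(2)[OF f]]
  have m: "(\<lambda>x. (norm (Lc f x))\<^sup>2) \<in> borel_measurable borel" by measurable
  have e: "(norm (Lc f x))\<^sup>2 * \<mu> x = (Lr (\<lambda>x. Re (f x)) x)\<^sup>2 * \<mu> x + (Lr (\<lambda>x. Im (f x)) x)\<^sup>2 * \<mu> x" for x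
    by (simp add: cmod_power2 test_Re_Im(5,6)[OF f] distrib_right)
  show "Lc f \<in> L2_mu \<mu>" using i unfolding L2_mu_iff M_integral(1)[OF m] e by simp
  show "N2 (Lc f) = EL (\<lambda>x. Re (f x)) + EL (\<lambda>x. Im (f x))"
    unfolding N2_def M_integral(2)[OF m] e EL_def using i by simp
qed

lemma Lc_diff:
  assumes f: "f \<in> test_functions" and g: "g \<in> test_functions"
  shows "Lc (\<lambda>x. f x - g x) x = Lc f x - Lc g x"
  using partials_diff[OF test_smooth[OF f] test_smooth[OF g], of "[i, i]" for i]
    partials_diff[OF test_smooth[OF f] test_smooth[OF g], of "[i]" for i]
  by (simp add: Lc_def laplacian_def partials_Cons sum_subtractf scaleR_diff_right)

definition idx :: "'n list set" where "idx = {is. length is \<le> 2}"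

lemma finite_idx: "finite idx"
  using finite_lists_length_le[of "UNIV :: 'n set" 2] by (simp add: idx_def)

lemma idx_cases:
  assumes "is \<in> idx"
  obtains "is = []" | i where "is = [i]" | i j where "is = [i, j]"
proof -
  have "length is \<le> 2" using assms by (simp add: idx_def)
  then have "length is = 0 \<or> length is = 1 \<or> length is = 2" by linarith
  then show ?thesis using that by (auto simp: length_Suc_conv numeral_2_eq_2)
qed

lemma complex_second_order_estimate:
  "\<exists>C\<ge>0. \<forall>f\<in>test_functions. \<forall>is\<in>idx. N2 (partials is f) \<le> C * (N2 f + N2 (Lc f))"
proof -
  obtain C where C: "C \<ge> 0" "\<And>f. f \<in> test_functions \<Longrightarrow> D1 f + D2 f \<le> C * (S f + EL f)"
    using second_order_estimate by blast
  have r: "S (partials is h) \<le> (C + 1) * (S h + EL h)" if h: "h \<in> test_functions" and "is": "is \<in> idx" for h "is"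
  proof -
    have "S (partials is h) \<le> S h + (D1 h + D2 h)"
      using "is"
    proof (cases rule: idx_cases)
      case 1
      then show ?thesis using D1_nonneg[of h] D2_nonneg[of h] by simp
    next
      case (2 i)
      have "S (partial i h) \<le> D1 h" unfolding D1_def by (rule member_le_sum) (auto intro: S_nonneg)
      with 2 show ?thesis using S_nonneg[of h] D2_nonneg[of h] by (simp add: partials_Cons)
    next
      case (3 i j)
      have "S (partial i (partial j h)) \<le> D1 (partial j h)" unfolding D1_def by (rule member_le_sum) (auto intro: S_nonneg)
      also have "\<dots> \<le> D2 h" unfolding D2_def by (rule member_le_sum) (auto intro: D1_nonneg)
      finally show ?thesis using 3 S_nonneg[of h] D1_nonneg[of h] by (simp add: partials_Cons)
    qed
    also have "\<dots> \<le> S h + C * (S h + EL h)" using C(2)[OF h] by simp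
    also have "\<dots> \<le> (C + 1) * (S h + EL h)" using EL_nonneg[of h] by (simp add: algebra_simps)
    finally show ?thesis .
  qed
  have "N2 (partials is f) \<le> (C + 1) * (N2 f + N2 (Lc f))" if f: "f \<in> test_functions" and "is": "is \<in> idx" for f "is"
    using r[OF test_Re_Im(1)[OF f] "is"] r[OF test_Re_Im(2)[OF f] "is"]
    unfolding test_N2(2)[OF f] Lc_N2(2)[OF f] test_N2(2)[OF test_partials[OF f]] test_Re_Im(3,4)[OF f]
    by (simp add: algebra_simps)
  with C(1) show ?thesis by (intro exI[of _ "C + 1"]) auto
qed

lemma complex_operator_bound:
  "\<exists>C\<ge>0. \<forall>f\<in>test_functions. N2 (Lc f) \<le> C * (\<Sum>is\<in>idx. N2 (partials is f))"
proof -
  let ?N = "real CARD('n)"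
  obtain C where C: "C \<ge> 0" "\<And>f. f \<in> test_functions \<Longrightarrow> EL f \<le> C * (D1 f + D2 f)"
    using operator_bound by blast
  have r: "EL h \<le> C * (?N + ?N * ?N) * (\<Sum>is\<in>idx. S (partials is h))" if h: "h \<in> test_functions" for h
  proof -
    let ?T = "\<Sum>is\<in>idx. S (partials is h)"
    have le: "S (partials is h) \<le> ?T" if "is \<in> idx" for "is"
      by (rule member_le_sum[OF that _ finite_idx]) (rule S_nonneg)
    have "D1 h \<le> (\<Sum>i\<in>(UNIV::'n set). ?T)"
      unfolding D1_def
    proof (rule sum_mono)
      fix i
      show "S (partial i h) \<le> ?T" using le[of "[i]"] by (simp add: idx_def partials_Cons)
    qed
    moreover have "D2 h \<le> (\<Sum>j\<in>(UNIV::'n set). \<Sum>i\<in>(UNIV::'n set). ?T)"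
      unfolding D2_def D1_def
    proof (intro sum_mono)
      fix i j
      show "S (partial i (partial j h)) \<le> ?T" using le[of "[i, j]"] by (simp add: idx_def partials_Cons)
    qed
    ultimately have "D1 h + D2 h \<le> (?N + ?N * ?N) * ?T" by (simp add: algebra_simps)
    then have "C * (D1 h + D2 h) \<le> C * ((?N + ?N * ?N) * ?T)" using C(1) by (intro mult_left_mono)
    with C(2)[OF h] show ?thesis by (simp add: mult.assoc)
  qed
  have "N2 (Lc f) \<le> C * (?N + ?N * ?N) * (\<Sum>is\<in>idx. N2 (partials is f))" if f: "f \<in> test_functions" for f
    using r[OF test_Re_Im(1)[OF f]] r[OF test_Re_Im(2)[OF f]]
    unfolding Lc_N2(2)[OF f] test_N2(2)[OF test_partials[OF f]] test_Re_Im(3,4)[OF f] sum.distrib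
    by (simp add: distrib_left)
  with C(1) show ?thesis by (intro exI[of _ "C * (?N + ?N * ?N)"]) auto
qed

subsection \<open>Passage to the limit\<close>

text \<open>On a ball \<open>\<mu> \<ge> c > 0\<close>, so passing from the weighted to the Lebesgue
  integral of the square costs at most the factor \<open>1 / c\<close>.\<close>

lemma L2_mu_loc:
  assumes u: "u \<in> L2_mu \<mu>" shows "u \<in> Lp_loc 2"
  unfolding L2_loc_iff
proof (intro conjI allI)
  show [measurable]: "u \<in> borel_measurable borel" using u by (simp add: L2_mu_iff)
  fix R
  obtain c where c: "c > 0" "AE x in lborel. norm x \<le> R \<longrightarrow> c \<le> \<mu> x" using low by blast
  have "integrable lborel (\<lambda>x. (norm (u x))\<^sup>2 * \<mu> x)"
    using u M_integral(1)[of "\<lambda>x. (norm (u x))\<^sup>2"] by (simp add: L2_mu_iff)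
  then have "integrable lborel (\<lambda>x. (1 / c) * ((norm (u x))\<^sup>2 * \<mu> x))" by (rule integrable_mult_right)
  then show "integrable lborel (\<lambda>x. indicator (cball 0 R) x * (norm (u x))\<^sup>2)"
  proof (rule Bochner_Integration.integrable_bound)
    show "AE x in lborel. norm (indicator (cball 0 R) x * (norm (u x))\<^sup>2) \<le> norm ((1 / c) * ((norm (u x))\<^sup>2 * \<mu> x))"
      using c(2) mu_pos
    proof eventually_elim
      case (elim x)
      show ?case
      proof (cases "norm x \<le> R")
        case True
        then have "(norm (u x))\<^sup>2 * c \<le> (norm (u x))\<^sup>2 * \<mu> x" using elim by (intro mult_left_mono) auto
        then show ?thesis using True c(1) elim(2) by (simp add: abs_mult pos_le_divide_eq)
      qed simp
    qed
  qed measurable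
qed

lemma L2_mu_L1_loc: "u \<in> L2_mu \<mu> \<Longrightarrow> u \<in> Lp_loc 1"
  by (intro L2_loc_imp_L1_loc L2_mu_loc)

text \<open>On the support of \<open>\<psi>\<close> the weight is bounded below by some
  \<open>c > 0\<close>, so \<open>|g n - u| \<le> e + |g n - u|^2 \<mu> / (e c)\<close> there; once
  the squared distance is below \<open>e^2\<close>, the integral is of order
  \<open>e\<close>.\<close>

lemma test_integral_tendsto:
  fixes \<psi> :: "real ^ 'n \<Rightarrow> real"
  assumes \<psi>: "\<psi> \<in> test_functions" and g: "L2_tendsto \<mu> g u"
  shows "(\<lambda>n. \<integral>x. \<psi> x *\<^sub>R g n x \<partial>lborel) \<longlonglongrightarrow> (\<integral>x. \<psi> x *\<^sub>R u x \<partial>lborel)"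
proof -
  have l: "g n \<in> L2_mu \<mu>" "u \<in> L2_mu \<mu>" for n
    using g by (auto simp: L2_tendsto_iff)
  have t: "(\<lambda>n. N2 (\<lambda>x. g n x - u x)) \<longlonglongrightarrow> 0" using g by (auto simp: L2_tendsto_iff)
  obtain C R where C: "C \<ge> 0" "\<And>x. \<bar>\<psi> x\<bar> \<le> C * indicator (cball 0 R) x"
    using bounded_supp_ball[OF test_bounded_supp[OF \<psi>]] by metis
  obtain c where c: "c > 0" "AE x in lborel. norm x \<le> R \<longrightarrow> c \<le> \<mu> x" using low by blast
  let ?V = "measure lborel (cball (0::real^'n) R)"
  have "(\<lambda>n. norm ((\<integral>x. \<psi> x *\<^sub>R g n x \<partial>lborel) - (\<integral>x. \<psi> x *\<^sub>R u x \<partial>lborel))) \<longlonglongrightarrow> 0"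
  proof (rule tendsto_zero_le_eps[where C="C * ?V + C / c"])
    fix e :: real assume e: "e > 0"
    have le: "norm ((\<integral>x. \<psi> x *\<^sub>R g n x \<partial>lborel) - (\<integral>x. \<psi> x *\<^sub>R u x \<partial>lborel)) \<le>
       C * e * ?V + C / (e * c) * N2 (\<lambda>x. g n x - u x)" for n
    proof -
      have d: "(\<lambda>x. g n x - u x) \<in> L2_mu \<mu>" by (rule L2_mu_diff(1)[OF l])
      have m: "(\<lambda>x. (norm (g n x - u x))\<^sup>2) \<in> borel_measurable borel" using d by (auto simp: L2_mu_iff)
      have id: "integrable lborel (\<lambda>x. (norm (g n x - u x))\<^sup>2 * \<mu> x)"
        using d unfolding L2_mu_iff M_integral(1)[OF m] by simp
      have ib: "integrable lborel (indicator (cball 0 R) :: real^'n \<Rightarrow> real)"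
        using emeasure_lborel_cball_finite[of "0::real^'n" R] by (intro integrable_real_indicator) auto
      have i: "integrable lborel (\<lambda>x. \<psi> x *\<^sub>R (g n x - u x))"
        by (intro integrable_test \<psi> L2_mu_L1_loc d)
      have "(\<integral>x. \<psi> x *\<^sub>R g n x \<partial>lborel) - (\<integral>x. \<psi> x *\<^sub>R u x \<partial>lborel) = (\<integral>x. \<psi> x *\<^sub>R (g n x - u x) \<partial>lborel)"
        using integrable_test[OF \<psi> L2_mu_L1_loc[OF l(1)]] integrable_test[OF \<psi> L2_mu_L1_loc[OF l(2)]]
        by (simp add: scaleR_diff_right)
      also have "norm \<dots> \<le> (\<integral>x. norm (\<psi> x *\<^sub>R (g n x - u x)) \<partial>lborel)" by (rule integral_norm_bound)
      also have "\<dots> \<le> (\<integral>x. C * e * indicator (cball 0 R) x + C / (e * c) * ((norm (g n x - u x))\<^sup>2 * \<mu> x) \<partial>lborel)"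
      proof (rule integral_mono_AE[OF integrable_norm[OF i]])
        show "AE x in lborel. norm (\<psi> x *\<^sub>R (g n x - u x)) \<le> C * e * indicator (cball 0 R) x + C / (e * c) * ((norm (g n x - u x))\<^sup>2 * \<mu> x)"
          using c(2) mu_pos
        proof eventually_elim
          case (elim x)
          let ?s = "norm (g n x - u x)"
          show ?case
          proof (cases "norm x \<le> R")
            case True
            have "?s \<le> e + (1 / e) * ?s\<^sup>2" using e by (intro le_eps_square) auto
            also have "\<dots> \<le> e + (1 / (e * c)) * (?s\<^sup>2 * \<mu> x)"
            proof -
              have "?s\<^sup>2 * c \<le> ?s\<^sup>2 * \<mu> x" using elim True by (intro mult_left_mono) auto
              then have "(1 / (e * c)) * (?s\<^sup>2 * c) \<le> (1 / (e * c)) * (?s\<^sup>2 * \<mu> x)"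
                by (rule mult_left_mono) (use e c(1) in simp)
              then show ?thesis using c(1) by simp
            qed
            finally have "\<bar>\<psi> x\<bar> * ?s \<le> C * (e + (1 / (e * c)) * (?s\<^sup>2 * \<mu> x))"
              using C(1) C(2)[of x] True by (intro mult_mono) auto
            then show ?thesis using True by (simp add: distrib_left)
          next
            case False
            then have "\<psi> x = 0" using C(2)[of x] by simp
            then show ?thesis using False C(1) c(1) e elim(2) by simp
          qed
        qed
      qed (use ib id in auto)
      also have "\<dots> = C * e * ?V + C / (e * c) * N2 (\<lambda>x. g n x - u x)"
        using ib id unfolding N2_def M_integral(2)[OF m] by simp
      finally show ?thesis .
    qed
    have "\<forall>\<^sub>F n in sequentially. N2 (\<lambda>x. g n x - u x) < e\<^sup>2"
      using t e by (intro order_tendstoD(2)) auto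
    then show "\<forall>\<^sub>F n in sequentially. norm ((\<integral>x. \<psi> x *\<^sub>R g n x \<partial>lborel) - (\<integral>x. \<psi> x *\<^sub>R u x \<partial>lborel)) \<le> (C * ?V + C / c) * e"
    proof eventually_elim
      case (elim n)
      have "C / (e * c) * N2 (\<lambda>x. g n x - u x) \<le> C / (e * c) * e\<^sup>2"
        using elim C(1) c(1) e by (intro mult_left_mono) auto
      also have "\<dots> = C / c * e" using e by (simp add: power2_eq_square)
      finally show ?case using le[of n] by (simp add: algebra_simps)
    qed
  qed simp
  then show ?thesis using LIM_zero_iff tendsto_norm_zero_iff by blast
qed

text \<open>Both sides of the defining identity are continuous under weighted convergence by
  \<open>test_integral_tendsto\<close>, so taking a weak derivative is a closed operation.\<close>

lemma has_weak_deriv_limit: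
  assumes g: "L2_tendsto \<mu> g u" and h: "L2_tendsto \<mu> h v" and w: "\<And>n. has_weak_deriv is (g n) (h n)"
  shows "has_weak_deriv is u v"
  unfolding has_weak_deriv_def
proof (intro conjI allI impI)
  show "u \<in> Lp_loc 1" "v \<in> Lp_loc 1" using g h by (auto simp: L2_tendsto_iff intro: L2_mu_L1_loc)
  fix \<phi> :: "real^'n \<Rightarrow> real" assume \<phi>: "\<phi> \<in> test_functions"
  have "(\<lambda>n. (-1) ^ length is *\<^sub>R (\<integral>x. \<phi> x *\<^sub>R h n x \<partial>lborel)) \<longlonglongrightarrow> (-1) ^ length is *\<^sub>R (\<integral>x. \<phi> x *\<^sub>R v x \<partial>lborel)"
    by (intro tendsto_scaleR tendsto_const test_integral_tendsto \<phi> h)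
  moreover have "(\<lambda>n. \<integral>x. partials is \<phi> x *\<^sub>R g n x \<partial>lborel) \<longlonglongrightarrow> (\<integral>x. partials is \<phi> x *\<^sub>R u x \<partial>lborel)"
    by (intro test_integral_tendsto test_partials \<phi> g)
  ultimately show "(\<integral>x. partials is \<phi> x *\<^sub>R u x \<partial>lborel) = (-1) ^ length is *\<^sub>R (\<integral>x. \<phi> x *\<^sub>R v x \<partial>lborel)"
    unfolding has_weak_derivD[OF w \<phi>] by (rule LIMSEQ_unique[symmetric])
qed

text \<open>The second-order estimate for \<open>f m - f n\<close> makes all derivatives up to order
  two Cauchy; their limits are weak derivatives of \<open>u\<close> by
  \<open>has_weak_deriv_limit\<close>.\<close>

lemma closure_subset:
  assumes f: "\<And>n. f n \<in> test_functions" and u: "L2_tendsto \<mu> f u" and v: "L2_tendsto \<mu> (\<lambda>n. Lc (f n)) v"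
  shows "u \<in> H_mu 2 \<mu>"
proof -
  obtain C where C: "C \<ge> 0" "\<And>f is. f \<in> test_functions \<Longrightarrow> is \<in> idx \<Longrightarrow> N2 (partials is f) \<le> C * (N2 f + N2 (Lc f))"
    using complex_second_order_estimate by blast
  have ul: "u \<in> L2_mu \<mu>" and vl: "v \<in> L2_mu \<mu>" using u v by (auto simp: L2_tendsto_iff)
  let ?a = "\<lambda>n. N2 (\<lambda>x. f n x - u x) + N2 (\<lambda>x. Lc (f n) x - v x)"
  have a: "?a \<longlonglongrightarrow> 0" using tendsto_add[of _ 0 _ _ 0] u v by (auto simp: L2_tendsto_iff intro: tendsto_add_zero)
  have "\<exists>w\<in>L2_mu \<mu>. has_weak_deriv is u w" if "length is \<le> 2" for "is"
  proof -
    \<comment> \<open>Reversed to match the order of weak derivatives in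
      \<open>smooth_has_weak_deriv\<close>.\<close>
    let ?p = "partials (rev is)"
    have idx: "rev is \<in> idx" using that by (simp add: idx_def)
    have pl: "?p (f n) \<in> L2_mu \<mu>" for n by (intro test_N2 test_partials f)
    have d: "N2 (\<lambda>x. ?p (f m) x - ?p (f n) x) \<le> (2 * C) * (?a m + ?a n)" for m n
    proof -
      have t: "(\<lambda>x. f m x - f n x) \<in> test_functions" by (intro test_diff f)
      have "N2 (?p (\<lambda>x. f m x - f n x)) \<le> C * (N2 (\<lambda>x. f m x - f n x) + N2 (Lc (\<lambda>x. f m x - f n x)))"
        by (rule C(2)[OF t idx])
      then have "N2 (\<lambda>x. ?p (f m) x - ?p (f n) x) \<le> C * (N2 (\<lambda>x. f m x - f n x) + N2 (\<lambda>x. Lc (f m) x - Lc (f n) x))"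
        using Lc_diff[OF f f, of m n] by (simp add: partials_diff[OF test_smooth[OF f] test_smooth[OF f]] N2_def)
      also have "\<dots> \<le> C * ((2 * N2 (\<lambda>x. f m x - u x) + 2 * N2 (\<lambda>x. f n x - u x))
          + (2 * N2 (\<lambda>x. Lc (f m) x - v x) + 2 * N2 (\<lambda>x. Lc (f n) x - v x)))"
        using N2_triangle[OF test_N2(1)[OF f] ul test_N2(1)[OF f], of m n] N2_triangle[OF Lc_N2(1)[OF f] vl Lc_N2(1)[OF f], of m n]
          N2_commute[of u "f n"] N2_commute[of v "Lc (f n)"] C(1)
        by (intro mult_left_mono add_mono) simp_all
      finally show ?thesis by (simp add: algebra_simps)
    qed
    have C2: "2 * C \<ge> 0" using C(1) by simp
    obtain w where w: "L2_tendsto \<mu> (\<lambda>n. ?p (f n)) w"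
      using L2_mu_complete[OF pl tendsto_zero_Cauchy[OF a d _ C2]] by blast
    have "has_weak_deriv is u w"
      by (rule has_weak_deriv_limit[OF u w]) (rule smooth_has_weak_deriv[OF test_smooth[OF f]])
    then show ?thesis using w by (auto simp: L2_tendsto_iff)
  qed
  with ul show ?thesis by (simp add: H_mu_def)
qed

subsection \<open>Density of test functions\<close>

lemma L2_tendsto_dct:
  fixes a :: "nat \<Rightarrow> real ^ 'n \<Rightarrow> real"
  assumes w: "w \<in> L2_mu \<mu>" and a: "\<And>m. a m \<in> borel_measurable borel"
    and b: "\<exists>C. \<forall>m x. \<bar>a m x\<bar> \<le> C" and l: "\<And>x. (\<lambda>m. a m x) \<longlonglongrightarrow> c"
  shows "L2_tendsto \<mu> (\<lambda>m x. a m x *\<^sub>R w x) (\<lambda>x. c *\<^sub>R w x)"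
  unfolding L2_tendsto_iff
proof (intro conjI allI)
  note a [measurable]
  have [measurable]: "w \<in> borel_measurable borel" using w by (simp add: L2_mu_iff)
  obtain C where C: "\<And>m x. \<bar>a m x\<bar> \<le> C" using b by blast
  show "(\<lambda>x. a m x *\<^sub>R w x) \<in> L2_mu \<mu>" for m
    by (rule L2_mu_bound[OF w, where C=C]) (use C in \<open>auto intro: mult_right_mono\<close>)
  show "(\<lambda>x. c *\<^sub>R w x) \<in> L2_mu \<mu>" by (rule L2_mu_scaleR[OF w])
  have ii: "integrable M (\<lambda>x. (norm (w x))\<^sup>2)" using w by (simp add: L2_mu_iff)
  have "(\<lambda>m. \<integral>x. (norm (a m x *\<^sub>R w x - c *\<^sub>R w x))\<^sup>2 \<partial>M) \<longlonglongrightarrow> (\<integral>x. 0 \<partial>M)"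
  proof (rule integral_dominated_convergence[where w="\<lambda>x. (C + \<bar>c\<bar>)\<^sup>2 * (norm (w x))\<^sup>2"])
    show "AE x in M. (\<lambda>m. (norm (a m x *\<^sub>R w x - c *\<^sub>R w x))\<^sup>2) \<longlonglongrightarrow> 0"
    proof (rule AE_I2)
      fix x
      have "(\<lambda>m. (norm (a m x *\<^sub>R w x - c *\<^sub>R w x))\<^sup>2) \<longlonglongrightarrow> (norm (c *\<^sub>R w x - c *\<^sub>R w x))\<^sup>2"
        by (intro tendsto_intros l)
      then show "(\<lambda>m. (norm (a m x *\<^sub>R w x - c *\<^sub>R w x))\<^sup>2) \<longlonglongrightarrow> 0" by simp
    qed
    show "AE x in M. norm ((norm (a m x *\<^sub>R w x - c *\<^sub>R w x))\<^sup>2) \<le> (C + \<bar>c\<bar>)\<^sup>2 * (norm (w x))\<^sup>2" for m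
    proof (rule AE_I2)
      fix x
      have "norm (a m x *\<^sub>R w x - c *\<^sub>R w x) = \<bar>a m x - c\<bar> * norm (w x)"
        by (simp flip: scaleR_diff_left)
      also have "\<dots> \<le> (C + \<bar>c\<bar>) * norm (w x)" using C[of m x] by (intro mult_right_mono) auto
      finally have "(norm (a m x *\<^sub>R w x - c *\<^sub>R w x))\<^sup>2 \<le> ((C + \<bar>c\<bar>) * norm (w x))\<^sup>2" by (intro power_mono) auto
      then show "norm ((norm (a m x *\<^sub>R w x - c *\<^sub>R w x))\<^sup>2) \<le> (C + \<bar>c\<bar>)\<^sup>2 * (norm (w x))\<^sup>2"
        by (simp add: power_mult_distrib)
    qed
    show "(\<lambda>x. (norm (a m x *\<^sub>R w x - c *\<^sub>R w x))\<^sup>2) \<in> borel_measurable M" for m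
      unfolding measurable_M by measurable
    show "integrable M (\<lambda>x. (C + \<bar>c\<bar>)\<^sup>2 * (norm (w x))\<^sup>2)" using ii by simp
  qed simp
  then show "(\<lambda>m. N2 (\<lambda>x. a m x *\<^sub>R w x - c *\<^sub>R w x)) \<longlonglongrightarrow> 0" by (simp add: N2_def)
qed

lemma mc_test:
  fixes g :: "real ^ 'n \<Rightarrow> complex"
  assumes g: "g \<in> Lp_loc 1" and supp: "\<And>x. norm x > R \<Longrightarrow> g x = 0"
  shows "mc k g \<in> test_functions" "norm x > R + 1 \<Longrightarrow> mc k g x = 0"
proof -
  have [measurable]: "g \<in> borel_measurable borel" by (rule Lp_loc_measurable[OF g])
  show z: "mc k g x = 0" if "norm x > R + 1" for x
  proof -
    have "g y = 0" if y: "y \<in> ball x (1 / real (Suc k))" for y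
    proof -
      have "norm (x - y) \<le> 1" using y order_less_le_trans[of "norm (x - y)" "1 / real (Suc k)" 1]
        by (simp add: dist_norm)
      then have "norm y > R" using \<open>norm x > R + 1\<close> norm_triangle_ineq2[of x y] by simp
      then show ?thesis by (rule supp)
    qed
    then have "mc k g x = mc k (\<lambda>x. 0) x" by (intro mc_cong) auto
    then show ?thesis by (simp add: conv_def)
  qed
  show "mc k g \<in> test_functions" by (rule testI[OF smooth_conv[OF moll(1) g] z])
qed

text \<open>The function and its mollifications live in the ball of radius \<open>R + 1\<close>,
  where \<open>\<mu>\<close> is bounded above, so the unweighted convergence carries over.\<close>

lemma mc_L2_mu_tendsto:
  assumes g: "g \<in> L2_mu \<mu>" and supp: "\<And>x. norm x > R \<Longrightarrow> g x = 0"
  shows "(\<lambda>k. N2 (\<lambda>x. mc k g x - g x)) \<longlonglongrightarrow> 0"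
proof -
  have g1: "g \<in> Lp_loc 1" by (rule L2_mu_L1_loc[OF g])
  have gm [measurable]: "g \<in> borel_measurable borel" by (rule Lp_loc_measurable[OF g1])
  have [measurable]: "mc k g \<in> borel_measurable borel" for k by (intro smooth_measurable smooth_conv moll g1)
  have e1: "(\<lambda>x. indicator (cball 0 R) x *\<^sub>R g x) = g" using supp by (auto simp: indicator_def fun_eq_iff)
  have e2: "(\<lambda>x. indicator (cball 0 R) x * (norm (g x))\<^sup>2) = (\<lambda>x. (norm (g x))\<^sup>2)"
    using supp by (auto simp: indicator_def fun_eq_iff)
  have i: "integrable lborel g" "integrable lborel (\<lambda>x. (norm (g x))\<^sup>2)"
    using L1_loc_ball[OF g1, of R] L2_loc_ball[OF L2_mu_loc[OF g], of R] unfolding e1 e2 by auto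
  obtain C where C: "AE x in lborel. norm x \<le> R + 1 \<longrightarrow> \<mu> x \<le> C" using bdd by blast
  have id: "integrable lborel (\<lambda>x. (norm (mc k g x - g x))\<^sup>2)" for k
  proof (rule Bochner_Integration.integrable_bound)
    show "integrable lborel (\<lambda>x. 2 * (norm (mc k g x))\<^sup>2 + 2 * (norm (g x))\<^sup>2)"
      using mc_L2(1)[OF i, of k] i by (intro Bochner_Integration.integrable_add integrable_mult_right)
    show "AE x in lborel. norm ((norm (mc k g x - g x))\<^sup>2) \<le> norm (2 * (norm (mc k g x))\<^sup>2 + 2 * (norm (g x))\<^sup>2)"
      using norm_sq_diff_le by (intro AE_I2) simp
  qed measurable
  have le: "N2 (\<lambda>x. mc k g x - g x) \<le> \<bar>C\<bar> * (\<integral>x. (norm (mc k g x - g x))\<^sup>2 \<partial>lborel)" for k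
  proof -
    have m: "(\<lambda>x. (norm (mc k g x - g x))\<^sup>2) \<in> borel_measurable borel" by measurable
    have "mc k g \<in> L2_mu \<mu>" by (rule test_N2(1)[OF mc_test(1)[OF g1 supp]])
    from L2_mu_diff(1)[OF this g] have im: "integrable lborel (\<lambda>x. (norm (mc k g x - g x))\<^sup>2 * \<mu> x)"
      unfolding L2_mu_iff M_integral(1)[OF m] by simp
    have "N2 (\<lambda>x. mc k g x - g x) \<le> (\<integral>x. \<bar>C\<bar> * (norm (mc k g x - g x))\<^sup>2 \<partial>lborel)"
      unfolding N2_def M_integral(2)[OF m]
    proof (rule integral_mono_AE[OF im])
      show "AE x in lborel. (norm (mc k g x - g x))\<^sup>2 * \<mu> x \<le> \<bar>C\<bar> * (norm (mc k g x - g x))\<^sup>2"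
        using C
      proof eventually_elim
        case (elim x)
        show ?case
        proof (cases "norm x \<le> R + 1")
          case True
          then have "\<mu> x \<le> \<bar>C\<bar>" using elim by simp
          then show ?thesis by (simp add: mult.commute mult_right_mono)
        next
          case False
          then have "mc k g x = 0" "g x = 0" using mc_test(2)[OF g1 supp, where x=x and k=k] supp[of x] by auto
          then show ?thesis by simp
        qed
      qed
    qed (use id in auto)
    then show ?thesis by simp
  qed
  have z: "(\<lambda>k. \<bar>C\<bar> * (\<integral>x. (norm (mc k g x - g x))\<^sup>2 \<partial>lborel)) \<longlonglongrightarrow> 0"
    by (intro tendsto_mult_right_zero mc_L2_tendsto i)
  show ?thesis
    by (rule tendsto_sandwich[OF _ _ tendsto_const z]) (auto intro!: always_eventually N2_nonneg le)
qed

text \<open>\<open>V is\<close> is a weak derivative of \<open>u\<close>, and \<open>W m is\<close>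
  is the Leibniz expansion of that of \<open>cutoffs m\<close> times \<open>u\<close>. The cut-off
  factors are bounded uniformly in \<open>m\<close>, and the differentiated ones eventually vanish
  pointwise, so dominated convergence leaves \<open>V is\<close>.\<close>

lemma truncation:
  assumes u: "u \<in> H_mu 2 \<mu>"
  obtains V :: "'n list \<Rightarrow> real ^ 'n \<Rightarrow> complex" and W where "V [] = u"
    "\<And>is. is \<in> idx \<Longrightarrow> L2_tendsto \<mu> (\<lambda>m. W m is) (V is)"
    "\<And>m is. is \<in> idx \<Longrightarrow> has_weak_deriv is (W m []) (W m is)"
    "\<And>m is x. norm x > 2 * real (Suc m) \<Longrightarrow> W m is x = 0"
proof -
  have ul: "u \<in> L2_mu \<mu>" and "\<forall>is. length is \<le> 2 \<longrightarrow> (\<exists>v\<in>L2_mu \<mu>. has_weak_deriv is u v)"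
    using u by (auto simp: H_mu_def)
  then obtain V0 where V0: "\<And>is. length is \<le> 2 \<Longrightarrow> V0 is \<in> L2_mu \<mu> \<and> has_weak_deriv is u (V0 is)" by metis
  \<comment> \<open>A chosen zeroth derivative agrees with \<open>u\<close> only almost everywhere,
    so this entry is overwritten by \<open>u\<close> itself.\<close>
  define V where "V = V0([] := u)"
  have Vl: "V is \<in> L2_mu \<mu>" if "length is \<le> 2" for "is" using that V0 ul by (auto simp: V_def)
  have V1: "has_weak_deriv [i] u (V [i])" and V2: "has_weak_deriv [i, j] u (V [i, j])" for i j
    using V0[of "[i]"] V0[of "[i, j]"] by (auto simp: V_def)
  have V3: "has_weak_deriv [j] (V [i]) (V [i, j])" for i j
    by (rule has_weak_deriv_step[OF V2 V1])
  let ?e = "\<lambda>is m. partials is (cutoffs m) :: real ^ 'n \<Rightarrow> real"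
  \<comment> \<open>In the last case the weak derivative is taken first along \<open>i\<close>, then
    along \<open>j\<close>, which differentiates the cut-off classically as
    \<open>partials [j, i]\<close>.\<close>
  define W where "W m is x = (case is of [] \<Rightarrow> ?e [] m x *\<^sub>R u x
      | [i] \<Rightarrow> ?e [i] m x *\<^sub>R u x + ?e [] m x *\<^sub>R V [i] x
      | i # j # _ \<Rightarrow> (?e [j, i] m x *\<^sub>R u x + ?e [i] m x *\<^sub>R V [j] x) + (?e [j] m x *\<^sub>R V [i] x + ?e [] m x *\<^sub>R V [i, j] x))"
    for m x and "is" :: "'n list"
  have tm: "L2_tendsto \<mu> (\<lambda>m x. ?e is m x *\<^sub>R w x) (\<lambda>x. (if is = [] then 1 else 0) *\<^sub>R w x)" if "w \<in> L2_mu \<mu>" for "is" w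
    by (rule L2_tendsto_dct[OF that]) (intro smooth_measurable smooth_partials cutoffs | rule cutoffs)+
  show ?thesis
  proof (rule that[of V W])
    show "V [] = u" by (simp add: V_def)
    show "L2_tendsto \<mu> (\<lambda>m. W m is) (V is)" if "is \<in> idx" for "is"
      using that
    proof (cases rule: idx_cases)
      case 1
      then show ?thesis using tm[OF ul, of "[]"] by (simp add: W_def[abs_def] V_def)
    next
      case (2 i)
      then show ?thesis using L2_tendsto_add[OF tm[OF ul, of "[i]"] tm[OF Vl[of "[i]"], of "[]"]]
        by (simp add: W_def[abs_def])
    next
      case (3 i j)
      then show ?thesis using L2_tendsto_add[OF L2_tendsto_add[OF tm[OF ul, of "[j, i]"] tm[OF Vl[of "[j]"], of "[i]"]]
          L2_tendsto_add[OF tm[OF Vl[of "[i]"], of "[j]"] tm[OF Vl[of "[i, j]"], of "[]"]]]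
        by (simp add: W_def[abs_def])
    qed
    show "has_weak_deriv is (W m []) (W m is)" if "is \<in> idx" for m "is"
    proof -
      have s: "smooth (?e [] m)" "smooth (?e [i] m)" for i by (intro smooth_partials cutoffs)+
      have w0: "W m [] = (\<lambda>x. ?e [] m x *\<^sub>R u x)" by (simp add: W_def fun_eq_iff)
      have w1: "has_weak_deriv [i] (W m []) (W m [i])" for i
        using has_weak_deriv_mult[OF V1[of i] s(1)] by (simp add: W_def[abs_def] partials_Cons)
      have w2: "has_weak_deriv [j] (W m [i]) (W m [i, j])" for i j
        using has_weak_deriv_add[OF has_weak_deriv_mult[OF V1[of j] s(2)[of i]] has_weak_deriv_mult[OF V3[where i=i and j=j] s(1)]]
        by (simp add: W_def[abs_def] partials_Cons)
      from that show ?thesis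
      proof (cases rule: idx_cases)
        case 1
        have "W m [] \<in> Lp_loc 1" using w1 by (simp add: has_weak_deriv_def)
        with 1 show ?thesis by (simp add: has_weak_deriv_def)
      next
        case (2 i) then show ?thesis using w1 by simp
      next
        case (3 i j) then show ?thesis using has_weak_deriv_compose[OF w1 w2] by simp
      qed
    qed
    show "W m is x = 0" if "norm x > 2 * real (Suc m)" for m "is" x
    proof -
      have z: "?e js m x = 0" for js by (rule cutoffs(2)[OF that])
      have "cutoffs m x = 0" using z[of "[]"] by simp
      with z show ?thesis unfolding W_def by (simp split: list.split)
    qed
  qed
qed

text \<open>For each truncation one mollification parameter \<open>K m\<close> serves the finitely
  many multi-indices of \<open>idx\<close> at once. Mollification commutes with weak derivatives, so
  \<open>f m\<close> converges to \<open>u\<close> with all derivatives up to order two, and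
  \<open>complex_operator_bound\<close> makes the images under \<open>Lc\<close> Cauchy.\<close>

lemma H2_approx:
  assumes u: "u \<in> H_mu 2 \<mu>"
  obtains f v where "\<And>n::nat. f n \<in> test_functions" "L2_tendsto \<mu> f u" "L2_tendsto \<mu> (\<lambda>n. Lc (f n)) v"
proof -
  obtain V :: "'n list \<Rightarrow> real ^ 'n \<Rightarrow> complex" and W where V: "V [] = u"
    and WV: "\<And>is. is \<in> idx \<Longrightarrow> L2_tendsto \<mu> (\<lambda>m. W m is) (V is)"
    and Ww: "\<And>m is. is \<in> idx \<Longrightarrow> has_weak_deriv is (W m []) (W m is)"
    and Ws: "\<And>m is x. norm x > 2 * real (Suc m) \<Longrightarrow> W m is x = 0"
    using truncation[OF u] by blast
  have nil: "[] \<in> idx" by (simp add: idx_def)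
  have Wl: "W m is \<in> L2_mu \<mu>" if "is \<in> idx" for m "is" using WV[OF that] by (simp add: L2_tendsto_iff)
  have Vl: "V is \<in> L2_mu \<mu>" if "is \<in> idx" for "is" using WV[OF that] by (simp add: L2_tendsto_iff)
  have "\<exists>k. \<forall>is\<in>idx. N2 (\<lambda>x. mc k (W m is) x - W m is x) < inverse (real (Suc m))" for m
  proof -
    have "\<forall>\<^sub>F k in sequentially. N2 (\<lambda>x. mc k (W m is) x - W m is x) < inverse (real (Suc m))" if "is \<in> idx" for "is"
      by (rule order_tendstoD(2)[OF mc_L2_mu_tendsto[where R="2 * real (Suc m)", OF Wl[OF that] Ws]]) simp_all
    then have "\<forall>\<^sub>F k in sequentially. \<forall>is\<in>idx. N2 (\<lambda>x. mc k (W m is) x - W m is x) < inverse (real (Suc m))"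
      using finite_idx by (simp add: eventually_ball_finite_distrib)
    then show ?thesis by (auto simp: eventually_sequentially)
  qed
  then obtain K where K: "\<And>m is. is \<in> idx \<Longrightarrow> N2 (\<lambda>x. mc (K m) (W m is) x - W m is x) < inverse (real (Suc m))" by metis
  define f where "f m = mc (K m) (W m [])" for m
  have ft: "f m \<in> test_functions" for m
    unfolding f_def by (rule mc_test(1)[OF L2_mu_L1_loc[OF Wl[OF nil]] Ws])
  have fp: "partials is (f m) = mc (K m) (W m is)" if "is \<in> idx" for m "is"
    unfolding f_def by (rule partials_conv_weak[OF moll(1) Ww[OF that]])
  have pl: "partials is (f m) \<in> L2_mu \<mu>" for m "is" by (intro test_N2 test_partials ft)
  have lim: "(\<lambda>m. N2 (\<lambda>x. partials is (f m) x - V is x)) \<longlonglongrightarrow> 0" if "is": "is \<in> idx" for "is"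
  proof -
    have le: "N2 (\<lambda>x. partials is (f m) x - V is x) \<le> 2 * inverse (real (Suc m)) + 2 * N2 (\<lambda>x. W m is x - V is x)" for m
      using N2_triangle[OF pl Wl[OF "is"] Vl[OF "is"], of "is" m m] K[OF "is", of m] by (simp add: fp[OF "is"])
    have "(\<lambda>m. 2 * inverse (real (Suc m)) + 2 * N2 (\<lambda>x. W m is x - V is x)) \<longlonglongrightarrow> 2 * 0 + 2 * 0"
      using WV[OF "is"] by (intro tendsto_intros LIMSEQ_inverse_real_of_nat) (simp add: L2_tendsto_iff)
    then have z: "(\<lambda>m. 2 * inverse (real (Suc m)) + 2 * N2 (\<lambda>x. W m is x - V is x)) \<longlonglongrightarrow> 0" by simp
    show ?thesis
      by (rule tendsto_sandwich[OF _ _ tendsto_const z]) (intro always_eventually allI N2_nonneg le)+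
  qed
  have fu: "L2_tendsto \<mu> f u"
    unfolding L2_tendsto_iff using lim[OF nil] Vl[OF nil] V by (auto intro: test_N2 ft)
  obtain C where C: "C \<ge> 0" "\<And>f. f \<in> test_functions \<Longrightarrow> N2 (Lc f) \<le> C * (\<Sum>is\<in>idx. N2 (partials is f))"
    using complex_operator_bound by blast
  let ?T = "\<lambda>m. \<Sum>is\<in>idx. N2 (\<lambda>x. partials is (f m) x - V is x)"
  have T: "?T \<longlonglongrightarrow> 0" by (intro tendsto_null_sum lim)
  have d: "N2 (\<lambda>x. Lc (f m) x - Lc (f n) x) \<le> (2 * C) * (?T m + ?T n)" for m n
  proof -
    have t: "(\<lambda>x. f m x - f n x) \<in> test_functions" by (intro test_diff ft)
    have "N2 (\<lambda>x. Lc (f m) x - Lc (f n) x) = N2 (Lc (\<lambda>x. f m x - f n x))"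
      by (simp add: N2_def Lc_diff[OF ft ft])
    also have "\<dots> \<le> C * (\<Sum>is\<in>idx. N2 (partials is (\<lambda>x. f m x - f n x)))" by (rule C(2)[OF t])
    also have "\<dots> \<le> C * (\<Sum>is\<in>idx. 2 * N2 (\<lambda>x. partials is (f m) x - V is x) + 2 * N2 (\<lambda>x. partials is (f n) x - V is x))"
    proof (intro mult_left_mono sum_mono C(1))
      fix "is" assume "is": "is \<in> idx"
      show "N2 (partials is (\<lambda>x. f m x - f n x)) \<le> 2 * N2 (\<lambda>x. partials is (f m) x - V is x) + 2 * N2 (\<lambda>x. partials is (f n) x - V is x)"
        using N2_triangle[OF pl Vl[OF "is"] pl, of "is" m "is" n] N2_commute[of "V is" "partials is (f n)"]
        by (simp add: partials_diff[OF test_smooth[OF ft] test_smooth[OF ft]])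
    qed
    also have "\<dots> = (2 * C) * (?T m + ?T n)" by (simp add: sum.distrib sum_distrib_left algebra_simps)
    finally show ?thesis .
  qed
  have C2: "2 * C \<ge> 0" using C(1) by simp
  obtain v where "L2_tendsto \<mu> (\<lambda>n. Lc (f n)) v"
    using L2_mu_complete[OF Lc_N2(1)[OF ft] tendsto_zero_Cauchy[OF T d _ C2]] by blast
  with ft fu that show ?thesis by blast
qed

end

section \<open>From the hypotheses of the theorem to the abstract setting\<close>

lemma Lp_loc_cong_AE:
  assumes u: "u \<in> Lp_loc p" and [measurable]: "v \<in> borel_measurable borel" and ae: "AE x in lborel. u x = v x"
  shows "v \<in> Lp_loc p"
  unfolding Lp_loc_iff
proof (intro conjI allI)
  show "v \<in> borel_measurable borel" by fact
  fix R
  have [measurable]: "u \<in> borel_measurable borel" by (rule Lp_loc_measurable[OF u])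
  have "integrable lborel (\<lambda>x. indicator (cball 0 R) x * norm (u x) powr p)" using u by (simp add: Lp_loc_iff)
  then show "integrable lborel (\<lambda>x. indicator (cball 0 R) x * norm (v x) powr p)"
    by (rule integrable_cong_AE[THEN iffD1, rotated 3]) (use ae in \<open>auto elim!: eventually_mono\<close>)
qed

theorem theorem5p4:
  fixes \<mu> :: "real ^ 'n \<Rightarrow> real"
  assumes N: "CARD('n) \<ge> 5"
    and mu_nonneg: "AE x in lborel. 0 \<le> \<mu> x"
    and mu_L1: "integrable lborel \<mu>"
    and mu_prob: "prob_space (weighted \<mu>)"
    and H1: "\<mu> \<in> W_loc 1 2"
      "\<exists>r. r > real CARD('n) \<and> (\<lambda>x. weak_grad \<mu> x /\<^sub>R \<mu> x) \<in> Lp_loc r"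
      "\<forall>K. compact K \<longrightarrow> (\<exists>c>0. AE x in lborel. x \<in> K \<longrightarrow> c \<le> \<mu> x)"
    and H2: "(\<lambda>x. sqrt (\<mu> x)) \<in> W_loc 1 2"
      "\<exists>v. has_weak_laplacian \<mu> v"
      "\<exists>R0>0. AE x in lborel. x \<in> ball 0 R0 \<longrightarrow>
         (norm x)\<^sup>2 * U_mu \<mu> x \<le> 1/4 * (1 / \<bar>ln (norm x)\<bar>\<^sup>2)"
      "\<forall>R>0. \<exists>C. AE x in lborel. x \<notin> ball 0 R \<longrightarrow> U_mu \<mu> x \<le> C"
    and H3: "\<mu> \<in> W_loc 2 1"
      "\<forall>i j. \<exists>v. has_weak_deriv [i] (\<lambda>x. weak_deriv [j] \<mu> x / \<mu> x) v"
      "\<forall>\<epsilon>>0. \<exists>C>0. \<forall>i j. AE x in lborel.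
         \<bar>weak_deriv [i] (\<lambda>y. weak_deriv [j] \<mu> y / \<mu> y) x\<bar>
           \<le> \<epsilon> / (norm x)\<^sup>2 + C * norm (weak_grad \<mu> x /\<^sub>R \<mu> x)"
  shows "D_L \<mu> = H_mu 2 \<mu>"
proof -
  let ?G = "\<lambda>i. weak_deriv [i] \<mu>"
  \<comment> \<open>Indices are ordered as in the Hessian below: the component \<open>i\<close> of
    \<open>b\<close>, differentiated along \<open>j\<close>. The hypothesis on
    \<open>D_i b_j\<close> is quantified over both indices.\<close>
  let ?B = "\<lambda>i j. weak_deriv [j] (\<lambda>x. ?G i x / \<mu> x)"
  let ?\<beta> = "\<lambda>x. norm (\<chi> i. ?G i x / \<mu> x)"
  have b: "weak_grad \<mu> x /\<^sub>R \<mu> x = (\<chi> i. ?G i x / \<mu> x)" for x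
    by (simp add: weak_grad_def vec_eq_iff divide_inverse mult.commute)
  have G: "has_weak_deriv [i] \<mu> (?G i)" "?G i \<in> Lp_loc 2" for i
  proof -
    obtain v where v: "v \<in> Lp_loc 2" "has_weak_deriv [i] \<mu> v" using H1(1) by (auto simp: W_loc_def dest!: spec[of _ "[i]"])
    show w: "has_weak_deriv [i] \<mu> (?G i)" by (rule has_weak_deriv_weak_deriv[OF v(2)])
    then have "?G i \<in> borel_measurable borel" by (auto simp: has_weak_deriv_def Lp_loc_def)
    then show "?G i \<in> Lp_loc 2"
      using has_weak_deriv_unique[OF v(2) w] by (rule Lp_loc_cong_AE[OF v(1)])
  qed
  interpret sobolev_weight \<mu> ?G
  proof
    show "\<mu> \<in> Lp_loc 2" using H1(1) by (simp add: W_loc_def)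
    show "\<exists>c>0. AE x in lborel. norm x \<le> R \<longrightarrow> c \<le> \<mu> x" for R
      using H1(3)[rule_format, OF compact_cball[of 0 R]] by simp
  qed (rule G)+
  \<comment> \<open>The hypothesis provides a weak derivative of \<open>\<mu>\<close> for the list
    \<open>[i, j]\<close>; \<open>has_weak_deriv_step\<close> makes it one of \<open>?G i\<close>
    along \<open>j\<close>.\<close>
  define Hs where "Hs i j = (SOME v. has_weak_deriv [j] (?G i) v)" for i j
  have Hs: "has_weak_deriv [j] (?G i) (Hs i j)" for i j
  proof -
    obtain v where "has_weak_deriv [i, j] \<mu> v" using H3(1) by (auto simp: W_loc_def dest!: spec[of _ "[i, j]"])
    from has_weak_deriv_step[OF this G(1)] show ?thesis
      unfolding Hs_def by (rule someI[where P="has_weak_deriv [j] (?G i)"])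
  qed
  interpret prob_space "weighted \<mu>" by (rule mu_prob)
  interpret kolmogorov_operator \<mu> ?G Hs ?B "weak_laplacian \<mu>"
  proof
    fix i j
    \<comment> \<open>\<open>weak_quotient\<close> gives an explicit weak derivative of
      \<open>b_i\<close>; by uniqueness the representative chosen by \<open>weak_deriv\<close>
      agrees with it almost everywhere, which is the assumption \<open>HB\<close>.\<close>
    note q = weak_quotient[OF Hs[where i=i and j=j]]
    note w = has_weak_deriv_weak_deriv[OF q]
    show "has_weak_deriv [j] (?G i) (Hs i j)" by (rule Hs)
    show "?B i j \<in> borel_measurable borel" using w by (auto simp: has_weak_deriv_def Lp_loc_def)
    show "AE x in lborel. Hs i j x = ?B i j x * \<mu> x + ?G i x * ?G j x / \<mu> x"
      using has_weak_deriv_unique[OF q w] mu_pos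
    proof eventually_elim
      case (elim x)
      show ?case unfolding elim(1)[symmetric] using elim(2) by (simp add: field_simps power2_eq_square)
    qed
  next
    show "\<exists>C. AE x in lborel. norm x \<le> R \<longrightarrow> \<mu> x \<le> C" for R
      using H1(2) mu_locally_bounded unfolding b by blast
    show "has_weak_laplacian \<mu> (weak_laplacian \<mu>)"
      unfolding weak_laplacian_def using H2(2) by (rule someI_ex)
    have U: "U_mu \<mu> x = 1/4 * (\<Sum>i\<in>UNIV. (?G i x / \<mu> x)\<^sup>2) - 1/2 * (weak_laplacian \<mu> x / \<mu> x)" for x
      unfolding U_mu_def b norm_sq_components by (simp add: power2_eq_square)
    obtain R0 where R0: "R0 > 0" "AE x in lborel. x \<in> ball 0 R0 \<longrightarrow>
         (norm x)\<^sup>2 * U_mu \<mu> x \<le> 1/4 * (1 / \<bar>ln (norm x)\<bar>\<^sup>2)" using H2(3) by blast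
    \<comment> \<open>For \<open>0 < |x| < exp (-1)\<close> the modulus of \<open>ln |x|\<close> is
      at least 1, so the logarithmic bound gives \<open>|x|^2 U \<le> 1/4\<close>, in particular
      \<open>U \<le> 1 / |x|^2\<close>. Outside this ball the upper bound on \<open>U\<close> takes
      over.\<close>
    define R where "R = min R0 (exp (-1))"
    have "R > 0" using R0 by (simp add: R_def)
    then obtain C where C: "AE x in lborel. x \<notin> ball 0 R \<longrightarrow> U_mu \<mu> x \<le> C" using H2(4) by blast
    have z: "AE x in lborel. x \<noteq> (0::real^'n)" by (rule AE_lborel_singleton)
    have "AE x in lborel. U_mu \<mu> x \<le> inverse ((norm x)\<^sup>2) + \<bar>C\<bar>"
      using R0(2) C z
    proof eventually_elim
      case (elim x)
      show ?case
      proof (cases "norm x < R")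
        case True
        have n0: "norm x > 0" using elim(3) by simp
        have "ln (norm x) \<le> ln (exp (-1))" using True n0 by (subst ln_le_cancel_iff) (auto simp: R_def)
        then have "1 \<le> \<bar>ln (norm x)\<bar>" by simp
        then have "1 \<le> \<bar>ln (norm x)\<bar>\<^sup>2" by (rule one_le_power)
        then have "1/4 * (1 / \<bar>ln (norm x)\<bar>\<^sup>2) \<le> 1" by (simp add: divide_le_eq)
        then have "(norm x)\<^sup>2 * U_mu \<mu> x \<le> 1" using elim(1) True by (simp add: R_def)
        then have "U_mu \<mu> x \<le> inverse ((norm x)\<^sup>2)" using n0 by (simp add: field_simps)
        then show ?thesis by simp
      next
        case False
        then have "U_mu \<mu> x \<le> C" using elim(2) by simp
        moreover have "C \<le> \<bar>C\<bar>" "0 \<le> inverse ((norm x)\<^sup>2)" by simp_all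
        ultimately show ?thesis by linarith
      qed
    qed
    then show "\<exists>C\<ge>0. AE x in lborel. 1/4 * (\<Sum>i\<in>UNIV. (?G i x / \<mu> x)\<^sup>2) - 1/2 * (weak_laplacian \<mu> x / \<mu> x)
        \<le> inverse ((norm x)\<^sup>2) + C"
      unfolding U by (intro exI[of _ "\<bar>C\<bar>"]) simp
    show "\<exists>C>0. \<forall>i j. AE x in lborel. \<bar>?B i j x\<bar> \<le> \<epsilon> * inverse ((norm x)\<^sup>2) + C * ?\<beta> x" if "\<epsilon> > 0" for \<epsilon>
      using H3(3)[rule_format, OF that] unfolding b by (auto simp: divide_inverse)
  qed (rule N)
  have Lt: "L_test \<mu> f = Lc f" for f
    by (simp add: L_test_def Lc_def fun_eq_iff b)
  show ?thesis
  proof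
    show "D_L \<mu> \<subseteq> H_mu 2 \<mu>"
      unfolding D_L_def L_graph_def Lt using closure_subset by fastforce
    show "H_mu 2 \<mu> \<subseteq> D_L \<mu>"
    proof
      fix u assume "u \<in> H_mu 2 \<mu>"
      from H2_approx[OF this] obtain f v where "\<And>n::nat. f n \<in> test_functions" "L2_tendsto \<mu> f u" "L2_tendsto \<mu> (\<lambda>n. Lc (f n)) v" by blast
      then show "u \<in> D_L \<mu>" unfolding D_L_def L_graph_def Lt by blast
    qed
  qed
qed

end
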